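(* Let $q\in\mathbb{C}\setminus\{0\}$, and let $\mathcal{O}(\widetilde{\mathrm{Af}}_1)_q$ be the universal HFG algebra generated by $z$ and $b$ subject to the relation $e^zb=q\,be^z$. Then $\mathcal{O}(\widetilde{\mathrm{Af}}_1)_q$ is an infinite-dimensional HFG Hopf algebra with respect to the comultiplication $\Delta$, counit $\varepsilon$ and antipode $S$ determined by $$\Delta\colon z\mapsto1\otimes z+z\otimes1,\quad b\mapsto e^z\otimes b+b\otimes1;$$ $$S\colon z\mapsto-z,\quad b\mapsto-e^{-z}b;\qquad\varepsilon\colon z,b\mapsto0.$$ Moreover, $S$ is invertible.
   Context: The algebra $\mathscr{F}_n$ of free entire functions in generators $\zeta_1,\ldots,\zeta_n$ consists of all series $a=\sum_{\alpha\in W_n}c_\alpha\zeta_\alpha$ with $\|a\|_\rho:=\sum_\alpha|c_\alpha|\rho^{|\alpha|}<\infty$ for all $\rho>0$, where $W_n$ is the set of words in $1,\ldots,n$ and $\zeta_\alpha$ is the corresponding product of generators. A Fr\'echet Arens--Michael algebra (Fr\'echet algebra whose topology is given by submultiplicative seminorms) is HFG (holomorphically finitely generated) if it is topologically isomorphic to $\mathscr{F}_n/I$ for some $n$ and closed two-sided ideal $I$. The universal HFG algebra generated by given generators subject to given relations (possibly involving entire functions of the generators) is the quotient of the algebra of free entire functions in these generators by the closed two-sided ideal generated by the relations. $\mathbin{\widehat{\otimes}}$ is the complete projective tensor product. A Hopf $\mathbin{\widehat{\otimes}}$-algebra is a Hopf algebra in the monoidal category of complete locally convex spaces with product $\mathbin{\widehat{\otimes}}$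 (all structure maps continuous). An HFG Hopf algebra is a Hopf $\mathbin{\widehat{\otimes}}$-algebra that is an HFG algebra. "Determined by" means that $\Delta$ and $\varepsilon$ are the continuous unital homomorphisms (with $\Delta$ taking values in the complete projective tensor square of the algebra), and $S$ the continuous antihomomorphism, with the given values on generators. *)

theory Defs
  imports
    "HOL-Analysis.Analysis"
    "HOL-Library.Poly_Mapping"
    "HOL-Algebra.QuotRing"
    "HOL-Algebra.Module"
begin

section \<open>Locally convex spaces and algebras over the complex numbers\<close>

text \<open>
  One record type serves for locally convex spaces and for locally convex algebras. The fields
  \<^term>\<open>mult\<close> and \<^term>\<open>one\<close> carry no meaning for a structure that is only used as a space.
\<close>

record 'a lcs = "(complex, 'a) module" +
  lctop :: "'a topology"

definition complex_lcs :: "complex lcs" where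
  "complex_lcs = \<lparr>carrier = UNIV, mult = (*), one = 1, zero = 0, add = (+), smult = (*),
     lctop = euclidean\<rparr>"

definition is_seminorm :: "(complex, 'a, 'm) module_scheme \<Rightarrow> ('a \<Rightarrow> real) \<Rightarrow> bool" where
  "is_seminorm E p \<longleftrightarrow>
     (\<forall>x\<in>carrier E. 0 \<le> p x) \<and>
     (\<forall>x\<in>carrier E. \<forall>y\<in>carrier E. p (x \<oplus>\<^bsub>E\<^esub> y) \<le> p x + p y) \<and>
     (\<forall>c. \<forall>x\<in>carrier E. p (c \<odot>\<^bsub>E\<^esub> x) = cmod c * p x)"

definition seminorm_open ::
    "(complex, 'a, 'm) module_scheme \<Rightarrow> ('a \<Rightarrow> real) set \<Rightarrow> 'a set \<Rightarrow> bool" where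
  "seminorm_open E P U \<longleftrightarrow> U \<subseteq> carrier E \<and>
     (\<forall>x\<in>U. \<exists>Q e. finite Q \<and> Q \<subseteq> P \<and> 0 < e \<and>
        {y \<in> carrier E. \<forall>p\<in>Q. p (y \<ominus>\<^bsub>E\<^esub> x) < e} \<subseteq> U)"

definition seminorm_topology ::
    "(complex, 'a, 'm) module_scheme \<Rightarrow> ('a \<Rightarrow> real) set \<Rightarrow> 'a topology" where
  "seminorm_topology E P = topology (seminorm_open E P)"

lemma istopology_seminorm_open: "istopology (seminorm_open E P)"
  unfolding istopology_def
proof (intro conjI allI impI)
  fix S T assume S: "seminorm_open E P S" and T: "seminorm_open E P T"
  show "seminorm_open E P (S \<inter> T)"
    unfolding seminorm_open_def
  proof (intro conjI ballI)
    show "S \<inter> T \<subseteq> carrier E" using S by (auto simp: seminorm_open_def)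
    fix x assume x: "x \<in> S \<inter> T"
    obtain Q1 e1 where 1: "finite Q1" "Q1 \<subseteq> P" "0 < (e1::real)"
      "{y \<in> carrier E. \<forall>p\<in>Q1. p (y \<ominus>\<^bsub>E\<^esub> x) < e1} \<subseteq> S"
      using S x unfolding seminorm_open_def by (meson IntD1)
    obtain Q2 e2 where 2: "finite Q2" "Q2 \<subseteq> P" "0 < (e2::real)"
      "{y \<in> carrier E. \<forall>p\<in>Q2. p (y \<ominus>\<^bsub>E\<^esub> x) < e2} \<subseteq> T"
      using T x unfolding seminorm_open_def by (meson IntD2)
    have "{y \<in> carrier E. \<forall>p\<in>Q1 \<union> Q2. p (y \<ominus>\<^bsub>E\<^esub> x) < min e1 e2} \<subseteq> S \<inter> T"
      using 1(4) 2(4) by auto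
    then show "\<exists>Q e. finite Q \<and> Q \<subseteq> P \<and> 0 < e \<and>
        {y \<in> carrier E. \<forall>p\<in>Q. p (y \<ominus>\<^bsub>E\<^esub> x) < e} \<subseteq> S \<inter> T"
      using 1(1-3) 2(1-3) by (intro exI[of _ "Q1 \<union> Q2"] exI[of _ "min e1 e2"]) auto
  qed
next
  fix K assume K: "\<forall>S\<in>K. seminorm_open E P S"
  show "seminorm_open E P (\<Union>K)"
    unfolding seminorm_open_def
  proof (intro conjI ballI)
    show "\<Union>K \<subseteq> carrier E" using K by (auto simp: seminorm_open_def)
    fix x assume "x \<in> \<Union>K"
    then obtain S where S: "S \<in> K" "x \<in> S" by blast
    obtain Q e where "finite Q" "Q \<subseteq> P" "0 < (e::real)"
      "{y \<in> carrier E. \<forall>p\<in>Q. p (y \<ominus>\<^bsub>E\<^esub> x) < e} \<subseteq> S"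
      using K S unfolding seminorm_open_def by meson
    then show "\<exists>Q e. finite Q \<and> Q \<subseteq> P \<and> 0 < e \<and>
        {y \<in> carrier E. \<forall>p\<in>Q. p (y \<ominus>\<^bsub>E\<^esub> x) < e} \<subseteq> \<Union>K"
      using S(1) by blast
  qed
qed

lemma openin_seminorm_topology: "openin (seminorm_topology E P) = seminorm_open E P"
  unfolding seminorm_topology_def
  using istopology_seminorm_open by (rule topology_inverse')

lemma topspace_seminorm_topology: "topspace (seminorm_topology E P) = carrier E"
proof -
  have "seminorm_open E P (carrier E)"
    unfolding seminorm_open_def by (auto intro!: exI[of _ "{}"] exI[of _ "1::real"])
  then show ?thesis
    unfolding topspace_def openin_seminorm_topology
    by (intro equalityI subsetI UnionI[of "carrier E"]) (auto simp only: seminorm_open_def)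
qed

definition is_lcs :: "'a lcs \<Rightarrow> bool" where
  "is_lcs E \<longleftrightarrow> Module.module complex_lcs E \<and>
     (\<exists>P. (\<forall>p\<in>P. is_seminorm E p) \<and> lctop E = seminorm_topology E P)"

definition cauchy_filter :: "'a lcs \<Rightarrow> 'a filter \<Rightarrow> bool" where
  "cauchy_filter E F \<longleftrightarrow> F \<noteq> bot \<and> eventually (\<lambda>x. x \<in> carrier E) F \<and>
     (\<forall>U. openin (lctop E) U \<and> \<zero>\<^bsub>E\<^esub> \<in> U \<longrightarrow>
        eventually (\<lambda>(x, y). x \<ominus>\<^bsub>E\<^esub> y \<in> U) (F \<times>\<^sub>F F))"

text \<open>Complete spaces are Hausdorff by convention.\<close>

definition is_complete_lcs :: "'a lcs \<Rightarrow> bool" where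
  "is_complete_lcs E \<longleftrightarrow> is_lcs E \<and> Hausdorff_space (lctop E) \<and>
     (\<forall>F. cauchy_filter E F \<longrightarrow> (\<exists>x. limitin (lctop E) (\<lambda>y. y) x F))"

text \<open>
  A complete locally convex algebra with jointly continuous multiplication, that is, a unital
  associative algebra in the monoidal category of complete locally convex spaces.
\<close>

definition is_complete_algebra :: "'a lcs \<Rightarrow> bool" where
  "is_complete_algebra A \<longleftrightarrow> is_complete_lcs A \<and> Ring.ring A \<and>
     (\<forall>c. \<forall>x\<in>carrier A. \<forall>y\<in>carrier A.
        (c \<odot>\<^bsub>A\<^esub> x) \<otimes>\<^bsub>A\<^esub> y = c \<odot>\<^bsub>A\<^esub> (x \<otimes>\<^bsub>A\<^esub> y) \<and>
        x \<otimes>\<^bsub>A\<^esub> (c \<odot>\<^bsub>A\<^esub> y) = c \<odot>\<^bsub>A\<^esub> (x \<otimes>\<^bsub>A\<^esub> y)) \<and>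
     continuous_map (prod_topology (lctop A) (lctop A)) (lctop A) (\<lambda>(x, y). x \<otimes>\<^bsub>A\<^esub> y)"

definition is_frechet_arens_michael :: "'a lcs \<Rightarrow> bool" where
  "is_frechet_arens_michael A \<longleftrightarrow> is_complete_algebra A \<and> metrizable_space (lctop A) \<and>
     (\<exists>P. (\<forall>p\<in>P. is_seminorm A p \<and>
             (\<forall>x\<in>carrier A. \<forall>y\<in>carrier A. p (x \<otimes>\<^bsub>A\<^esub> y) \<le> p x * p y)) \<and>
          lctop A = seminorm_topology A P)"

definition infinite_dimensional :: "'a lcs \<Rightarrow> bool" where
  "infinite_dimensional E \<longleftrightarrow>
     \<not> (\<exists>B. finite B \<and> B \<subseteq> carrier E \<and>
          (\<forall>x\<in>carrier E. \<exists>c. x = (\<Oplus>\<^bsub>E\<^esub>v\<in>B. c v \<odot>\<^bsub>E\<^esub> v)))"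

definition cont_linear :: "'a lcs \<Rightarrow> 'b lcs \<Rightarrow> ('a \<Rightarrow> 'b) \<Rightarrow> bool" where
  "cont_linear E F f \<longleftrightarrow> f \<in> carrier E \<rightarrow> carrier F \<and>
     (\<forall>x\<in>carrier E. \<forall>y\<in>carrier E. f (x \<oplus>\<^bsub>E\<^esub> y) = f x \<oplus>\<^bsub>F\<^esub> f y) \<and>
     (\<forall>c. \<forall>x\<in>carrier E. f (c \<odot>\<^bsub>E\<^esub> x) = c \<odot>\<^bsub>F\<^esub> f x) \<and>
     continuous_map (lctop E) (lctop F) f"

definition cont_alg_hom :: "'a lcs \<Rightarrow> 'b lcs \<Rightarrow> ('a \<Rightarrow> 'b) \<Rightarrow> bool" where
  "cont_alg_hom A B f \<longleftrightarrow> cont_linear A B f \<and> f \<in> ring_hom A B"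

definition cont_alg_antihom :: "'a lcs \<Rightarrow> 'b lcs \<Rightarrow> ('a \<Rightarrow> 'b) \<Rightarrow> bool" where
  "cont_alg_antihom A B f \<longleftrightarrow> cont_linear A B f \<and> f \<one>\<^bsub>A\<^esub> = \<one>\<^bsub>B\<^esub> \<and>
     (\<forall>x\<in>carrier A. \<forall>y\<in>carrier A. f (x \<otimes>\<^bsub>A\<^esub> y) = f y \<otimes>\<^bsub>B\<^esub> f x)"

definition topologically_isomorphic :: "'a lcs \<Rightarrow> 'b lcs \<Rightarrow> bool" where
  "topologically_isomorphic A B \<longleftrightarrow>
     (\<exists>f. cont_alg_hom A B f \<and> homeomorphic_map (lctop A) (lctop B) f)"

definition alg_exp :: "'a lcs \<Rightarrow> 'a \<Rightarrow> 'a" where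
  "alg_exp A x = (THE y. limitin (lctop A)
     (\<lambda>N. \<Oplus>\<^bsub>A\<^esub>k\<in>{..<N}. (1 / fact k) \<odot>\<^bsub>A\<^esub> (x [^]\<^bsub>A\<^esub> (k::nat))) y sequentially)"


section \<open>Quotients\<close>

text \<open>
  The quotient by a linear subspace, as a vector space of cosets. The multiplication of cosets is
  meaningful if \<open>I\<close> is a two-sided ideal of an algebra.
\<close>

definition quot_module ::
    "(complex, 'a, 'm) module_scheme \<Rightarrow> 'a set \<Rightarrow> (complex, 'a set) module" where
  "quot_module A I = ring.extend (A Quot I)
     (module.fields (\<lambda>c X. \<Union>x\<in>X. I +>\<^bsub>A\<^esub> (c \<odot>\<^bsub>A\<^esub> x)))"

definition quot_open :: "'a lcs \<Rightarrow> 'a set \<Rightarrow> 'a set set \<Rightarrow> bool" where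
  "quot_open A I U \<longleftrightarrow> U \<subseteq> (\<lambda>x. I +>\<^bsub>A\<^esub> x) ` topspace (lctop A) \<and>
     openin (lctop A) {x \<in> topspace (lctop A). I +>\<^bsub>A\<^esub> x \<in> U}"

definition quot_lcs :: "'a lcs \<Rightarrow> 'a set \<Rightarrow> 'a set lcs" where
  "quot_lcs A I = module.extend (quot_module A I) (lcs.fields (topology (quot_open A I)))"

lemma istopology_quot_open: "istopology (quot_open A I)"
  unfolding istopology_def
proof (intro conjI allI impI)
  fix S T assume ST: "quot_open A I S" "quot_open A I T"
  have eq: "{x \<in> topspace (lctop A). I +>\<^bsub>A\<^esub> x \<in> S \<inter> T} =
      {x \<in> topspace (lctop A). I +>\<^bsub>A\<^esub> x \<in> S} \<inter> {x \<in> topspace (lctop A). I +>\<^bsub>A\<^esub> x \<in> T}"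
    by auto
  have "openin (lctop A) {x \<in> topspace (lctop A). I +>\<^bsub>A\<^esub> x \<in> S \<inter> T}"
    unfolding eq using ST by (auto simp only: quot_open_def intro: openin_Int)
  then show "quot_open A I (S \<inter> T)" using ST by (auto simp: quot_open_def)
next
  fix K assume K: "\<forall>S\<in>K. quot_open A I S"
  have eq: "{x \<in> topspace (lctop A). I +>\<^bsub>A\<^esub> x \<in> \<Union>K} =
      (\<Union>S\<in>K. {x \<in> topspace (lctop A). I +>\<^bsub>A\<^esub> x \<in> S})"
    by auto
  have "openin (lctop A) {x \<in> topspace (lctop A). I +>\<^bsub>A\<^esub> x \<in> \<Union>K}"
    unfolding eq using K by (auto simp only: quot_open_def intro: openin_Union)
  moreover have "\<Union>K \<subseteq> (\<lambda>x. I +>\<^bsub>A\<^esub> x) ` topspace (lctop A)"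
    using K by (auto simp only: quot_open_def)
  ultimately show "quot_open A I (\<Union>K)" by (auto simp: quot_open_def)
qed

lemma openin_quot_lcs: "openin (lctop (quot_lcs A I)) = quot_open A I"
  by (simp add: quot_lcs_def module.defs lcs.defs topology_inverse'[OF istopology_quot_open])


section \<open>Free entire functions and HFG algebras\<close>

text \<open>
  A series is given by its family of coefficients, indexed by all lists of naturals and vanishing
  off the words in \<open>1, \<dots>, n\<close>.
\<close>

definition fe_norm :: "real \<Rightarrow> (nat list \<Rightarrow> complex) \<Rightarrow> real" where
  "fe_norm \<rho> a = (\<Sum>\<^sub>\<infinity>w. cmod (a w) * \<rho> ^ length w)"

definition free_entire_module :: "nat \<Rightarrow> (complex, nat list \<Rightarrow> complex) module" where
  "free_entire_module n =
     \<lparr>carrier = {a. (\<forall>w. \<not> set w \<subseteq> {1..n} \<longrightarrow> a w = 0) \<and>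
                    (\<forall>\<rho>>0. (\<lambda>w. cmod (a w) * \<rho> ^ length w) summable_on UNIV)},
      mult = (\<lambda>a b w. \<Sum>k\<le>length w. a (take k w) * b (drop k w)),
      one = (\<lambda>w. if w = [] then 1 else 0),
      zero = (\<lambda>w. 0),
      add = (\<lambda>a b w. a w + b w),
      smult = (\<lambda>c a w. c * a w)\<rparr>"

definition free_entire :: "nat \<Rightarrow> (nat list \<Rightarrow> complex) lcs" where
  "free_entire n = module.extend (free_entire_module n)
     (lcs.fields (seminorm_topology (free_entire_module n) (fe_norm ` {\<rho>. 0 < \<rho>})))"

definition fe_gen :: "nat \<Rightarrow> nat list \<Rightarrow> complex" where
  "fe_gen i = (\<lambda>w. if w = [i] then 1 else 0)"

definition is_HFG :: "'a lcs \<Rightarrow> bool" where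
  "is_HFG A \<longleftrightarrow> is_frechet_arens_michael A \<and>
     (\<exists>n I. ideal I (free_entire n) \<and> closedin (lctop (free_entire n)) I \<and>
            topologically_isomorphic A (quot_lcs (free_entire n) I))"

definition closed_ideal_generated :: "'a lcs \<Rightarrow> 'a set \<Rightarrow> 'a set" where
  "closed_ideal_generated A R = \<Inter>{I. ideal I A \<and> closedin (lctop A) I \<and> R \<subseteq> I}"

definition universal_HFG ::
    "nat \<Rightarrow> (nat list \<Rightarrow> complex) set \<Rightarrow> (nat list \<Rightarrow> complex) set lcs" where
  "universal_HFG n R = quot_lcs (free_entire n) (closed_ideal_generated (free_entire n) R)"

definition universal_HFG_gen ::
    "nat \<Rightarrow> (nat list \<Rightarrow> complex) set \<Rightarrow> nat \<Rightarrow> (nat list \<Rightarrow> complex) set" where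
  "universal_HFG_gen n R i = closed_ideal_generated (free_entire n) R +>\<^bsub>free_entire n\<^esub> fe_gen i"


section \<open>The algebraic tensor product with the projective topology\<close>

definition formal_sums ::
    "'a lcs \<Rightarrow> 'b lcs \<Rightarrow> (complex, ('a \<times> 'b) \<Rightarrow>\<^sub>0 complex) module" where
  "formal_sums E F =
     \<lparr>carrier = {w. Poly_Mapping.keys w \<subseteq> carrier E \<times> carrier F},
      mult = (\<lambda>v w. \<Sum>s\<in>Poly_Mapping.keys v. \<Sum>t\<in>Poly_Mapping.keys w.
         Poly_Mapping.single (fst s \<otimes>\<^bsub>E\<^esub> fst t, snd s \<otimes>\<^bsub>F\<^esub> snd t)
           (Poly_Mapping.lookup v s * Poly_Mapping.lookup w t)),
      one = Poly_Mapping.single (\<one>\<^bsub>E\<^esub>, \<one>\<^bsub>F\<^esub>) 1,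
      zero = 0,
      add = (+),
      smult = (\<lambda>c. Poly_Mapping.map (\<lambda>a. c * a))\<rparr>"

definition bilinear_relations :: "'a lcs \<Rightarrow> 'b lcs \<Rightarrow> (('a \<times> 'b) \<Rightarrow>\<^sub>0 complex) set" where
  "bilinear_relations E F =
     {Poly_Mapping.single (x \<oplus>\<^bsub>E\<^esub> x', y) 1 - Poly_Mapping.single (x, y) 1
        - Poly_Mapping.single (x', y) 1 |
        x x' y. x \<in> carrier E \<and> x' \<in> carrier E \<and> y \<in> carrier F} \<union>
     {Poly_Mapping.single (x, y \<oplus>\<^bsub>F\<^esub> y') 1 - Poly_Mapping.single (x, y) 1
        - Poly_Mapping.single (x, y') 1 |
        x y y'. x \<in> carrier E \<and> y \<in> carrier F \<and> y' \<in> carrier F} \<union>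
     {Poly_Mapping.single (c \<odot>\<^bsub>E\<^esub> x, y) 1 - Poly_Mapping.single (x, y) c |
        c x y. x \<in> carrier E \<and> y \<in> carrier F} \<union>
     {Poly_Mapping.single (x, c \<odot>\<^bsub>F\<^esub> y) 1 - Poly_Mapping.single (x, y) c |
        c x y. x \<in> carrier E \<and> y \<in> carrier F}"

definition tensor_null :: "'a lcs \<Rightarrow> 'b lcs \<Rightarrow> (('a \<times> 'b) \<Rightarrow>\<^sub>0 complex) set" where
  "tensor_null E F =
     \<Inter>{N. submodule N complex_lcs (formal_sums E F) \<and> bilinear_relations E F \<subseteq> N}"

definition cont_seminorms :: "'a lcs \<Rightarrow> ('a \<Rightarrow> real) set" where
  "cont_seminorms E = {p. is_seminorm E p \<and> continuous_map (lctop E) euclideanreal p}"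

text \<open>
  The elements of a coset \<open>U\<close> are exactly the formal sums representing the tensor \<open>U\<close>, so this is
  the infimum of \<open>\<Sum>\<^sub>i |c\<^sub>i| p(x\<^sub>i) r(y\<^sub>i)\<close> over all representations of \<open>U\<close> as \<open>\<Sum>\<^sub>i c\<^sub>i x\<^sub>i \<otimes> y\<^sub>i\<close>.
\<close>

definition proj_seminorm ::
    "('a \<Rightarrow> real) \<Rightarrow> ('b \<Rightarrow> real) \<Rightarrow> (('a \<times> 'b) \<Rightarrow>\<^sub>0 complex) set \<Rightarrow> real" where
  "proj_seminorm p r U = (INF w\<in>U. \<Sum>s\<in>Poly_Mapping.keys w.
     cmod (Poly_Mapping.lookup w s) * p (fst s) * r (snd s))"

definition alg_tensor :: "'a lcs \<Rightarrow> 'b lcs \<Rightarrow> (('a \<times> 'b) \<Rightarrow>\<^sub>0 complex) set lcs" where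
  "alg_tensor E F = (let M = quot_module (formal_sums E F) (tensor_null E F) in
     module.extend M (lcs.fields (seminorm_topology M
       {proj_seminorm p r | p r. p \<in> cont_seminorms E \<and> r \<in> cont_seminorms F})))"


section \<open>Completion\<close>

text \<open>
  The completion consists of Cauchy nets modulo null nets. Nets indexed by the directed set of all
  continuous seminorms suffice: each neighbourhood of \<open>0\<close> contains the open unit ball of a
  continuous seminorm.
\<close>

definition net_filter :: "'a lcs \<Rightarrow> ('a \<Rightarrow> real) filter" where
  "net_filter E = (INF p\<in>cont_seminorms E.
     principal {r \<in> cont_seminorms E. \<forall>x\<in>carrier E. p x \<le> r x})"

definition cauchy_nets :: "'a lcs \<Rightarrow> (complex, ('a \<Rightarrow> real) \<Rightarrow> 'a) module" where
  "cauchy_nets E =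
     \<lparr>carrier = {x \<in> cont_seminorms E \<rightarrow>\<^sub>E carrier E.
                   cauchy_filter E (filtermap x (net_filter E))},
      mult = (\<lambda>x y. \<lambda>i\<in>cont_seminorms E. x i \<otimes>\<^bsub>E\<^esub> y i),
      one = (\<lambda>i\<in>cont_seminorms E. \<one>\<^bsub>E\<^esub>),
      zero = (\<lambda>i\<in>cont_seminorms E. \<zero>\<^bsub>E\<^esub>),
      add = (\<lambda>x y. \<lambda>i\<in>cont_seminorms E. x i \<oplus>\<^bsub>E\<^esub> y i),
      smult = (\<lambda>c x. \<lambda>i\<in>cont_seminorms E. c \<odot>\<^bsub>E\<^esub> x i)\<rparr>"

definition null_nets :: "'a lcs \<Rightarrow> (('a \<Rightarrow> real) \<Rightarrow> 'a) set" where
  "null_nets E = {x \<in> carrier (cauchy_nets E). limitin (lctop E) x \<zero>\<^bsub>E\<^esub> (net_filter E)}"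

definition extended_seminorm ::
    "'a lcs \<Rightarrow> ('a \<Rightarrow> real) \<Rightarrow> (('a \<Rightarrow> real) \<Rightarrow> 'a) set \<Rightarrow> real" where
  "extended_seminorm E p X = (THE l. \<forall>x\<in>X. ((\<lambda>i. p (x i)) \<longlongrightarrow> l) (net_filter E))"

definition completion :: "'a lcs \<Rightarrow> (('a \<Rightarrow> real) \<Rightarrow> 'a) set lcs" where
  "completion E = (let M = quot_module (cauchy_nets E) (null_nets E) in
     module.extend M (lcs.fields (seminorm_topology M
       (extended_seminorm E ` cont_seminorms E))))"

definition to_completion :: "'a lcs \<Rightarrow> 'a \<Rightarrow> (('a \<Rightarrow> real) \<Rightarrow> 'a) set" where
  "to_completion E x = null_nets E +>\<^bsub>cauchy_nets E\<^esub> (\<lambda>i\<in>cont_seminorms E. x)"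


section \<open>The complete projective tensor product\<close>

type_synonym ('a, 'b) tensor =
  "(((('a \<times> 'b) \<Rightarrow>\<^sub>0 complex) set \<Rightarrow> real) \<Rightarrow> (('a \<times> 'b) \<Rightarrow>\<^sub>0 complex) set) set"

text \<open>
  If both factors are algebras, the multiplication is the one determined by
  \<open>(x \<otimes> y)(x' \<otimes> y') = xx' \<otimes> yy'\<close>.
\<close>

definition proj_tensor :: "'a lcs \<Rightarrow> 'b lcs \<Rightarrow> ('a, 'b) tensor lcs" where
  "proj_tensor E F = completion (alg_tensor E F)"

definition pure_tensor :: "'a lcs \<Rightarrow> 'b lcs \<Rightarrow> 'a \<Rightarrow> 'b \<Rightarrow> ('a, 'b) tensor" where
  "pure_tensor E F x y = to_completion (alg_tensor E F)
     (tensor_null E F +>\<^bsub>formal_sums E F\<^esub> Poly_Mapping.single (x, y) 1)"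

text \<open>
  Continuous linear maps out of a complete projective tensor product (into a complete space) are
  determined by their values on elementary tensors, and every jointly continuous bilinear map
  arises in this way. The following maps are therefore specified by these values.
\<close>

definition linearization ::
    "'a lcs \<Rightarrow> 'b lcs \<Rightarrow> 'c lcs \<Rightarrow> ('a \<Rightarrow> 'b \<Rightarrow> 'c) \<Rightarrow> ('a, 'b) tensor \<Rightarrow> 'c" where
  "linearization E F G B = (THE h. h \<in> extensional (carrier (proj_tensor E F)) \<and>
     cont_linear (proj_tensor E F) G h \<and>
     (\<forall>x\<in>carrier E. \<forall>y\<in>carrier F. h (pure_tensor E F x y) = B x y))"

definition tensor_map ::
    "'a lcs \<Rightarrow> 'b lcs \<Rightarrow> 'c lcs \<Rightarrow> 'd lcs \<Rightarrow> ('a \<Rightarrow> 'c) \<Rightarrow> ('b \<Rightarrow> 'd) \<Rightarrow>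
       ('a, 'b) tensor \<Rightarrow> ('c, 'd) tensor" where
  "tensor_map E F E' F' f g =
     linearization E F (proj_tensor E' F') (\<lambda>x y. pure_tensor E' F' (f x) (g y))"

definition tensor_assoc ::
    "'a lcs \<Rightarrow> 'b lcs \<Rightarrow> 'c lcs \<Rightarrow>
       (('a, 'b) tensor, 'c) tensor \<Rightarrow> ('a, ('b, 'c) tensor) tensor" where
  "tensor_assoc E F G =
     (THE h. h \<in> extensional (carrier (proj_tensor (proj_tensor E F) G)) \<and>
        cont_linear (proj_tensor (proj_tensor E F) G) (proj_tensor E (proj_tensor F G)) h \<and>
        (\<forall>x\<in>carrier E. \<forall>y\<in>carrier F. \<forall>z\<in>carrier G.
           h (pure_tensor (proj_tensor E F) G (pure_tensor E F x y) z) =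
           pure_tensor E (proj_tensor F G) x (pure_tensor F G y z)))"


section \<open>Hopf algebras with respect to the complete projective tensor product\<close>

text \<open>
  In the counit axiom, \<open>a \<mapsto> 1 \<otimes> a\<close> and \<open>a \<mapsto> a \<otimes> 1\<close> are the inverses of the unit constraints of the
  monoidal category.
\<close>

definition is_hopf_algebra ::
    "'a lcs \<Rightarrow> ('a \<Rightarrow> ('a, 'a) tensor) \<Rightarrow> ('a \<Rightarrow> complex) \<Rightarrow> ('a \<Rightarrow> 'a) \<Rightarrow> bool" where
  "is_hopf_algebra H \<Delta> \<epsilon> S \<longleftrightarrow>
     is_complete_algebra H \<and>
     cont_alg_hom H (proj_tensor H H) \<Delta> \<and>
     cont_alg_hom H complex_lcs \<epsilon> \<and>
     cont_linear H H S \<and>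
     (\<forall>a\<in>carrier H.
        tensor_assoc H H H (tensor_map H H (proj_tensor H H) H \<Delta> (\<lambda>x. x) (\<Delta> a)) =
        tensor_map H H H (proj_tensor H H) (\<lambda>x. x) \<Delta> (\<Delta> a)) \<and>
     (\<forall>a\<in>carrier H.
        tensor_map H H complex_lcs H \<epsilon> (\<lambda>x. x) (\<Delta> a) = pure_tensor complex_lcs H 1 a \<and>
        tensor_map H H H complex_lcs (\<lambda>x. x) \<epsilon> (\<Delta> a) = pure_tensor H complex_lcs a 1) \<and>
     (\<forall>a\<in>carrier H.
        linearization H H H (mult H) (tensor_map H H H H S (\<lambda>x. x) (\<Delta> a)) = \<epsilon> a \<odot>\<^bsub>H\<^esub> \<one>\<^bsub>H\<^esub> \<and>
        linearization H H H (mult H) (tensor_map H H H H (\<lambda>x. x) S (\<Delta> a)) = \<epsilon> a \<odot>\<^bsub>H\<^esub> \<one>\<^bsub>H\<^esub>)"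

definition is_HFG_hopf_algebra ::
    "'a lcs \<Rightarrow> ('a \<Rightarrow> ('a, 'a) tensor) \<Rightarrow> ('a \<Rightarrow> complex) \<Rightarrow> ('a \<Rightarrow> 'a) \<Rightarrow> bool" where
  "is_HFG_hopf_algebra H \<Delta> \<epsilon> S \<longleftrightarrow> is_HFG H \<and> is_hopf_algebra H \<Delta> \<epsilon> S"

text \<open>\<open>f\<close> satisfies \<open>P\<close>, and \<open>P\<close> determines its values on \<open>X\<close>.\<close>

definition determined_on :: "'a set \<Rightarrow> (('a \<Rightarrow> 'b) \<Rightarrow> bool) \<Rightarrow> ('a \<Rightarrow> 'b) \<Rightarrow> bool" where
  "determined_on X P f \<longleftrightarrow> P f \<and> (\<forall>g. P g \<longrightarrow> (\<forall>x\<in>X. g x = f x))"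


section \<open>The algebra with generators \<open>z\<close>, \<open>b\<close> and relation \<open>e\<^sup>z b = q b e\<^sup>z\<close>\<close>

text \<open>The generator \<open>z\<close> has index 1, the generator \<open>b\<close> has index 2.\<close>

definition Af_relation :: "complex \<Rightarrow> nat list \<Rightarrow> complex" where
  "Af_relation q =
     (alg_exp (free_entire 2) (fe_gen 1) \<otimes>\<^bsub>free_entire 2\<^esub> fe_gen 2) \<ominus>\<^bsub>free_entire 2\<^esub>
     (q \<odot>\<^bsub>free_entire 2\<^esub> (fe_gen 2 \<otimes>\<^bsub>free_entire 2\<^esub> alg_exp (free_entire 2) (fe_gen 1)))"

definition Af :: "complex \<Rightarrow> (nat list \<Rightarrow> complex) set lcs" where
  "Af q = universal_HFG 2 {Af_relation q}"

definition Af_z :: "complex \<Rightarrow> (nat list \<Rightarrow> complex) set" where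
  "Af_z q = universal_HFG_gen 2 {Af_relation q} 1"

definition Af_b :: "complex \<Rightarrow> (nat list \<Rightarrow> complex) set" where
  "Af_b q = universal_HFG_gen 2 {Af_relation q} 2"

end

theory Submission
  imports Defs
begin

text \<open>
  The algebra \<open>Af q\<close> is a quotient of the algebra of free entire functions, so continuous
  homomorphisms out of it are the same as pairs of elements \<open>x\<close>, \<open>y\<close> of a complete Arens--Michael
  algebra with \<open>e\<^sup>x y = q y e\<^sup>x\<close> (\<open>Af_hom_exists\<close>, \<open>Af_hom_unique\<close>). This rests on substitution into free
  entire functions (\<open>evaluation_exists\<close>), and on the fact that a quotient of a Frechet Arens--Michael
  algebra by a closed ideal is again one (\<open>Q_complete\<close>).

  The structure maps are obtained from this property. The elements \<open>1 \<otimes> z\<close> and \<open>z \<otimes> 1\<close> commute,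
  so the functional equation \<open>exp_add\<close> shows that the exponential of their sum is \<open>e\<^sup>z \<otimes> e\<^sup>z\<close>. With this, the
  proposed image of \<open>b\<close> satisfies the relation and the comultiplication exists. The antipode is a
  homomorphism into the opposite algebra, and the map \<open>z \<mapsto> -z\<close>, \<open>b \<mapsto> -b e\<^sup>-\<^sup>z\<close> is its inverse.

  Coassociativity and the counit axioms compare continuous homomorphisms and are checked on \<open>z\<close> and \<open>b\<close>.
  The antipode axioms do not compare homomorphisms. With \<open>L(x \<otimes> y) = S(x) y\<close>, the elements \<open>a\<close>
  such that \<open>L(\<Delta>(a) w) = \<epsilon>(a) L(w)\<close> for all \<open>w\<close> form a subalgebra that contains \<open>z\<close> and \<open>b\<close>, and the products of
  generators span a dense subspace; the axiom is the case \<open>w = 1\<close> (\<open>antipode_left\<close>, \<open>antipode_right\<close>).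

  Infinite dimension follows from the characters \<open>z \<mapsto> t\<close>, \<open>b \<mapsto> 0\<close>, under which the powers of \<open>z\<close> become
  the linearly independent functions \<open>t\<^sup>k\<close> (\<open>infinite_dimensional_Af\<close>).

  The analytic background is the theory of complete projective tensor products. A linear map that is
  defined on a dense span and dominated by continuous seminorms extends uniquely to a complete target
  (\<open>extension_exists\<close>). Together with the completeness of the completion by Cauchy nets (\<open>completion_complete\<close>) this
  yields the universal property of the tensor product (\<open>linearization_spec\<close>). The projective
  seminorms of submultiplicative seminorms are submultiplicative (\<open>weight_mult\<close>), so that tensor products of
  Arens--Michael algebras are Arens--Michael algebras.
\<close>

section \<open>Notation\<close>

text \<open>
  Subscripts abbreviate the structure index of the algebraic operations. In the short names, \<open>csn\<close>
  stands for continuous seminorms, \<open>cpl\<close> for the completion, \<open>CN\<close> and \<open>NF\<close> for Cauchy nets and the filter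
  on their indices, \<open>FSum\<close> for formal sums, \<open>PT\<close> for the complete projective tensor product, \<open>CC\<close> for
  the complex numbers.
\<close>

abbreviation (input) "cpl \<equiv> completion"
abbreviation (input) "car \<equiv> carrier"
abbreviation (input) "CN \<equiv> cauchy_nets"
abbreviation (input) "NF \<equiv> net_filter"
abbreviation (input) "FSum \<equiv> formal_sums"
abbreviation (input) "CC \<equiv> complex_lcs"
abbreviation (input) "keys \<equiv> Poly_Mapping.keys"
abbreviation (input) "lookup \<equiv> Poly_Mapping.lookup"
abbreviation (input) "single \<equiv> Poly_Mapping.single"
abbreviation (input) "csn \<equiv> cont_seminorms"
abbreviation (input) "PT \<equiv> proj_tensor"
abbreviation (input) "pure \<equiv> pure_tensor"

abbreviation (input) struct_zero ("\<zero>\<^sub>_" [1000] 1000) where "\<zero>\<^sub>R \<equiv> \<zero>\<^bsub>R\<^esub>"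
abbreviation (input) struct_one ("\<one>\<^sub>_" [1000] 1000) where "\<one>\<^sub>R \<equiv> \<one>\<^bsub>R\<^esub>"
abbreviation (input) struct_add ("_ \<oplus>\<^sub>_ _" [65, 1000, 66] 65) where "x \<oplus>\<^sub>R y \<equiv> x \<oplus>\<^bsub>R\<^esub> y"
abbreviation (input) struct_minus ("_ \<ominus>\<^sub>_ _" [65, 1000, 66] 65) where "x \<ominus>\<^sub>R y \<equiv> x \<ominus>\<^bsub>R\<^esub> y"
abbreviation (input) struct_uminus ("\<ominus>\<^sub>_ _" [1000, 81] 80) where "\<ominus>\<^sub>R x \<equiv> \<ominus>\<^bsub>R\<^esub> x"
abbreviation (input) struct_mult ("_ \<otimes>\<^sub>_ _" [70, 1000, 71] 70) where "x \<otimes>\<^sub>R y \<equiv> x \<otimes>\<^bsub>R\<^esub> y"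
abbreviation (input) struct_smult ("_ \<odot>\<^sub>_ _" [70, 1000, 71] 70) where "c \<odot>\<^sub>R x \<equiv> c \<odot>\<^bsub>R\<^esub> x"

section \<open>Complex vector spaces and seminorms\<close>

lemma complex_lcs_simps [simp]:
  "car CC = UNIV" "add CC = (+)" "mult CC = (*)"
  "zero CC = 0" "one CC = 1" "smult CC = (*)" "lctop CC = euclidean" by (simp_all add: complex_lcs_def)

lemma abelian_group_complex: "abelian_group CC"
proof (rule abelian_groupI)
  fix x :: complex assume "x \<in> car CC"
  show "\<exists>y\<in>car CC. y \<oplus>\<^bsub>CC\<^esub> x = \<zero>\<^bsub>CC\<^esub>"
    by (rule bexI[of _ "- x"]) auto
qed auto

lemma cring_complex: "Ring.cring CC"
  by (rule cringI) (auto simp: abelian_group_complex algebra_simps intro!: comm_monoidI)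

lemma complex_lcs_minus [simp]: "\<ominus>\<^bsub>CC\<^esub> x = - x" "x \<ominus>\<^bsub>CC\<^esub> y = x - y"
proof -
  interpret cring CC by (rule cring_complex)
  show 1: "\<ominus>\<^bsub>CC\<^esub> x = - x" for x by (rule minus_equality) auto
  show "x \<ominus>\<^bsub>CC\<^esub> y = x - y" by (simp add: a_minus_def 1)
qed

locale cvs =
  fixes M :: "(complex, 'a, 'm) module_scheme" (structure)
  assumes is_module: "Module.module CC M"
begin

sublocale abelian_group M using is_module by (simp add: module_def)

lemma smult_closed [simp, intro]: "x \<in> car M ==> c \<odot> x \<in> car M"
  using module.smult_closed[OF is_module, of c x] by simp

lemma smult_l_distr: "x \<in> car M ==> (c + d) \<odot> x = c \<odot> x \<oplus> d \<odot> x"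
  using module.smult_l_distr[OF is_module, of c d x] by simp

lemma smult_r_distr: "x \<in> car M ==> y \<in> car M ==> c \<odot> (x \<oplus> y) = c \<odot> x \<oplus> c \<odot> y"
  using module.smult_r_distr[OF is_module, of c x y] by simp

lemma smult_assoc: "x \<in> car M ==> c \<odot> (d \<odot> x) = (c * d) \<odot> x"
  using module.smult_assoc1[OF is_module, of c d x] by simp

lemma smult_one [simp]: "x \<in> car M ==> 1 \<odot> x = x" using module.smult_one[OF is_module, of x] by simp

lemma smult_0 [simp]: "x \<in> car M ==> 0 \<odot> x = \<zero>" using module.smult_l_null[OF is_module, of x] by simp

lemma smult_zero [simp]: "c \<odot> \<zero> = \<zero>" using module.smult_r_null[OF is_module, of c] by simp

lemma smult_uminus: "x \<in> car M ==> (- c) \<odot> x = \<ominus> (c \<odot> x)"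
  by (rule minus_equality[symmetric]) (simp_all flip: smult_l_distr)

lemma uminus_smult: "x \<in> car M ==> \<ominus> x = (-1) \<odot> x" by (simp add: smult_uminus)

lemma smult_neg: "x \<in> car M ==> c \<odot> (\<ominus> x) = \<ominus> (c \<odot> x)"
  by (simp add: uminus_smult smult_assoc)

lemma smult_diff: "x \<in> car M ==> y \<in> car M ==> c \<odot> (x \<ominus> y) = c \<odot> x \<ominus> c \<odot> y"
  by (simp add: a_minus_def smult_r_distr smult_neg)

lemma minus_chain:
  assumes "x \<in> car M" "y \<in> car M" "z \<in> car M"
  shows "(x \<ominus> y) \<oplus> (y \<ominus> z) = x \<ominus> z" using assms by (simp add: a_minus_def a_assoc r_neg1)

lemma minus_minus_swap: "x \<in> car M ==> y \<in> car M ==> \<ominus> (x \<ominus> y) = y \<ominus> x"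
  by (simp add: a_minus_def minus_add a_comm)

lemma minus_zero_right [simp]: "x \<in> car M ==> x \<ominus> \<zero> = x" by (simp add: a_minus_def)

lemma minus_self [simp]: "x \<in> car M ==> x \<ominus> x = \<zero>" by (simp add: a_minus_def r_neg)

lemma add_minus_add:
  assumes "x \<in> car M" "y \<in> car M" "z \<in> car M" "w \<in> car M"
  shows "(x \<oplus> y) \<ominus> (z \<oplus> w) = (x \<ominus> z) \<oplus> (y \<ominus> w)"
  using assms by (simp add: a_minus_def minus_add a_ac)

lemma minus_eq_zero: "x \<in> car M ==> y \<in> car M ==> x \<ominus> y = \<zero> \<longleftrightarrow> x = y"
  by (metis add.inv_closed a_minus_def minus_equality minus_minus r_neg)

lemma minus_add_cancel: "x \<in> car M ==> y \<in> car M ==> (x \<ominus> y) \<oplus> y = x"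
  by (simp add: a_minus_def a_assoc l_neg)

lemma sn_nonneg: "is_seminorm M p ==> x \<in> car M ==> 0 \<le> p x" by (simp add: is_seminorm_def)

lemma seminorm_add: "is_seminorm M p ==> x \<in> car M ==> y \<in> car M ==> p (x \<oplus> y) \<le> p x + p y"
  by (simp add: is_seminorm_def)

lemma seminorm_smult: "is_seminorm M p ==> x \<in> car M ==> p (c \<odot> x) = cmod c * p x"
  by (simp add: is_seminorm_def)

lemma seminorm_zero: "is_seminorm M p ==> p \<zero> = 0" using seminorm_smult[of p \<zero> 0] by simp

lemma seminorm_uminus: "is_seminorm M p ==> x \<in> car M ==> p (\<ominus> x) = p x"
  by (simp add: uminus_smult seminorm_smult)

lemma seminorm_minus_commute:
  "is_seminorm M p ==> x \<in> car M ==> y \<in> car M ==> p (x \<ominus> y) = p (y \<ominus> x)"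
  by (metis minus_minus_swap minus_closed seminorm_uminus)

lemma seminorm_triangle:
  assumes "is_seminorm M p" "x \<in> car M" "y \<in> car M" "z \<in> car M"
  shows "p (x \<ominus> z) \<le> p (x \<ominus> y) + p (y \<ominus> z)"
  using seminorm_add[OF assms(1), of "x \<ominus> y" "y \<ominus> z"] assms by (simp add: minus_chain)

lemma seminorm_diff_le:
  assumes "is_seminorm M p" "x \<in> car M" "y \<in> car M"
  shows "\<bar>p x - p y\<bar> \<le> p (x \<ominus> y)"
  using seminorm_triangle[OF assms(1), of x y \<zero>] seminorm_triangle[OF assms(1), of y x \<zero>]
    seminorm_minus_commute[OF assms] assms by simp

lemma seminorm_finsum:
  assumes p: "is_seminorm M p" and "finite A" "\<And>i. i \<in> A ==> f i \<in> car M"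
  shows "p (\<Oplus>i\<in>A. f i) \<le> (\<Sum>i\<in>A. p (f i))" using assms(2,3)
proof (induction A)
  case empty then show ?case by (simp add: seminorm_zero[OF p])
next
  case (insert a A)
  then have "(\<Oplus>i\<in>insert a A. f i) = f a \<oplus> (\<Oplus>i\<in>A. f i)" by (intro finsum_insert) auto
  moreover have "p (f a \<oplus> (\<Oplus>i\<in>A. f i)) \<le> p (f a) + p (\<Oplus>i\<in>A. f i)"
    using insert by (intro seminorm_add[OF p] finsum_closed) auto
  ultimately show ?case using insert by force
qed

lemma is_seminormI:
  assumes "\<And>x. x \<in> car M ==> 0 \<le> p x"
    and "\<And>x y. x \<in> car M ==> y \<in> car M ==> p (x \<oplus> y) \<le> p x + p y"
    and "\<And>c x. x \<in> car M ==> p (c \<odot> x) = cmod c * p x"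
  shows "is_seminorm M p" using assms by (simp add: is_seminorm_def)

lemma is_seminorm_scale: "is_seminorm M p ==> 0 \<le> C ==> is_seminorm M (\<lambda>x. C * p x)" by (rule is_seminormI)
    (simp_all add: sn_nonneg seminorm_smult seminorm_add mult_left_mono flip: distrib_left)

lemma is_seminorm_add:
  assumes "is_seminorm M p" "is_seminorm M q"
  shows "is_seminorm M (\<lambda>x. p x + q x)"
proof (rule is_seminormI)
  fix x y assume xy: "x \<in> car M" "y \<in> car M"
  show "p (x \<oplus> y) + q (x \<oplus> y) \<le> p x + q x + (p y + q y)"
    using seminorm_add[OF assms(1) xy] seminorm_add[OF assms(2) xy] by linarith
qed (use assms in \<open>simp_all add: sn_nonneg seminorm_smult distrib_left\<close>)

lemma is_seminorm_zero: "is_seminorm M (\<lambda>x. 0)" unfolding is_seminorm_def by auto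

end

section \<open>Locally convex spaces\<close>

locale lc_space = cvs E for E :: "'a lcs" (structure) +
  assumes topology_seminorms:
    "\<exists>P. (\<forall>p\<in>P. is_seminorm E p) \<and> lctop E = seminorm_topology E P"

lemma is_lcs_iff: "is_lcs E \<longleftrightarrow> lc_space E"
  by (auto simp: is_lcs_def lc_space_def lc_space_axioms_def cvs_def)

context cvs
begin

lemma seminorm_ball_open:
  assumes P: "\<forall>p\<in>P. is_seminorm M p" and Q: "finite Q" "Q \<subseteq> P" and p: "is_seminorm M p"
    and C: "0 \<le> C" "\<forall>x\<in>car M. p x \<le> C * (\<Sum>q\<in>Q. q x)"
    and x: "x \<in> car M" and e: "0 < e"
  shows "\<exists>Q e'. finite Q \<and> Q \<subseteq> P \<and> 0 < e' \<and>
    {y \<in> car M. \<forall>p\<in>Q. p (y \<ominus> x) < e'} \<subseteq> {y \<in> car M. p (y \<ominus> x) < e}"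
proof (intro exI conjI)
  define D where "D = 1 + C * (1 + real (card Q))"
  have D: "D > 0" using C by (auto simp: D_def add_pos_nonneg)
  show "finite Q" "Q \<subseteq> P" by fact+
  show "0 < e / D" using D e by simp
  show "{y \<in> car M. \<forall>p\<in>Q. p (y \<ominus> x) < e / D} \<subseteq> {y \<in> car M. p (y \<ominus> x) < e}"
  proof safe
    fix y assume y: "y \<in> car M" "\<forall>p\<in>Q. p (y \<ominus> x) < e / D"
    have "p (y \<ominus> x) \<le> C * (\<Sum>q\<in>Q. q (y \<ominus> x))" using C x y by auto
    also have "\<dots> \<le> C * (\<Sum>q\<in>Q. e / D)" using y C by (intro mult_left_mono sum_mono) (auto intro: less_imp_le)
    also have "\<dots> = (C * real (card Q)) * (e / D)" by simp
    also have "\<dots> < D * (e / D)" using D e C by (intro mult_strict_right_mono) (auto simp: D_def algebra_simps)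
    also have "\<dots> = e" using D by simp
    finally show "p (y \<ominus> x) < e" .
  qed
qed

end

text \<open>
  A seminorm that is continuous at \<open>0\<close> is below 1 on some basic ball; homogeneity turns this
  into a bound by a multiple of the finite sum that defines the ball.
\<close>

lemma seminorm_topology_cont_seminorms_iff:
  assumes "cvs E" and P: "\<forall>p\<in>P. is_seminorm E p" and top: "lctop E = seminorm_topology E P"
  shows "p \<in> csn E \<longleftrightarrow> is_seminorm E p \<and>
    (\<exists>Q C. finite Q \<and> Q \<subseteq> P \<and> 0 \<le> C \<and> (\<forall>x\<in>car E. p x \<le> C * (\<Sum>q\<in>Q. q x)))"
    (is "_ \<longleftrightarrow> _ \<and> ?dom")
proof -
  interpret cvs E by fact
  have topspace: "topspace (lctop E) = car E" by (simp add: top topspace_seminorm_topology)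
  show ?thesis
  proof safe
    assume p: "p \<in> csn E"
    then show sp: "is_seminorm E p" by (simp add: cont_seminorms_def)
    have "openin (lctop E) {x \<in> topspace (lctop E). p x \<in> {..<1}}"
     using p unfolding cont_seminorms_def by (intro openin_continuous_map_preimage) auto
    then have "seminorm_open E P {x \<in> car E. p x < 1}"
     by (simp add: topspace top openin_seminorm_topology topspace_seminorm_topology)
    moreover have "\<zero>\<^sub>E \<in> {x \<in> car E. p x < 1}" by (simp add: seminorm_zero[OF sp])
    ultimately obtain Q e where Q: "finite Q" "Q \<subseteq> P" "0 < e"
     "{y \<in> car E. \<forall>q\<in>Q. q (y \<ominus>\<^sub>E \<zero>\<^sub>E) < e} \<subseteq> {x \<in> car E. p x < 1}"
     unfolding seminorm_open_def by meson
    let ?s = "\<lambda>x. \<Sum>q\<in>Q. q x"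
    have Qn: "0 \<le> q x" if "q \<in> Q" "x \<in> car E" for q x using that Q(2) P by (auto intro: sn_nonneg)
    have "p x \<le> (1 / e) * ?s x" if x: "x \<in> car E" for x
    proof (rule field_le_epsilon)
     fix d :: real assume d: "0 < d"
     define t where "t = ?s x / e + d"
     have t: "t > 0" using d Qn x Q(3) by (auto simp: t_def intro!: add_nonneg_pos divide_nonneg_pos sum_nonneg)
     have "q (complex_of_real (1 / t) \<odot>\<^sub>E x) < e" if q: "q \<in> Q" for q
     proof -
      have "q (complex_of_real (1 / t) \<odot>\<^sub>E x) = q x / t"
       using P Q q t x by (subst seminorm_smult) (auto simp: norm_divide)
      also have "q x \<le> ?s x" using Q q Qn x by (intro member_le_sum) auto
      then have "q x / t \<le> ?s x / t" using t by (simp add: divide_right_mono)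
      also have "\<dots> < e" using t d Q(3) by (simp add: t_def field_simps)
      finally show ?thesis .
     qed
     then have "complex_of_real (1 / t) \<odot>\<^sub>E x \<in> {y \<in> car E. \<forall>q\<in>Q. q (y \<ominus>\<^sub>E \<zero>\<^sub>E) < e}"
      using x by simp
     then have "p (complex_of_real (1 / t) \<odot>\<^sub>E x) < 1" using Q(4) by blast
     then have "p x / t < 1" using sp t x by (simp add: seminorm_smult norm_divide)
     then show "p x \<le> (1 / e) * ?s x + d" using t by (simp add: t_def field_simps)
    qed
    then show ?dom using Q by (intro exI[of _ Q] exI[of _ "1 / e"]) auto
  next
    fix Q C assume sp: "is_seminorm E p" and Q: "finite Q" "Q \<subseteq> P"
     and C: "0 \<le> C" "\<forall>x\<in>car E. p x \<le> C * (\<Sum>q\<in>Q. q x)"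
    have "openin (lctop E) {x \<in> topspace (lctop E). p x \<in> U}" if U: "open U" for U
     unfolding topspace top openin_seminorm_topology topspace_seminorm_topology seminorm_open_def
    proof (intro conjI ballI)
     fix x assume x: "x \<in> {x \<in> car E. p x \<in> U}"
     then have "p x \<in> U" by simp
     then have "\<exists>e>0. ball (p x) e \<subseteq> U" using U by (simp add: open_contains_ball)
     then obtain e where e: "e > 0" "ball (p x) e \<subseteq> U" by (elim exE conjE)
     have xc: "x \<in> car E" using x by simp
     obtain Q' e' where Q': "finite Q'" "Q' \<subseteq> P" "0 < e'"
      "{y \<in> car E. \<forall>p\<in>Q'. p (y \<ominus>\<^sub>E x) < e'} \<subseteq> {y \<in> car E. p (y \<ominus>\<^sub>E x) < e}"
      using seminorm_ball_open[OF P Q sp C xc e(1)] by (elim exE conjE)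
     have "{y \<in> car E. p (y \<ominus>\<^sub>E x) < e} \<subseteq> {x \<in> car E. p x \<in> U}"
     proof safe
      fix y assume y: "y \<in> car E" "p (y \<ominus>\<^sub>E x) < e"
      have "\<bar>p x - p y\<bar> < e" using seminorm_diff_le[OF sp y(1), of x] x y by auto
      then show "p y \<in> U" using e by (auto simp: dist_real_def)
     qed
     then have "{y \<in> car E. \<forall>p\<in>Q'. p (y \<ominus>\<^sub>E x) < e'} \<subseteq> {x \<in> car E. p x \<in> U}"
      using Q'(4) by (rule subset_trans[rotated])
     then show "\<exists>Q e. finite Q \<and> Q \<subseteq> P \<and> 0 < e \<and>
       {y \<in> car E. \<forall>p\<in>Q. p (y \<ominus>\<^sub>E x) < e} \<subseteq> {x \<in> car E. p x \<in> U}"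
      using Q'(1-3) by (intro exI[of _ Q'] exI[of _ e'] conjI)
    qed auto
    then show "p \<in> csn E" unfolding cont_seminorms_def using sp by (auto simp: continuous_map_def)
  qed
qed

context lc_space
begin

lemma topspace [simp]: "topspace (lctop E) = car E" using topology_seminorms by (auto simp: topspace_seminorm_topology)

lemma csnD: "p \<in> csn E ==> is_seminorm E p" by (simp add: cont_seminorms_def)

lemma csn_le:
  assumes r: "r \<in> csn E" and p: "is_seminorm E p" and "0 \<le> C"
    and le: "\<And>x. x \<in> car E ==> p x \<le> C * r x"
  shows "p \<in> csn E"
proof -
  obtain P where P: "\<forall>p\<in>P. is_seminorm E p" "lctop E = seminorm_topology E P"
    using topology_seminorms by (elim exE conjE)
  note iff = seminorm_topology_cont_seminorms_iff[OF cvs_axioms P]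
  obtain Q D where Q: "finite Q" "Q \<subseteq> P" "0 \<le> D" "\<forall>x\<in>car E. r x \<le> D * (\<Sum>q\<in>Q. q x)"
    using r unfolding iff by (elim exE conjE)
  have "p x \<le> (C * D) * (\<Sum>q\<in>Q. q x)" if "x \<in> car E" for x
  proof -
    have "p x \<le> C * r x" using le that .
    also have "\<dots> \<le> C * (D * (\<Sum>q\<in>Q. q x))" using Q(4) that assms(3) by (intro mult_left_mono) auto
    finally show ?thesis by (simp add: mult.assoc)
  qed
  then show ?thesis unfolding iff using p Q assms(3) by (intro conjI exI[of _ Q] exI[of _ "C * D"]) auto
qed

lemma csn_zero: "(\<lambda>x. 0) \<in> csn E" by (simp add: cont_seminorms_def is_seminorm_zero)

lemma csn_scale: "p \<in> csn E ==> 0 \<le> C ==> (\<lambda>x. C * p x) \<in> csn E"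
  by (rule csn_le[of p _ C]) (auto intro: is_seminorm_scale csnD)

lemma csn_add:
  assumes "p \<in> csn E" "q \<in> csn E"
  shows "(\<lambda>x. p x + q x) \<in> csn E"
  using assms unfolding cont_seminorms_def by (auto intro: is_seminorm_add continuous_map_add)

lemma csn_sum:
  assumes "finite Q" "\<And>q. q \<in> Q ==> f q \<in> csn E"
  shows "(\<lambda>x. \<Sum>q\<in>Q. f q x) \<in> csn E" using assms by (induction Q) (auto intro: csn_add csn_zero)

text \<open>
  Finitely many continuous seminorms and a radius can be replaced by one continuous seminorm and radius 1:
  take the sum and divide it by the radius. This is the form in which neighbourhoods are used below.
\<close>

lemma openin_iff:
  "openin (lctop E) U \<longleftrightarrow> U \<subseteq> car E \<and>
    (\<forall>x\<in>U. \<exists>p\<in>csn E. {y \<in> car E. p (y \<ominus> x) < 1} \<subseteq> U)"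
proof -
  obtain P where P: "\<forall>p\<in>P. is_seminorm E p" "lctop E = seminorm_topology E P"
    using topology_seminorms by (elim exE conjE)
  note iff = seminorm_topology_cont_seminorms_iff[OF cvs_axioms P]
  have PCS: "p \<in> csn E" if "p \<in> P" for p
    unfolding iff using that P by (auto intro!: exI[of _ "{p}"] exI[of _ 1])
  have eq: "(\<exists>Q e. finite Q \<and> Q \<subseteq> P \<and> 0 < e \<and> {y \<in> car E. \<forall>p\<in>Q. p (y \<ominus> x) < e} \<subseteq> U) \<longleftrightarrow>
     (\<exists>p\<in>csn E. {y \<in> car E. p (y \<ominus> x) < 1} \<subseteq> U)" if x: "x \<in> car E" for x
  proof
    assume "\<exists>Q e. finite Q \<and> Q \<subseteq> P \<and> 0 < e \<and> {y \<in> car E. \<forall>p\<in>Q. p (y \<ominus> x) < e} \<subseteq> U"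
    then obtain Q e where Q: "finite Q" "Q \<subseteq> P" "0 < (e::real)" "{y \<in> car E. \<forall>p\<in>Q. p (y \<ominus> x) < e} \<subseteq> U"
     by (elim exE conjE bexE)
    let ?p = "\<lambda>y. (1 / e) * (\<Sum>q\<in>Q. q y)"
    have mem: "?p \<in> csn E" using Q PCS by (intro csn_scale csn_sum) auto
    have sub: "{y \<in> car E. ?p (y \<ominus> x) < 1} \<subseteq> {y \<in> car E. \<forall>p\<in>Q. p (y \<ominus> x) < e}"
    proof safe
     fix y q assume y: "y \<in> car E" "?p (y \<ominus> x) < 1" "q \<in> Q"
     have "q (y \<ominus> x) \<le> (\<Sum>q\<in>Q. q (y \<ominus> x))"
      using Q P x y by (intro member_le_sum) (auto intro!: sn_nonneg)
     also have "\<dots> < e" using y Q by (simp add: field_simps)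
     finally show "q (y \<ominus> x) < e" .
    qed
    show "\<exists>p\<in>csn E. {y \<in> car E. p (y \<ominus> x) < 1} \<subseteq> U"
     by (rule bexI[OF _ mem]) (rule subset_trans[OF sub Q(4)])
  next
    assume "\<exists>p\<in>csn E. {y \<in> car E. p (y \<ominus> x) < 1} \<subseteq> U"
    then obtain p where p: "p \<in> csn E" "{y \<in> car E. p (y \<ominus> x) < 1} \<subseteq> U" by (elim bexE)
    obtain Q C where Q: "finite Q" "Q \<subseteq> P" "0 \<le> C" "\<forall>x\<in>car E. p x \<le> C * (\<Sum>q\<in>Q. q x)"
     using p(1) unfolding iff by (elim exE conjE)
    obtain Q' e' where "finite Q'" "Q' \<subseteq> P" "0 < e'"
     "{y \<in> car E. \<forall>p\<in>Q'. p (y \<ominus> x) < e'} \<subseteq> {y \<in> car E. p (y \<ominus> x) < 1}"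
     using seminorm_ball_open[OF P(1) Q(1,2) csnD[OF p(1)] Q(3,4) x zero_less_one] by (elim exE conjE)
    then show "\<exists>Q e. finite Q \<and> Q \<subseteq> P \<and> 0 < e \<and> {y \<in> car E. \<forall>p\<in>Q. p (y \<ominus> x) < e} \<subseteq> U"
     using p(2) by (intro exI[of _ Q'] exI[of _ e'] conjI subset_trans[OF _ p(2)])
  qed
  then have "(\<forall>x\<in>U. \<exists>Q e. finite Q \<and> Q \<subseteq> P \<and> 0 < e \<and> {y \<in> car E. \<forall>p\<in>Q. p (y \<ominus> x) < e} \<subseteq> U) \<longleftrightarrow>
     (\<forall>x\<in>U. \<exists>p\<in>csn E. {y \<in> car E. p (y \<ominus> x) < 1} \<subseteq> U)" if "U \<subseteq> car E"
    by (intro ball_cong refl eq subsetD[OF that])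
  then show ?thesis unfolding P(2) openin_seminorm_topology seminorm_open_def by argo
qed

lemma ball_nhd:
  assumes p: "p \<in> csn E" and x: "x \<in> car E" and e: "0 < e"
  shows "openin (lctop E) {y \<in> car E. p (y \<ominus> x) < e}" unfolding openin_iff
proof (intro conjI ballI)
  note sp = csnD[OF p]
  fix y assume y: "y \<in> {y \<in> car E. p (y \<ominus> x) < e}"
  define d where "d = e - p (y \<ominus> x)"
  have d: "d > 0" using y by (simp add: d_def)
  show "\<exists>p'\<in>csn E. {z \<in> car E. p' (z \<ominus> y) < 1} \<subseteq> {y \<in> car E. p (y \<ominus> x) < e}"
  proof (intro bexI[of _ "\<lambda>z. (1 / d) * p z"] subsetI)
    fix z assume z: "z \<in> {z \<in> car E. (1 / d) * p (z \<ominus> y) < 1}"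
    then have "p (z \<ominus> y) < d" using d by (simp add: field_simps)
    then show "z \<in> {y \<in> car E. p (y \<ominus> x) < e}"
     using seminorm_triangle[OF sp, of z y x] x y z by (auto simp: d_def)
  qed (use csn_scale[OF p, of "1 / d"] d in simp)
qed auto

lemma limitin_iff:
  "limitin (lctop E) f l F \<longleftrightarrow> l \<in> car E \<and> eventually (\<lambda>i. f i \<in> car E) F \<and>
    (\<forall>p\<in>csn E. \<forall>e>0. eventually (\<lambda>i. p (f i \<ominus> l) < e) F)"
proof safe
  assume L: "limitin (lctop E) f l F"
  then show l: "l \<in> car E" by (simp add: limitin_def)
  have "openin (lctop E) (car E)" using openin_topspace[of "lctop E"] by simp
  then show "eventually (\<lambda>i. f i \<in> car E) F" using L l by (simp add: limitin_def)
  fix p :: "'a => real" and e :: real assume p: "p \<in> csn E" "0 < e"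
  have "l \<in> {y \<in> car E. p (y \<ominus> l) < e}" using l p seminorm_zero[OF csnD[OF p(1)]] by simp
  then have "eventually (\<lambda>i. f i \<in> {y \<in> car E. p (y \<ominus> l) < e}) F"
    by (rule L[unfolded limitin_def, THEN conjunct2, rule_format, OF conjI, OF ball_nhd[OF p(1) l p(2)]])
  then show "eventually (\<lambda>i. p (f i \<ominus> l) < e) F" by (rule eventually_mono) auto
next
  assume l: "l \<in> car E" and c: "eventually (\<lambda>i. f i \<in> car E) F"
    and e: "\<forall>p\<in>csn E. \<forall>e>0. eventually (\<lambda>i. p (f i \<ominus> l) < e) F"
  show "limitin (lctop E) f l F" unfolding limitin_def
  proof (intro conjI allI impI)
    show "l \<in> topspace (lctop E)" using l by simp
    fix U assume U: "openin (lctop E) U \<and> l \<in> U"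
    then obtain p where p: "p \<in> csn E" "{y \<in> car E. p (y \<ominus> l) < 1} \<subseteq> U"
     unfolding openin_iff by meson
    then have "eventually (\<lambda>i. p (f i \<ominus> l) < 1) F" using e by simp
    then show "eventually (\<lambda>i. f i \<in> U) F" using c by eventually_elim (use p in auto)
  qed
qed

text \<open>
  The condition on pairs splits into one on single points because the events \<open>Q x\<close>, \<open>Q y\<close> generate
  the product filter.
\<close>

lemma cauchy_filter_iff:
  "cauchy_filter E F \<longleftrightarrow> F \<noteq> bot \<and> eventually (\<lambda>x. x \<in> car E) F \<and>
    (\<forall>p\<in>csn E. \<forall>e>0. \<exists>Q. eventually Q F \<and>
     (\<forall>x\<in>car E. \<forall>y\<in>car E. Q x --> Q y --> p (x \<ominus> y) < e))"
  (is "_ \<longleftrightarrow> _ \<and> _ \<and> ?C")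
proof -
  have "?C" if C: "cauchy_filter E F"
  proof (intro ballI allI impI)
    fix p and e :: real assume p: "p \<in> csn E" "0 < e"
    have "openin (lctop E) {y \<in> car E. p (y \<ominus> \<zero>) < e}" by (rule ball_nhd[OF p(1) zero_closed p(2)])
    moreover have "\<zero> \<in> {y \<in> car E. p (y \<ominus> \<zero>) < e}"
     using p seminorm_zero[OF csnD[OF p(1)]] by simp
    ultimately have "eventually (\<lambda>(x, y). x \<ominus> y \<in> {y \<in> car E. p (y \<ominus> \<zero>) < e}) (F \<times>\<^sub>F F)"
     using C unfolding cauchy_filter_def by (elim conjE allE impE) (rule conjI)
    then obtain Q where Q: "eventually Q F" "\<forall>x y. Q x --> Q y --> x \<ominus> y \<in> {y \<in> car E. p (y \<ominus> \<zero>) < e}"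
     unfolding eventually_prod_same by (elim exE conjE) simp
    then show "\<exists>Q. eventually Q F \<and> (\<forall>x\<in>car E. \<forall>y\<in>car E. Q x --> Q y --> p (x \<ominus> y) < e)"
    proof (intro exI[of _ Q] conjI ballI impI)
     fix x y assume xy: "x \<in> car E" "y \<in> car E" "Q x" "Q y"
     then have "p (x \<ominus> y \<ominus> \<zero>) < e" using Q(2)[rule_format, of x y] by simp
     then show "p (x \<ominus> y) < e" using xy by simp
    qed (rule Q(1))
  qed
  moreover have "cauchy_filter E F" if "F \<noteq> bot" and c: "eventually (\<lambda>x. x \<in> car E) F" and C: "?C"
    unfolding cauchy_filter_def
  proof (intro conjI allI impI that)
    fix U assume U: "openin (lctop E) U \<and> \<zero> \<in> U"
    then obtain p where p: "p \<in> csn E" "{y \<in> car E. p (y \<ominus> \<zero>) < 1} \<subseteq> U"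
     unfolding openin_iff by meson
    then obtain Q where Q: "eventually Q F"
     "\<And>x y. x \<in> car E ==> y \<in> car E ==> Q x ==> Q y ==> p (x \<ominus> y) < 1"
     using C[rule_format, OF p(1), of 1] by auto
    show "eventually (\<lambda>(x, y). x \<ominus> y \<in> U) (F \<times>\<^sub>F F)" unfolding eventually_prod_same
    proof (intro exI[of _ "\<lambda>x. Q x \<and> x \<in> car E"] conjI allI impI)
     show "eventually (\<lambda>x. Q x \<and> x \<in> car E) F" using Q(1) c by eventually_elim auto
    qed (use Q(2) p(2) in auto)
  qed
  ultimately show ?thesis by (auto simp: cauchy_filter_def)
qed

lemma Hausdorff_iff:
  "Hausdorff_space (lctop E) \<longleftrightarrow>
    (\<forall>x\<in>car E. (\<forall>p\<in>csn E. p x = 0) --> x = \<zero>)"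
proof safe
  fix x assume H: "Hausdorff_space (lctop E)" and x: "x \<in> car E" "\<forall>p\<in>csn E. p x = 0"
  have "limitin (lctop E) (\<lambda>_::unit. x) \<zero> (principal UNIV)"
    using x unfolding limitin_iff by (auto simp: eventually_principal)
  moreover have "limitin (lctop E) (\<lambda>_::unit. x) x (principal UNIV)" using x unfolding limitin_iff
    by (auto simp: eventually_principal seminorm_zero[OF csnD])
  ultimately show "x = \<zero>"
    using limitin_Hausdorff_unique[OF _ _ _ H, of "\<lambda>_. x" x "principal (UNIV :: unit set)" \<zero>]
    by (auto simp: trivial_limit_def eventually_principal)
next
  assume H: "\<forall>x\<in>car E. (\<forall>p\<in>csn E. p x = 0) --> x = \<zero>"
  show "Hausdorff_space (lctop E)" unfolding Hausdorff_space_def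
  proof (intro allI impI)
    fix x y assume xy: "x \<in> topspace (lctop E) \<and> y \<in> topspace (lctop E) \<and> x \<noteq> y"
    then have "x \<ominus> y \<noteq> \<zero>" by (simp add: minus_eq_zero)
    then obtain p where p: "p \<in> csn E" "p (x \<ominus> y) \<noteq> 0" using H xy by auto
    note sp = csnD[OF p(1)]
    define e where "e = p (x \<ominus> y) / 2"
    have e: "e > 0" using p sn_nonneg[OF sp, of "x \<ominus> y"] xy by (simp add: e_def)
    show "\<exists>U V. openin (lctop E) U \<and> openin (lctop E) V \<and> x \<in> U \<and> y \<in> V \<and> disjnt U V"
    proof (intro exI conjI)
     show "openin (lctop E) {z \<in> car E. p (z \<ominus> x) < e}" "openin (lctop E) {z \<in> car E. p (z \<ominus> y) < e}"
      using xy by (auto intro!: ball_nhd[OF p(1) _ e] simp del: Collect_conj_eq)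
     show "disjnt {z \<in> car E. p (z \<ominus> x) < e} {z \<in> car E. p (z \<ominus> y) < e}" unfolding disjnt_iff
     proof safe
      fix z assume z: "z \<in> car E" "p (z \<ominus> x) < e" "p (z \<ominus> y) < e"
      have "p (x \<ominus> y) \<le> p (x \<ominus> z) + p (z \<ominus> y)"
       using seminorm_triangle[OF sp, of x z y] xy z(1) by simp
      moreover have "p (x \<ominus> z) = p (z \<ominus> x)"
       using seminorm_minus_commute[OF sp, of x z] xy z(1) by simp
      ultimately show False using z(2,3) unfolding e_def by linarith
     qed
    next
     show "x \<in> {z \<in> car E. p (z \<ominus> x) < e}" "y \<in> {z \<in> car E. p (z \<ominus> y) < e}"
      using xy e seminorm_zero[OF sp] by simp_all
    qed
  qed
qed

end

lemma lc_space_seminorm_topology: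
  assumes "cvs E" and P: "\<forall>p\<in>P. is_seminorm E p" and top: "lctop E = seminorm_topology E P"
  shows "lc_space E" using assms by (auto simp: lc_space_def lc_space_axioms_def)

lemma generating_cont_seminorms:
  assumes "cvs E" and P: "\<forall>p\<in>P. is_seminorm E p" and top: "lctop E = seminorm_topology E P"
  shows "P \<subseteq> csn E"
proof
  fix p assume "p \<in> P"
  then show "p \<in> csn E" using P by (subst seminorm_topology_cont_seminorms_iff[OF assms])
     (auto intro!: exI[of _ "{p}"] exI[of _ 1])
qed

text \<open>
  For a directed family of defining seminorms, the finite sum in the general bound can be replaced by a single member.
\<close>

lemma cont_seminorm_dominated:
  assumes "cvs E" and P: "\<forall>p\<in>P. is_seminorm E p" and top: "lctop E = seminorm_topology E P"
    and ne: "P \<noteq> {}"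
    and dir: "\<And>p p'. p \<in> P ==> p' \<in> P ==> \<exists>q\<in>P. \<forall>x\<in>car E. p x \<le> q x \<and> p' x \<le> q x"
    and p: "p \<in> csn E"
  shows "\<exists>q\<in>P. \<exists>C>0. \<forall>x\<in>car E. p x \<le> C * q x"
proof -
  interpret cvs E by fact
  obtain Q C where Q: "finite Q" "Q \<subseteq> P" "0 \<le> C" "\<forall>x\<in>car E. p x \<le> C * (\<Sum>q\<in>Q. q x)"
    using p unfolding seminorm_topology_cont_seminorms_iff[OF assms(1-3)] by (elim exE conjE)
  have "\<exists>q\<in>P. \<forall>q'\<in>Q. \<forall>x\<in>car E. q' x \<le> q x" using Q(1,2)
  proof (induction Q)
    case empty
    then show ?case using ne by auto
  next
    case (insert a Q)
    then obtain q where q: "q \<in> P" "\<forall>q'\<in>Q. \<forall>x\<in>car E. q' x \<le> q x" by auto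
    obtain q2 where q2: "q2 \<in> P" "\<forall>x\<in>car E. q x \<le> q2 x \<and> a x \<le> q2 x"
     using dir[OF q(1), of a] insert.prems by auto
    have "q' x \<le> q2 x" if "q' \<in> insert a Q" "x \<in> car E" for q' x
     using that q(2) q2(2) order_trans[of "q' x" "q x" "q2 x"] by auto
    then show ?case using q2(1) by blast
  qed
  then obtain q where q: "q \<in> P" "\<forall>q'\<in>Q. \<forall>x\<in>car E. q' x \<le> q x" by (elim bexE)
  have "p x \<le> (C * real (card Q) + 1) * q x" if x: "x \<in> car E" for x
  proof -
    have "p x \<le> C * (\<Sum>q\<in>Q. q x)" using Q(4) x by auto
    also have "\<dots> \<le> C * (\<Sum>_\<in>Q. q x)" using q x Q by (intro mult_left_mono sum_mono) auto
    also have "\<dots> \<le> (C * real (card Q) + 1) * q x" using sn_nonneg[of q x] P q x by (simp add: algebra_simps)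
    finally show ?thesis .
  qed
  moreover have "C * real (card Q) + 1 > 0" using Q(3) by (simp add: add_nonneg_pos)
  ultimately show ?thesis using q(1) by blast
qed

text \<open>
  Continuity of a linear map needs to be tested at \<open>0\<close> only, and there it is a domination of seminorms.
\<close>

lemma cont_linear_iff:
  assumes E: "lc_space E" and G: "lc_space G"
  shows "cont_linear E G f \<longleftrightarrow> f \<in> car E \<rightarrow> car G \<and>
    (\<forall>x\<in>car E. \<forall>y\<in>car E. f (x \<oplus>\<^sub>E y) = f x \<oplus>\<^sub>G f y) \<and>
    (\<forall>c. \<forall>x\<in>car E. f (c \<odot>\<^sub>E x) = c \<odot>\<^sub>G f x) \<and>
    (\<forall>p\<in>csn G. \<exists>r\<in>csn E. \<forall>x\<in>car E. p (f x) \<le> r x)"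
proof -
  interpret E: lc_space E by fact
  interpret G: lc_space G by fact
  have cont: "continuous_map (lctop E) (lctop G) f \<longleftrightarrow>
    (\<forall>p\<in>csn G. \<exists>r\<in>csn E. \<forall>x\<in>car E. p (f x) \<le> r x)"
    if f: "f \<in> car E \<rightarrow> car G" and
    add: "\<forall>x\<in>car E. \<forall>y\<in>car E. f (x \<oplus>\<^sub>E y) = f x \<oplus>\<^sub>G f y" and
    sc: "\<forall>c. \<forall>x\<in>car E. f (c \<odot>\<^sub>E x) = c \<odot>\<^sub>G f x"
  proof safe
    fix p assume c: "continuous_map (lctop E) (lctop G) f" and p: "p \<in> csn G"
    have "is_seminorm E (\<lambda>x. p (f x))"
    proof (rule E.is_seminormI)
     note sp = G.csnD[OF p]
     have fc: "f x \<in> car G" if "x \<in> car E" for x using f that by (rule funcset_mem)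
     fix x y c assume x: "x \<in> car E"
     show "0 \<le> p (f x)" by (rule G.sn_nonneg[OF sp fc[OF x]])
     show "p (f (c \<odot>\<^sub>E x)) = cmod c * p (f x)" using G.seminorm_smult[OF sp fc[OF x]] sc x by simp
     assume y: "y \<in> car E"
     show "p (f (x \<oplus>\<^sub>E y)) \<le> p (f x) + p (f y)"
      using G.seminorm_add[OF sp fc[OF x] fc[OF y]] add x y by simp
    qed
    then have "(\<lambda>x. p (f x)) \<in> csn E"
     using continuous_map_compose[OF c, of euclideanreal p] p by (simp add: cont_seminorms_def o_def)
    then show "\<exists>r\<in>csn E. \<forall>x\<in>car E. p (f x) \<le> r x"
     by (intro bexI[of _ "\<lambda>x. p (f x)"] ballI order_refl)
  next
    assume b: "\<forall>p\<in>csn G. \<exists>r\<in>csn E. \<forall>x\<in>car E. p (f x) \<le> r x"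
    show "continuous_map (lctop E) (lctop G) f" unfolding continuous_map_def
    proof (intro conjI allI impI)
     show "f \<in> topspace (lctop E) \<rightarrow> topspace (lctop G)" using f by simp
     fix U assume U: "openin (lctop G) U"
     show "openin (lctop E) {x \<in> topspace (lctop E). f x \<in> U}" unfolding E.openin_iff
     proof (intro conjI ballI)
      fix x assume x: "x \<in> {x \<in> topspace (lctop E). f x \<in> U}"
      then obtain p where p: "p \<in> csn G" "{y \<in> car G. p (y \<ominus>\<^sub>G f x) < 1} \<subseteq> U"
       using U unfolding G.openin_iff by auto
      then obtain r where r: "r \<in> csn E" "\<forall>x\<in>car E. p (f x) \<le> r x" using bspec[OF b p(1)] by (elim bexE)
      have xE: "x \<in> car E" using x by simp
      have fc: "f x \<in> car G" if "x \<in> car E" for x using f that by (rule funcset_mem)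
      have diff: "f (y \<ominus>\<^sub>E x) = f y \<ominus>\<^sub>G f x" if "y \<in> car E" for y
       using xE that fc add sc by (simp add: a_minus_def E.uminus_smult G.uminus_smult)
      show "\<exists>p\<in>csn E. {y \<in> car E. p (y \<ominus>\<^sub>E x) < 1} \<subseteq> {x \<in> topspace (lctop E). f x \<in> U}"
      proof (intro bexI[OF _ r(1)] subsetI CollectI conjI)
       fix y assume y: "y \<in> {y \<in> car E. r (y \<ominus>\<^sub>E x) < 1}"
       then show "y \<in> topspace (lctop E)" by simp
       have "p (f (y \<ominus>\<^sub>E x)) \<le> r (y \<ominus>\<^sub>E x)" using r(2) y xE by simp
       then have "f y \<in> {z \<in> car G. p (z \<ominus>\<^sub>G f x) < 1}" using y diff[of y] fc[of y] by simp
       then show "f y \<in> U" using p(2) by (rule subsetD[rotated])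
      qed
     qed auto
    qed
  qed
  show ?thesis unfolding cont_linear_def by (intro conj_cong refl cont)
qed

section \<open>Linear combinations of a family and extension by density\<close>

text \<open>
  Finitely supported functions model the free vector space, so that linear combinations can be added
  and compared before they are evaluated in a space.
\<close>

definition lincomb :: "(complex, 'a, 'm) module_scheme => ('k => 'a) => ('k \<Rightarrow>\<^sub>0 complex) => 'a" where
  "lincomb M X w = (\<Oplus>\<^bsub>M\<^esub>k\<in>keys w. lookup w k \<odot>\<^sub>M X k)"

definition scale :: "complex => ('k \<Rightarrow>\<^sub>0 complex) => ('k \<Rightarrow>\<^sub>0 complex)" where
  "scale c = Poly_Mapping.map (\<lambda>a. c * a)"

lemma lookup_scale: "lookup (scale c w) k = c * lookup w k" by (simp add: scale_def Poly_Mapping.map.rep_eq when_def)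

lemma keys_scale: "keys (scale c w) \<subseteq> keys w" by (auto simp: in_keys_iff lookup_scale)

lemma scale_single: "scale c (single k a) = single k (c * a)"
  by (rule poly_mapping_eqI) (simp add: lookup_scale lookup_single when_def)

lemma scale_add: "scale c (v + w) = scale c v + scale c w"
  by (rule poly_mapping_eqI) (simp add: lookup_scale lookup_add algebra_simps)

lemma scale_minus_one: "scale (-1) v = - v" by (rule poly_mapping_eqI) (simp add: lookup_scale)

lemma keys_single_subset: "k \<in> K ==> keys (single k c) \<subseteq> K" by (simp add: keys_single)

lemma keys_add_subset:
  "keys v \<subseteq> K ==> keys w \<subseteq> K ==> keys (v + w) \<subseteq> K"
  using keys_add[of v w] by (meson Un_least subset_trans)

lemma keys_scale_subset: "keys v \<subseteq> K ==> keys (scale c v) \<subseteq> K"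
  using keys_scale by (rule subset_trans)

lemma keys_minus_subset:
  "keys v \<subseteq> K ==> keys w \<subseteq> K ==>
    keys (v - w :: 'k \<Rightarrow>\<^sub>0 complex) \<subseteq> K"
proof
  fix t assume vw: "keys v \<subseteq> K" "keys w \<subseteq> K" and "t \<in> keys (v - w)"
  then have "lookup v t \<noteq> 0 \<or> lookup w t \<noteq> 0" by (auto simp: in_keys_iff lookup_minus)
  then show "t \<in> K" using vw by (auto simp: in_keys_iff subset_iff)
qed

lemma free_vector_induct [consumes 1, case_names zero step]:
  fixes w :: "'k \<Rightarrow>\<^sub>0 complex"
  assumes "keys w \<subseteq> K"
    and "P 0"
    and step: "\<And>k c v. k \<in> K ==> keys v \<subseteq> K ==> P v ==> P (single k c + v)"
  shows "P w"
proof -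
  have main: "\<forall>w. keys w = A --> A \<subseteq> K --> P w" if "finite A" for A using that
  proof (induction A)
    case empty
    then show ?case using \<open>P 0\<close> by simp
  next
    case (insert k A)
    show ?case
    proof (intro allI impI)
     fix w :: "'k \<Rightarrow>\<^sub>0 complex" assume w: "keys w = insert k A" "insert k A \<subseteq> K"
     define v where "v = w - single k (lookup w k)"
     have v: "lookup v j = (if j = k then 0 else lookup w j)" for j
      by (simp add: v_def lookup_minus lookup_single when_def)
     have "keys v = A" using w(1) insert.hyps(2) by (auto simp: in_keys_iff v set_eq_iff split: if_splits)
     then have "P v" "keys v \<subseteq> K" using insert.IH w(2) by auto
     then have "P (single k (lookup w k) + v)" using step w(2) by simp
     then show "P w" by (simp add: v_def)
    qed
  qed
  show ?thesis using main[OF finite_keys[of w]] assms(1) by simp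
qed

context cvs
begin

lemma lincomb_superset:
  assumes "finite A" "keys w \<subseteq> A" "\<And>k. k \<in> A ==> X k \<in> car M"
  shows "lincomb M X w = (\<Oplus>k\<in>A. lookup w k \<odot> X k)" unfolding lincomb_def
proof (rule add.finprod_mono_neutral_cong_left)
  show "lookup w i \<odot> X i = \<zero>" if "i \<in> A - keys w" for i using assms(3) that by (auto simp: in_keys_iff)
qed (use assms in auto)

lemma lincomb_closed:
  "X \<in> K \<rightarrow> car M ==> keys w \<subseteq> K ==> lincomb M X w \<in> car M"
  unfolding lincomb_def by (intro finsum_closed) (auto simp: Pi_iff subset_iff)

lemma lincomb_add:
  assumes X: "X \<in> K \<rightarrow> car M" and v: "keys v \<subseteq> K" and w: "keys w \<subseteq> K"
  shows "lincomb M X (v + w) = lincomb M X v \<oplus> lincomb M X w"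
proof -
  define A where "A = keys v \<union> keys w"
  have A: "finite A" "\<And>k. k \<in> A ==> X k \<in> car M" using X v w by (auto simp: A_def)
  have "lincomb M X (v + w) = (\<Oplus>k\<in>A. lookup (v + w) k \<odot> X k)"
    using A keys_add[of v w] by (intro lincomb_superset) (auto simp: A_def)
  also have "\<dots> = (\<Oplus>k\<in>A. lookup v k \<odot> X k \<oplus> lookup w k \<odot> X k)"
    using A by (intro finsum_cong') (auto simp: lookup_add smult_l_distr)
  also have "\<dots> = (\<Oplus>k\<in>A. lookup v k \<odot> X k) \<oplus> (\<Oplus>k\<in>A. lookup w k \<odot> X k)"
    using A by (intro finsum_addf) auto
  also have "(\<Oplus>k\<in>A. lookup v k \<odot> X k) = lincomb M X v"
    using A by (intro lincomb_superset[symmetric]) (auto simp: A_def)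
  also have "(\<Oplus>k\<in>A. lookup w k \<odot> X k) = lincomb M X w"
    using A by (intro lincomb_superset[symmetric]) (auto simp: A_def)
  finally show ?thesis .
qed

lemma lincomb_zero [simp]: "lincomb M X 0 = \<zero>" by (simp add: lincomb_def)

lemma lincomb_single:
  assumes "X k \<in> car M"
  shows "lincomb M X (single k c) = c \<odot> X k"
  using assms by (subst lincomb_superset[of "{k}"]) (auto simp: lookup_single)

lemma lincomb_scale:
  assumes X: "X \<in> K \<rightarrow> car M" and w: "keys w \<subseteq> K"
  shows "lincomb M X (scale c w) = c \<odot> lincomb M X w" using w
proof (induction w rule: free_vector_induct)
  case zero
  have "scale c 0 = (0 :: 'b \<Rightarrow>\<^sub>0 complex)" by (rule poly_mapping_eqI) (simp add: lookup_scale)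
  then show ?case by simp
next
  case (step k d v)
  have k: "X k \<in> car M" using X step by auto
  have "lincomb M X (scale c (single k d + v))
     = lincomb M X (single k (c * d)) \<oplus> lincomb M X (scale c v)" unfolding scale_add scale_single
    using step by (intro lincomb_add[OF X] keys_single_subset keys_scale_subset)
  also have "\<dots> = c \<odot> (lincomb M X (single k d) \<oplus> lincomb M X v)"
    using k lincomb_closed[OF X step(2)] step by (simp add: lincomb_single smult_assoc smult_r_distr)
  also have "lincomb M X (single k d) \<oplus> lincomb M X v
     = lincomb M X (single k d + v)" using step by (intro lincomb_add[OF X, symmetric] keys_single_subset)
  finally show ?case .
qed

lemma lincomb_minus:
  assumes X: "X \<in> K \<rightarrow> car M" and v: "keys v \<subseteq> K" and w: "keys w \<subseteq> K"
  shows "lincomb M X (v - w) = lincomb M X v \<ominus> lincomb M X w"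
proof -
  have eq: "v - w = v + scale (-1) w" by (simp add: scale_minus_one)
  show ?thesis unfolding eq using lincomb_add[OF X v keys_scale_subset[OF w]] lincomb_scale[OF X w, of "-1"]
     lincomb_closed[OF X w] by (simp add: a_minus_def uminus_smult)
qed

lemma lincomb_cong:
  assumes "\<And>k. k \<in> K ==> X k = Y k" "Y \<in> K \<rightarrow> car M" "keys w \<subseteq> K"
  shows "lincomb M X w = lincomb M Y w" unfolding lincomb_def using assms by (intro finsum_cong') auto

lemma seminorm_lincomb:
  assumes p: "is_seminorm M p" and X: "X \<in> K \<rightarrow> car M" and w: "keys w \<subseteq> K"
  shows "p (lincomb M X w) \<le> (\<Sum>k\<in>keys w. cmod (lookup w k) * p (X k))"
proof -
  have X': "X k \<in> car M" if "k \<in> keys w" for k using X w that by auto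
  have "p (lincomb M X w) \<le> (\<Sum>k\<in>keys w. p (lookup w k \<odot> X k))"
    unfolding lincomb_def using X' by (intro seminorm_finsum[OF p]) auto
  also have "\<dots> = (\<Sum>k\<in>keys w. cmod (lookup w k) * p (X k))"
    using X' by (intro sum.cong refl seminorm_smult[OF p])
  finally show ?thesis .
qed

end

definition is_linear ::
    "(complex, 'a, 'm) module_scheme => (complex, 'b, 'n) module_scheme => ('a => 'b) => bool" where
  "is_linear M N f \<longleftrightarrow> f \<in> car M \<rightarrow> car N \<and>
    (\<forall>x\<in>car M. \<forall>y\<in>car M. f (x \<oplus>\<^sub>M y) = f x \<oplus>\<^sub>N f y) \<and>
    (\<forall>c. \<forall>x\<in>car M. f (c \<odot>\<^sub>M x) = c \<odot>\<^sub>N f x)"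

lemma is_linearI:
  assumes "\<And>x. x \<in> car M ==> f x \<in> car N"
    and "\<And>x y. x \<in> car M ==> y \<in> car M ==> f (x \<oplus>\<^sub>M y) = f x \<oplus>\<^sub>N f y"
    and "\<And>c x. x \<in> car M ==> f (c \<odot>\<^sub>M x) = c \<odot>\<^sub>N f x"
  shows "is_linear M N f" using assms by (simp add: is_linear_def)

lemma lin_closed: "is_linear M N f ==> x \<in> car M ==> f x \<in> car N" by (auto simp: is_linear_def)

lemma lin_add:
  "is_linear M N f ==> x \<in> car M ==> y \<in> car M ==> f (x \<oplus>\<^sub>M y) = f x \<oplus>\<^sub>N f y"
  by (simp add: is_linear_def)

lemma lin_smult: "is_linear M N f ==> x \<in> car M ==> f (c \<odot>\<^sub>M x) = c \<odot>\<^sub>N f x"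
  by (simp add: is_linear_def)

lemma lin_zero:
  assumes "cvs M" "cvs N" "is_linear M N f"
  shows "f \<zero>\<^sub>M = \<zero>\<^sub>N"
proof -
  interpret M: cvs M by fact
  interpret N: cvs N by fact
  show ?thesis
    using lin_smult[OF assms(3), of "\<zero>\<^sub>M" 0] lin_closed[OF assms(3), of "\<zero>\<^sub>M"] by simp
qed

lemma lin_uminus:
  assumes "cvs M" "cvs N" "is_linear M N f" "x \<in> car M"
  shows "f (\<ominus>\<^sub>M x) = \<ominus>\<^sub>N f x"
proof -
  interpret M: cvs M by fact
  interpret N: cvs N by fact
  show ?thesis using lin_smult[OF assms(3,4), of "-1"] lin_closed[OF assms(3,4)] assms(4)
    by (simp add: M.uminus_smult N.uminus_smult)
qed

lemma lin_minus:
  assumes "cvs M" "cvs N" "is_linear M N f" "x \<in> car M" "y \<in> car M"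
  shows "f (x \<ominus>\<^sub>M y) = f x \<ominus>\<^sub>N f y"
proof -
  interpret M: cvs M by fact
  interpret N: cvs N by fact
  show ?thesis using lin_add[OF assms(3,4), of "\<ominus>\<^sub>M y"] lin_uminus[OF assms(1-3,5)] assms(5)
    by (simp add: a_minus_def)
qed

lemma lin_lincomb:
  assumes "cvs M" "cvs N" and f: "is_linear M N f" and X: "X \<in> K \<rightarrow> car M"
    and w: "keys w \<subseteq> K"
  shows "f (lincomb M X w) = lincomb N (\<lambda>k. f (X k)) w"
proof -
  interpret M: cvs M by fact
  interpret N: cvs N by fact
  have fX: "(\<lambda>k. f (X k)) \<in> K \<rightarrow> car N" using X lin_closed[OF f] by auto
  show ?thesis using w
  proof (induction w rule: free_vector_induct)
    case zero
    then show ?case using lin_zero[OF assms(1-3)] by simp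
  next
    case (step k d v)
    have k: "X k \<in> car M" using X step by auto
    have k': "f (X k) \<in> car N" using lin_closed[OF f k] .
    show ?case using k k' step M.lincomb_closed[OF X step(2)] f
     by (simp add: M.lincomb_add[OF X keys_single_subset step(2)] N.lincomb_add[OF fX keys_single_subset step(2)]
       lin_add lin_smult M.lincomb_single N.lincomb_single)
  qed
qed

lemma lin_compose: "is_linear M N f ==> is_linear N L g ==> is_linear M L (\<lambda>x. g (f x))"
  by (intro is_linearI) (simp_all add: lin_closed lin_add lin_smult)

lemma lin_seminorm:
  assumes "cvs M" "cvs N" "is_linear M N f" "is_seminorm N p"
  shows "is_seminorm M (\<lambda>x. p (f x))"
proof -
  interpret M: cvs M by fact
  interpret N: cvs N by fact
  show ?thesis using assms(3,4) by (intro M.is_seminormI) (simp_all add: lin_closed lin_add lin_smult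
      N.sn_nonneg N.seminorm_add N.seminorm_smult)
qed

lemma cont_linearD: "cont_linear E G f ==> is_linear E G f" by (simp add: cont_linear_def is_linear_def)

lemma cont_linear_bound:
  assumes "lc_space E" "lc_space G" "cont_linear E G f" "p \<in> csn G"
  shows "\<exists>r\<in>csn E. \<forall>x\<in>car E. p (f x) \<le> r x"
  using assms(3,4) unfolding cont_linear_iff[OF assms(1,2)] by simp

lemma cont_linearI:
  assumes "lc_space E" "lc_space G" "is_linear E G f"
    and "\<And>p. p \<in> csn G ==> \<exists>r\<in>csn E. \<forall>x\<in>car E. p (f x) \<le> r x"
  shows "cont_linear E G f" using assms(3,4) unfolding cont_linear_iff[OF assms(1,2)] by (simp add: is_linear_def)

lemma cont_linear_seminorm:
  assumes "lc_space E" "lc_space G" "cont_linear E G f" "p \<in> csn G"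
  shows "(\<lambda>x. p (f x)) \<in> csn E"
proof -
  interpret E: lc_space E by fact
  interpret G: lc_space G by fact
  obtain r where r: "r \<in> csn E" "\<forall>x\<in>car E. p (f x) \<le> r x"
    using cont_linear_bound[OF assms] by (elim bexE)
  show ?thesis by (rule E.csn_le[OF r(1) lin_seminorm[OF E.cvs_axioms G.cvs_axioms
     cont_linearD[OF assms(3)] G.csnD[OF assms(4)]], of 1]) (use r in auto)
qed

lemma clin_compose: "cont_linear E F f ==> cont_linear F G g ==> cont_linear E G (\<lambda>x. g (f x))"
  unfolding cont_linear_def using continuous_map_compose[of "lctop E" "lctop F" f "lctop G" g]
  by (auto simp: o_def Pi_iff)

lemma cont_linear_id: "cont_linear E E (\<lambda>x. x)" by (simp add: cont_linear_def)

text \<open>A family whose linear span is dense.\<close>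

definition total_in :: "'a lcs => 'k set => ('k => 'a) => bool" where
  "total_in E K Y \<longleftrightarrow> Y \<in> K \<rightarrow> car E \<and>
    (\<forall>x\<in>car E. \<forall>p\<in>csn E. \<forall>e>0. \<exists>w. keys w \<subseteq> K \<and>
      p (lincomb E Y w \<ominus>\<^sub>E x) < e)"

lemma total_in_family: "total_in E K Y ==> Y \<in> K \<rightarrow> car E" by (simp add: total_in_def)

lemma total_in_approx:
  assumes "total_in E K Y" "x \<in> car E" "p \<in> csn E" "0 < e"
  obtains w where "keys w \<subseteq> K" "p (lincomb E Y w \<ominus>\<^sub>E x) < e"
proof -
  have "\<exists>w. keys w \<subseteq> K \<and> p (lincomb E Y w \<ominus>\<^sub>E x) < e"
    using assms unfolding total_in_def by simp
  then show ?thesis by (elim exE conjE) (rule that)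
qed

lemma complete_lc_space: "is_complete_lcs G ==> lc_space G" by (simp add: is_complete_lcs_def is_lcs_iff)

lemma complete_separated:
  assumes "is_complete_lcs G" "x \<in> car G" "\<And>p. p \<in> csn G ==> p x = 0"
  shows "x = \<zero>\<^sub>G" using assms lc_space.Hausdorff_iff[of G] by (simp add: is_complete_lcs_def is_lcs_iff)

lemma complete_eqI:
  assumes G: "is_complete_lcs G" and x: "x \<in> car G" and y: "y \<in> car G"
    and small: "\<And>p e. p \<in> csn G ==> 0 < e ==> p (x \<ominus>\<^sub>G y) \<le> e"
  shows "x = y"
proof -
  interpret G: lc_space G using G by (rule complete_lc_space)
  have xy: "x \<ominus>\<^sub>G y \<in> car G" using x y by simp
  have "x \<ominus>\<^sub>G y = \<zero>\<^sub>G"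
  proof (rule complete_separated[OF G xy])
    fix p assume p: "p \<in> csn G"
    have "p (x \<ominus>\<^sub>G y) \<le> 0"
    proof (rule field_le_epsilon)
     fix e :: real assume "0 < e"
     from small[OF p this] show "p (x \<ominus>\<^sub>G y) \<le> 0 + e" by simp
    qed
    moreover have "0 \<le> p (x \<ominus>\<^sub>G y)" by (rule G.sn_nonneg[OF G.csnD[OF p] xy])
    ultimately show "p (x \<ominus>\<^sub>G y) = 0" by simp
  qed
  then show ?thesis using G.minus_eq_zero[OF x y] by simp
qed

lemma cont_linear_eq_on_total:
  assumes E: "lc_space E" and G: "is_complete_lcs G" and f: "cont_linear E G f" and g: "cont_linear E G g"
    and tot: "total_in E K Y" and eq: "\<And>k. k \<in> K ==> f (Y k) = g (Y k)" and x: "x \<in> car E"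
  shows "f x = g x"
proof (rule complete_eqI[OF G])
  interpret E: lc_space E by fact
  interpret G: lc_space G using G by (rule complete_lc_space)
  note lf = cont_linearD[OF f] and lg = cont_linearD[OF g]
  show "f x \<in> car G" "g x \<in> car G" using x lf lg by (auto intro: lin_closed)
  fix p and e :: real assume p: "p \<in> csn G" and e: "0 < e"
  note sp = G.csnD[OF p]
  let ?r = "\<lambda>x. p (f x) + p (g x)"
  have r: "?r \<in> csn E" by (intro E.csn_add cont_linear_seminorm[OF E G.lc_space_axioms _ p] f g)
  obtain w where w: "keys w \<subseteq> K" "?r (lincomb E Y w \<ominus>\<^sub>E x) < e"
    using total_in_approx[OF tot x r e] .
  define y where "y = lincomb E Y w"
  have y: "y \<in> car E" unfolding y_def using total_in_family[OF tot] w(1) by (rule E.lincomb_closed)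
  have fy: "f y = g y" unfolding y_def using lin_lincomb[OF E.cvs_axioms G.cvs_axioms lf total_in_family[OF tot] w(1)]
     lin_lincomb[OF E.cvs_axioms G.cvs_axioms lg total_in_family[OF tot] w(1)]
     G.lincomb_cong[of K "\<lambda>k. f (Y k)" "\<lambda>k. g (Y k)" w] eq w(1) lin_closed[OF lg]
     total_in_family[OF tot] by (simp add: Pi_iff)
  have "p (f x \<ominus>\<^sub>G g x) \<le> p (f x \<ominus>\<^sub>G f y) + p (f y \<ominus>\<^sub>G g x)"
    using x y lf lg by (intro G.seminorm_triangle[OF sp]) (auto intro: lin_closed)
  also have "p (f x \<ominus>\<^sub>G f y) = p (f (y \<ominus>\<^sub>E x))"
    using x y lin_closed[OF lf] G.seminorm_minus_commute[OF sp, of "f x" "f y"]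
    by (simp add: lin_minus[OF E.cvs_axioms G.cvs_axioms lf])
  also have "p (f y \<ominus>\<^sub>G g x) = p (g (y \<ominus>\<^sub>E x))"
    using x y by (simp add: fy lin_minus[OF E.cvs_axioms G.cvs_axioms lg])
  finally show "p (f x \<ominus>\<^sub>G g x) \<le> e" using w(2) by (simp add: y_def)
qed

lemma cont_linear_bound_on_total:
  assumes E: "lc_space E" and G: "lc_space G" and f: "cont_linear E G f" and tot: "total_in E K Y"
    and p: "p \<in> csn G" and r: "r \<in> csn E"
    and le: "\<And>w. keys w \<subseteq> K ==> p (f (lincomb E Y w)) \<le> r (lincomb E Y w)"
    and x: "x \<in> car E"
  shows "p (f x) \<le> r x"
proof (rule field_le_epsilon)
  interpret E: lc_space E by fact
  interpret G: lc_space G by fact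
  note lf = cont_linearD[OF f] and sp = G.csnD[OF p] and sr = E.csnD[OF r]
  fix e :: real assume e: "0 < e"
  let ?s = "\<lambda>x. p (f x) + r x"
  have s: "?s \<in> csn E" by (intro E.csn_add cont_linear_seminorm[OF E G f p] r)
  obtain w where w: "keys w \<subseteq> K" "?s (lincomb E Y w \<ominus>\<^sub>E x) < e"
    using total_in_approx[OF tot x s e] .
  define y where "y = lincomb E Y w"
  have y: "y \<in> car E" unfolding y_def using total_in_family[OF tot] w(1) by (rule E.lincomb_closed)
  have 1: "\<bar>r y - r x\<bar> \<le> r (y \<ominus>\<^sub>E x)" using y x by (rule E.seminorm_diff_le[OF sr])
  have 2: "\<bar>p (f y) - p (f x)\<bar> \<le> p (f (y \<ominus>\<^sub>E x))"
    using G.seminorm_diff_le[OF sp lin_closed[OF lf y] lin_closed[OF lf x]]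
     lin_minus[OF E.cvs_axioms G.cvs_axioms lf y x] by simp
  have "p (f y) \<le> r y" using le[OF w(1)] by (simp add: y_def)
  then show "p (f x) \<le> r x + e" using 1 2 w(2) unfolding y_def[symmetric] by linarith
qed

text \<open>
  A linear map that is defined on the span of a total family and is dominated there by continuous
  seminorms extends to the whole space: its value at \<open>x\<close> is the limit of its values along the filter of
  linear combinations converging to \<open>x\<close>, a Cauchy filter by the domination.
\<close>

lemma extension_value:
  assumes E: "lc_space E" and G: "is_complete_lcs G" and tot: "total_in E K Y"
    and X: "X \<in> K \<rightarrow> car G"
    and dom: "\<And>p. p \<in> csn G ==> \<exists>r\<in>csn E. \<forall>w. keys w \<subseteq> K -->
     p (lincomb G X w) \<le> r (lincomb E Y w)"
    and x: "x \<in> car E"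
  shows "\<exists>g\<in>car G. \<forall>p\<in>csn G. \<forall>r\<in>csn E.
    (\<forall>w. keys w \<subseteq> K --> p (lincomb G X w) \<le> r (lincomb E Y w)) -->
    (\<forall>w. keys w \<subseteq> K --> p (lincomb G X w \<ominus>\<^sub>G g) \<le> r (lincomb E Y w \<ominus>\<^sub>E x))"
proof -
  interpret E: lc_space E by fact
  interpret G: lc_space G using G by (rule complete_lc_space)
  note Y = total_in_family[OF tot]
  let ?Y = "lincomb E Y" and ?X = "lincomb G X"
  let ?K = "\<lambda>w. keys (w :: _ \<Rightarrow>\<^sub>0 complex) \<subseteq> K"
  have Yc: "?Y w \<in> car E" if "?K w" for w using Y that by (rule E.lincomb_closed)
  have Xc: "?X w \<in> car G" if "?K w" for w using X that by (rule G.lincomb_closed)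
  define A where "A r = {?X w |w. ?K w \<and> r (?Y w \<ominus>\<^sub>E x) < 1}" for r :: "_ => real"
  define F where "F = (INF r\<in>csn E. principal (A r))"
  have ev: "eventually P F \<longleftrightarrow> (\<exists>r\<in>csn E. \<forall>y\<in>A r. P y)" for P unfolding F_def
  proof (subst eventually_INF_base)
    show "csn E \<noteq> {}" using E.csn_zero by (rule ex_in_conv[THEN iffD1, OF exI])
    fix r s assume rs: "r \<in> csn E" "s \<in> csn E"
    have "A (\<lambda>x. r x + s x) \<subseteq> A r \<inter> A s"
    proof
     fix y assume "y \<in> A (\<lambda>x. r x + s x)"
     then obtain w where w: "y = ?X w" "?K w" "r (?Y w \<ominus>\<^sub>E x) + s (?Y w \<ominus>\<^sub>E x) < 1"
      unfolding A_def by (elim CollectE exE conjE)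
     moreover have "0 \<le> r (?Y w \<ominus>\<^sub>E x)" "0 \<le> s (?Y w \<ominus>\<^sub>E x)"
      using rs Yc[OF w(2)] x by (auto intro!: E.sn_nonneg[OF E.csnD])
     ultimately show "y \<in> A r \<inter> A s" unfolding A_def by auto
    qed
    then show "\<exists>t\<in>csn E. principal (A t) \<le> inf (principal (A r)) (principal (A s))"
     using E.csn_add[OF rs] by (intro bexI[of _ "\<lambda>x. r x + s x"]) auto
  qed (simp add: eventually_principal)
  have lin: "p (?X v \<ominus>\<^sub>G ?X w) \<le> r (?Y v \<ominus>\<^sub>E ?Y w)"
    if d: "\<forall>w. ?K w --> p (?X w) \<le> r (?Y w)" and "?K v" "?K w" for p r v w
    using d[rule_format, OF keys_minus_subset[OF that(2,3)]]
    by (simp add: G.lincomb_minus[OF X that(2,3)] E.lincomb_minus[OF Y that(2,3)])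
  have "cauchy_filter G F" unfolding G.cauchy_filter_iff
  proof (intro conjI ballI allI impI)
    show "F \<noteq> bot"
    proof
     assume "F = bot"
     then have "eventually (\<lambda>_. False) F" by simp
     then obtain r where r: "r \<in> csn E" "A r = {}" unfolding ev by auto
     obtain w where "?K w" "r (?Y w \<ominus>\<^sub>E x) < 1" using total_in_approx[OF tot x r(1), of 1] by auto
     then have "?X w \<in> A r" unfolding A_def by auto
     then show False using r(2) by simp
    qed
    show "eventually (\<lambda>x. x \<in> car G) F"
     unfolding ev by (rule bexI[OF _ E.csn_zero]) (auto simp: A_def intro: Xc)
    fix p and e :: real assume p: "p \<in> csn G" and e: "0 < e"
    obtain r where r: "r \<in> csn E" and d: "\<forall>w. ?K w --> p (?X w) \<le> r (?Y w)"
     using dom[OF p] by (elim bexE)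
    note sr = E.csnD[OF r]
    let ?r = "\<lambda>x. (2 / e) * r x"
    show "\<exists>Q. eventually Q F \<and> (\<forall>x\<in>car G. \<forall>y\<in>car G. Q x --> Q y --> p (x \<ominus>\<^sub>G y) < e)"
    proof (intro exI[of _ "\<lambda>y. y \<in> A ?r"] conjI ballI impI)
     show "eventually (\<lambda>y. y \<in> A ?r) F"
      unfolding ev using e by (intro bexI[OF _ E.csn_scale[OF r, of "2 / e"]]) auto
     fix a b assume "a \<in> A ?r" "b \<in> A ?r"
     then obtain v w where v: "a = ?X v" "?K v" "?r (?Y v \<ominus>\<^sub>E x) < 1"
      and w: "b = ?X w" "?K w" "?r (?Y w \<ominus>\<^sub>E x) < 1" unfolding A_def by (elim CollectE exE conjE)
     have "p (a \<ominus>\<^sub>G b) \<le> r (?Y v \<ominus>\<^sub>E ?Y w)"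
      unfolding v(1) w(1) using d v(2) w(2) by (rule lin)
     also have "\<dots> \<le> r (?Y v \<ominus>\<^sub>E x) + r (x \<ominus>\<^sub>E ?Y w)"
      using Yc v(2) w(2) x by (intro E.seminorm_triangle[OF sr]) auto
     also have "r (x \<ominus>\<^sub>E ?Y w) = r (?Y w \<ominus>\<^sub>E x)"
      using Yc w(2) x by (intro E.seminorm_minus_commute[OF sr]) auto
     also have "r (?Y v \<ominus>\<^sub>E x) + r (?Y w \<ominus>\<^sub>E x) < e"
      using v(3) w(3) e by (simp add: field_simps)
     finally show "p (a \<ominus>\<^sub>G b) < e" .
    qed
  qed
  then obtain g where "limitin (lctop G) (\<lambda>y. y) g F" using G unfolding is_complete_lcs_def by auto
  then have g: "g \<in> car G" and gl: "\<forall>p\<in>csn G. \<forall>e>0. eventually (\<lambda>y. p (y \<ominus>\<^sub>G g) < e) F"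
    unfolding G.limitin_iff by auto
  show ?thesis
  proof (intro bexI[OF _ g] ballI allI impI)
    fix p r w assume p: "p \<in> csn G" and r: "r \<in> csn E"
     and d: "\<forall>w. ?K w --> p (?X w) \<le> r (?Y w)" and w: "?K w"
    note sr = E.csnD[OF r] and sp = G.csnD[OF p]
    show "p (?X w \<ominus>\<^sub>G g) \<le> r (?Y w \<ominus>\<^sub>E x)"
    proof (rule field_le_epsilon)
     fix e :: real assume e: "0 < e"
     have "eventually (\<lambda>y. p (y \<ominus>\<^sub>G g) < e / 2) F" by (rule gl[rule_format, OF p half_gt_zero[OF e]])
     then obtain s where s: "s \<in> csn E" "\<forall>y\<in>A s. p (y \<ominus>\<^sub>G g) < e / 2"
      unfolding ev by (elim bexE)
     let ?t = "\<lambda>x. s x + (2 / e) * r x"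
     have t: "?t \<in> csn E" using s r e by (intro E.csn_add E.csn_scale) auto
     obtain v where v: "?K v" "?t (?Y v \<ominus>\<^sub>E x) < 1" using total_in_approx[OF tot x t, of 1] by auto
     have n: "0 \<le> s (?Y v \<ominus>\<^sub>E x)" "0 \<le> r (?Y v \<ominus>\<^sub>E x)"
      using Yc[OF v(1)] x s(1) by (auto intro!: E.sn_nonneg[OF E.csnD] E.sn_nonneg[OF sr])
     have "0 \<le> (2 / e) * r (?Y v \<ominus>\<^sub>E x)" using n(2) e by (intro mult_nonneg_nonneg) auto
     then have "s (?Y v \<ominus>\<^sub>E x) < 1" using v(2) by linarith
     then have "?X v \<in> A s" unfolding A_def using v(1) by auto
     then have pv: "p (?X v \<ominus>\<^sub>G g) < e / 2" using s(2) by simp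
     have "(2 / e) * r (?Y v \<ominus>\<^sub>E x) < 1" using v(2) n by simp
     then have rv: "r (?Y v \<ominus>\<^sub>E x) < e / 2" using e by (simp add: field_simps)
     have "p (?X w \<ominus>\<^sub>G g) \<le> p (?X w \<ominus>\<^sub>G ?X v) + p (?X v \<ominus>\<^sub>G g)"
      using Xc w v(1) g by (intro G.seminorm_triangle[OF sp]) auto
     also have "p (?X w \<ominus>\<^sub>G ?X v) \<le> r (?Y w \<ominus>\<^sub>E ?Y v)" using d w v(1) by (rule lin)
     also have "\<dots> \<le> r (?Y w \<ominus>\<^sub>E x) + r (x \<ominus>\<^sub>E ?Y v)"
      using Yc w v(1) x by (intro E.seminorm_triangle[OF sr]) auto
     also have "r (x \<ominus>\<^sub>E ?Y v) = r (?Y v \<ominus>\<^sub>E x)"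
      using Yc v(1) x by (intro E.seminorm_minus_commute[OF sr]) auto
     finally show "p (?X w \<ominus>\<^sub>G g) \<le> r (?Y w \<ominus>\<^sub>E x) + e" using pv rv by simp
    qed
  qed
qed

text \<open>
  The values found above depend linearly on \<open>x\<close> because each of them is characterized by approximation, and
  approximations may be added and scaled.
\<close>

lemma extension_exists:
  assumes E: "lc_space E" and G: "is_complete_lcs G" and tot: "total_in E K Y"
    and X: "X \<in> K \<rightarrow> car G"
    and dom: "\<And>p. p \<in> csn G ==> \<exists>r\<in>csn E. \<forall>w. keys w \<subseteq> K -->
     p (lincomb G X w) \<le> r (lincomb E Y w)"
  shows "\<exists>h. cont_linear E G h \<and> (\<forall>k\<in>K. h (Y k) = X k)"
proof -
  interpret E: lc_space E by fact
  interpret G: lc_space G using G by (rule complete_lc_space)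
  note Y = total_in_family[OF tot]
  let ?Y = "lincomb E Y" and ?X = "lincomb G X"
  let ?K = "\<lambda>w. keys (w :: _ \<Rightarrow>\<^sub>0 complex) \<subseteq> K"
  let ?d = "\<lambda>p r. \<forall>w. ?K w --> p (?X w) \<le> r (?Y w)"
  have Yc: "?Y w \<in> car E" if "?K w" for w using Y that by (rule E.lincomb_closed)
  have Xc: "?X w \<in> car G" if "?K w" for w using X that by (rule G.lincomb_closed)
  have "\<forall>x\<in>car E. \<exists>g. g \<in> car G \<and> (\<forall>p\<in>csn G. \<forall>r\<in>csn E. ?d p r -->
    (\<forall>w. ?K w --> p (?X w \<ominus>\<^sub>G g) \<le> r (?Y w \<ominus>\<^sub>E x)))"
    using extension_value[OF E G tot X dom] unfolding Bex_def by (intro ballI)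
  from bchoice[OF this] obtain h where
    h0: "\<forall>x\<in>car E. h x \<in> car G \<and> (\<forall>p\<in>csn G. \<forall>r\<in>csn E. ?d p r -->
    (\<forall>w. ?K w --> p (?X w \<ominus>\<^sub>G h x) \<le> r (?Y w \<ominus>\<^sub>E x)))" by (elim exE)
  have h: "\<And>x. x \<in> car E ==> h x \<in> car G" and
    hle: "\<And>x p r w. x \<in> car E ==> p \<in> csn G ==> r \<in> csn E ==> ?d p r ==> ?K w ==>
     p (?X w \<ominus>\<^sub>G h x) \<le> r (?Y w \<ominus>\<^sub>E x)" using h0 by simp_all
  \<comment> \<open>\<open>h x\<close> is the only element that the images of all good approximations of \<open>x\<close> approach.\<close>
  have unique: "h x = y"
    if x: "x \<in> car E" and y: "y \<in> car G"
     and near: "\<And>p r e. p \<in> csn G ==> r \<in> csn E ==> ?d p r ==> 0 < (e::real) ==>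
      \<exists>w. ?K w \<and> r (?Y w \<ominus>\<^sub>E x) < e \<and> p (?X w \<ominus>\<^sub>G y) < e" for x y
  proof (rule complete_eqI[OF G h[OF x] y])
    fix p and e :: real assume p: "p \<in> csn G" and e: "0 < e"
    note sp = G.csnD[OF p]
    obtain r where r: "r \<in> csn E" and d: "?d p r" using dom[OF p] by (elim bexE)
    obtain w where w: "?K w" "r (?Y w \<ominus>\<^sub>E x) < e / 2" "p (?X w \<ominus>\<^sub>G y) < e / 2"
     using near[OF p r d half_gt_zero[OF e]] by (elim exE conjE)
    have "p (h x \<ominus>\<^sub>G y) \<le> p (h x \<ominus>\<^sub>G ?X w) + p (?X w \<ominus>\<^sub>G y)"
     by (rule G.seminorm_triangle[OF sp h[OF x] Xc[OF w(1)] y])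
    moreover have "p (h x \<ominus>\<^sub>G ?X w) = p (?X w \<ominus>\<^sub>G h x)"
     by (rule G.seminorm_minus_commute[OF sp h[OF x] Xc[OF w(1)]])
    ultimately show "p (h x \<ominus>\<^sub>G y) \<le> e" using hle[OF x p r d w(1)] w(2,3) by linarith
  qed
  have approx: "\<exists>w. ?K w \<and> r (?Y w \<ominus>\<^sub>E x) < e \<and> p (?X w \<ominus>\<^sub>G h x) < e"
    if x: "x \<in> car E" and p: "p \<in> csn G" and r: "r \<in> csn E" and d: "?d p r"
     and e: "0 < e" for x p r and e :: real
  proof -
    obtain w where w: "?K w" "r (?Y w \<ominus>\<^sub>E x) < e" using total_in_approx[OF tot x r e] .
    then show ?thesis using hle[OF x p r d w(1)] by (intro exI[of _ w]) simp
  qed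
  have h_comb: "h (?Y w) = ?X w" if w: "?K w" for w
  proof (rule unique[OF Yc[OF w] Xc[OF w]])
    fix p r and e :: real assume p: "p \<in> csn G" and r: "r \<in> csn E" and e: "0 < e"
    show "\<exists>v. ?K v \<and> r (?Y v \<ominus>\<^sub>E ?Y w) < e \<and> p (?X v \<ominus>\<^sub>G ?X w) < e"
     using w e Yc[OF w] Xc[OF w] E.seminorm_zero[OF E.csnD[OF r]] G.seminorm_zero[OF G.csnD[OF p]]
     by (intro exI[of _ w]) simp
  qed
  have h_add: "h (x \<oplus>\<^sub>E y) = h x \<oplus>\<^sub>G h y" if x: "x \<in> car E" and y: "y \<in> car E" for x y
  proof (rule unique[OF E.a_closed[OF x y] G.a_closed[OF h[OF x] h[OF y]]])
    fix p r and e :: real assume p: "p \<in> csn G" and r: "r \<in> csn E" and d: "?d p r" and e: "0 < e"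
    obtain v where v: "?K v" "r (?Y v \<ominus>\<^sub>E x) < e / 2" "p (?X v \<ominus>\<^sub>G h x) < e / 2"
     using approx[OF x p r d half_gt_zero[OF e]] by (elim exE conjE)
    obtain w where w: "?K w" "r (?Y w \<ominus>\<^sub>E y) < e / 2" "p (?X w \<ominus>\<^sub>G h y) < e / 2"
     using approx[OF y p r d half_gt_zero[OF e]] by (elim exE conjE)
    note c = Yc[OF v(1)] Yc[OF w(1)] Xc[OF v(1)] Xc[OF w(1)]
    have "r (?Y (v + w) \<ominus>\<^sub>E (x \<oplus>\<^sub>E y)) \<le> r (?Y v \<ominus>\<^sub>E x) + r (?Y w \<ominus>\<^sub>E y)"
     unfolding E.lincomb_add[OF Y v(1) w(1)] E.add_minus_add[OF c(1,2) x y]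
     by (rule E.seminorm_add[OF E.csnD[OF r] E.minus_closed[OF c(1) x] E.minus_closed[OF c(2) y]])
    moreover have "p (?X (v + w) \<ominus>\<^sub>G (h x \<oplus>\<^sub>G h y)) \<le> p (?X v \<ominus>\<^sub>G h x) + p (?X w \<ominus>\<^sub>G h y)"
     unfolding G.lincomb_add[OF X v(1) w(1)] G.add_minus_add[OF c(3,4) h[OF x] h[OF y]]
     by (rule G.seminorm_add[OF G.csnD[OF p] G.minus_closed[OF c(3) h[OF x]] G.minus_closed[OF c(4) h[OF y]]])
    ultimately show "\<exists>w. ?K w \<and> r (?Y w \<ominus>\<^sub>E (x \<oplus>\<^sub>E y)) < e \<and> p (?X w \<ominus>\<^sub>G (h x \<oplus>\<^sub>G h y)) < e"
     using v(2,3) w(2,3) keys_add_subset[OF v(1) w(1)] by (intro exI[of _ "v + w"]) linarith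
  qed
  have h_smult: "h (c \<odot>\<^sub>E x) = c \<odot>\<^sub>G h x" if x: "x \<in> car E" for c x
  proof (rule unique[OF E.smult_closed[OF x] G.smult_closed[OF h[OF x]]])
    fix p r and e :: real assume p: "p \<in> csn G" and r: "r \<in> csn E" and d: "?d p r" and e: "0 < e"
    define e' where "e' = e / (cmod c + 1)"
    have c1: "0 < cmod c + 1" by (simp add: add_nonneg_pos)
    have e': "0 < e'" "cmod c * e' < e" using e c1 by (simp_all add: e'_def field_simps)
    obtain v where v: "?K v" "r (?Y v \<ominus>\<^sub>E x) < e'" "p (?X v \<ominus>\<^sub>G h x) < e'"
     using approx[OF x p r d e'(1)] by (elim exE conjE)
    have "r (?Y (scale c v) \<ominus>\<^sub>E c \<odot>\<^sub>E x) = cmod c * r (?Y v \<ominus>\<^sub>E x)"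
     unfolding E.lincomb_scale[OF Y v(1)] E.smult_diff[OF Yc[OF v(1)] x, symmetric]
     by (rule E.seminorm_smult[OF E.csnD[OF r] E.minus_closed[OF Yc[OF v(1)] x]])
    moreover have "p (?X (scale c v) \<ominus>\<^sub>G c \<odot>\<^sub>G h x) = cmod c * p (?X v \<ominus>\<^sub>G h x)"
     unfolding G.lincomb_scale[OF X v(1)] G.smult_diff[OF Xc[OF v(1)] h[OF x], symmetric]
     by (rule G.seminorm_smult[OF G.csnD[OF p] G.minus_closed[OF Xc[OF v(1)] h[OF x]]])
    moreover have "cmod c * t < e" if "t < e'" for t using mult_left_mono[OF less_imp_le[OF that], of "cmod c"] e'(2) by simp
    ultimately show "\<exists>w. ?K w \<and> r (?Y w \<ominus>\<^sub>E c \<odot>\<^sub>E x) < e \<and> p (?X w \<ominus>\<^sub>G c \<odot>\<^sub>G h x) < e"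
     using v keys_scale_subset[OF v(1)] by (intro exI[of _ "scale c v"]) simp
  qed
  have "cont_linear E G h"
  proof (rule cont_linearI[OF E G.lc_space_axioms])
    show "is_linear E G h" by (rule is_linearI) (simp_all add: h h_add h_smult)
    fix p assume p: "p \<in> csn G"
    note sp = G.csnD[OF p]
    obtain r where r: "r \<in> csn E" and d: "?d p r" using dom[OF p] by (elim bexE)
    have "p (h x) \<le> r x" if x: "x \<in> car E" for x
    proof -
     have K0: "?K 0" by simp
     have "p (?X 0 \<ominus>\<^sub>G h x) \<le> r (?Y 0 \<ominus>\<^sub>E x)" using x p r d K0 by (rule hle)
     then show ?thesis using x h[OF x] E.seminorm_minus_commute[OF E.csnD[OF r], of "\<zero>\<^sub>E" x]
       G.seminorm_minus_commute[OF sp, of "\<zero>\<^sub>G" "h x"] by simp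
    qed
    then show "\<exists>r\<in>csn E. \<forall>x\<in>car E. p (h x) \<le> r x" using r by (intro bexI[OF _ r] ballI)
  qed
  moreover have "h (Y k) = X k" if k: "k \<in> K" for k
  proof -
    have "Y k \<in> car E" "X k \<in> car G" using X Y k by auto
    then show ?thesis using h_comb[OF keys_single_subset[OF k, of 1]] by (simp add: E.lincomb_single G.lincomb_single)
  qed
  ultimately show ?thesis by (intro exI[of _ h]) simp
qed

section \<open>Quotients of modules and rings\<close>

lemma cvs_image:
  assumes "cvs M" and car: "car Q = h ` car M"
    and add: "\<And>x y. x \<in> car M ==> y \<in> car M ==> h x \<oplus>\<^sub>Q h y = h (x \<oplus>\<^sub>M y)"
    and zero: "\<zero>\<^sub>Q = h \<zero>\<^sub>M"
    and smult: "\<And>c x. x \<in> car M ==> c \<odot>\<^sub>Q h x = h (c \<odot>\<^sub>M x)"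
  shows "cvs Q"
proof -
  interpret M: cvs M by fact
  have "abelian_group Q"
  proof (rule abelian_groupI)
    fix x assume "x \<in> car Q"
    then obtain a where a: "x = h a" "a \<in> car M" unfolding car by (elim imageE)
    show "\<exists>y\<in>car Q. y \<oplus>\<^sub>Q x = \<zero>\<^sub>Q"
     using a by (intro bexI[of _ "h (\<ominus>\<^sub>M a)"]) (auto simp: add zero car M.l_neg)
  qed (auto simp: car add zero M.a_ac)
  then have "Module.module CC Q"
    by (intro moduleI cring_complex) (auto simp: car smult add M.smult_l_distr M.smult_r_distr M.smult_assoc)
  then show ?thesis by (rule cvs.intro)
qed

lemma ring_image:
  assumes "Ring.ring M" and car: "car Q = h ` car M"
    and add: "\<And>x y. x \<in> car M ==> y \<in> car M ==> h x \<oplus>\<^sub>Q h y = h (x \<oplus>\<^sub>M y)"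
    and zero: "\<zero>\<^sub>Q = h \<zero>\<^sub>M"
    and mult: "\<And>x y. x \<in> car M ==> y \<in> car M ==> h x \<otimes>\<^sub>Q h y = h (x \<otimes>\<^sub>M y)"
    and one: "\<one>\<^sub>Q = h \<one>\<^sub>M"
  shows "Ring.ring Q"
proof -
  interpret M: ring M by fact
  show ?thesis
  proof (rule ringI)
    show "abelian_group Q"
    proof (rule abelian_groupI)
     fix x assume "x \<in> car Q"
     then obtain a where a: "x = h a" "a \<in> car M" unfolding car by (elim imageE)
     show "\<exists>y\<in>car Q. y \<oplus>\<^sub>Q x = \<zero>\<^sub>Q"
      using a by (intro bexI[of _ "h (\<ominus>\<^sub>M a)"]) (auto simp: add zero car M.l_neg)
    qed (auto simp: car add zero M.a_ac)
    show "Group.monoid Q" by (rule monoidI) (auto simp: car mult one M.m_assoc)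
  qed (auto simp: car mult add M.l_distr M.r_distr)
qed

text \<open>
  The seminorm that \<open>s\<close> induces on cosets.
\<close>

definition qsn :: "('a => real) => 'a set => real" where
  "qsn s U = (INF w\<in>U. s w)"

locale quot_space = cvs M for M :: "(complex, 'a, 'm) module_scheme" (structure) +
  fixes N :: "'a set"
  assumes sub: "submodule N CC M"
begin

abbreviation proj :: "'a => 'a set" where "proj x \<equiv> N +>\<^bsub>M\<^esub> x"

sublocale S: abelian_subgroup N M by (rule abelian_subgroupI3[OF additive_subgroup.intro abelian_group_axioms])
    (rule submodule.axioms(1)[OF sub])

lemma smult_mem: "x \<in> N ==> c \<odot> x \<in> N" using submodule.smult_closed[OF sub, of c x] by simp

lemma mem_proj_iff: "x \<in> car M ==> y \<in> proj x \<longleftrightarrow> y \<in> car M \<and> y \<ominus> x \<in> N"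
  using S.a_rcos_module[of x y] S.a_elemrcos_carrier[of x y] by (auto simp: a_minus_def)

lemma proj_eq_iff:
  assumes "x \<in> car M" "y \<in> car M"
  shows "proj x = proj y \<longleftrightarrow> x \<ominus> y \<in> N"
proof
  assume "proj x = proj y"
  then have "x \<in> proj y" using S.a_rcos_self[OF assms(1)] by simp
  then show "x \<ominus> y \<in> N" using mem_proj_iff assms by simp
next
  assume "x \<ominus> y \<in> N"
  then have "x \<in> proj y" using mem_proj_iff assms by simp
  then show "proj x = proj y" using S.a_repr_independence' assms(2) by simp
qed

lemma proj_zero: "proj \<zero> = N" using a_coset_join2[of \<zero> N] S.a_subgroup by simp

lemma carrier_quot: "car (quot_module M N) = proj ` car M"
  by (auto simp: quot_module_def ring.defs module.defs FactRing_def A_RCOSETS_def')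

lemma add_quot:
  "x \<in> car M ==> y \<in> car M ==> proj x \<oplus>\<^bsub>quot_module M N\<^esub> proj y = proj (x \<oplus> y)"
  by (simp add: quot_module_def ring.defs module.defs FactRing_def S.a_rcos_sum)

lemma zero_quot: "\<zero>\<^bsub>quot_module M N\<^esub> = proj \<zero>"
  by (simp add: quot_module_def ring.defs module.defs FactRing_def proj_zero)

lemma smult_quot:
  assumes x: "x \<in> car M"
  shows "c \<odot>\<^bsub>quot_module M N\<^esub> proj x = proj (c \<odot> x)"
proof -
  have "proj (c \<odot> z) = proj (c \<odot> x)" if "z \<in> proj x" for z
  proof -
    have z: "z \<in> car M" "z \<ominus> x \<in> N" using that mem_proj_iff[OF x] by auto
    then have "c \<odot> z \<ominus> c \<odot> x \<in> N" using smult_mem[OF z(2), of c] x by (simp add: smult_diff)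
    then show ?thesis using z x proj_eq_iff by simp
  qed
  moreover have "x \<in> proj x" using S.a_rcos_self[OF x] .
  ultimately have "(\<Union>z\<in>proj x. proj (c \<odot> z)) = proj (c \<odot> x)" by blast
  then show ?thesis by (simp add: quot_module_def ring.defs module.defs FactRing_def)
qed

lemma one_quot: "\<one>\<^bsub>quot_module M N\<^esub> = proj \<one>"
  by (simp add: quot_module_def ring.defs module.defs FactRing_def)

lemma mult_quot:
  assumes "ideal N M" "x \<in> car M" "y \<in> car M"
  shows "proj x \<otimes>\<^bsub>quot_module M N\<^esub> proj y = proj (x \<otimes> y)"
  using ideal.rcoset_mult_add[OF assms] by (simp add: quot_module_def ring.defs module.defs FactRing_def)

lemma lin_proj: "is_linear M (quot_module M N) proj"
  by (rule is_linearI) (simp_all add: carrier_quot add_quot smult_quot)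

lemma cvs_quot: "cvs (quot_module M N)"
  by (rule cvs_image[OF cvs_axioms carrier_quot]) (simp_all add: add_quot zero_quot smult_quot)

lemma ring_quot: "ideal N M ==> Ring.ring (quot_module M N)" by (rule ring_image[OF ideal.axioms(2) carrier_quot])
    (simp_all add: add_quot zero_quot mult_quot one_quot)

lemma qsn_le:
  assumes s: "is_seminorm M s" and x: "x \<in> car M"
  shows "qsn s (proj x) \<le> s x" unfolding qsn_def
proof (rule cINF_lower)
  show "bdd_below (s ` proj x)" using sn_nonneg[OF s] mem_proj_iff[OF x] by (intro bdd_belowI[of _ 0]) auto
qed (rule S.a_rcos_self[OF x])

lemma qsn_greatest:
  assumes x: "x \<in> car M" and le: "\<And>y. y \<in> car M ==> proj y = proj x ==> t \<le> s y"
  shows "t \<le> qsn s (proj x)" unfolding qsn_def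
proof (rule cINF_greatest)
  show "proj x \<noteq> {}" using S.a_rcos_self[OF x] by auto
  fix y assume "y \<in> proj x"
  then have "y \<in> car M" "proj y = proj x" using mem_proj_iff[OF x] proj_eq_iff x by auto
  then show "t \<le> s y" by (rule le)
qed

lemma qsn_approx:
  assumes x: "x \<in> car M" and e: "0 < e"
  shows "\<exists>y\<in>car M. proj y = proj x \<and> s y < qsn s (proj x) + e"
proof (rule ccontr)
  assume "\<not> ?thesis"
  then have "qsn s (proj x) + e \<le> qsn s (proj x)" by (intro qsn_greatest[OF x]) (auto simp: not_less)
  then show False using e by simp
qed

lemma qsn_greatest_mult:
  assumes s: "is_seminorm M s" and x: "x \<in> car M" and k: "0 \<le> k"
    and le: "\<And>y. y \<in> car M ==> proj y = proj x ==> t \<le> s y * k"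
  shows "t \<le> qsn s (proj x) * k"
proof (cases "k = 0")
  case True
  then show ?thesis using le[OF x refl] by simp
next
  case False
  then have "t / k \<le> qsn s (proj x)" using k le by (intro qsn_greatest[OF x]) (simp add: field_simps)
  then show ?thesis using False k by (simp add: field_simps)
qed

lemma qsn_nonneg:
  assumes s: "is_seminorm M s" and x: "x \<in> car M"
  shows "0 \<le> qsn s (proj x)" by (intro qsn_greatest[OF x] sn_nonneg[OF s])

text \<open>
  The infimum over a coset is positively homogeneous since multiplication by a nonzero scalar permutes the cosets.
\<close>

lemma is_seminorm_quot:
  assumes s: "is_seminorm M s"
  shows "is_seminorm (quot_module M N) (qsn s)"
proof -
  interpret Q: cvs "quot_module M N" by (rule cvs_quot)
  have smult_le: "qsn s (proj (c \<odot> x)) \<le> qsn s (proj x) * cmod c"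
    if x: "x \<in> car M" for c x
  proof (rule qsn_greatest_mult[OF s x])
    fix y assume y: "y \<in> car M" "proj y = proj x"
    have "proj (c \<odot> x) = proj (c \<odot> y)" using y x smult_quot by metis
    then show "qsn s (proj (c \<odot> x)) \<le> s y * cmod c"
     using qsn_le[OF s smult_closed[OF y(1)], of c] seminorm_smult[OF s y(1)] by (simp add: mult.commute)
  qed simp
  show ?thesis
  proof (rule Q.is_seminormI)
    fix X assume "X \<in> car (quot_module M N)"
    then obtain x where x: "X = proj x" "x \<in> car M" unfolding carrier_quot by (elim imageE)
    show "0 \<le> qsn s X" unfolding x(1) by (rule qsn_nonneg[OF s x(2)])
    fix c
    show "qsn s (c \<odot>\<^bsub>quot_module M N\<^esub> X) = cmod c * qsn s X"
    proof (cases "c = 0")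
     case True
     then show ?thesis using smult_le[OF x(2), of 0] qsn_nonneg[OF s zero_closed] x by (simp add: smult_quot)
    next
     case False
     have "qsn s (proj x) \<le> qsn s (proj (c \<odot> x)) * cmod (1 / c)"
      using smult_le[of "c \<odot> x" "1 / c"] x(2) False by (simp add: smult_assoc)
     then have "cmod c * qsn s (proj x) \<le> qsn s (proj (c \<odot> x))"
      using False by (simp add: norm_divide field_simps)
     then show ?thesis using smult_le[OF x(2), of c] x by (simp add: smult_quot mult.commute)
    qed
    fix Y assume "Y \<in> car (quot_module M N)"
    then obtain y where y: "Y = proj y" "y \<in> car M" unfolding carrier_quot by (elim imageE)
    show "qsn s (X \<oplus>\<^bsub>quot_module M N\<^esub> Y) \<le> qsn s X + qsn s Y"
    proof (rule field_le_epsilon)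
     fix e :: real assume "0 < e"
     then have e: "0 < e / 2" by simp
     obtain x' where x': "x' \<in> car M" "proj x' = X" "s x' < qsn s X + e / 2"
      using qsn_approx[OF x(2) e, of s] unfolding x(1) by (elim bexE conjE)
     obtain y' where y': "y' \<in> car M" "proj y' = Y" "s y' < qsn s Y + e / 2"
      using qsn_approx[OF y(2) e, of s] unfolding y(1) by (elim bexE conjE)
     have "qsn s (X \<oplus>\<^bsub>quot_module M N\<^esub> Y) \<le> s (x' \<oplus> y')"
      using qsn_le[OF s a_closed[OF x'(1) y'(1)]] add_quot[OF x'(1) y'(1)] x'(2) y'(2) by simp
     also have "\<dots> \<le> s x' + s y'" using x'(1) y'(1) by (rule seminorm_add[OF s])
     finally show "qsn s (X \<oplus>\<^bsub>quot_module M N\<^esub> Y) \<le> qsn s X + qsn s Y + e"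
      using x'(3) y'(3) by simp
    qed
  qed
qed

lemma qsn_submult:
  assumes N: "ideal N M" and s: "is_seminorm M s"
    and sm: "\<And>x y. x \<in> car M ==> y \<in> car M ==> s (x \<otimes> y) \<le> s x * s y"
    and X: "X \<in> car (quot_module M N)" and Y: "Y \<in> car (quot_module M N)"
  shows "qsn s (X \<otimes>\<^bsub>quot_module M N\<^esub> Y) \<le> qsn s X * qsn s Y"
proof -
  interpret R: ring M by (rule ideal.axioms(2)[OF N])
  obtain x where x: "X = proj x" "x \<in> car M" using X unfolding carrier_quot by (elim imageE)
  obtain y where y: "Y = proj y" "y \<in> car M" using Y unfolding carrier_quot by (elim imageE)
  show ?thesis unfolding x(1)
  proof (rule qsn_greatest_mult[OF s x(2)])
    show "0 \<le> qsn s Y" unfolding y(1) by (rule qsn_nonneg[OF s y(2)])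
    fix x' assume x': "x' \<in> car M" "proj x' = proj x"
    have "qsn s (proj x \<otimes>\<^bsub>quot_module M N\<^esub> Y) \<le> qsn s (proj y) * s x'"
    proof (rule qsn_greatest_mult[OF s y(2) sn_nonneg[OF s x'(1)]])
     fix y' assume y': "y' \<in> car M" "proj y' = proj y"
     have "proj x \<otimes>\<^bsub>quot_module M N\<^esub> Y = proj (x' \<otimes> y')"
      unfolding y(1) x'(2)[symmetric] y'(2)[symmetric] by (rule mult_quot[OF N x'(1) y'(1)])
     then have "qsn s (proj x \<otimes>\<^bsub>quot_module M N\<^esub> Y) \<le> s (x' \<otimes> y')"
      using qsn_le[OF s R.m_closed[OF x'(1) y'(1)]] by simp
     also have "\<dots> \<le> s x' * s y'" using x'(1) y'(1) by (rule sm)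
     finally show "qsn s (proj x \<otimes>\<^bsub>quot_module M N\<^esub> Y) \<le> s y' * s x'" by (simp add: mult.commute)
    qed
    then show "qsn s (proj x \<otimes>\<^bsub>quot_module M N\<^esub> Y) \<le> s x' * qsn s Y"
     by (simp add: y(1) mult.commute)
  qed
qed

end

lemma module_extend_simps [simp]:
  "car (module.extend M t) = car M" "add (module.extend M t) = add M"
  "zero (module.extend M t) = zero M" "mult (module.extend M t) = mult M"
  "one (module.extend M t) = one M" "smult (module.extend M t) = smult M" by (simp_all add: module.defs)

lemma lctop_extend [simp]: "lctop (module.extend M (lcs.fields T)) = T" by (simp add: module.defs lcs.defs)

lemma a_minus_cong:
  assumes "car A = car B" "add A = add B" "zero A = zero B"
  shows "a_minus A = a_minus B"
proof -
  have "a_inv A = a_inv B" by (simp add: fun_eq_iff a_inv_def m_inv_def assms)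
  then show ?thesis by (simp add: fun_eq_iff a_minus_def assms(2))
qed

lemma cvs_extend: "cvs M ==> cvs (module.extend M t)" by (rule cvs_image[of M _ "\<lambda>x. x"]) simp_all

lemma ring_extend: "Ring.ring M ==> Ring.ring (module.extend M t)" by (rule ring_image[of M _ "\<lambda>x. x"]) simp_all

lemma is_seminorm_extend [simp]: "is_seminorm (module.extend M t) = is_seminorm M"
  by (simp add: fun_eq_iff is_seminorm_def)

lemma seminorm_topology_extend [simp]: "seminorm_topology (module.extend M t) P = seminorm_topology M P"
proof -
  have "seminorm_open (module.extend M t) P = seminorm_open M P"
    using a_minus_cong[of "module.extend M t" M] by (simp add: seminorm_open_def fun_eq_iff)
  then show ?thesis by (simp add: seminorm_topology_def)
qed

lemma lin_extend [simp]:
  "is_linear M (module.extend Q t) f = is_linear M Q f"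
  "is_linear (module.extend M t') Q f = is_linear M Q f" by (simp_all add: is_linear_def)

section \<open>Algebras with submultiplicative seminorms\<close>

definition submult :: "'a lcs => ('a => real) => bool" where
  "submult A s \<longleftrightarrow> s \<in> csn A \<and>
    (\<forall>x\<in>car A. \<forall>y\<in>car A. s (x \<otimes>\<^sub>A y) \<le> s x * s y)"

definition sn_le :: "'a lcs => ('a => real) => ('a => real) => bool" where
  "sn_le E p r \<longleftrightarrow> (\<forall>x\<in>car E. p x \<le> r x)"

lemma sn_leD: "sn_le E p r ==> x \<in> car E ==> p x \<le> r x" by (simp add: sn_le_def)

lemma sn_leI: "(\<And>x. x \<in> car E ==> p x \<le> r x) ==> sn_le E p r" by (simp add: sn_le_def)

lemma sn_le_trans: "sn_le E p r ==> sn_le E r s ==> sn_le E p s" unfolding sn_le_def by (blast intro: order_trans)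

text \<open>
  The Arens--Michael condition, without completeness. It is phrased as domination of each continuous seminorm, since in
  this form it passes to completions, tensor products and quotients.
\<close>

locale am_algebra = lc_space A + ring A for A :: "'a lcs" (structure) +
  assumes smult_mult_left: "x \<in> car A ==> y \<in> car A ==> (c \<odot> x) \<otimes> y = c \<odot> (x \<otimes> y)"
    and smult_mult_right: "x \<in> car A ==> y \<in> car A ==> x \<otimes> (c \<odot> y) = c \<odot> (x \<otimes> y)"
    and submult_above:
     "p \<in> csn A ==> \<exists>s. submult A s \<and> sn_le A p s"

lemma submultD:
  assumes "submult A s"
  shows "s \<in> csn A"
    "x \<in> car A ==> y \<in> car A ==> s (x \<otimes>\<^sub>A y) \<le> s x * s y"
  using assms by (simp_all add: submult_def)

text \<open>
  This makes it possible to absorb the constant of a domination into a submultiplicative seminorm.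
\<close>

lemma (in lc_space) submult_scale:
  assumes s: "submult E s" and C: "1 \<le> C"
    and closed: "\<And>x y. x \<in> car E ==> y \<in> car E ==> x \<otimes> y \<in> car E"
  shows "submult E (\<lambda>x. C * s x)" unfolding submult_def
proof (intro conjI ballI)
  note s1 = submultD(1)[OF s]
  show "(\<lambda>x. C * s x) \<in> csn E" using C by (intro csn_scale s1) simp
  fix x y assume xy: "x \<in> car E" "y \<in> car E"
  have n: "0 \<le> s x" "0 \<le> s y" using xy sn_nonneg[OF csnD[OF s1]] by auto
  have "C * s (x \<otimes> y) \<le> C * (s x * s y)" using C submultD(2)[OF s xy] by (intro mult_left_mono) auto
  also have "\<dots> \<le> C * (C * (s x * s y))"
    using C n mult_right_mono[of 1 C "s x * s y"] by (intro mult_left_mono) auto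
  finally show "C * s (x \<otimes> y) \<le> C * s x * (C * s y)" by (simp add: mult_ac)
qed

section \<open>Completion\<close>

context lc_space
begin

definition tail :: "('a => real) => ('a => real) set" where
  "tail s = {i \<in> csn E. sn_le E s i}"

lemma tail_self: "s \<in> csn E ==> s \<in> tail s" by (simp add: tail_def sn_le_def)

lemma tail_cont: "i \<in> tail s ==> i \<in> csn E" by (simp add: tail_def)

lemma tail_le: "i \<in> tail s ==> x \<in> car E ==> s x \<le> i x" by (simp add: tail_def sn_le_def)

lemma tail_add:
  assumes "s \<in> csn E" "t \<in> csn E"
  shows "tail (\<lambda>x. s x + t x) \<subseteq> tail s \<inter> tail t"
proof
  fix i assume i: "i \<in> tail (\<lambda>x. s x + t x)"
  have "s x \<le> i x \<and> t x \<le> i x" if x: "x \<in> car E" for x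
    using tail_le[OF i x] sn_nonneg[OF csnD[OF assms(1)] x]
     sn_nonneg[OF csnD[OF assms(2)] x] by simp
  then show "i \<in> tail s \<inter> tail t" using i by (simp add: tail_def sn_le_def)
qed

text \<open>
  The sum of two seminorms dominates both, so the indices form a directed set and a single tail suffices.
\<close>

lemma eventually_net:
  "eventually P (NF E) \<longleftrightarrow> (\<exists>s\<in>csn E. \<forall>i\<in>tail s. P i)"
proof -
  have net: "NF E = (INF s\<in>csn E. principal (tail s))" by (simp add: net_filter_def tail_def sn_le_def)
  show ?thesis unfolding net
  proof (subst eventually_INF_base)
    show "csn E \<noteq> {}" using csn_zero by (rule ex_in_conv[THEN iffD1, OF exI])
    fix s t assume st: "s \<in> csn E" "t \<in> csn E"
    show "\<exists>u\<in>csn E. principal (tail u) \<le> inf (principal (tail s)) (principal (tail t))"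
     using tail_add[OF st] by (intro bexI[OF _ csn_add[OF st]]) simp
  qed (simp add: eventually_principal)
qed

lemma net_filter_nontrivial [simp]: "NF E \<noteq> bot"
proof
  assume "NF E = bot"
  then have "eventually (\<lambda>_. False) (NF E)" by simp
  then obtain s where "s \<in> csn E" "\<forall>i\<in>tail s. False" unfolding eventually_net by (elim bexE)
  then show False using tail_self[of s] by simp
qed

lemma eventually_net_cont: "eventually (\<lambda>i. i \<in> csn E) (NF E)"
  unfolding eventually_net by (rule bexI[OF _ csn_zero]) (simp add: tail_def)

definition cauchy_net :: "(('a => real) => 'a) => bool" where
  "cauchy_net x \<longleftrightarrow> (\<forall>i\<in>csn E. x i \<in> car E) \<and>
    (\<forall>p\<in>csn E. \<forall>e>0. \<exists>s\<in>csn E. \<forall>i\<in>tail s. \<forall>j\<in>tail s. p (x i \<ominus> x j) < e)"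

lemma cauchy_netD:
  assumes "cauchy_net x" "p \<in> csn E" "0 < e"
  shows "\<exists>s\<in>csn E. \<forall>i\<in>tail s. \<forall>j\<in>tail s. p (x i \<ominus> x j) < e"
  using assms(1)[unfolded cauchy_net_def, THEN conjunct2, rule_format, OF assms(2,3)] .

lemma cauchy_net_closed: "cauchy_net x ==> i \<in> csn E ==> x i \<in> car E" by (simp add: cauchy_net_def)

lemma carrier_cauchy_nets:
  "x \<in> car (CN E) \<longleftrightarrow> x \<in> extensional (csn E) \<and> cauchy_net x"
proof -
  have "cauchy_filter E (filtermap x (NF E)) \<longleftrightarrow>
     (\<forall>p\<in>csn E. \<forall>e>0. \<exists>s\<in>csn E. \<forall>i\<in>tail s. \<forall>j\<in>tail s. p (x i \<ominus> x j) < e)"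
    if x: "\<forall>i\<in>csn E. x i \<in> car E"
  proof
    assume "cauchy_filter E (filtermap x (NF E))"
    then have c: "\<forall>p\<in>csn E. \<forall>e>0. \<exists>Q. eventually Q (filtermap x (NF E)) \<and>
     (\<forall>x\<in>car E. \<forall>y\<in>car E. Q x --> Q y --> p (x \<ominus> y) < e)"
     unfolding cauchy_filter_iff by (elim conjE)
    show "\<forall>p\<in>csn E. \<forall>e>0. \<exists>s\<in>csn E. \<forall>i\<in>tail s. \<forall>j\<in>tail s. p (x i \<ominus> x j) < e"
    proof (intro ballI allI impI)
     fix p and e :: real assume "p \<in> csn E" "0 < e"
     from c[rule_format, OF this] obtain Q where Q: "eventually Q (filtermap x (NF E))"
      "\<forall>x\<in>car E. \<forall>y\<in>car E. Q x --> Q y --> p (x \<ominus> y) < e" by (elim exE conjE)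
     obtain s where s: "s \<in> csn E" "\<forall>i\<in>tail s. Q (x i)"
      using Q(1) unfolding eventually_filtermap eventually_net by (elim bexE)
     show "\<exists>s\<in>csn E. \<forall>i\<in>tail s. \<forall>j\<in>tail s. p (x i \<ominus> x j) < e"
      by (rule bexI[OF _ s(1)], intro ballI, rule Q(2)[rule_format])
       (use x s(2) in \<open>auto simp: tail_def\<close>)
    qed
  next
    assume c: "\<forall>p\<in>csn E. \<forall>e>0. \<exists>s\<in>csn E. \<forall>i\<in>tail s. \<forall>j\<in>tail s. p (x i \<ominus> x j) < e"
    show "cauchy_filter E (filtermap x (NF E))" unfolding cauchy_filter_iff
    proof (intro conjI ballI allI impI)
     show "filtermap x (NF E) \<noteq> bot" by (simp add: filtermap_bot_iff)
     show "eventually (\<lambda>y. y \<in> car E) (filtermap x (NF E))"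
      unfolding eventually_filtermap by (rule eventually_mono[OF eventually_net_cont]) (use x in simp)
     fix p and e :: real assume "p \<in> csn E" "0 < e"
     from c[rule_format, OF this] obtain s where s: "s \<in> csn E"
      "\<forall>i\<in>tail s. \<forall>j\<in>tail s. p (x i \<ominus> x j) < e" by (elim bexE)
     show "\<exists>Q. eventually Q (filtermap x (NF E)) \<and>
      (\<forall>x\<in>car E. \<forall>y\<in>car E. Q x --> Q y --> p (x \<ominus> y) < e)"
     proof (intro exI[of _ "\<lambda>y. y \<in> x ` tail s"] conjI ballI impI)
      show "eventually (\<lambda>y. y \<in> x ` tail s) (filtermap x (NF E))"
       unfolding eventually_filtermap eventually_net by (rule bexI[OF _ s(1)]) simp
      fix a b assume "a \<in> x ` tail s" "b \<in> x ` tail s"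
      then show "p (a \<ominus> b) < e" using s(2) by (elim imageE) simp
     qed
    qed
  qed
  then show ?thesis by (auto simp: cauchy_nets_def cauchy_net_def PiE_def Pi_iff)
qed

lemma cauchy_net_cong:
  assumes "\<And>i. i \<in> csn E ==> x i = y i" "cauchy_net y"
  shows "cauchy_net x"
proof -
  have "x i = y i" if "i \<in> tail s" for i s using assms(1) tail_cont[OF that] by simp
  then show ?thesis using assms unfolding cauchy_net_def by (simp cong: ball_cong)
qed

lemma cauchy_net_add:
  assumes x: "cauchy_net x" and y: "cauchy_net y"
  shows "cauchy_net (\<lambda>i. x i \<oplus> y i)" unfolding cauchy_net_def
proof (intro conjI ballI allI impI)
  fix p and e :: real assume p: "p \<in> csn E" and "0 < e"
  then have e: "0 < e / 2" by simp
  obtain s where s: "s \<in> csn E" "\<forall>i\<in>tail s. \<forall>j\<in>tail s. p (x i \<ominus> x j) < e / 2"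
    using cauchy_netD[OF x p e] by (elim bexE)
  obtain t where t: "t \<in> csn E" "\<forall>i\<in>tail t. \<forall>j\<in>tail t. p (y i \<ominus> y j) < e / 2"
    using cauchy_netD[OF y p e] by (elim bexE)
  show "\<exists>s\<in>csn E. \<forall>i\<in>tail s. \<forall>j\<in>tail s. p (x i \<oplus> y i \<ominus> (x j \<oplus> y j)) < e"
  proof (rule bexI[OF _ csn_add[OF s(1) t(1)]], intro ballI)
    fix i j assume ij: "i \<in> tail (\<lambda>x. s x + t x)" "j \<in> tail (\<lambda>x. s x + t x)"
    then have st: "i \<in> tail s" "i \<in> tail t" "j \<in> tail s" "j \<in> tail t"
     using tail_add[OF s(1) t(1)] by auto
    have c: "x i \<in> car E" "x j \<in> car E" "y i \<in> car E" "y j \<in> car E"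
     using ij tail_cont cauchy_net_closed x y by auto
    have "p (x i \<oplus> y i \<ominus> (x j \<oplus> y j)) \<le> p (x i \<ominus> x j) + p (y i \<ominus> y j)"
     using c seminorm_add[OF csnD[OF p]] by (simp add: add_minus_add)
    also have "\<dots> < e / 2 + e / 2"
     by (rule add_strict_mono[OF s(2)[rule_format, OF st(1,3)] t(2)[rule_format, OF st(2,4)]])
    finally show "p (x i \<oplus> y i \<ominus> (x j \<oplus> y j)) < e" by simp
  qed
qed (use x y cauchy_net_closed in auto)

lemma cauchy_net_smult:
  assumes x: "cauchy_net x"
  shows "cauchy_net (\<lambda>i. c \<odot> x i)" unfolding cauchy_net_def
proof (intro conjI ballI allI impI)
  fix p and e :: real assume p: "p \<in> csn E" and e: "0 < e"
  obtain s where s: "s \<in> csn E" "\<forall>i\<in>tail s. \<forall>j\<in>tail s. cmod c * p (x i \<ominus> x j) < e"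
    using cauchy_netD[OF x csn_scale[OF p norm_ge_zero[of c]] e] by (elim bexE)
  show "\<exists>s\<in>csn E. \<forall>i\<in>tail s. \<forall>j\<in>tail s. p (c \<odot> x i \<ominus> c \<odot> x j) < e"
  proof (rule bexI[OF _ s(1)], intro ballI)
    fix i j assume ij: "i \<in> tail s" "j \<in> tail s"
    have c: "x i \<in> car E" "x j \<in> car E" using ij tail_cont cauchy_net_closed x by auto
    then have "c \<odot> x i \<ominus> c \<odot> x j = c \<odot> (x i \<ominus> x j)" by (simp add: smult_diff)
    then show "p (c \<odot> x i \<ominus> c \<odot> x j) < e"
     using s(2)[rule_format, OF ij] seminorm_smult[OF csnD[OF p] minus_closed[OF c]] by simp
  qed
qed (use x cauchy_net_closed in auto)

lemma cauchy_net_const: "a \<in> car E ==> cauchy_net (\<lambda>i. a)" unfolding cauchy_net_def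
  by (auto simp: seminorm_zero[OF csnD] intro!: bexI[OF _ csn_zero])

definition rs :: "(('a => real) => 'a) => (('a => real) => 'a)" where
  "rs x = restrict x (csn E)"

lemma rs_apply [simp]: "i \<in> csn E ==> rs x i = x i" by (simp add: rs_def)

lemma rs_cong: "(\<And>i. i \<in> csn E ==> x i = y i) ==> rs x = rs y" by (auto simp: rs_def restrict_def)

lemma rs_mem: "cauchy_net x ==> rs x \<in> car (CN E)"
  unfolding carrier_cauchy_nets by (auto simp: rs_def intro: cauchy_net_cong[of _ x])

lemma mem_rs: "x \<in> car (CN E) ==> rs x = x" unfolding carrier_cauchy_nets by (simp add: rs_def extensional_restrict)

lemma mem_cauchy: "x \<in> car (CN E) ==> cauchy_net x" unfolding carrier_cauchy_nets by simp

lemma mem_closed: "x \<in> car (CN E) ==> i \<in> csn E ==> x i \<in> car E" by (intro cauchy_net_closed mem_cauchy)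

lemma CN_ops:
  "x \<oplus>\<^bsub>CN E\<^esub> y = rs (\<lambda>i. x i \<oplus> y i)" "c \<odot>\<^bsub>CN E\<^esub> x = rs (\<lambda>i. c \<odot> x i)"
  "\<zero>\<^bsub>CN E\<^esub> = rs (\<lambda>i. \<zero>)" "x \<otimes>\<^bsub>CN E\<^esub> y = rs (\<lambda>i. x i \<otimes> y i)"
  "\<one>\<^bsub>CN E\<^esub> = rs (\<lambda>i. \<one>)" by (simp_all add: cauchy_nets_def rs_def)

lemma cvs_cauchy_nets: "cvs (CN E)"
proof -
  let ?N = "CN E"
  have "abelian_group ?N"
  proof (rule abelian_groupI)
    fix x assume x: "x \<in> car ?N"
    show "\<exists>y\<in>car ?N. y \<oplus>\<^sub>?N x = \<zero>\<^sub>?N"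
    proof (rule bexI)
     show "rs (\<lambda>i. (-1) \<odot> x i) \<oplus>\<^sub>?N x = \<zero>\<^sub>?N"
      unfolding CN_ops using mem_closed[OF x] by (intro rs_cong) (simp add: l_neg flip: uminus_smult)
     show "rs (\<lambda>i. (-1) \<odot> x i) \<in> car ?N" by (intro rs_mem cauchy_net_smult mem_cauchy x)
    qed
    show "\<zero>\<^sub>?N \<oplus>\<^sub>?N x = x" unfolding CN_ops using mem_closed[OF x]
     by (subst (2) mem_rs[OF x, symmetric], intro rs_cong) simp
    fix y assume y: "y \<in> car ?N"
    show "x \<oplus>\<^sub>?N y \<in> car ?N" unfolding CN_ops by (intro rs_mem cauchy_net_add mem_cauchy x y)
    show "x \<oplus>\<^sub>?N y = y \<oplus>\<^sub>?N x"
     unfolding CN_ops using mem_closed[OF x] mem_closed[OF y] by (intro rs_cong) (simp add: a_comm)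
    fix z assume z: "z \<in> car ?N"
    show "x \<oplus>\<^sub>?N y \<oplus>\<^sub>?N z = x \<oplus>\<^sub>?N (y \<oplus>\<^sub>?N z)"
     unfolding CN_ops using mem_closed[OF x] mem_closed[OF y] mem_closed[OF z] by (intro rs_cong) (simp add: a_assoc)
  qed (unfold CN_ops, intro rs_mem cauchy_net_const zero_closed)
  then have "Module.module CC ?N"
  proof (intro moduleI cring_complex)
    fix c d :: complex and x y assume x: "x \<in> car ?N"
    show "c \<odot>\<^sub>?N x \<in> car ?N" unfolding CN_ops by (intro rs_mem cauchy_net_smult mem_cauchy x)
    show "(c \<oplus>\<^bsub>CC\<^esub> d) \<odot>\<^sub>?N x = c \<odot>\<^sub>?N x \<oplus>\<^sub>?N d \<odot>\<^sub>?N x"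
     unfolding CN_ops using mem_closed[OF x] by (intro rs_cong) (simp add: smult_l_distr)
    show "(c \<otimes>\<^bsub>CC\<^esub> d) \<odot>\<^sub>?N x = c \<odot>\<^sub>?N (d \<odot>\<^sub>?N x)"
     unfolding CN_ops using mem_closed[OF x] by (intro rs_cong) (simp add: smult_assoc)
    show "\<one>\<^bsub>CC\<^esub> \<odot>\<^sub>?N x = x" unfolding CN_ops using mem_closed[OF x]
     by (subst (2) mem_rs[OF x, symmetric], intro rs_cong) simp
    assume y: "y \<in> car ?N"
    show "c \<odot>\<^sub>?N (x \<oplus>\<^sub>?N y) = c \<odot>\<^sub>?N x \<oplus>\<^sub>?N c \<odot>\<^sub>?N y"
     unfolding CN_ops using mem_closed[OF x] mem_closed[OF y] by (intro rs_cong) (simp add: smult_r_distr)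
  qed
  then show ?thesis by (rule cvs.intro)
qed

lemma CN_minus:
  assumes x: "x \<in> car (CN E)" and y: "y \<in> car (CN E)" and i: "i \<in> csn E"
  shows "(x \<ominus>\<^bsub>CN E\<^esub> y) i = x i \<ominus> y i"
proof -
  interpret N: cvs "CN E" by (rule cvs_cauchy_nets)
  show ?thesis unfolding a_minus_def N.uminus_smult[OF y] using mem_closed[OF y i] i by (simp add: CN_ops uminus_smult)
qed

text \<open>
  By the reverse triangle inequality a seminorm maps a Cauchy net to a Cauchy net of reals. Its limit is the value of the
  extended seminorm.
\<close>

lemma net_seminorm_convergent:
  assumes x: "cauchy_net x" and p: "p \<in> csn E"
  shows "\<exists>l. ((\<lambda>i. p (x i)) \<longlongrightarrow> l) (NF E)"
proof -
  note sp = csnD[OF p]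
  let ?F = "filtermap (\<lambda>i. p (x i)) (NF E)"
  have "uniform_space_class.cauchy_filter ?F" unfolding cauchy_filter_metric_filtermap
  proof (intro allI impI)
    fix e :: real assume e: "0 < e"
    obtain s where s: "s \<in> csn E" "\<forall>i\<in>tail s. \<forall>j\<in>tail s. p (x i \<ominus> x j) < e"
     using cauchy_netD[OF x p e] by (elim bexE)
    show "\<exists>P. eventually P (NF E) \<and> (\<forall>i j. P i \<and> P j --> dist (p (x i)) (p (x j)) < e)"
    proof (intro exI[of _ "\<lambda>i. i \<in> tail s"] conjI allI impI)
     show "eventually (\<lambda>i. i \<in> tail s) (NF E)" unfolding eventually_net by (rule bexI[OF _ s(1)]) simp
     fix i j assume ij: "i \<in> tail s \<and> j \<in> tail s"
     then have "\<bar>p (x i) - p (x j)\<bar> \<le> p (x i \<ominus> x j)"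
      by (intro seminorm_diff_le[OF sp] cauchy_net_closed[OF x] tail_cont[of _ s]) auto
     also have "\<dots> < e" using s(2) ij by auto
     finally show "dist (p (x i)) (p (x j)) < e" by (simp add: dist_real_def)
    qed
  qed
  then obtain l where "?F \<le> nhds l" using cauchy_filter_complete_converges[of ?F UNIV] complete_UNIV
    by (auto simp: filtermap_bot_iff)
  then show ?thesis by (auto simp: filterlim_def)
qed

lemma null_nets_iff:
  assumes "x \<in> car (CN E)"
  shows "x \<in> null_nets E \<longleftrightarrow> (\<forall>p\<in>csn E. ((\<lambda>i. p (x i)) \<longlongrightarrow> 0) (NF E))"
proof -
  have ev: "eventually (\<lambda>i. x i \<in> car E) (NF E)"
    by (rule eventually_mono[OF eventually_net_cont]) (rule mem_closed[OF assms])
  have "(\<forall>e>0. eventually (\<lambda>i. p (x i \<ominus> \<zero>) < e) (NF E)) \<longleftrightarrow> ((\<lambda>i. p (x i)) \<longlongrightarrow> 0) (NF E)"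
    if p: "p \<in> csn E" for p
  proof -
    have "eventually (\<lambda>i. (p (x i \<ominus> \<zero>) < e) = (dist (p (x i)) 0 < e)) (NF E)" for e
     using ev by eventually_elim (simp add: sn_nonneg[OF csnD[OF p]])
    from eventually_subst[OF this] show ?thesis by (simp add: tendsto_iff)
  qed
  then show ?thesis unfolding null_nets_def limitin_iff using assms ev by (simp cong: ball_cong)
qed

lemma submodule_null_nets: "submodule (null_nets E) CC (CN E)"
proof -
  interpret N: cvs "CN E" by (rule cvs_cauchy_nets)
  interpret NM: Module.module CC "CN E" by (rule N.is_module)
  have sub: "null_nets E \<subseteq> car (CN E)" by (auto simp: null_nets_def)
  have smult: "c \<odot>\<^bsub>CN E\<^esub> x \<in> null_nets E" if x: "x \<in> null_nets E" for c x
  proof -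
    have xc: "x \<in> car (CN E)" using sub x by auto
    show ?thesis
    proof (subst null_nets_iff[OF N.smult_closed[OF xc]], intro ballI)
     fix p assume p: "p \<in> csn E"
     have "((\<lambda>i. cmod c * p (x i)) \<longlongrightarrow> cmod c * 0) (NF E)"
      using x[unfolded null_nets_iff[OF xc], rule_format, OF p] by (rule tendsto_mult_left)
     moreover have "eventually (\<lambda>i. cmod c * p (x i) = p ((c \<odot>\<^bsub>CN E\<^esub> x) i)) (NF E)"
      using eventually_net_cont by eventually_elim (simp add: CN_ops seminorm_smult[OF csnD[OF p] mem_closed[OF xc]])
     ultimately show "((\<lambda>i. p ((c \<odot>\<^bsub>CN E\<^esub> x) i)) \<longlongrightarrow> 0) (NF E)"
      using Lim_transform_eventually by fastforce
    qed
  qed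
  show ?thesis
  proof (rule NM.submoduleI[OF sub])
    show "\<zero>\<^bsub>CN E\<^esub> \<in> null_nets E"
    proof (subst null_nets_iff[OF N.zero_closed], intro ballI)
     fix p assume p: "p \<in> csn E"
     have "eventually (\<lambda>i. 0 = p (\<zero>\<^bsub>CN E\<^esub> i)) (NF E)"
      using eventually_net_cont by eventually_elim (simp add: CN_ops seminorm_zero[OF csnD[OF p]])
     then show "((\<lambda>i. p (\<zero>\<^bsub>CN E\<^esub> i)) \<longlongrightarrow> 0) (NF E)"
      by (rule Lim_transform_eventually[OF tendsto_const])
    qed
    fix a b assume a: "a \<in> null_nets E" and b: "b \<in> null_nets E"
    have ac: "a \<in> car (CN E)" "b \<in> car (CN E)" using sub a b by auto
    show "\<ominus>\<^bsub>CN E\<^esub> a \<in> null_nets E" using smult[OF a, of "-1"] ac by (simp add: N.uminus_smult)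
    show "a \<oplus>\<^bsub>CN E\<^esub> b \<in> null_nets E"
    proof (subst null_nets_iff[OF N.a_closed[OF ac]], intro ballI)
     fix p assume p: "p \<in> csn E"
     note sp = csnD[OF p]
     have lim: "((\<lambda>i. p (a i) + p (b i)) \<longlongrightarrow> 0 + 0) (NF E)"
      using a[unfolded null_nets_iff[OF ac(1)], rule_format, OF p] b[unfolded null_nets_iff[OF ac(2)], rule_format, OF p]
      by (rule tendsto_add)
     have ev1: "eventually (\<lambda>i. 0 \<le> p ((a \<oplus>\<^bsub>CN E\<^esub> b) i)) (NF E)"
      using eventually_net_cont
      by eventually_elim (simp add: CN_ops sn_nonneg[OF sp] mem_closed[OF ac(1)] mem_closed[OF ac(2)])
     have ev2: "eventually (\<lambda>i. p ((a \<oplus>\<^bsub>CN E\<^esub> b) i) \<le> p (a i) + p (b i)) (NF E)"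
      using eventually_net_cont
      by eventually_elim (simp add: CN_ops seminorm_add[OF sp] mem_closed[OF ac(1)] mem_closed[OF ac(2)])
     show "((\<lambda>i. p ((a \<oplus>\<^bsub>CN E\<^esub> b) i)) \<longlongrightarrow> 0) (NF E)"
      by (rule tendsto_sandwich[OF ev1 ev2 tendsto_const lim[unfolded add_0_left]])
    qed
  qed (rule smult)
qed

sublocale C: quot_space "CN E" "null_nets E"
  by (rule quot_space.intro[OF cvs_cauchy_nets quot_space_axioms.intro[OF submodule_null_nets]])

lemma ext_sn_eq:
  assumes x: "x \<in> car (CN E)" and p: "p \<in> csn E"
    and l: "((\<lambda>i. p (x i)) \<longlongrightarrow> l) (NF E)"
  shows "extended_seminorm E p (C.proj x) = l" unfolding extended_seminorm_def
proof (rule the_equality)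
  note sp = csnD[OF p]
  show "\<forall>y\<in>C.proj x. ((\<lambda>i. p (y i)) \<longlongrightarrow> l) (NF E)"
  proof
    fix y assume "y \<in> C.proj x"
    then have y: "y \<in> car (CN E)" "y \<ominus>\<^bsub>CN E\<^esub> x \<in> null_nets E"
     using C.mem_proj_iff[OF x] by auto
    have "((\<lambda>i. p ((y \<ominus>\<^bsub>CN E\<^esub> x) i)) \<longlongrightarrow> 0) (NF E)"
     using y(2)[unfolded null_nets_iff[OF C.minus_closed[OF y(1) x]], rule_format, OF p] .
    moreover have "eventually (\<lambda>i. norm (p (y i) - p (x i)) \<le> p ((y \<ominus>\<^bsub>CN E\<^esub> x) i)) (NF E)"
     using eventually_net_cont by eventually_elim
      (simp add: CN_minus[OF y(1) x] seminorm_diff_le[OF sp] mem_closed[OF x] mem_closed[OF y(1)])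
    ultimately have "((\<lambda>i. p (y i) - p (x i)) \<longlongrightarrow> 0) (NF E)"
     by (rule Lim_null_comparison[rotated])
    from tendsto_add[OF this l] show "((\<lambda>i. p (y i)) \<longlongrightarrow> l) (NF E)" by simp
  qed
  fix l' assume "\<forall>y\<in>C.proj x. ((\<lambda>i. p (y i)) \<longlongrightarrow> l') (NF E)"
  then have "((\<lambda>i. p (x i)) \<longlongrightarrow> l') (NF E)" using C.S.a_rcos_self[OF x] by (rule bspec)
  then show "l' = l" using l by (rule tendsto_unique[OF net_filter_nontrivial])
qed

lemma ext_sn_tendsto:
  assumes x: "x \<in> car (CN E)" and p: "p \<in> csn E"
  shows "((\<lambda>i. p (x i)) \<longlongrightarrow> extended_seminorm E p (C.proj x)) (NF E)"
proof -
  obtain l where l: "((\<lambda>i. p (x i)) \<longlongrightarrow> l) (NF E)"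
    using net_seminorm_convergent[OF mem_cauchy[OF x] p] by (elim exE)
  show ?thesis unfolding ext_sn_eq[OF x p l] by (rule l)
qed

end

context lc_space
begin

abbreviation hat :: "('a => real) => (('a => real) => 'a) set => real" where
  "hat p \<equiv> extended_seminorm E p"

lemma completion_simps:
  "car (cpl E) = C.proj ` car (CN E)"
  "zero (cpl E) = C.proj (zero (CN E))"
  "one (cpl E) = C.proj (one (CN E))" by (simp_all add: completion_def Let_def C.carrier_quot C.zero_quot C.one_quot)

lemma completion_add:
  "x \<in> car (CN E) ==> y \<in> car (CN E) ==>
    C.proj x \<oplus>\<^sub>(cpl E) C.proj y = C.proj (x \<oplus>\<^bsub>CN E\<^esub> y)"
  by (simp add: completion_def Let_def C.add_quot)

lemma completion_smult:
  "x \<in> car (CN E) ==> c \<odot>\<^sub>(cpl E) C.proj x = C.proj (c \<odot>\<^bsub>CN E\<^esub> x)"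
  by (simp add: completion_def Let_def C.smult_quot)

lemma cvs_completion: "cvs (cpl E)" by (rule cvs_image[OF C.cvs_axioms completion_simps(1)])
    (simp_all add: completion_simps completion_add completion_smult)

lemma lin_completion_proj: "is_linear (CN E) (cpl E) C.proj"
  by (rule is_linearI) (simp_all add: completion_simps completion_add completion_smult)

lemma hat_leI:
  assumes x: "x \<in> car (CN E)" and p: "p \<in> csn E"
    and le: "eventually (\<lambda>i. p (x i) \<le> e) (NF E)"
  shows "hat p (C.proj x) \<le> e" by (rule tendsto_upperbound[OF ext_sn_tendsto[OF x p] le net_filter_nontrivial])

lemma hat_mono:
  assumes X: "X \<in> car (cpl E)" and p: "p \<in> csn E" and r: "r \<in> csn E"
    and le: "sn_le E p r"
  shows "hat p X \<le> hat r X"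
proof -
  obtain x where x: "X = C.proj x" "x \<in> car (CN E)" using X unfolding completion_simps by (elim imageE)
  have "eventually (\<lambda>i. p (x i) \<le> r (x i)) (NF E)"
    using eventually_net_cont by eventually_elim (rule sn_leD[OF le mem_closed[OF x(2)]])
  then show ?thesis unfolding x(1)
    by (rule tendsto_le[OF net_filter_nontrivial ext_sn_tendsto[OF x(2) r] ext_sn_tendsto[OF x(2) p]])
qed

lemma hat_scale:
  assumes X: "X \<in> car (cpl E)" and p: "p \<in> csn E" and C: "0 \<le> C"
  shows "hat (\<lambda>x. C * p x) X = C * hat p X"
proof -
  obtain x where x: "X = C.proj x" "x \<in> car (CN E)" using X unfolding completion_simps by (elim imageE)
  show ?thesis unfolding x(1)
    by (rule ext_sn_eq[OF x(2) csn_scale[OF p C] tendsto_mult_left[OF ext_sn_tendsto[OF x(2) p]]])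
qed

lemma is_seminorm_hat:
  assumes p: "p \<in> csn E"
  shows "is_seminorm (cpl E) (hat p)"
proof -
  interpret CC: cvs "cpl E" by (rule cvs_completion)
  note sp = csnD[OF p]
  show ?thesis
  proof (rule CC.is_seminormI)
    fix X assume "X \<in> car (cpl E)"
    then obtain x where x: "X = C.proj x" "x \<in> car (CN E)" unfolding completion_simps by (elim imageE)
    have "eventually (\<lambda>i. 0 \<le> p (x i)) (NF E)"
     using eventually_net_cont by eventually_elim (rule sn_nonneg[OF sp mem_closed[OF x(2)]])
    then show "0 \<le> hat p X"
     unfolding x(1) by (rule tendsto_lowerbound[OF ext_sn_tendsto[OF x(2) p] _ net_filter_nontrivial])
    fix c
    have "eventually (\<lambda>i. cmod c * p (x i) = p ((c \<odot>\<^bsub>CN E\<^esub> x) i)) (NF E)"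
     using eventually_net_cont by eventually_elim (simp add: CN_ops seminorm_smult[OF sp mem_closed[OF x(2)]])
    then have "((\<lambda>i. p ((c \<odot>\<^bsub>CN E\<^esub> x) i)) \<longlongrightarrow> cmod c * hat p (C.proj x)) (NF E)"
     by (rule Lim_transform_eventually[OF tendsto_mult_left[OF ext_sn_tendsto[OF x(2) p]]])
    then show "hat p (c \<odot>\<^sub>(cpl E) X) = cmod c * hat p X"
     unfolding x(1) completion_smult[OF x(2)] by (rule ext_sn_eq[OF C.smult_closed[OF x(2)] p])
    fix Y assume "Y \<in> car (cpl E)"
    then obtain y where y: "Y = C.proj y" "y \<in> car (CN E)" unfolding completion_simps by (elim imageE)
    have "eventually (\<lambda>i. p ((x \<oplus>\<^bsub>CN E\<^esub> y) i) \<le> p (x i) + p (y i)) (NF E)"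
     using eventually_net_cont
     by eventually_elim (simp add: CN_ops seminorm_add[OF sp] mem_closed[OF x(2)] mem_closed[OF y(2)])
    then show "hat p (X \<oplus>\<^sub>(cpl E) Y) \<le> hat p X + hat p Y"
     unfolding x(1) y(1) completion_add[OF x(2) y(2)] by (rule tendsto_le[OF net_filter_nontrivial
        tendsto_add[OF ext_sn_tendsto[OF x(2) p] ext_sn_tendsto[OF y(2) p]]
        ext_sn_tendsto[OF C.a_closed[OF x(2) y(2)] p]])
  qed
qed

lemma completion_topology: "lctop (cpl E) = seminorm_topology (cpl E) (hat ` csn E)"
  by (simp add: completion_def Let_def)

lemma hat_seminorms: "\<forall>p\<in>hat ` csn E. is_seminorm (cpl E) p"
  by (intro ballI) (elim imageE, simp add: is_seminorm_hat)

lemma lc_space_completion: "lc_space (cpl E)"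
  by (rule lc_space_seminorm_topology[OF cvs_completion hat_seminorms completion_topology])

lemma hat_cont: "p \<in> csn E ==> hat p \<in> csn (cpl E)"
  using generating_cont_seminorms[OF cvs_completion hat_seminorms completion_topology] by auto

lemma completion_cont_seminorm_le_hat:
  assumes "q \<in> csn (cpl E)"
  shows "\<exists>p\<in>csn E. sn_le (cpl E) q (hat p)"
proof -
  have "\<exists>p\<in>hat ` csn E. \<exists>C>0. \<forall>X\<in>car (cpl E). q X \<le> C * p X"
  proof (rule cont_seminorm_dominated[OF cvs_completion hat_seminorms completion_topology _ _ assms])
    show "hat ` csn E \<noteq> {}" using csn_zero by blast
    fix a b assume "a \<in> hat ` csn E" "b \<in> hat ` csn E"
    then obtain p r where p: "a = hat p" "p \<in> csn E" and r: "b = hat r" "r \<in> csn E" by (elim imageE)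
    note pr = csn_add[OF p(2) r(2)]
    have le: "sn_le E p (\<lambda>x. p x + r x)" "sn_le E r (\<lambda>x. p x + r x)"
     by (rule sn_leI, simp add: sn_nonneg[OF csnD[OF p(2)]] sn_nonneg[OF csnD[OF r(2)]])+
    show "\<exists>c\<in>hat ` csn E. \<forall>X\<in>car (cpl E). a X \<le> c X \<and> b X \<le> c X"
     by (rule bexI[OF _ imageI[OF pr]], unfold p(1) r(1), intro ballI conjI)
      (erule hat_mono[OF _ p(2) pr le(1)], erule hat_mono[OF _ r(2) pr le(2)])
  qed
  then obtain p C where p: "p \<in> csn E" "C > 0" "\<forall>X\<in>car (cpl E). q X \<le> C * hat p X"
    by (elim bexE exE conjE imageE) simp
  have "sn_le (cpl E) q (hat (\<lambda>x. C * p x))" using p(2,3) by (intro sn_leI) (simp add: hat_scale[OF _ p(1)])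
  then show ?thesis using csn_scale[OF p(1), of C] p(2) by (intro bexI[of _ "\<lambda>x. C * p x"]) simp_all
qed

abbreviation \<iota> :: "'a => (('a => real) => 'a) set" where "\<iota> \<equiv> to_completion E"

lemma to_completion_rs: "\<iota> a = C.proj (rs (\<lambda>i. a))" by (simp add: to_completion_def rs_def)

lemma rs_const_mem: "a \<in> car E ==> rs (\<lambda>i. a) \<in> car (CN E)" by (intro rs_mem cauchy_net_const)

lemma lin_to_completion: "is_linear E (cpl E) \<iota>"
proof (rule is_linearI)
  fix x y c assume x: "x \<in> car E"
  show "\<iota> x \<in> car (cpl E)" using rs_const_mem[OF x] by (simp add: to_completion_rs completion_simps)
  show "\<iota> (c \<odot> x) = c \<odot>\<^sub>(cpl E) \<iota> x"
    unfolding to_completion_rs completion_smult[OF rs_const_mem[OF x]] CN_ops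
    by (rule arg_cong[of _ _ C.proj]) (rule rs_cong, simp)
  assume y: "y \<in> car E"
  show "\<iota> (x \<oplus> y) = \<iota> x \<oplus>\<^sub>(cpl E) \<iota> y"
    unfolding to_completion_rs completion_add[OF rs_const_mem[OF x] rs_const_mem[OF y]] CN_ops
    by (rule arg_cong[of _ _ C.proj]) (rule rs_cong, simp)
qed

lemma hat_to_completion:
  assumes a: "a \<in> car E" and p: "p \<in> csn E"
  shows "hat p (\<iota> a) = p a"
proof -
  have "eventually (\<lambda>i. p a = p (rs (\<lambda>i. a) i)) (NF E)"
    using eventually_net_cont by eventually_elim simp
  then show ?thesis unfolding to_completion_rs
    by (intro ext_sn_eq[OF rs_const_mem[OF a] p] Lim_transform_eventually[OF tendsto_const])
qed

text \<open>
  A Cauchy net converges to its own class in the completion.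
\<close>

lemma to_completion_approx_net:
  assumes x: "x \<in> car (CN E)" and p: "p \<in> csn E" and e: "0 < e"
  shows "\<exists>s\<in>csn E. \<forall>i\<in>tail s. hat p (C.proj x \<ominus>\<^sub>(cpl E) \<iota> (x i)) \<le> e"
proof -
  obtain s where s: "s \<in> csn E" "\<forall>i\<in>tail s. \<forall>j\<in>tail s. p (x i \<ominus> x j) < e"
    using cauchy_netD[OF mem_cauchy[OF x] p e] by (elim bexE)
  have "hat p (C.proj x \<ominus>\<^sub>(cpl E) \<iota> (x i)) \<le> e" if i: "i \<in> tail s" for i
  proof -
    have xi: "x i \<in> car E" using mem_closed[OF x tail_cont[OF i]] .
    have "eventually (\<lambda>j. p ((x \<ominus>\<^bsub>CN E\<^esub> rs (\<lambda>_. x i)) j) \<le> e) (NF E)"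
     unfolding eventually_net
    proof (rule bexI[OF _ s(1)], intro ballI)
     fix j assume j: "j \<in> tail s"
     show "p ((x \<ominus>\<^bsub>CN E\<^esub> rs (\<lambda>_. x i)) j) \<le> e"
      using s(2)[rule_format, OF j i] CN_minus[OF x rs_const_mem[OF xi] tail_cont[OF j]] tail_cont[OF j] by simp
    qed
    then have "hat p (C.proj (x \<ominus>\<^bsub>CN E\<^esub> rs (\<lambda>_. x i))) \<le> e"
     by (rule hat_leI[OF C.minus_closed[OF x rs_const_mem[OF xi]] p])
    then show ?thesis unfolding to_completion_rs
      lin_minus[OF C.cvs_axioms cvs_completion lin_completion_proj x rs_const_mem[OF xi]] .
  qed
  then show ?thesis using s(1) by (intro bexI[OF _ s(1)] ballI)
qed

lemma to_completion_dense:
  assumes X: "X \<in> car (cpl E)" and p: "p \<in> csn E" and e: "0 < e"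
  shows "\<exists>a\<in>car E. hat p (X \<ominus>\<^sub>(cpl E) \<iota> a) < e"
proof -
  obtain x where x: "X = C.proj x" "x \<in> car (CN E)" using X unfolding completion_simps by (elim imageE)
  obtain s where s: "s \<in> csn E" "\<forall>i\<in>tail s. hat p (C.proj x \<ominus>\<^sub>(cpl E) \<iota> (x i)) \<le> e / 2"
    using to_completion_approx_net[OF x(2) p half_gt_zero[OF e]] by (elim bexE)
  have "hat p (X \<ominus>\<^sub>(cpl E) \<iota> (x s)) \<le> e / 2" using s(2)[rule_format, OF tail_self[OF s(1)]] x(1) by simp
  then show ?thesis using mem_closed[OF x(2) s(1)] e by (intro bexI[of _ "x s"]) simp_all
qed

lemma completion_separated:
  assumes X: "X \<in> car (cpl E)" and 0: "\<And>p. p \<in> csn E ==> hat p X = 0"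
  shows "X = \<zero>\<^sub>(cpl E)"
proof -
  obtain x where x: "X = C.proj x" "x \<in> car (CN E)" using X unfolding completion_simps by (elim imageE)
  have "x \<in> null_nets E"
  proof (subst null_nets_iff[OF x(2)], intro ballI)
    fix p assume p: "p \<in> csn E"
    show "((\<lambda>i. p (x i)) \<longlongrightarrow> 0) (NF E)"
     using ext_sn_tendsto[OF x(2) p] 0[OF p] unfolding x(1) by simp
  qed
  then have "C.proj x = C.proj \<zero>\<^bsub>CN E\<^esub>" using x(2) by (subst C.proj_eq_iff) simp_all
  then show ?thesis by (simp add: x(1) completion_simps)
qed

text \<open>
  A Cauchy filter converges to the class of a net in \<open>E\<close> that, at the index \<open>i\<close>, picks an element that is close to the
  filter with respect to \<open>i\<close>. Such a net is Cauchy because its indices are the seminorms themselves.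
\<close>

lemma completion_complete: "is_complete_lcs (cpl E)"
proof -
  interpret CC: lc_space "cpl E" by (rule lc_space_completion)
  have "\<exists>X. limitin (lctop (cpl E)) (\<lambda>y. y) X F" if F: "cauchy_filter (cpl E) F" for F
  proof -
    note F' = F[unfolded CC.cauchy_filter_iff]
    have nt: "F \<noteq> bot" and car: "eventually (\<lambda>Y. Y \<in> car (cpl E)) F"
     and cau: "\<forall>p\<in>csn (cpl E). \<forall>e>0. \<exists>Q. eventually Q F \<and>
      (\<forall>x\<in>car (cpl E). \<forall>y\<in>car (cpl E). Q x --> Q y --> p (x \<ominus>\<^sub>(cpl E) y) < e)"
     by (rule conjunct1[OF F'], rule conjunct1[OF conjunct2[OF F']], rule conjunct2[OF conjunct2[OF F']])
    have "\<exists>a. a \<in> car E \<and> eventually (\<lambda>Y. hat i (Y \<ominus>\<^sub>(cpl E) \<iota> a) < 1) F"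
     if i: "i \<in> csn E" for i
    proof -
     note si = is_seminorm_hat[OF i]
     have half: "0 < (1 / 2 :: real)" by simp
     obtain Q where Q: "eventually Q F" "\<forall>x\<in>car (cpl E). \<forall>y\<in>car (cpl E). Q x --> Q y -->
      hat i (x \<ominus>\<^sub>(cpl E) y) < 1 / 2" using cau[rule_format, OF hat_cont[OF i] half] by (elim exE conjE)
     have QC: "eventually (\<lambda>Y. Q Y \<and> Y \<in> car (cpl E)) F" using Q(1) car by (rule eventually_conj)
     obtain Y0 where Y0: "Q Y0" "Y0 \<in> car (cpl E)"
      using eventually_happens[OF QC] nt by (elim disjE exE conjE) simp_all
     obtain a where a: "a \<in> car E" "hat i (Y0 \<ominus>\<^sub>(cpl E) \<iota> a) < 1 / 2"
      using to_completion_dense[OF Y0(2) i half] by (elim bexE)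
     have ia: "\<iota> a \<in> car (cpl E)" by (rule lin_closed[OF lin_to_completion a(1)])
     have "eventually (\<lambda>Y. hat i (Y \<ominus>\<^sub>(cpl E) \<iota> a) < 1) F" using QC
     proof eventually_elim
      fix Y assume Y: "Q Y \<and> Y \<in> car (cpl E)"
      have "hat i (Y \<ominus>\<^sub>(cpl E) \<iota> a) \<le> hat i (Y \<ominus>\<^sub>(cpl E) Y0) + hat i (Y0 \<ominus>\<^sub>(cpl E) \<iota> a)"
       using Y Y0 ia by (intro CC.seminorm_triangle[OF si]) auto
      also have "hat i (Y \<ominus>\<^sub>(cpl E) Y0) < 1 / 2" using Y Y0 by (intro Q(2)[rule_format]) auto
      finally show "hat i (Y \<ominus>\<^sub>(cpl E) \<iota> a) < 1" using a(2) by simp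
     qed
     then show ?thesis using a(1) by (intro exI[of _ a] conjI)
    qed
    then have "\<forall>i\<in>csn E. \<exists>a. a \<in> car E \<and> eventually (\<lambda>Y. hat i (Y \<ominus>\<^sub>(cpl E) \<iota> a) < 1) F"
     by (intro ballI)
    from bchoice[OF this] obtain x where
     x0: "\<forall>i\<in>csn E. x i \<in> car E \<and> eventually (\<lambda>Y. hat i (Y \<ominus>\<^sub>(cpl E) \<iota> (x i)) < 1) F"
     by (elim exE)
    have x: "x i \<in> car E" and xF: "eventually (\<lambda>Y. hat i (Y \<ominus>\<^sub>(cpl E) \<iota> (x i)) < 1) F"
     if "i \<in> csn E" for i using x0 that by simp_all
    \<comment> \<open>An index beyond a multiple of \<open>p\<close> controls \<open>p\<close> with the inverse factor.\<close>
    have xFp: "eventually (\<lambda>Y. hat p (Y \<ominus>\<^sub>(cpl E) \<iota> (x i)) < e) F"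
     if p: "p \<in> csn E" and e: "0 < e" and i: "i \<in> tail (\<lambda>x. (1 / e) * p x)" for p e i
    proof -
     have pe: "(\<lambda>x. (1 / e) * p x) \<in> csn E" using e by (intro csn_scale[OF p]) simp
     have ia: "\<iota> (x i) \<in> car (cpl E)" by (rule lin_closed[OF lin_to_completion x[OF tail_cont[OF i]]])
     show ?thesis using xF[OF tail_cont[OF i]] car
     proof eventually_elim
      fix Y assume Y: "hat i (Y \<ominus>\<^sub>(cpl E) \<iota> (x i)) < 1" "Y \<in> car (cpl E)"
      have d: "Y \<ominus>\<^sub>(cpl E) \<iota> (x i) \<in> car (cpl E)" by (rule CC.minus_closed[OF Y(2) ia])
      have "(1 / e) * hat p (Y \<ominus>\<^sub>(cpl E) \<iota> (x i)) = hat (\<lambda>x. (1 / e) * p x) (Y \<ominus>\<^sub>(cpl E) \<iota> (x i))"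
       by (rule hat_scale[OF d p, symmetric]) (use e in simp)
      also have "\<dots> \<le> hat i (Y \<ominus>\<^sub>(cpl E) \<iota> (x i))"
       using i by (intro hat_mono[OF d pe tail_cont[OF i]]) (simp add: tail_def)
      finally have "(1 / e) * hat p (Y \<ominus>\<^sub>(cpl E) \<iota> (x i)) < 1" using Y(1) by (rule le_less_trans)
      then show "hat p (Y \<ominus>\<^sub>(cpl E) \<iota> (x i)) < e" using e by (simp add: field_simps)
     qed
    qed
    have cx: "cauchy_net x" unfolding cauchy_net_def
    proof (intro conjI ballI allI impI)
     fix p and e :: real assume p: "p \<in> csn E" and "0 < e"
     then have e: "0 < e / 2" by simp
     have pe: "(\<lambda>x. (1 / (e / 2)) * p x) \<in> csn E" using e by (intro csn_scale[OF p]) simp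
     show "\<exists>s\<in>csn E. \<forall>i\<in>tail s. \<forall>j\<in>tail s. p (x i \<ominus> x j) < e"
     proof (rule bexI[OF _ pe], intro ballI)
      fix i j assume i: "i \<in> tail (\<lambda>x. (1 / (e / 2)) * p x)" and j: "j \<in> tail (\<lambda>x. (1 / (e / 2)) * p x)"
      note xi = x[OF tail_cont[OF i]] and xj = x[OF tail_cont[OF j]]
      have ii: "\<iota> (x i) \<in> car (cpl E)" "\<iota> (x j) \<in> car (cpl E)"
       by (rule lin_closed[OF lin_to_completion], fact)+
      obtain Y where Y: "hat p (Y \<ominus>\<^sub>(cpl E) \<iota> (x i)) < e / 2" "hat p (Y \<ominus>\<^sub>(cpl E) \<iota> (x j)) < e / 2"
       "Y \<in> car (cpl E)"
       using eventually_happens[OF eventually_conj[OF xFp[OF p e i] eventually_conj[OF xFp[OF p e j] car]]] nt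
       by (elim disjE exE conjE) simp_all
      have "p (x i \<ominus> x j) = hat p (\<iota> (x i) \<ominus>\<^sub>(cpl E) \<iota> (x j))"
       using hat_to_completion[OF minus_closed[OF xi xj] p]
        lin_minus[OF cvs_axioms cvs_completion lin_to_completion xi xj] by simp
      also have "\<dots> \<le> hat p (\<iota> (x i) \<ominus>\<^sub>(cpl E) Y) + hat p (Y \<ominus>\<^sub>(cpl E) \<iota> (x j))"
       by (rule CC.seminorm_triangle[OF is_seminorm_hat[OF p] ii(1) Y(3) ii(2)])
      also have "hat p (\<iota> (x i) \<ominus>\<^sub>(cpl E) Y) = hat p (Y \<ominus>\<^sub>(cpl E) \<iota> (x i))"
       by (rule CC.seminorm_minus_commute[OF is_seminorm_hat[OF p] ii(1) Y(3)])
      finally show "p (x i \<ominus> x j) < e" using Y(1,2) by simp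
     qed
    qed (rule x)
    define X where "X = C.proj (rs x)"
    have X: "X \<in> car (cpl E)" unfolding X_def completion_simps by (intro imageI rs_mem cx)
    have "limitin (lctop (cpl E)) (\<lambda>y. y) X F" unfolding CC.limitin_iff
    proof (intro conjI X car ballI allI impI)
     fix q and e :: real assume q: "q \<in> csn (cpl E)" and "0 < e"
     then have e: "0 < e / 2" by simp
     obtain p where p: "p \<in> csn E" "sn_le (cpl E) q (hat p)"
      using completion_cont_seminorm_le_hat[OF q] by (elim bexE)
     obtain s where s: "s \<in> csn E" "\<forall>i\<in>tail s. hat p (C.proj (rs x) \<ominus>\<^sub>(cpl E) \<iota> (rs x i)) \<le> e / 2"
      using to_completion_approx_net[OF rs_mem[OF cx] p(1) e] by (elim bexE)
     have pe: "(\<lambda>x. (1 / (e / 2)) * p x) \<in> csn E" using e by (intro csn_scale[OF p(1)]) simp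
     define i where "i = (\<lambda>x. s x + (1 / (e / 2)) * p x)"
     have "i \<in> tail i" unfolding i_def by (rule tail_self[OF csn_add[OF s(1) pe]])
     then have i: "i \<in> tail s" "i \<in> tail (\<lambda>x. (1 / (e / 2)) * p x)"
      using tail_add[OF s(1) pe] unfolding i_def by auto
     have ia: "\<iota> (x i) \<in> car (cpl E)" by (rule lin_closed[OF lin_to_completion x[OF tail_cont[OF i(1)]]])
     have Xi: "hat p (X \<ominus>\<^sub>(cpl E) \<iota> (x i)) \<le> e / 2"
      using s(2)[rule_format, OF i(1)] tail_cont[OF i(1)] by (simp add: X_def)
     show "eventually (\<lambda>Y. q (Y \<ominus>\<^sub>(cpl E) X) < e) F" using xFp[OF p(1) e i(2)] car
     proof eventually_elim
      fix Y assume Y: "hat p (Y \<ominus>\<^sub>(cpl E) \<iota> (x i)) < e / 2" "Y \<in> car (cpl E)"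
      have "q (Y \<ominus>\<^sub>(cpl E) X) \<le> hat p (Y \<ominus>\<^sub>(cpl E) X)"
       by (rule sn_leD[OF p(2) CC.minus_closed[OF Y(2) X]])
      also have "\<dots> \<le> hat p (Y \<ominus>\<^sub>(cpl E) \<iota> (x i)) + hat p (\<iota> (x i) \<ominus>\<^sub>(cpl E) X)"
       by (rule CC.seminorm_triangle[OF is_seminorm_hat[OF p(1)] Y(2) ia X])
      also have "hat p (\<iota> (x i) \<ominus>\<^sub>(cpl E) X) = hat p (X \<ominus>\<^sub>(cpl E) \<iota> (x i))"
       by (rule CC.seminorm_minus_commute[OF is_seminorm_hat[OF p(1)] ia X])
      finally show "q (Y \<ominus>\<^sub>(cpl E) X) < e" using Y(1) Xi by simp
     qed
    qed
    then show ?thesis by (rule exI)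
  qed
  moreover have "Hausdorff_space (lctop (cpl E))" unfolding CC.Hausdorff_iff
  proof (intro ballI impI)
    fix X assume X: "X \<in> car (cpl E)" and 0: "\<forall>p\<in>csn (cpl E). p X = 0"
    show "X = \<zero>\<^sub>(cpl E)" by (rule completion_separated[OF X]) (rule 0[rule_format, OF hat_cont])
  qed
  ultimately show ?thesis unfolding is_complete_lcs_def is_lcs_iff using lc_space_completion by (intro conjI allI impI)
qed

end

section \<open>Completion of an algebra\<close>

context am_algebra
begin

text \<open>
  The difference of two products is split as \<open>(x - x')y + x'(y - y')\<close>; Cauchy nets are eventually bounded in each
  submultiplicative seminorm.
\<close>

lemma cauchy_net_mult:
  assumes x: "cauchy_net x" and y: "cauchy_net y"
  shows "cauchy_net (\<lambda>i. x i \<otimes> y i)" unfolding cauchy_net_def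
proof (intro conjI ballI allI impI)
  fix p and e :: real assume p: "p \<in> csn A" and e: "0 < e"
  obtain r where r: "submult A r" "sn_le A p r" using submult_above[OF p] by (elim exE conjE)
  note rc = submultD(1)[OF r(1)] and rm = submultD(2)[OF r(1)]
  note sr = csnD[OF rc]
  have one: "0 < (1::real)" by simp
  obtain s where s: "s \<in> csn A" "\<forall>i\<in>tail s. \<forall>j\<in>tail s. r (x i \<ominus> x j) < 1"
    using cauchy_netD[OF x rc one] by (elim bexE)
  obtain t where t: "t \<in> csn A" "\<forall>i\<in>tail t. \<forall>j\<in>tail t. r (y i \<ominus> y j) < 1"
    using cauchy_netD[OF y rc one] by (elim bexE)
  define B where "B = r (x s) + r (y t) + 1"
  have B: "0 < B" unfolding B_def using sn_nonneg[OF sr] cauchy_net_closed[OF x s(1)] cauchy_net_closed[OF y t(1)]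
    by (intro add_nonneg_pos add_nonneg_nonneg) auto
  have bx: "r (x i) \<le> B" if i: "i \<in> tail s" for i
  proof -
    have c: "x i \<in> car A" "x s \<in> car A" using cauchy_net_closed[OF x] tail_cont[OF i] s(1) by auto
    have "\<bar>r (x i) - r (x s)\<bar> \<le> r (x i \<ominus> x s)" by (rule seminorm_diff_le[OF sr c])
    also have "\<dots> < 1" using s(2)[rule_format, OF i tail_self[OF s(1)]] .
    finally show ?thesis using sn_nonneg[OF sr cauchy_net_closed[OF y t(1)]] by (simp add: B_def)
  qed
  have b_y: "r (y i) \<le> B" if i: "i \<in> tail t" for i
  proof -
    have c: "y i \<in> car A" "y t \<in> car A" using cauchy_net_closed[OF y] tail_cont[OF i] t(1) by auto
    have "\<bar>r (y i) - r (y t)\<bar> \<le> r (y i \<ominus> y t)" by (rule seminorm_diff_le[OF sr c])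
    also have "\<dots> < 1" using t(2)[rule_format, OF i tail_self[OF t(1)]] .
    finally show ?thesis using sn_nonneg[OF sr cauchy_net_closed[OF x s(1)]] by (simp add: B_def)
  qed
  define e' where "e' = e / (2 * B)"
  have e': "0 < e'" "B * e' = e / 2" using e B by (simp_all add: e'_def)
  obtain s' where s': "s' \<in> csn A" "\<forall>i\<in>tail s'. \<forall>j\<in>tail s'. r (x i \<ominus> x j) < e'"
    using cauchy_netD[OF x rc e'(1)] by (elim bexE)
  obtain t' where t': "t' \<in> csn A" "\<forall>i\<in>tail t'. \<forall>j\<in>tail t'. r (y i \<ominus> y j) < e'"
    using cauchy_netD[OF y rc e'(1)] by (elim bexE)
  define u where "u = (\<lambda>z. s z + t z)"
  define u' where "u' = (\<lambda>z. s' z + t' z)"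
  have uc: "u \<in> csn A" "u' \<in> csn A" unfolding u_def u'_def using s(1) t(1) s'(1) t'(1) by (auto intro: csn_add)
  show "\<exists>s\<in>csn A. \<forall>i\<in>tail s. \<forall>j\<in>tail s. p (x i \<otimes> y i \<ominus> x j \<otimes> y j) < e"
  proof (rule bexI[OF _ csn_add[OF uc]], intro ballI)
    fix i j assume ij: "i \<in> tail (\<lambda>z. u z + u' z)" "j \<in> tail (\<lambda>z. u z + u' z)"
    then have i: "i \<in> tail s" "i \<in> tail t" "i \<in> tail s'" "i \<in> tail t'"
     and j: "j \<in> tail s" "j \<in> tail t" "j \<in> tail s'" "j \<in> tail t'"
     using tail_add[OF uc] tail_add[OF s(1) t(1)] tail_add[OF s'(1) t'(1)] unfolding u_def u'_def by blast+
    have c: "x i \<in> car A" "x j \<in> car A" "y i \<in> car A" "y j \<in> car A"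
     using cauchy_net_closed[OF x] cauchy_net_closed[OF y] tail_cont[OF i(1)] tail_cont[OF j(1)] by auto
    have "x i \<otimes> y i \<ominus> x j \<otimes> y j = (x i \<otimes> y i \<ominus> x i \<otimes> y j) \<oplus> (x i \<otimes> y j \<ominus> x j \<otimes> y j)"
     using c by (simp add: minus_chain)
    also have "\<dots> = x i \<otimes> (y i \<ominus> y j) \<oplus> (x i \<ominus> x j) \<otimes> y j"
     using c by (simp add: a_minus_def r_distr l_distr r_minus l_minus)
    finally have eq: "x i \<otimes> y i \<ominus> x j \<otimes> y j = x i \<otimes> (y i \<ominus> y j) \<oplus> (x i \<ominus> x j) \<otimes> y j" .
    have "p (x i \<otimes> y i \<ominus> x j \<otimes> y j) \<le> r (x i \<otimes> y i \<ominus> x j \<otimes> y j)"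
     using c by (intro sn_leD[OF r(2)]) simp
    also have "\<dots> \<le> r (x i \<otimes> (y i \<ominus> y j)) + r ((x i \<ominus> x j) \<otimes> y j)"
     unfolding eq using c by (intro seminorm_add[OF sr]) auto
    also have "\<dots> \<le> r (x i) * r (y i \<ominus> y j) + r (x i \<ominus> x j) * r (y j)"
     using c by (intro add_mono rm) auto
    also have "\<dots> \<le> B * r (y i \<ominus> y j) + r (x i \<ominus> x j) * B"
     using c bx[OF i(1)] b_y[OF j(2)] sn_nonneg[OF sr] by (intro add_mono mult_right_mono mult_left_mono) auto
    also have "\<dots> < B * e' + e' * B" using B s'(2)[rule_format, OF i(3) j(3)] t'(2)[rule_format, OF i(4) j(4)]
     by (intro add_strict_mono mult_strict_left_mono mult_strict_right_mono) auto
    also have "\<dots> = e" using e'(2) by (simp add: mult.commute)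
    finally show "p (x i \<otimes> y i \<ominus> x j \<otimes> y j) < e" .
  qed
qed (use x y cauchy_net_closed in auto)

lemma ring_cauchy_nets: "Ring.ring (CN A)"
proof (rule ringI)
  let ?N = "CN A"
  show "abelian_group ?N" by (rule C.abelian_group_axioms)
  have mc: "x \<otimes>\<^sub>?N y \<in> car ?N" if "x \<in> car ?N" "y \<in> car ?N" for x y
    unfolding CN_ops by (intro rs_mem cauchy_net_mult mem_cauchy that)
  show "Group.monoid ?N"
  proof (rule monoidI)
    show "\<one>\<^sub>?N \<in> car ?N" unfolding CN_ops by (intro rs_mem cauchy_net_const one_closed)
    fix x assume x: "x \<in> car ?N"
    show "\<one>\<^sub>?N \<otimes>\<^sub>?N x = x" "x \<otimes>\<^sub>?N \<one>\<^sub>?N = x"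
     unfolding CN_ops using mem_closed[OF x] by (subst (2) mem_rs[OF x, symmetric], intro rs_cong, simp)+
    fix y assume y: "y \<in> car ?N"
    show "x \<otimes>\<^sub>?N y \<in> car ?N" by (rule mc[OF x y])
    fix z assume z: "z \<in> car ?N"
    show "x \<otimes>\<^sub>?N y \<otimes>\<^sub>?N z = x \<otimes>\<^sub>?N (y \<otimes>\<^sub>?N z)"
     unfolding CN_ops using mem_closed[OF x] mem_closed[OF y] mem_closed[OF z] by (intro rs_cong) (simp add: m_assoc)
  qed
  fix x y z assume x: "x \<in> car ?N" and y: "y \<in> car ?N" and z: "z \<in> car ?N"
  show "(x \<oplus>\<^sub>?N y) \<otimes>\<^sub>?N z = x \<otimes>\<^sub>?N z \<oplus>\<^sub>?N y \<otimes>\<^sub>?N z"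
    "z \<otimes>\<^sub>?N (x \<oplus>\<^sub>?N y) = z \<otimes>\<^sub>?N x \<oplus>\<^sub>?N z \<otimes>\<^sub>?N y"
    unfolding CN_ops using mem_closed[OF x] mem_closed[OF y] mem_closed[OF z]
    by (intro rs_cong, simp add: l_distr r_distr)+
qed

lemma null_nets_subset: "null_nets A \<subseteq> car (CN A)" unfolding null_nets_def by (rule Collect_restrict)

lemma subgroup_null_nets: "subgroup (null_nets A) (add_monoid (CN A))"
  by (rule submodule.axioms(1)[OF submodule_null_nets])

text \<open>
  A null net times an eventually bounded net is a null net.
\<close>

lemma ideal_null_nets: "ideal (null_nets A) (CN A)"
proof (rule idealI[OF ring_cauchy_nets subgroup_null_nets])
  interpret N: ring "CN A" by (rule ring_cauchy_nets)
  fix a x assume a: "a \<in> null_nets A" and x: "x \<in> car (CN A)"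
  have ac: "a \<in> car (CN A)" by (rule subsetD[OF null_nets_subset a])
  have *: "((\<lambda>i. p ((x \<otimes>\<^bsub>CN A\<^esub> a) i)) \<longlongrightarrow> 0) (NF A) \<and>
     ((\<lambda>i. p ((a \<otimes>\<^bsub>CN A\<^esub> x) i)) \<longlongrightarrow> 0) (NF A)" if p: "p \<in> csn A" for p
  proof -
    obtain r where r: "submult A r" "sn_le A p r" using submult_above[OF p] by (elim exE conjE)
    note rc = submultD(1)[OF r(1)] and rm = submultD(2)[OF r(1)]
    have lim: "((\<lambda>i. r (x i) * r (a i)) \<longlongrightarrow> 0) (NF A)"
     using tendsto_mult[OF ext_sn_tendsto[OF x rc] a[unfolded null_nets_iff[OF ac], rule_format, OF rc]] by simp
    have 1: "eventually (\<lambda>i. norm (p ((x \<otimes>\<^bsub>CN A\<^esub> a) i)) \<le> r (x i) * r (a i)) (NF A)"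
     using eventually_net_cont
    proof eventually_elim
     fix i assume i: "i \<in> csn A"
     note c = mem_closed[OF x i] mem_closed[OF ac i]
     have "p (x i \<otimes> a i) \<le> r (x i) * r (a i)" using sn_leD[OF r(2) m_closed[OF c]] rm[OF c] by simp
     then show "norm (p ((x \<otimes>\<^bsub>CN A\<^esub> a) i)) \<le> r (x i) * r (a i)"
      using i sn_nonneg[OF csnD[OF p] m_closed[OF c]] by (simp add: CN_ops)
    qed
    have 2: "eventually (\<lambda>i. norm (p ((a \<otimes>\<^bsub>CN A\<^esub> x) i)) \<le> r (x i) * r (a i)) (NF A)"
     using eventually_net_cont
    proof eventually_elim
     fix i assume i: "i \<in> csn A"
     note c = mem_closed[OF ac i] mem_closed[OF x i]
     have "p (a i \<otimes> x i) \<le> r (x i) * r (a i)"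
      using sn_leD[OF r(2) m_closed[OF c]] rm[OF c] by (simp add: mult.commute)
     then show "norm (p ((a \<otimes>\<^bsub>CN A\<^esub> x) i)) \<le> r (x i) * r (a i)"
      using i sn_nonneg[OF csnD[OF p] m_closed[OF c]] by (simp add: CN_ops)
    qed
    show ?thesis using Lim_null_comparison[OF 1 lim] Lim_null_comparison[OF 2 lim] by simp
  qed
  show "x \<otimes>\<^bsub>CN A\<^esub> a \<in> null_nets A"
    by (subst null_nets_iff[OF N.m_closed[OF x ac]], intro ballI) (rule conjunct1[OF *])
  show "a \<otimes>\<^bsub>CN A\<^esub> x \<in> null_nets A"
    by (subst null_nets_iff[OF N.m_closed[OF ac x]], intro ballI) (rule conjunct2[OF *])
qed

lemma completion_mult:
  "x \<in> car (CN A) ==> y \<in> car (CN A) ==>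
    C.proj x \<otimes>\<^sub>(cpl A) C.proj y = C.proj (x \<otimes>\<^bsub>CN A\<^esub> y)"
  by (simp add: completion_def Let_def C.mult_quot[OF ideal_null_nets])

lemma to_completion_mult:
  assumes "x \<in> car A" "y \<in> car A"
  shows "\<iota> (x \<otimes> y) = \<iota> x \<otimes>\<^sub>(cpl A) \<iota> y"
  unfolding to_completion_rs completion_mult[OF rs_const_mem[OF assms(1)] rs_const_mem[OF assms(2)]] CN_ops
  by (rule arg_cong[of _ _ C.proj]) (rule rs_cong, simp)

lemma to_completion_one: "\<iota> \<one> = \<one>\<^sub>(cpl A)" by (simp add: to_completion_rs completion_simps CN_ops)

text \<open>
  The submultiplicative bound holds along the nets and survives the passage to the limit.
\<close>

lemma submult_hat:
  assumes s: "submult A s"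
  shows "submult (cpl A) (hat s)" unfolding submult_def
proof (intro conjI ballI)
  interpret N: ring "CN A" by (rule ring_cauchy_nets)
  note sc = submultD(1)[OF s]
  show "hat s \<in> csn (cpl A)" by (rule hat_cont[OF sc])
  fix X Y assume X: "X \<in> car (cpl A)" and Y: "Y \<in> car (cpl A)"
  obtain x where x: "X = C.proj x" "x \<in> car (CN A)" using X unfolding completion_simps by (elim imageE)
  obtain y where y: "Y = C.proj y" "y \<in> car (CN A)" using Y unfolding completion_simps by (elim imageE)
  have "eventually (\<lambda>i. s ((x \<otimes>\<^bsub>CN A\<^esub> y) i) \<le> s (x i) * s (y i)) (NF A)"
    using eventually_net_cont
    by eventually_elim (simp add: CN_ops submultD(2)[OF s mem_closed[OF x(2)] mem_closed[OF y(2)]])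
  then show "hat s (X \<otimes>\<^sub>(cpl A) Y) \<le> hat s X * hat s Y"
    unfolding x(1) y(1) completion_mult[OF x(2) y(2)] by (rule tendsto_le[OF net_filter_nontrivial
       tendsto_mult[OF ext_sn_tendsto[OF x(2) sc] ext_sn_tendsto[OF y(2) sc]]
       ext_sn_tendsto[OF N.m_closed[OF x(2) y(2)] sc]])
qed

lemma am_algebra_completion: "am_algebra (cpl A)"
proof -
  interpret CC: lc_space "cpl A" by (rule lc_space_completion)
  interpret N: ring "CN A" by (rule ring_cauchy_nets)
  have R: "Ring.ring (cpl A)" by (rule ring_image[OF ring_cauchy_nets completion_simps(1)])
     (simp_all add: completion_simps completion_add completion_mult)
  have sm: "(c \<odot>\<^sub>(cpl A) X) \<otimes>\<^sub>(cpl A) Y = c \<odot>\<^sub>(cpl A) (X \<otimes>\<^sub>(cpl A) Y) \<and>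
    X \<otimes>\<^sub>(cpl A) (c \<odot>\<^sub>(cpl A) Y) = c \<odot>\<^sub>(cpl A) (X \<otimes>\<^sub>(cpl A) Y)"
    if X: "X \<in> car (cpl A)" and Y: "Y \<in> car (cpl A)" for c X Y
  proof -
    obtain x where x: "X = C.proj x" "x \<in> car (CN A)" using X unfolding completion_simps by (elim imageE)
    obtain y where y: "Y = C.proj y" "y \<in> car (CN A)" using Y unfolding completion_simps by (elim imageE)
    have "(c \<odot>\<^bsub>CN A\<^esub> x) \<otimes>\<^bsub>CN A\<^esub> y = c \<odot>\<^bsub>CN A\<^esub> (x \<otimes>\<^bsub>CN A\<^esub> y)"
     "x \<otimes>\<^bsub>CN A\<^esub> (c \<odot>\<^bsub>CN A\<^esub> y) = c \<odot>\<^bsub>CN A\<^esub> (x \<otimes>\<^bsub>CN A\<^esub> y)"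
     unfolding CN_ops using mem_closed[OF x(2)] mem_closed[OF y(2)]
     by (intro rs_cong, simp add: smult_mult_left smult_mult_right)+
    then show ?thesis unfolding x(1) y(1) using x(2) y(2) by (simp add: completion_smult completion_mult)
  qed
  have dom: "\<exists>s. submult (cpl A) s \<and> sn_le (cpl A) q s"
    if q: "q \<in> csn (cpl A)" for q
  proof -
    obtain p where p: "p \<in> csn A" "sn_le (cpl A) q (hat p)"
     using completion_cont_seminorm_le_hat[OF q] by (elim bexE)
    obtain s where s: "submult A s" "sn_le A p s" using submult_above[OF p(1)] by (elim exE conjE)
    have "sn_le (cpl A) (hat p) (hat s)" by (rule sn_leI) (rule hat_mono[OF _ p(1) submultD(1)[OF s(1)] s(2)])
    then show ?thesis using submult_hat[OF s(1)] sn_le_trans[OF p(2)] by (intro exI[of _ "hat s"] conjI)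
  qed
  show ?thesis by (intro am_algebra.intro CC.lc_space_axioms R am_algebra_axioms.intro dom) (simp_all add: sm)
qed

end

section \<open>The algebraic tensor product\<close>

definition weight ::
    "('a => real) => ('b => real) => (('a \<times> 'b) \<Rightarrow>\<^sub>0 complex) => real" where
  "weight p r w = (\<Sum>s\<in>keys w. cmod (lookup w s) * p (fst s) * r (snd s))"

lemma proj_seminorm_quot: "proj_seminorm p r = qsn (weight p r)"
  by (simp add: fun_eq_iff proj_seminorm_def qsn_def weight_def)

lemma fsum_simps:
  "car (FSum E F) = {w. keys w \<subseteq> car E \<times> car F}"
  "add (FSum E F) = (+)" "zero (FSum E F) = 0" "smult (FSum E F) = scale"
  "one (FSum E F) = single (\<one>\<^sub>E, \<one>\<^sub>F) 1" by (simp_all add: formal_sums_def scale_def fun_eq_iff)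

lemma mem_formal_sums: "w \<in> car (FSum E F) \<longleftrightarrow> keys w \<subseteq> car E \<times> car F"
  by (simp add: fsum_simps)

lemma single_mem_formal_sums:
  "x \<in> car E ==> y \<in> car F ==> single (x, y) c \<in> car (FSum E F)"
  unfolding mem_formal_sums by (rule keys_single_subset) simp

lemma cvs_formal_sums: "cvs (FSum E F)"
proof -
  have "abelian_group (FSum E F)"
  proof (rule abelian_groupI)
    fix x assume "x \<in> car (FSum E F)"
    then show "\<exists>y\<in>car (FSum E F). y \<oplus>\<^bsub>FSum E F\<^esub> x = \<zero>\<^bsub>FSum E F\<^esub>"
     by (intro bexI[of _ "scale (-1) x"])
      (simp_all add: fsum_simps keys_scale_subset, simp add: scale_minus_one)
  qed (simp_all add: fsum_simps keys_add_subset add_ac)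
  then have "Module.module CC (FSum E F)"
  proof (intro moduleI cring_complex)
    fix c d :: complex and x y :: "('a \<times> 'b) \<Rightarrow>\<^sub>0 complex"
    assume "x \<in> car (FSum E F)"
    then show "c \<odot>\<^bsub>FSum E F\<^esub> x \<in> car (FSum E F)" by (simp add: fsum_simps keys_scale_subset)
    show "(c \<oplus>\<^bsub>CC\<^esub> d) \<odot>\<^bsub>FSum E F\<^esub> x =
      c \<odot>\<^bsub>FSum E F\<^esub> x \<oplus>\<^bsub>FSum E F\<^esub> d \<odot>\<^bsub>FSum E F\<^esub> x"
     by (simp add: fsum_simps, rule poly_mapping_eqI) (simp add: lookup_scale lookup_add distrib_right)
    show "c \<odot>\<^bsub>FSum E F\<^esub> (x \<oplus>\<^bsub>FSum E F\<^esub> y) =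
      c \<odot>\<^bsub>FSum E F\<^esub> x \<oplus>\<^bsub>FSum E F\<^esub> c \<odot>\<^bsub>FSum E F\<^esub> y"
     by (simp add: fsum_simps scale_add)
    show "(c \<otimes>\<^bsub>CC\<^esub> d) \<odot>\<^bsub>FSum E F\<^esub> x = c \<odot>\<^bsub>FSum E F\<^esub> (d \<odot>\<^bsub>FSum E F\<^esub> x)"
     by (simp add: fsum_simps, rule poly_mapping_eqI) (simp add: lookup_scale)
    show "\<one>\<^bsub>CC\<^esub> \<odot>\<^bsub>FSum E F\<^esub> x = x"
     by (simp add: fsum_simps, rule poly_mapping_eqI) (simp add: lookup_scale)
  qed
  then show ?thesis by (rule cvs.intro)
qed

lemma fsum_minus:
  assumes "y \<in> car (FSum E F)"
  shows "x \<ominus>\<^bsub>FSum E F\<^esub> y = x - y"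
proof -
  interpret cvs "FSum E F" by (rule cvs_formal_sums)
  show ?thesis unfolding a_minus_def uminus_smult[OF assms] by (simp add: fsum_simps scale_minus_one)
qed

definition is_bilinear :: "'a lcs => 'b lcs => (complex, 'c, 'm) module_scheme => ('a => 'b => 'c) => bool" where
  "is_bilinear E F G B \<longleftrightarrow>
    (\<forall>x\<in>car E. is_linear F G (B x)) \<and> (\<forall>y\<in>car F. is_linear E G (\<lambda>x. B x y))"

lemma is_bilinearI:
  assumes "\<And>x. x \<in> car E ==> is_linear F G (B x)" "\<And>y. y \<in> car F ==> is_linear E G (\<lambda>x. B x y)"
  shows "is_bilinear E F G B" using assms by (simp add: is_bilinear_def)

lemma is_bilinearD:
  assumes "is_bilinear E F G B"
  shows "x \<in> car E ==> is_linear F G (B x)" "y \<in> car F ==> is_linear E G (\<lambda>x. B x y)"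
  using assms by (simp_all add: is_bilinear_def)

abbreviation uncurried :: "('a => 'b => 'c) => 'a \<times> 'b => 'c" where
  "uncurried B \<equiv> \<lambda>s. B (fst s) (snd s)"

lemma is_bilinear_uncurried:
  "is_bilinear E F G B ==> uncurried B \<in> car E \<times> car F \<rightarrow> car G"
proof
  fix s assume B: "is_bilinear E F G B" and "s \<in> car E \<times> car F"
  then have s: "fst s \<in> car E" "snd s \<in> car F" by auto
  show "B (fst s) (snd s) \<in> car G" by (rule lin_closed[OF is_bilinearD(1)[OF B s(1)] s(2)])
qed

lemma lin_lincomb_formal_sums:
  assumes "cvs G" "X \<in> car E \<times> car F \<rightarrow> car G"
  shows "is_linear (FSum E F) G (lincomb G X)"
proof -
  interpret G: cvs G by fact
  show ?thesis by (rule is_linearI)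
     (simp_all add: fsum_simps G.lincomb_closed[OF assms(2)] G.lincomb_add[OF assms(2)] G.lincomb_scale[OF assms(2)])
qed

lemma lincomb_singles:
  assumes "keys w \<subseteq> car E \<times> car F"
  shows "lincomb (FSum E F) (\<lambda>s. single s 1) w = w"
proof -
  interpret cvs "FSum E F" by (rule cvs_formal_sums)
  have X: "(\<lambda>s. single s 1) \<in> car E \<times> car F \<rightarrow> car (FSum E F)"
    using single_mem_formal_sums by fastforce
  show ?thesis using assms
  proof (induction w rule: free_vector_induct)
    case zero
    then show ?case by (simp add: fsum_simps)
  next
    case (step k c v)
    have k: "single k 1 \<in> car (FSum E F)" using X step(1) by auto
    show ?case unfolding lincomb_add[OF X keys_single_subset[OF step(1)] step(2)] step(3)
     using lincomb_single[of "\<lambda>s. single s 1" k c] k by (simp add: fsum_simps scale_single)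
  qed
qed

lemma linear_formal_sums_eq_lincomb:
  assumes "cvs G" "is_linear (FSum E F) G f" "w \<in> car (FSum E F)"
  shows "f w = lincomb G (\<lambda>s. f (single s 1)) w"
proof -
  have X: "(\<lambda>s. single s 1) \<in> car E \<times> car F \<rightarrow> car (FSum E F)"
    using single_mem_formal_sums by fastforce
  have w: "keys w \<subseteq> car E \<times> car F" using assms(3) by (simp add: mem_formal_sums)
  show ?thesis using lin_lincomb[OF cvs_formal_sums assms(1,2) X w] unfolding lincomb_singles[OF w] .
qed

lemma bilinear_relations_subset:
  assumes "cvs E" "cvs F"
  shows "bilinear_relations E F \<subseteq> car (FSum E F)"
proof -
  interpret E: cvs E by fact
  interpret F: cvs F by fact
  show ?thesis
  proof
    fix r assume "r \<in> bilinear_relations E F"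
    then show "r \<in> car (FSum E F)" unfolding bilinear_relations_def Un_iff mem_Collect_eq mem_formal_sums
     by (elim disjE exE conjE; simp only:; intro keys_minus_subset keys_single_subset; simp)
  qed
qed

locale lc_pair = E: lc_space E + F: lc_space F for E :: "'a lcs" and F :: "'b lcs"
begin

abbreviation FS where "FS \<equiv> FSum E F"

lemma submodule_tensor_null: "submodule (tensor_null E F) CC FS"
proof -
  interpret FS: cvs FS by (rule cvs_formal_sums)
  interpret FM: Module.module CC FS by (rule FS.is_module)
  have car: "submodule (car FS) CC FS" by (rule FM.carrier_is_submodule)
  have rel: "bilinear_relations E F \<subseteq> car FS" by (rule bilinear_relations_subset[OF E.cvs_axioms F.cvs_axioms])
  have sub: "tensor_null E F \<subseteq> car FS"
    unfolding tensor_null_def using car rel by (intro Inter_lower CollectI conjI)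
  have zero: "\<zero>\<^sub>FS \<in> N" if "submodule N CC FS" for N
    using subgroup.one_closed[OF submodule.axioms(1)[OF that]] by simp
  show ?thesis
  proof (rule FM.submoduleI[OF sub])
    show "\<zero>\<^sub>FS \<in> tensor_null E F" unfolding tensor_null_def using zero by simp
    fix a assume a: "a \<in> tensor_null E F"
    show "\<ominus>\<^sub>FS a \<in> tensor_null E F" using a FM.submoduleE(3) unfolding tensor_null_def by simp
    fix c show "c \<odot>\<^sub>FS a \<in> tensor_null E F"
     using a FM.submoduleE(4)[of _ c] unfolding tensor_null_def by simp
    fix b assume b: "b \<in> tensor_null E F"
    show "a \<oplus>\<^sub>FS b \<in> tensor_null E F" using a b FM.submoduleE(5) unfolding tensor_null_def by simp
  qed
qed

sublocale Q: quot_space FS "tensor_null E F"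
  by (rule quot_space.intro[OF cvs_formal_sums quot_space_axioms.intro[OF submodule_tensor_null]])

lemma relations_null: "bilinear_relations E F \<subseteq> tensor_null E F"
  unfolding tensor_null_def by (rule Inter_greatest) simp

lemma tensor_null_kernel:
  assumes G: "cvs G" and f: "is_linear FS G f" and rel: "\<And>r. r \<in> bilinear_relations E F ==> f r = \<zero>\<^sub>G"
    and w: "w \<in> tensor_null E F"
  shows "f w = \<zero>\<^sub>G"
proof -
  interpret G: cvs G by fact
  interpret FM: Module.module CC FS by (rule Q.is_module)
  let ?K = "{w \<in> car FS. f w = \<zero>\<^sub>G}"
  have "submodule ?K CC FS"
  proof (rule FM.submoduleI)
    fix a b and c :: complex assume a: "a \<in> ?K"
    show "\<ominus>\<^sub>FS a \<in> ?K" using a lin_uminus[OF Q.cvs_axioms G f] by simp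
    show "c \<odot>\<^sub>FS a \<in> ?K" using a lin_smult[OF f] by simp
    assume b: "b \<in> ?K"
    show "a \<oplus>\<^sub>FS b \<in> ?K" using a b lin_add[OF f] by simp
  qed (use lin_zero[OF Q.cvs_axioms G f] in auto)
  moreover have "bilinear_relations E F \<subseteq> ?K"
    using rel bilinear_relations_subset[OF E.cvs_axioms F.cvs_axioms] by auto
  ultimately have "tensor_null E F \<subseteq> ?K" unfolding tensor_null_def by (intro Inter_lower CollectI conjI)
  then show ?thesis using w by auto
qed

text \<open>
  The formal sums killed by the linear map that a bilinear map induces form a subspace containing the bilinear
  relations, hence contain \<open>tensor_null\<close>.
\<close>

lemma lincomb_bilinear_null:
  assumes G: "cvs G" and B: "is_bilinear E F G B" and w: "w \<in> tensor_null E F"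
  shows "lincomb G (uncurried B) w = \<zero>\<^sub>G"
proof (rule tensor_null_kernel[OF G lin_lincomb_formal_sums[OF G is_bilinear_uncurried[OF B]] _ w])
  interpret G: cvs G by fact
  let ?L = "lincomb G (uncurried B)"
  note X = is_bilinear_uncurried[OF B]
  note Bx = is_bilinearD(1)[OF B] and By = is_bilinearD(2)[OF B]
  have Bc: "B x y \<in> car G" if "x \<in> car E" "y \<in> car F" for x y using lin_closed[OF Bx] that by simp
  have m: "?L (single s c - v) = c \<odot>\<^sub>G B (fst s) (snd s) \<ominus>\<^sub>G ?L v"
    if "fst s \<in> car E" "snd s \<in> car F" "keys v \<subseteq> car E \<times> car F" for s c v
    using G.lincomb_minus[OF X keys_single_subset that(3), of s c] that Bc by (simp add: mem_Times_iff G.lincomb_single)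
  have sg: "?L (single (x, y) c) = c \<odot>\<^sub>G B x y" if "x \<in> car E" "y \<in> car F" for x y c
    using that Bc by (subst G.lincomb_single) simp_all
  have d: "?L (single (x, y) a - single (x', y') b) =
     a \<odot>\<^sub>G B x y \<ominus>\<^sub>G b \<odot>\<^sub>G B x' y'"
    if "x \<in> car E" "y \<in> car F" "x' \<in> car E" "y' \<in> car F" for x y x' y' a b
    using that m[of "(x, y)" "single (x', y') b" a] keys_single_subset[of "(x', y')" "car E \<times> car F" b]
    by (simp add: sg)
  have t: "?L (single (x, y) 1 - single (x', y') 1 - single (x'', y'') 1) =
     (B x y \<ominus>\<^sub>G B x' y') \<ominus>\<^sub>G B x'' y''"
    if "x \<in> car E" "y \<in> car F" "x' \<in> car E" "y' \<in> car F" "x'' \<in> car E" "y'' \<in> car F"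
    for x y x' y' x'' y''
  proof -
    have k: "keys (single (x, y) 1 - single (x', y') 1 :: _ \<Rightarrow>\<^sub>0 complex) \<subseteq> car E \<times> car F"
     using that by (intro keys_minus_subset keys_single_subset) auto
    have k2: "keys (single (x'', y'') 1 :: _ \<Rightarrow>\<^sub>0 complex) \<subseteq> car E \<times> car F"
     using that by (intro keys_single_subset) auto
    show ?thesis using G.lincomb_minus[OF X k k2] d[of x y x' y' 1 1] sg[of x'' y'' 1] that Bc by simp
  qed
  have cancel: "(a \<oplus>\<^sub>G b \<ominus>\<^sub>G a) \<ominus>\<^sub>G b = \<zero>\<^sub>G" if "a \<in> car G" "b \<in> car G" for a b
  proof -
    have "(a \<oplus>\<^sub>G b \<ominus>\<^sub>G a) \<ominus>\<^sub>G b = (a \<oplus>\<^sub>G b) \<oplus>\<^sub>G \<ominus>\<^sub>G (a \<oplus>\<^sub>G b)"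
     using that by (simp add: a_minus_def G.minus_add G.a_ac)
    then show ?thesis using that by (simp add: G.r_neg)
  qed
  fix r assume "r \<in> bilinear_relations E F"
  then consider
     x x' y where "r = single (x \<oplus>\<^sub>E x', y) 1 - single (x, y) 1 - single (x', y) 1"
      "x \<in> car E" "x' \<in> car E" "y \<in> car F"
    | x y y' where "r = single (x, y \<oplus>\<^sub>F y') 1 - single (x, y) 1 - single (x, y') 1"
      "x \<in> car E" "y \<in> car F" "y' \<in> car F"
    | c x y where "r = single (c \<odot>\<^sub>E x, y) 1 - single (x, y) c" "x \<in> car E" "y \<in> car F"
    | c x y where "r = single (x, c \<odot>\<^sub>F y) 1 - single (x, y) c" "x \<in> car E" "y \<in> car F"
    unfolding bilinear_relations_def Un_iff mem_Collect_eq by (elim disjE exE conjE) simp_all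
  then show "?L r = \<zero>\<^sub>G"
  proof cases
    case 1
    then show ?thesis by (simp add: t lin_add[OF By] cancel Bc)
  next
    case 2
    then show ?thesis by (simp add: t lin_add[OF Bx] cancel Bc)
  next
    case 3
    then show ?thesis by (simp add: d lin_smult[OF By] Bc)
  next
    case 4
    then show ?thesis by (simp add: d lin_smult[OF Bx] Bc)
  qed
qed

abbreviation AT where "AT \<equiv> alg_tensor E F"

definition tens :: "'a => 'b => (('a \<times> 'b) \<Rightarrow>\<^sub>0 complex) set" where
  "tens x y = Q.proj (single (x, y) 1)"

lemma alg_tensor_carrier: "car AT = Q.proj ` car FS" by (simp add: alg_tensor_def Let_def Q.carrier_quot)

lemma lin_proj_AT: "is_linear FS AT Q.proj" using Q.lin_proj by (simp add: alg_tensor_def Let_def)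

lemma cvs_AT: "cvs AT" unfolding alg_tensor_def Let_def by (rule cvs_extend[OF Q.cvs_quot])

lemma is_bilinear_tens: "is_bilinear E F AT tens"
proof -
  have eqI: "Q.proj v = Q.proj w" if "v - w \<in> tensor_null E F" "v \<in> car FS" "w \<in> car FS" for v w
    using that by (subst Q.proj_eq_iff) (simp_all add: fsum_minus)
  have rel: "r \<in> bilinear_relations E F ==> r \<in> tensor_null E F" for r using relations_null by auto
  note sm = single_mem_formal_sums[where E = E and F = F]
  have add: "Q.proj v \<oplus>\<^sub>AT Q.proj w = Q.proj (v + w)" if "v \<in> car FS" "w \<in> car FS" for v w
    using lin_add[OF lin_proj_AT that] by (simp add: fsum_simps)
  have sc: "c \<odot>\<^sub>AT Q.proj v = Q.proj (scale c v)" if "v \<in> car FS" for c v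
    using lin_smult[OF lin_proj_AT that] by (simp add: fsum_simps)
  have plus: "v + w \<in> car FS" if "v \<in> car FS" "w \<in> car FS" for v w
    using Q.a_closed[OF that] by (simp add: fsum_simps)
  show ?thesis
  proof (rule is_bilinearI)
    fix x assume x: "x \<in> car E"
    show "is_linear F AT (tens x)"
    proof (rule is_linearI)
     fix y y' c assume y: "y \<in> car F"
     show "tens x y \<in> car AT" unfolding tens_def using lin_closed[OF lin_proj_AT] sm[OF x y] by simp
     have "single (x, c \<odot>\<^sub>F y) 1 - single (x, y) c \<in> bilinear_relations E F"
      unfolding bilinear_relations_def using x y by blast
     then show "tens x (c \<odot>\<^sub>F y) = c \<odot>\<^sub>AT tens x y"
      unfolding tens_def sc[OF sm[OF x y]] scale_single using x y by (intro eqI rel) (simp_all add: sm)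
     assume y': "y' \<in> car F"
     have "single (x, y \<oplus>\<^sub>F y') 1 - single (x, y) 1 - single (x, y') 1
       \<in> bilinear_relations E F" unfolding bilinear_relations_def using x y y' by blast
     then show "tens x (y \<oplus>\<^sub>F y') = tens x y \<oplus>\<^sub>AT tens x y'"
      unfolding tens_def add[OF sm[OF x y] sm[OF x y']] using x y y'
      by (intro eqI rel) (simp_all add: sm plus diff_diff_eq)
    qed
  next
    fix y assume y: "y \<in> car F"
    show "is_linear E AT (\<lambda>x. tens x y)"
    proof (rule is_linearI)
     fix x x' c assume x: "x \<in> car E"
     show "tens x y \<in> car AT" unfolding tens_def using lin_closed[OF lin_proj_AT] sm[OF x y] by simp
     have "single (c \<odot>\<^sub>E x, y) 1 - single (x, y) c \<in> bilinear_relations E F"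
      unfolding bilinear_relations_def using x y by blast
     then show "tens (c \<odot>\<^sub>E x) y = c \<odot>\<^sub>AT tens x y"
      unfolding tens_def sc[OF sm[OF x y]] scale_single using x y by (intro eqI rel) (simp_all add: sm)
     assume x': "x' \<in> car E"
     have "single (x \<oplus>\<^sub>E x', y) 1 - single (x, y) 1 - single (x', y) 1
       \<in> bilinear_relations E F" unfolding bilinear_relations_def using x y x' by blast
     then show "tens (x \<oplus>\<^sub>E x') y = tens x y \<oplus>\<^sub>AT tens x' y"
      unfolding tens_def add[OF sm[OF x y] sm[OF x' y]] using x y x'
      by (intro eqI rel) (simp_all add: sm plus diff_diff_eq)
    qed
  qed
qed

lemma weight_superset:
  assumes "finite A" "keys w \<subseteq> A"
  shows "weight p r w = (\<Sum>s\<in>A. cmod (lookup w s) * p (fst s) * r (snd s))"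
  unfolding weight_def using assms by (intro sum.mono_neutral_left) (auto simp: in_keys_iff)

lemma weight_single: "weight p r (single (x, y) c) = cmod c * p x * r y"
  by (subst weight_superset[of "{(x, y)}"]) (auto simp: lookup_single)

lemma is_seminorm_weight:
  assumes p: "is_seminorm E p" and r: "is_seminorm F r"
  shows "is_seminorm FS (weight p r)"
proof (rule Q.is_seminormI)
  fix w assume w: "w \<in> car FS"
  have n: "0 \<le> p (fst s)" "0 \<le> r (snd s)" if "s \<in> car E \<times> car F" for s
    using that E.sn_nonneg[OF p] F.sn_nonneg[OF r] by auto
  show "0 \<le> weight p r w"
    unfolding weight_def using w n by (intro sum_nonneg mult_nonneg_nonneg) (auto simp: mem_formal_sums)
  fix c show "weight p r (c \<odot>\<^sub>FS w) = cmod c * weight p r w" unfolding fsum_simps(4)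
    by (subst (1 2) weight_superset[of "keys w"])
     (simp_all add: keys_scale lookup_scale norm_mult sum_distrib_left mult.assoc)
  fix v assume v: "v \<in> car FS"
  let ?A = "keys v \<union> keys w"
  have "weight p r (w + v) = (\<Sum>s\<in>?A. cmod (lookup (w + v) s) * p (fst s) * r (snd s))"
    using keys_add[of w v] by (intro weight_superset) auto
  also have "\<dots> \<le> (\<Sum>s\<in>?A. cmod (lookup w s) * p (fst s) * r (snd s) +
     cmod (lookup v s) * p (fst s) * r (snd s))"
  proof (rule sum_mono)
    fix s assume "s \<in> ?A"
    then have s: "s \<in> car E \<times> car F" using v w by (auto simp: mem_formal_sums)
    show "cmod (lookup (w + v) s) * p (fst s) * r (snd s) \<le>
      cmod (lookup w s) * p (fst s) * r (snd s) + cmod (lookup v s) * p (fst s) * r (snd s)"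
     unfolding distrib_right[symmetric] using n[OF s]
     by (intro mult_right_mono) (simp_all add: lookup_add norm_triangle_ineq)
  qed
  also have "\<dots> = weight p r w + weight p r v" unfolding sum.distrib by (subst (1 2) weight_superset[of ?A]) auto
  finally show "weight p r (w \<oplus>\<^sub>FS v) \<le> weight p r w + weight p r v" by (simp add: fsum_simps)
qed

definition proj_seminorms :: "((('a \<times> 'b) \<Rightarrow>\<^sub>0 complex) set => real) set" where
  "proj_seminorms = {proj_seminorm p r | p r. p \<in> csn E \<and> r \<in> csn F}"

lemma AT_topology: "lctop AT = seminorm_topology AT proj_seminorms"
  by (simp add: alg_tensor_def Let_def proj_seminorms_def)

lemma is_seminorm_proj:
  assumes "p \<in> csn E" "r \<in> csn F"
  shows "is_seminorm AT (proj_seminorm p r)" unfolding proj_seminorm_quot alg_tensor_def Let_def is_seminorm_extend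
  by (rule Q.is_seminorm_quot[OF is_seminorm_weight[OF E.csnD[OF assms(1)] F.csnD[OF assms(2)]]])

lemma AT_seminorms: "\<forall>p\<in>proj_seminorms. is_seminorm AT p"
  unfolding proj_seminorms_def using is_seminorm_proj by auto

lemma lc_space_AT: "lc_space AT" by (rule lc_space_seminorm_topology[OF cvs_AT AT_seminorms AT_topology])

lemma proj_seminorm_cont:
  assumes "p \<in> csn E" "r \<in> csn F"
  shows "proj_seminorm p r \<in> csn AT" using generating_cont_seminorms[OF cvs_AT AT_seminorms AT_topology] assms
  unfolding proj_seminorms_def by auto

lemma weight_mono:
  assumes w: "w \<in> car FS" and p: "p \<in> csn E" and r: "r \<in> csn F"
    and p': "p' \<in> csn E"
    and le: "sn_le E p p'" "sn_le F r r'"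
  shows "weight p r w \<le> weight p' r' w" unfolding weight_def
proof (rule sum_mono)
  fix s assume "s \<in> keys w"
  then have s: "fst s \<in> car E" "snd s \<in> car F" using w by (auto simp: mem_formal_sums)
  show "cmod (lookup w s) * p (fst s) * r (snd s) \<le> cmod (lookup w s) * p' (fst s) * r' (snd s)"
    using sn_leD[OF le(1) s(1)] sn_leD[OF le(2) s(2)] E.sn_nonneg[OF E.csnD[OF p'] s(1)]
     F.sn_nonneg[OF F.csnD[OF r] s(2)] by (intro mult_mono mult_left_mono mult_nonneg_nonneg) auto
qed

lemma proj_seminorm_mono:
  assumes "p \<in> csn E" "r \<in> csn F" "p' \<in> csn E"
    and le: "sn_le E p p'" "sn_le F r r'"
  shows "sn_le AT (proj_seminorm p r) (proj_seminorm p' r')"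
proof (rule sn_leI)
  fix U assume "U \<in> car AT"
  then obtain u where u: "U = Q.proj u" "u \<in> car FS" unfolding alg_tensor_carrier by (elim imageE)
  show "proj_seminorm p r U \<le> proj_seminorm p' r' U" unfolding proj_seminorm_quot u(1)
  proof (rule Q.qsn_greatest[OF u(2)])
    fix v assume v: "v \<in> car FS" "Q.proj v = Q.proj u"
    have "qsn (weight p r) (Q.proj u) \<le> weight p r v"
     using Q.qsn_le[OF is_seminorm_weight[OF E.csnD[OF assms(1)] F.csnD[OF assms(2)]] v(1)] v(2) by simp
    also have "\<dots> \<le> weight p' r' v" by (rule weight_mono[OF v(1) assms])
    finally show "qsn (weight p r) (Q.proj u) \<le> weight p' r' v" .
  qed
qed

text \<open>
  The tensor seminorms are directed: \<open>p + p'\<close> and \<open>r + r'\<close> give a seminorm above those of \<open>p, r\<close> and \<open>p', r'\<close>.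
\<close>

lemma AT_cont_seminorm_le_proj:
  assumes "q \<in> csn AT"
  shows "\<exists>p\<in>csn E. \<exists>r\<in>csn F. sn_le AT q (proj_seminorm p r)"
proof -
  have "\<exists>a\<in>proj_seminorms. \<exists>C>0. \<forall>X\<in>car AT. q X \<le> C * a X"
  proof (rule cont_seminorm_dominated[OF cvs_AT AT_seminorms AT_topology _ _ assms])
    show "proj_seminorms \<noteq> {}" unfolding proj_seminorms_def using E.csn_zero F.csn_zero by auto
    fix a b assume "a \<in> proj_seminorms" "b \<in> proj_seminorms"
    then obtain p r p' r' where a: "a = proj_seminorm p r" and b: "b = proj_seminorm p' r'"
     and p: "p \<in> csn E" "p' \<in> csn E" and r: "r \<in> csn F" "r' \<in> csn F"
     unfolding proj_seminorms_def by (elim CollectE exE conjE)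
    note pp = E.csn_add[OF p] and rr = F.csn_add[OF r]
    have le: "sn_le E p (\<lambda>x. p x + p' x)" "sn_le E p' (\<lambda>x. p x + p' x)"
     "sn_le F r (\<lambda>x. r x + r' x)" "sn_le F r' (\<lambda>x. r x + r' x)"
     using p r by (simp_all add: sn_le_def E.sn_nonneg[OF E.csnD] F.sn_nonneg[OF F.csnD])
    show "\<exists>c\<in>proj_seminorms. \<forall>X\<in>car AT. a X \<le> c X \<and> b X \<le> c X"
    proof (rule bexI)
     show "proj_seminorm (\<lambda>x. p x + p' x) (\<lambda>x. r x + r' x) \<in> proj_seminorms"
      unfolding proj_seminorms_def using pp rr by (intro CollectI exI conjI) (rule refl)
     show "\<forall>X\<in>car AT. a X \<le> proj_seminorm (\<lambda>x. p x + p' x) (\<lambda>x. r x + r' x) X \<and>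
       b X \<le> proj_seminorm (\<lambda>x. p x + p' x) (\<lambda>x. r x + r' x) X" unfolding a b
      using proj_seminorm_mono[OF p(1) r(1) pp le(1,3)] proj_seminorm_mono[OF p(2) r(2) pp le(2,4)]
      by (simp add: sn_le_def)
    qed
  qed
  then obtain p r C where pr: "p \<in> csn E" "r \<in> csn F" and C: "C > 0"
     and le: "\<forall>X\<in>car AT. q X \<le> C * proj_seminorm p r X"
    unfolding proj_seminorms_def by (elim bexE CollectE exE conjE) simp
  have Cp: "(\<lambda>x. C * p x) \<in> csn E" using C by (intro E.csn_scale pr) simp
  have "sn_le AT q (proj_seminorm (\<lambda>x. C * p x) r)"
  proof (rule sn_leI)
    fix U assume U: "U \<in> car AT"
    then obtain u where u: "U = Q.proj u" "u \<in> car FS" unfolding alg_tensor_carrier by (elim imageE)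
    have "q U / C \<le> proj_seminorm p r U" using le[rule_format, OF U] C by (simp add: field_simps)
    have "q U \<le> weight (\<lambda>x. C * p x) r v" if v: "v \<in> car FS" "Q.proj v = Q.proj u" for v
    proof -
     have "proj_seminorm p r U \<le> weight p r v"
      using Q.qsn_le[OF is_seminorm_weight[OF E.csnD[OF pr(1)] F.csnD[OF pr(2)]] v(1)] v(2)
      by (simp add: proj_seminorm_quot u(1))
     then have "C * proj_seminorm p r U \<le> C * weight p r v" using C by (intro mult_left_mono) auto
     also have "C * weight p r v = weight (\<lambda>x. C * p x) r v"
      unfolding weight_def sum_distrib_left by (intro sum.cong) (auto simp: mult_ac)
     finally show ?thesis using le[rule_format, OF U] by linarith
    qed
    then show "q U \<le> proj_seminorm (\<lambda>x. C * p x) r U"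
     unfolding proj_seminorm_quot u(1) by (intro Q.qsn_greatest[OF u(2)])
  qed
  then show ?thesis using Cp pr(2) by (intro bexI[of _ "\<lambda>x. C * p x"] bexI[of _ r])
qed

lemma proj_seminorm_tens_le:
  assumes "p \<in> csn E" "r \<in> csn F" "x \<in> car E" "y \<in> car F"
  shows "proj_seminorm p r (tens x y) \<le> p x * r y"
  using Q.qsn_le[OF is_seminorm_weight[OF E.csnD[OF assms(1)] F.csnD[OF assms(2)]]
     single_mem_formal_sums[OF assms(3,4), of 1]] by (simp add: proj_seminorm_quot tens_def weight_single)

section \<open>The complete projective tensor product\<close>

sublocale AT: lc_space AT by (rule lc_space_AT)

abbreviation T where "T \<equiv> PT E F"

definition tproj :: "('a => real) => ('b => real) => ('a, 'b) tensor => real" where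
  "tproj p r = AT.hat (proj_seminorm p r)"

lemma tensor_complete: "is_complete_lcs T" unfolding proj_tensor_def by (rule AT.completion_complete)

lemma lc_space_T: "lc_space T" by (rule complete_lc_space[OF tensor_complete])

lemma pure_tensor_eq: "pure E F x y = AT.\<iota> (tens x y)" by (simp add: pure_tensor_def tens_def)

lemma tproj_cont: "p \<in> csn E ==> r \<in> csn F ==> tproj p r \<in> csn T"
  unfolding tproj_def proj_tensor_def by (intro AT.hat_cont proj_seminorm_cont)

lemma tens_closed: "x \<in> car E ==> y \<in> car F ==> tens x y \<in> car AT"
  by (intro lin_closed[OF is_bilinearD(1)[OF is_bilinear_tens]])

lemma is_bilinear_pure: "is_bilinear E F T (pure E F)"
proof (rule is_bilinearI)
  fix x assume x: "x \<in> car E"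
  show "is_linear F T (pure E F x)" unfolding pure_tensor_eq[abs_def] proj_tensor_def
    by (rule lin_compose[OF is_bilinearD(1)[OF is_bilinear_tens x] AT.lin_to_completion])
next
  fix y assume y: "y \<in> car F"
  show "is_linear E T (\<lambda>x. pure E F x y)" unfolding pure_tensor_eq proj_tensor_def
    by (rule lin_compose[OF is_bilinearD(2)[OF is_bilinear_tens y] AT.lin_to_completion])
qed

lemma pure_closed: "x \<in> car E ==> y \<in> car F ==> pure E F x y \<in> car T"
  by (intro lin_closed[OF is_bilinearD(1)[OF is_bilinear_pure]])

lemma tproj_pure_le:
  assumes "p \<in> csn E" "r \<in> csn F" "x \<in> car E" "y \<in> car F"
  shows "tproj p r (pure E F x y) \<le> p x * r y"
  unfolding tproj_def pure_tensor_eq AT.hat_to_completion[OF tens_closed[OF assms(3,4)] proj_seminorm_cont[OF assms(1,2)]]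
  by (rule proj_seminorm_tens_le[OF assms])

lemma T_cont_seminorm_bound:
  assumes "q \<in> csn T"
  shows "\<exists>p\<in>csn E. \<exists>r\<in>csn F. sn_le T q (tproj p r)"
proof -
  obtain a where a: "a \<in> csn AT" "sn_le T q (AT.hat a)"
    using AT.completion_cont_seminorm_le_hat assms unfolding proj_tensor_def by (elim bexE[rotated]) auto
  obtain p r where pr: "p \<in> csn E" "r \<in> csn F" and le: "sn_le AT a (proj_seminorm p r)"
    using AT_cont_seminorm_le_proj[OF a(1)] by (elim bexE)
  have "sn_le T (AT.hat a) (tproj p r)" unfolding tproj_def proj_tensor_def
    by (rule sn_leI) (rule AT.hat_mono[OF _ a(1) proj_seminorm_cont[OF pr] le])
  then show ?thesis using sn_le_trans[OF a(2)] pr by (intro bexI[of _ p] bexI[of _ r])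
qed

lemma lincomb_pure:
  assumes w: "w \<in> car FS"
  shows "lincomb T (uncurried (pure E F)) w = AT.\<iota> (Q.proj w)"
proof -
  have lin: "is_linear FS T (\<lambda>w. AT.\<iota> (Q.proj w))"
    unfolding proj_tensor_def by (rule lin_compose[OF lin_proj_AT AT.lin_to_completion])
  have "AT.\<iota> (Q.proj w) = lincomb T (\<lambda>s. AT.\<iota> (Q.proj (single s 1))) w"
    by (rule linear_formal_sums_eq_lincomb[OF lc_space.axioms(1)[OF lc_space_T] lin w])
  then show ?thesis by (simp add: pure_tensor_eq tens_def)
qed

text \<open>
  Formal sums of elementary tensors are dense in the completion of the algebraic tensor product.
\<close>

lemma total_pure: "total_in T (car E \<times> car F) (uncurried (pure E F))" unfolding total_in_def
proof (intro conjI ballI allI impI)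
  show "uncurried (pure E F) \<in> car E \<times> car F \<rightarrow> car T"
    by (rule is_bilinear_uncurried[OF is_bilinear_pure])
  interpret T: lc_space T by (rule lc_space_T)
  fix X q and e :: real assume X: "X \<in> car T" and q: "q \<in> csn T" and e: "0 < e"
  obtain a where a: "a \<in> csn AT" "sn_le T q (AT.hat a)"
    using AT.completion_cont_seminorm_le_hat q unfolding proj_tensor_def by (elim bexE[rotated]) auto
  obtain u where u: "u \<in> car AT" "AT.hat a (X \<ominus>\<^sub>T AT.\<iota> u) < e"
    using AT.to_completion_dense[OF _ a(1) e] X unfolding proj_tensor_def by (elim bexE[rotated]) auto
  obtain w where w: "u = Q.proj w" "w \<in> car FS" using u(1) unfolding alg_tensor_carrier by (elim imageE)
  have iu: "AT.\<iota> u \<in> car T" unfolding proj_tensor_def by (rule lin_closed[OF AT.lin_to_completion u(1)])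
  have "q (AT.\<iota> u \<ominus>\<^sub>T X) \<le> AT.hat a (AT.\<iota> u \<ominus>\<^sub>T X)"
    by (rule sn_leD[OF a(2) T.minus_closed[OF iu X]])
  also have "\<dots> = AT.hat a (X \<ominus>\<^sub>T AT.\<iota> u)"
    by (rule T.seminorm_minus_commute[OF _ iu X]) (use AT.is_seminorm_hat[OF a(1)] in \<open>simp add: proj_tensor_def\<close>)
  finally have "q (AT.\<iota> u \<ominus>\<^sub>T X) < e" using u(2) by simp
  then show "\<exists>w. keys w \<subseteq> car E \<times> car F \<and> q (lincomb T (uncurried (pure E F)) w \<ominus>\<^sub>T X) < e"
    using w lincomb_pure[OF w(2)] by (intro exI[of _ w]) (simp add: mem_formal_sums)
qed

definition bounded_bilinear_map :: "'c lcs => ('a => 'b => 'c) => bool" where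
  "bounded_bilinear_map G B \<longleftrightarrow> is_bilinear E F G B \<and>
    (\<forall>q\<in>csn G. \<exists>p\<in>csn E. \<exists>r\<in>csn F.
      \<forall>x\<in>car E. \<forall>y\<in>car F. q (B x y) \<le> p x * r y)"

lemma lincomb_bilinear_bound:
  assumes G: "lc_space G" and B: "is_bilinear E F G B" and q: "q \<in> csn G"
    and p: "p \<in> csn E" and r: "r \<in> csn F"
    and le: "\<forall>x\<in>car E. \<forall>y\<in>car F. q (B x y) \<le> p x * r y"
    and w: "keys w \<subseteq> car E \<times> car F"
  shows "q (lincomb G (uncurried B) w) \<le> tproj p r (lincomb T (uncurried (pure E F)) w)"
proof -
  interpret G: lc_space G by fact
  have w: "w \<in> car FS" using w by (simp add: mem_formal_sums)
  have lin: "is_linear FS G (lincomb G (uncurried B))"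
    by (rule lin_lincomb_formal_sums[OF G.cvs_axioms is_bilinear_uncurried[OF B]])
  have "q (lincomb G (uncurried B) w) \<le> qsn (weight p r) (Q.proj w)"
  proof (rule Q.qsn_greatest[OF w])
    fix v assume v: "v \<in> car FS" "Q.proj v = Q.proj w"
    then have "v \<ominus>\<^sub>FS w \<in> tensor_null E F" using Q.proj_eq_iff[OF v(1) w] by simp
    then have "lincomb G (uncurried B) (v \<ominus>\<^sub>FS w) = \<zero>\<^sub>G" by (rule lincomb_bilinear_null[OF G.cvs_axioms B])
    then have eq: "lincomb G (uncurried B) v = lincomb G (uncurried B) w"
     using lin_minus[OF Q.cvs_axioms G.cvs_axioms lin v(1) w] G.minus_eq_zero lin_closed[OF lin] v(1) w by simp
    have "q (lincomb G (uncurried B) v) \<le>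
      (\<Sum>s\<in>keys v. cmod (lookup v s) * q (B (fst s) (snd s)))"
     by (rule G.seminorm_lincomb[OF G.csnD[OF q] is_bilinear_uncurried[OF B]]) (use v in \<open>simp add: mem_formal_sums\<close>)
    also have "\<dots> \<le> weight p r v" unfolding weight_def
    proof (rule sum_mono)
     fix s assume "s \<in> keys v"
     then have "fst s \<in> car E" "snd s \<in> car F" using v(1) by (auto simp: mem_formal_sums)
     then have "q (B (fst s) (snd s)) \<le> p (fst s) * r (snd s)" using le by simp
     then show "cmod (lookup v s) * q (B (fst s) (snd s)) \<le> cmod (lookup v s) * p (fst s) * r (snd s)"
      by (simp add: mult.assoc mult_left_mono)
    qed
    finally show "q (lincomb G (uncurried B) w) \<le> weight p r v" by (simp add: eq)
  qed
  also have "qsn (weight p r) (Q.proj w) = tproj p r (AT.\<iota> (Q.proj w))" unfolding tproj_def using w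
    by (subst AT.hat_to_completion[OF _ proj_seminorm_cont[OF p r]]) (simp_all add: alg_tensor_carrier proj_seminorm_quot)
  finally show ?thesis by (simp add: lincomb_pure[OF w])
qed

lemma tensor_map_unique:
  assumes "is_complete_lcs G" "cont_linear T G f" "cont_linear T G g"
    and "\<And>x y. x \<in> car E ==> y \<in> car F ==> f (pure E F x y) = g (pure E F x y)"
    and "t \<in> car T"
  shows "f t = g t"
  by (rule cont_linear_eq_on_total[OF lc_space_T assms(1-3) total_pure _ assms(5)]) (auto intro: assms(4))

text \<open>
  The bound on elementary tensors extends to all representations of a tensor by the triangle inequality, hence to
  their infimum. Density of the elementary tensors gives existence and uniqueness.
\<close>

lemma linearization_spec:
  assumes G: "is_complete_lcs G" and B: "bounded_bilinear_map G B"
  shows "linearization E F G B \<in> extensional (car T) \<and> cont_linear T G (linearization E F G B) \<and>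
    (\<forall>x\<in>car E. \<forall>y\<in>car F. linearization E F G B (pure E F x y) = B x y)"
proof -
  have lcG: "lc_space G" by (rule complete_lc_space[OF G])
  have bil: "is_bilinear E F G B" using B by (simp add: bounded_bilinear_map_def)
  have "\<exists>h. cont_linear T G h \<and> (\<forall>s\<in>car E \<times> car F. h (uncurried (pure E F) s) = uncurried B s)"
  proof (rule extension_exists[OF lc_space_T G total_pure is_bilinear_uncurried[OF bil]])
    fix q assume q: "q \<in> csn G"
    obtain p r where pr: "p \<in> csn E" "r \<in> csn F"
      and le: "\<forall>x\<in>car E. \<forall>y\<in>car F. q (B x y) \<le> p x * r y"
     using bspec[OF conjunct2[OF B[unfolded bounded_bilinear_map_def]] q] by (elim bexE)
    show "\<exists>t\<in>csn T. \<forall>w. keys w \<subseteq> car E \<times> car F -->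
      q (lincomb G (uncurried B) w) \<le> t (lincomb T (uncurried (pure E F)) w)"
     by (rule bexI[OF _ tproj_cont[OF pr]]) (intro allI impI, rule lincomb_bilinear_bound[OF lcG bil q pr le])
  qed
  then obtain h where h: "cont_linear T G h" "\<forall>s\<in>car E \<times> car F. h (uncurried (pure E F) s) = uncurried B s"
    by (elim exE conjE)
  interpret T: lc_space T by (rule lc_space_T)
  define h' where "h' = restrict h (car T)"
  have h'_eq: "h' t = h t" if "t \<in> car T" for t using that by (simp add: h'_def)
  have cl: "cont_linear T G h'"
  proof (rule cont_linearI[OF lc_space_T lcG])
    show "is_linear T G h'" by (rule is_linearI) (simp_all add: h'_eq lin_closed[OF cont_linearD[OF h(1)]]
       lin_add[OF cont_linearD[OF h(1)]] lin_smult[OF cont_linearD[OF h(1)]])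
    fix q assume "q \<in> csn G"
    from cont_linear_bound[OF lc_space_T lcG h(1) this]
    show "\<exists>r\<in>csn T. \<forall>x\<in>car T. q (h' x) \<le> r x" by (simp add: h'_eq cong: ball_cong)
  qed
  have val: "h' (pure E F x y) = B x y" if "x \<in> car E" "y \<in> car F" for x y
    using h(2) that by (force simp: h'_eq pure_closed)
  have "\<exists>!h. h \<in> extensional (car T) \<and> cont_linear T G h \<and>
     (\<forall>x\<in>car E. \<forall>y\<in>car F. h (pure E F x y) = B x y)"
  proof (rule ex1I[of _ h'])
    show "h' \<in> extensional (car T) \<and> cont_linear T G h' \<and> (\<forall>x\<in>car E. \<forall>y\<in>car F. h' (pure E F x y) = B x y)"
     using cl val by (simp add: h'_def)
    fix g assume g: "g \<in> extensional (car T) \<and> cont_linear T G g \<and> (\<forall>x\<in>car E. \<forall>y\<in>car F. g (pure E F x y) = B x y)"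
    show "g = h'"
    proof (rule extensionalityI[of _ "car T"])
     show "g \<in> extensional (car T)" using g by simp
     show "h' \<in> extensional (car T)" by (simp add: h'_def)
     fix t assume t: "t \<in> car T"
     have gc: "cont_linear T G g" using g by simp
     show "g t = h' t" by (rule tensor_map_unique[OF G gc cl _ t]) (use g val in simp)
    qed
  qed
  from theI'[OF this] show ?thesis unfolding linearization_def .
qed

lemmas linearization_ext = linearization_spec[THEN conjunct1]
lemmas linearization_cont = linearization_spec[THEN conjunct2, THEN conjunct1]
lemmas linearization_pure = linearization_spec[THEN conjunct2, THEN conjunct2, rule_format]

lemma linearization_bound:
  assumes G: "is_complete_lcs G" and B: "bounded_bilinear_map G B" and q: "q \<in> csn G"
    and p: "p \<in> csn E" and r: "r \<in> csn F"
    and le: "\<forall>x\<in>car E. \<forall>y\<in>car F. q (B x y) \<le> p x * r y"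
    and t: "t \<in> car T"
  shows "q (linearization E F G B t) \<le> tproj p r t"
proof -
  have lcG: "lc_space G" by (rule complete_lc_space[OF G])
  interpret G: lc_space G by (rule lcG)
  have bil: "is_bilinear E F G B" using B by (simp add: bounded_bilinear_map_def)
  note c = linearization_cont[OF G B]
  show ?thesis
  proof (rule cont_linear_bound_on_total[OF lc_space_T lcG c total_pure q tproj_cont[OF p r] _ t])
    fix w :: "_ \<Rightarrow>\<^sub>0 complex" assume w: "keys w \<subseteq> car E \<times> car F"
    have "linearization E F G B (lincomb T (uncurried (pure E F)) w) =
      lincomb G (\<lambda>s. linearization E F G B (uncurried (pure E F) s)) w"
     by (rule lin_lincomb[OF lc_space.axioms(1)[OF lc_space_T] G.cvs_axioms cont_linearD[OF c]
        is_bilinear_uncurried[OF is_bilinear_pure] w])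
    also have "\<dots> = lincomb G (uncurried B) w"
     by (rule G.lincomb_cong[OF _ is_bilinear_uncurried[OF bil] w]) (auto simp: linearization_pure[OF G B])
    finally show "q (linearization E F G B (lincomb T (uncurried (pure E F)) w)) \<le>
      tproj p r (lincomb T (uncurried (pure E F)) w)" using lincomb_bilinear_bound[OF lcG bil q p r le w] by simp
  qed
qed

end

section \<open>Tensor products of algebras\<close>

lemma fsum_mult_eq:
  "v \<otimes>\<^bsub>FSum E F\<^esub> w = (\<Sum>s\<in>keys v. \<Sum>t\<in>keys w.
    single (fst s \<otimes>\<^sub>E fst t, snd s \<otimes>\<^sub>F snd t)
     (lookup v s * lookup w t))" by (simp add: formal_sums_def)

lemma fsum_mult_add_left:
  "(v + v') \<otimes>\<^bsub>FSum E F\<^esub> w = v \<otimes>\<^bsub>FSum E F\<^esub> w + v' \<otimes>\<^bsub>FSum E F\<^esub> w"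
  unfolding fsum_mult_eq by (rule setsum_keys_plus_distrib[where f = "\<lambda>s c. \<Sum>t\<in>keys w.
    single (fst s \<otimes>\<^sub>E fst t, snd s \<otimes>\<^sub>F snd t) (c * lookup w t)"])
    (simp_all add: distrib_right single_add sum.distrib)

lemma fsum_mult_add_right:
  "v \<otimes>\<^bsub>FSum E F\<^esub> (w + w') = v \<otimes>\<^bsub>FSum E F\<^esub> w + v \<otimes>\<^bsub>FSum E F\<^esub> w'"
  unfolding fsum_mult_eq sum.distrib[symmetric]
  by (rule sum.cong[OF refl], rule setsum_keys_plus_distrib[where f = "\<lambda>t c.
    single (fst _ \<otimes>\<^sub>E fst t, snd _ \<otimes>\<^sub>F snd t) (lookup v _ * c)"])
    (simp_all add: distrib_left single_add)

lemma fsum_mult_single: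
  "single s c \<otimes>\<^bsub>FSum E F\<^esub> single t d =
    single (fst s \<otimes>\<^sub>E fst t, snd s \<otimes>\<^sub>F snd t) (c * d)" by (simp add: fsum_mult_eq)

lemma fsum_mult_zero [simp]:
  "0 \<otimes>\<^bsub>FSum E F\<^esub> w = 0" "w \<otimes>\<^bsub>FSum E F\<^esub> 0 = 0"
  by (simp_all add: fsum_mult_eq)

locale am_pair = E: am_algebra E + F: am_algebra F for E :: "'a lcs" and F :: "'b lcs"
begin

sublocale lc_pair E F by unfold_locales

abbreviation fmul :: "('a \<times> 'b \<Rightarrow>\<^sub>0 complex) => ('a \<times> 'b \<Rightarrow>\<^sub>0 complex) => ('a \<times> 'b \<Rightarrow>\<^sub>0 complex)" where
  "fmul v w \<equiv> v \<otimes>\<^sub>FS w"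

abbreviation KS where "KS \<equiv> car E \<times> car F"

lemma fmul_closed:
  assumes v: "keys v \<subseteq> KS" and w: "keys w \<subseteq> KS"
  shows "keys (fmul v w) \<subseteq> KS" using v
proof (induction v rule: free_vector_induct)
  case (step s c v)
  have "keys (fmul (single s c) w) \<subseteq> KS" using w
  proof (induction w rule: free_vector_induct)
    case (step t d w)
    have "(fst s \<otimes>\<^sub>E fst t, snd s \<otimes>\<^sub>F snd t) \<in> KS" using \<open>s \<in> KS\<close> \<open>t \<in> KS\<close> by auto
    then show ?case unfolding fsum_mult_add_right fsum_mult_single by (intro keys_add_subset keys_single_subset step.IH)
  qed simp
  then show ?case unfolding fsum_mult_add_left by (intro keys_add_subset step.IH)
qed simp

lemma fmul_assoc:
  assumes u: "keys u \<subseteq> KS" and v: "keys v \<subseteq> KS" and w: "keys w \<subseteq> KS"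
  shows "fmul (fmul u v) w = fmul u (fmul v w)" using u
proof (induction u rule: free_vector_induct)
  case (step a c u)
  have "fmul (fmul (single a c) v) w = fmul (single a c) (fmul v w)" using v
  proof (induction v rule: free_vector_induct)
    case (step b d v)
    have "fmul (fmul (single a c) (single b d)) w =
      fmul (single a c) (fmul (single b d) w)" using w
    proof (induction w rule: free_vector_induct)
     case (step e f w)
     have "a \<in> KS" "b \<in> KS" "e \<in> KS" by fact+
     then have "fst a \<otimes>\<^sub>E fst b \<otimes>\<^sub>E fst e = fst a \<otimes>\<^sub>E (fst b \<otimes>\<^sub>E fst e)"
      "snd a \<otimes>\<^sub>F snd b \<otimes>\<^sub>F snd e = snd a \<otimes>\<^sub>F (snd b \<otimes>\<^sub>F snd e)"
      by (auto simp: E.m_assoc F.m_assoc)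
     then show ?case using step.IH by (simp add: fsum_mult_add_right fsum_mult_single mult.assoc)
    qed simp
    then show ?case using step.IH by (simp add: fsum_mult_add_left fsum_mult_add_right)
  qed simp
  then show ?case using step.IH by (simp add: fsum_mult_add_left)
qed simp

lemma fmul_one:
  assumes "keys w \<subseteq> KS"
  shows "fmul (one FS) w = w" "fmul w (one FS) = w" using assms
proof (induction w rule: free_vector_induct)
  case (step s c w)
  have "s \<in> KS" by fact
  then have s: "(\<one>\<^sub>E \<otimes>\<^sub>E fst s, \<one>\<^sub>F \<otimes>\<^sub>F snd s) = s" "(fst s \<otimes>\<^sub>E \<one>\<^sub>E, snd s \<otimes>\<^sub>F \<one>\<^sub>F) = s" by auto
  {
    case 1
    then show ?case using step.IH s by (simp add: fsum_mult_add_right fsum_simps(5) fsum_mult_single)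
  next
    case 2
    then show ?case using step.IH s by (simp add: fsum_mult_add_left fsum_simps(5) fsum_mult_single)
  }
qed simp_all

lemma ring_formal_sums: "Ring.ring FS"
proof (rule ringI)
  show "abelian_group FS" by (rule Q.abelian_group_axioms)
  show "Group.monoid FS" by (rule monoidI)
     (simp_all add: mem_formal_sums fmul_closed fmul_assoc fmul_one fsum_simps(5) keys_single_subset,
      simp_all add: fmul_one flip: fsum_simps(5)[of E F])
qed (simp_all add: fsum_simps(2) fsum_mult_add_left fsum_mult_add_right)

lemma scale_fmul:
  assumes v: "keys v \<subseteq> KS" and w: "keys w \<subseteq> KS"
  shows "fmul (scale c v) w = scale c (fmul v w)" "fmul v (scale c w) = scale c (fmul v w)"
proof -
  have z: "scale c (0 :: 'a \<times> 'b \<Rightarrow>\<^sub>0 complex) = 0" for c by (rule poly_mapping_eqI) (simp add: lookup_scale)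
  have "fmul (scale c v) w = scale c (fmul v w) \<and> fmul v (scale c w) = scale c (fmul v w)" using v
  proof (induction v rule: free_vector_induct)
    case (step s d v)
    have "fmul (scale c (single s d)) w = scale c (fmul (single s d) w) \<and>
      fmul (single s d) (scale c w) = scale c (fmul (single s d) w)" using w by (induction w rule: free_vector_induct)
      (simp_all add: z scale_add fsum_mult_add_right scale_single fsum_mult_single mult_ac)
    then show ?case using step.IH by (simp add: scale_add fsum_mult_add_left)
  qed (simp add: z)
  then show "fmul (scale c v) w = scale c (fmul v w)" "fmul v (scale c w) = scale c (fmul v w)" by simp_all
qed

text \<open>
  Translation of an elementary tensor by a fixed one is again bilinear, so multiplication by an
  elementary tensor preserves the relations of the tensor product.
\<close>

lemma single_mult_null:
  assumes s: "s \<in> KS" and w: "w \<in> tensor_null E F"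
  shows "fmul (single s c) w \<in> tensor_null E F" "fmul w (single s c) \<in> tensor_null E F"
proof -
  have wc: "w \<in> car FS" using Q.S.a_subset w by auto
  have wk: "keys w \<subseteq> KS" using wc by (simp add: mem_formal_sums)
  have sk: "keys (single s c) \<subseteq> KS" by (rule keys_single_subset[OF s])
  have null: "v \<in> tensor_null E F" if "v \<in> car FS" "Q.proj v = \<zero>\<^sub>AT" for v
    using that lin_zero[OF Q.cvs_axioms cvs_AT lin_proj_AT]
     Q.proj_eq_iff[OF that(1) Q.zero_closed] by simp
  note bt = is_bilinear_tens
  have bil: "is_bilinear E F AT (\<lambda>x y. c \<odot>\<^sub>AT tens (g x) (h y))"
    if g: "is_linear E E g" and h: "is_linear F F h" for g h
  proof -
    interpret AT: cvs AT by (rule cvs_AT)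
    have sc: "is_linear AT AT (\<lambda>u. c \<odot>\<^sub>AT u)"
     by (rule is_linearI) (simp_all add: AT.smult_r_distr AT.smult_assoc mult.commute)
    show ?thesis
    proof (rule is_bilinearI)
     fix x assume x: "x \<in> car E"
     show "is_linear F AT (\<lambda>y. c \<odot>\<^sub>AT tens (g x) (h y))"
      by (rule lin_compose[OF lin_compose[OF h is_bilinearD(1)[OF bt lin_closed[OF g x]]] sc])
    next
     fix y assume y: "y \<in> car F"
     show "is_linear E AT (\<lambda>x. c \<odot>\<^sub>AT tens (g x) (h y))"
      by (rule lin_compose[OF lin_compose[OF g is_bilinearD(2)[OF bt lin_closed[OF h y]]] sc])
    qed
  qed
  have val: "Q.proj (single (x, y) c) = c \<odot>\<^sub>AT tens x y" if "x \<in> car E" "y \<in> car F" for x y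
    using lin_smult[OF lin_proj_AT single_mem_formal_sums[OF that, of 1], of c]
    by (simp add: tens_def fsum_simps scale_single)
  have sc: "fst s \<in> car E" "snd s \<in> car F" using s by auto
  have lin: "is_linear FS FS (\<lambda>w. fmul (single s c) w)" "is_linear FS FS (\<lambda>w. fmul w (single s c))"
    by (rule is_linearI; simp add: fsum_simps fmul_closed[OF sk] fmul_closed[OF _ sk]
      fsum_mult_add_left fsum_mult_add_right scale_fmul(2)[OF sk] scale_fmul(1)[OF _ sk])+
  have l: "is_linear E E (\<lambda>x. fst s \<otimes>\<^sub>E x)" "is_linear F F (\<lambda>y. snd s \<otimes>\<^sub>F y)"
    "is_linear E E (\<lambda>x. x \<otimes>\<^sub>E fst s)" "is_linear F F (\<lambda>y. y \<otimes>\<^sub>F snd s)"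
    using sc by (auto intro!: is_linearI simp: E.r_distr F.r_distr E.l_distr F.l_distr
      E.smult_mult_left E.smult_mult_right F.smult_mult_left F.smult_mult_right)
  have eq1: "Q.proj (fmul (single s c) w) =
     lincomb AT (uncurried (\<lambda>x y. c \<odot>\<^sub>AT tens (fst s \<otimes>\<^sub>E x) (snd s \<otimes>\<^sub>F y))) w"
  proof -
    interpret AT: cvs AT by (rule cvs_AT)
    have "Q.proj (fmul (single s c) w) =
      lincomb AT (\<lambda>t. Q.proj (fmul (single s c) (single t 1))) w"
     by (rule linear_formal_sums_eq_lincomb[OF cvs_AT lin_compose[OF lin(1) lin_proj_AT] wc])
    also have "\<dots> = lincomb AT (uncurried (\<lambda>x y. c \<odot>\<^sub>AT tens (fst s \<otimes>\<^sub>E x) (snd s \<otimes>\<^sub>F y))) w"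
     by (rule AT.lincomb_cong[OF _ is_bilinear_uncurried[OF bil[OF l(1,2)]] wk])
      (use sc in \<open>auto simp: fsum_mult_single val\<close>)
    finally show ?thesis .
  qed
  have eq2: "Q.proj (fmul w (single s c)) =
     lincomb AT (uncurried (\<lambda>x y. c \<odot>\<^sub>AT tens (x \<otimes>\<^sub>E fst s) (y \<otimes>\<^sub>F snd s))) w"
  proof -
    interpret AT: cvs AT by (rule cvs_AT)
    have "Q.proj (fmul w (single s c)) =
      lincomb AT (\<lambda>t. Q.proj (fmul (single t 1) (single s c))) w"
     by (rule linear_formal_sums_eq_lincomb[OF cvs_AT lin_compose[OF lin(2) lin_proj_AT] wc])
    also have "\<dots> = lincomb AT (uncurried (\<lambda>x y. c \<odot>\<^sub>AT tens (x \<otimes>\<^sub>E fst s) (y \<otimes>\<^sub>F snd s))) w"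
     by (rule AT.lincomb_cong[OF _ is_bilinear_uncurried[OF bil[OF l(3,4)]] wk])
      (use sc in \<open>auto simp: fsum_mult_single val\<close>)
    finally show ?thesis .
  qed
  show "fmul (single s c) w \<in> tensor_null E F" using lincomb_bilinear_null[OF cvs_AT bil[OF l(1,2)] w] eq1
    by (intro null lin_closed[OF lin(1) wc]) simp
  show "fmul w (single s c) \<in> tensor_null E F" using lincomb_bilinear_null[OF cvs_AT bil[OF l(3,4)] w] eq2
    by (intro null lin_closed[OF lin(2) wc]) simp
qed

lemma subgroup_tensor_null: "subgroup (tensor_null E F) (add_monoid FS)"
  by (rule submodule.axioms(1)[OF submodule_tensor_null])

lemma ideal_tensor_null: "ideal (tensor_null E F) FS"
proof (rule idealI[OF ring_formal_sums subgroup_tensor_null])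
  fix w v assume w: "w \<in> tensor_null E F" and v: "v \<in> car FS"
  have plus: "a + b \<in> tensor_null E F" if "a \<in> tensor_null E F" "b \<in> tensor_null E F" for a b
    using Q.S.a_closed[OF that] by (simp add: fsum_simps)
  have zero: "0 \<in> tensor_null E F" using Q.S.zero_closed by (simp add: fsum_simps)
  have vk: "keys v \<subseteq> KS" using v by (simp add: mem_formal_sums)
  show "fmul v w \<in> tensor_null E F" using vk by (induction v rule: free_vector_induct)
     (simp_all add: zero fsum_mult_add_left plus single_mult_null(1)[OF _ w])
  show "fmul w v \<in> tensor_null E F" using vk by (induction v rule: free_vector_induct)
     (simp_all add: zero fsum_mult_add_right plus single_mult_null(2)[OF _ w])
qed

text \<open>
  For submultiplicative \<open>p\<close> and \<open>r\<close> the weighted sum over a representation is submultiplicative already before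
  infima are taken; this is the reason why the projective tensor product of Arens--Michael algebras is again of this type.
\<close>

lemma weight_mult:
  assumes p: "submult E p" and r: "submult F r"
    and v: "v \<in> car FS" and w: "w \<in> car FS"
  shows "weight p r (fmul v w) \<le> weight p r v * weight p r w"
proof -
  note pc = submultD(1)[OF p] and rc = submultD(1)[OF r]
  note sp = E.csnD[OF pc] and sr = F.csnD[OF rc]
  note sw = is_seminorm_weight[OF sp sr]
  have k: "s \<in> KS" if "s \<in> keys v" for s using that v by (auto simp: mem_formal_sums)
  have k': "t \<in> KS" if "t \<in> keys w" for t using that w by (auto simp: mem_formal_sums)
  have ws: "(\<Sum>i\<in>I. f i) \<in> car FS \<and> weight p r (\<Sum>i\<in>I. f i) \<le> (\<Sum>i\<in>I. weight p r (f i))"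
    if "finite I" "\<And>i. i \<in> I ==> f i \<in> car FS" for I :: "'z set" and f using that
  proof (induction I)
    case empty
    then show ?case using Q.zero_closed Q.seminorm_zero[OF sw] by (simp add: fsum_simps(3))
  next
    case (insert a I)
    have "f a \<in> car FS" "(\<Sum>i\<in>I. f i) \<in> car FS" using insert by auto
    then have "f a + (\<Sum>i\<in>I. f i) \<in> car FS"
     "weight p r (f a + (\<Sum>i\<in>I. f i)) \<le> weight p r (f a) + weight p r (\<Sum>i\<in>I. f i)"
     using Q.a_closed Q.seminorm_add[OF sw] by (simp_all add: fsum_simps(2))
    moreover have "weight p r (\<Sum>i\<in>I. f i) \<le> (\<Sum>i\<in>I. weight p r (f i))" using insert by auto
    ultimately show ?case using insert(1,2) by simp
  qed
  define g where "g s t = single (fst s \<otimes>\<^sub>E fst t, snd s \<otimes>\<^sub>F snd t)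
     (lookup v s * lookup w t)" for s t
  have g: "g s t \<in> car FS" if "s \<in> KS" "t \<in> KS" for s t
    using that unfolding g_def by (intro single_mem_formal_sums) auto
  have g_le: "weight p r (g s t) \<le> (cmod (lookup v s) * p (fst s) * r (snd s)) *
     (cmod (lookup w t) * p (fst t) * r (snd t))" if "s \<in> KS" "t \<in> KS" for s t
  proof -
    have c: "fst s \<in> car E" "fst t \<in> car E" "snd s \<in> car F" "snd t \<in> car F" using that by auto
    have "weight p r (g s t) = (cmod (lookup v s) * cmod (lookup w t)) *
      (p (fst s \<otimes>\<^sub>E fst t) * r (snd s \<otimes>\<^sub>F snd t))"
     by (simp add: g_def weight_single norm_mult mult_ac)
    also have "\<dots> \<le> (cmod (lookup v s) * cmod (lookup w t)) *
      ((p (fst s) * p (fst t)) * (r (snd s) * r (snd t)))" using submultD(2)[OF p c(1,2)] submultD(2)[OF r c(3,4)] c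
      E.sn_nonneg[OF sp] F.sn_nonneg[OF sr] by (intro mult_left_mono mult_mono) auto
    finally show ?thesis by (simp add: mult_ac)
  qed
  have "weight p r (fmul v w) = weight p r (\<Sum>s\<in>keys v. \<Sum>t\<in>keys w. g s t)"
    by (simp add: fsum_mult_eq g_def)
  also have "\<dots> \<le> (\<Sum>s\<in>keys v. weight p r (\<Sum>t\<in>keys w. g s t))"
    by (rule ws[THEN conjunct2, OF finite_keys], rule ws[THEN conjunct1, OF finite_keys], rule g[OF k k'])
  also have "\<dots> \<le> (\<Sum>s\<in>keys v. \<Sum>t\<in>keys w. weight p r (g s t))"
    by (rule sum_mono, rule ws[THEN conjunct2, OF finite_keys], rule g[OF k k'])
  also have "\<dots> \<le> (\<Sum>s\<in>keys v. \<Sum>t\<in>keys w.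
     (cmod (lookup v s) * p (fst s) * r (snd s)) * (cmod (lookup w t) * p (fst t) * r (snd t)))"
    by (intro sum_mono g_le k k')
  also have "\<dots> = weight p r v * weight p r w" unfolding weight_def by (simp add: sum_product)
  finally show ?thesis .
qed

lemma AT_simps:
  "v \<in> car FS ==> w \<in> car FS ==> Q.proj v \<otimes>\<^sub>AT Q.proj w = Q.proj (fmul v w)"
  "one AT = Q.proj (one FS)" by (simp_all add: alg_tensor_def Let_def Q.mult_quot[OF ideal_tensor_null] Q.one_quot)

lemma am_algebra_AT: "am_algebra AT"
proof -
  have R: "Ring.ring AT" unfolding alg_tensor_def Let_def by (rule ring_extend[OF Q.ring_quot[OF ideal_tensor_null]])
  interpret FS: ring FS by (rule ring_formal_sums)
  note lp = lin_proj_AT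
  have sm: "(c \<odot>\<^sub>AT X) \<otimes>\<^sub>AT Y = c \<odot>\<^sub>AT (X \<otimes>\<^sub>AT Y) \<and> X \<otimes>\<^sub>AT (c \<odot>\<^sub>AT Y) = c \<odot>\<^sub>AT (X \<otimes>\<^sub>AT Y)"
    if X: "X \<in> car AT" and Y: "Y \<in> car AT" for c X Y
  proof -
    obtain x where x: "X = Q.proj x" "x \<in> car FS" using X unfolding alg_tensor_carrier by (elim imageE)
    obtain y where y: "Y = Q.proj y" "y \<in> car FS" using Y unfolding alg_tensor_carrier by (elim imageE)
    have k: "keys x \<subseteq> KS" "keys y \<subseteq> KS" using x y by (simp_all add: mem_formal_sums)
    note lx = lin_smult[OF lp x(2), of c, symmetric] and ly = lin_smult[OF lp y(2), of c, symmetric]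
     and lxy = lin_smult[OF lp FS.m_closed[OF x(2) y(2)], of c, symmetric]
    have "fmul (c \<odot>\<^sub>FS x) y = c \<odot>\<^sub>FS fmul x y" "fmul x (c \<odot>\<^sub>FS y) = c \<odot>\<^sub>FS fmul x y"
     by (simp_all add: fsum_simps(4) scale_fmul[OF k])
    then show ?thesis unfolding x(1) y(1) AT_simps(1)[OF x(2) y(2)] lx ly lxy using x(2) y(2) by (simp add: AT_simps(1))
  qed
  have dom: "\<exists>s. submult AT s \<and> sn_le AT q s" if q: "q \<in> csn AT" for q
  proof -
    obtain p r where pr: "p \<in> csn E" "r \<in> csn F" and le: "sn_le AT q (proj_seminorm p r)"
     using AT_cont_seminorm_le_proj[OF q] by (elim bexE)
    obtain p' where p': "submult E p'" "sn_le E p p'" using E.submult_above[OF pr(1)] by (elim exE conjE)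
    obtain r' where r': "submult F r'" "sn_le F r r'" using F.submult_above[OF pr(2)] by (elim exE conjE)
    note pc = submultD(1)[OF p'(1)] and rc = submultD(1)[OF r'(1)]
    have sw: "is_seminorm FS (weight p' r')" by (rule is_seminorm_weight[OF E.csnD[OF pc] F.csnD[OF rc]])
    have "submult AT (proj_seminorm p' r')" unfolding submult_def
    proof (intro conjI ballI)
     show "proj_seminorm p' r' \<in> csn AT" by (rule proj_seminorm_cont[OF pc rc])
     fix X Y assume "X \<in> car AT" "Y \<in> car AT"
     then show "proj_seminorm p' r' (X \<otimes>\<^sub>AT Y) \<le> proj_seminorm p' r' X * proj_seminorm p' r' Y"
      unfolding proj_seminorm_quot using Q.qsn_submult[OF ideal_tensor_null sw weight_mult[OF p'(1) r'(1)]]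
      by (simp add: alg_tensor_def Let_def)
    qed
    moreover have "sn_le AT q (proj_seminorm p' r')"
     by (rule sn_le_trans[OF le proj_seminorm_mono[OF pr pc p'(2) r'(2)]])
    ultimately show ?thesis by (intro exI[of _ "proj_seminorm p' r'"] conjI)
  qed
  show ?thesis by (intro am_algebra.intro lc_space_AT R am_algebra_axioms.intro dom) (simp_all add: sm)
qed

lemma am_algebra_T: "am_algebra T"
  unfolding proj_tensor_def by (rule am_algebra.am_algebra_completion[OF am_algebra_AT])

lemma pure_mult:
  assumes "x \<in> car E" "y \<in> car F" "x' \<in> car E" "y' \<in> car F"
  shows "pure E F x y \<otimes>\<^sub>T pure E F x' y' = pure E F (x \<otimes>\<^sub>E x') (y \<otimes>\<^sub>F y')"
proof -
  have "tens x y \<otimes>\<^sub>AT tens x' y' = tens (x \<otimes>\<^sub>E x') (y \<otimes>\<^sub>F y')"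
    unfolding tens_def AT_simps(1)[OF single_mem_formal_sums[OF assms(1,2)] single_mem_formal_sums[OF assms(3,4)]]
    by (simp add: fsum_mult_single)
  then show ?thesis unfolding pure_tensor_eq proj_tensor_def
    using am_algebra.to_completion_mult[OF am_algebra_AT tens_closed[OF assms(1,2)] tens_closed[OF assms(3,4)]] by simp
qed

lemma pure_one: "pure E F \<one>\<^sub>E \<one>\<^sub>F = \<one>\<^sub>T"
proof -
  have "tens \<one>\<^sub>E \<one>\<^sub>F = \<one>\<^sub>AT" by (simp add: tens_def AT_simps(2) fsum_simps(5))
  then show ?thesis
    unfolding pure_tensor_eq proj_tensor_def using am_algebra.to_completion_one[OF am_algebra_AT] by simp
qed

end

lemma (in am_algebra) cont_linear_mult_left:
  assumes a: "a \<in> car A"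
  shows "cont_linear A A (\<lambda>x. a \<otimes> x)"
proof (rule cont_linearI[OF lc_space_axioms lc_space_axioms])
  show "is_linear A A (\<lambda>x. a \<otimes> x)" using a by (intro is_linearI) (simp_all add: r_distr smult_mult_right)
  fix p assume p: "p \<in> csn A"
  obtain s where s: "submult A s" "sn_le A p s" using submult_above[OF p] by (elim exE conjE)
  note sc = submultD(1)[OF s(1)]
  show "\<exists>r\<in>csn A. \<forall>x\<in>car A. p (a \<otimes> x) \<le> r x"
  proof (rule bexI[OF _ csn_scale[OF sc sn_nonneg[OF csnD[OF sc] a]]], intro ballI)
    fix x assume x: "x \<in> car A"
    show "p (a \<otimes> x) \<le> s a * s x"
     by (rule order_trans[OF sn_leD[OF s(2) m_closed[OF a x]] submultD(2)[OF s(1) a x]])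
  qed
qed

lemma (in am_algebra) cont_linear_mult_right:
  assumes a: "a \<in> car A"
  shows "cont_linear A A (\<lambda>x. x \<otimes> a)"
proof (rule cont_linearI[OF lc_space_axioms lc_space_axioms])
  show "is_linear A A (\<lambda>x. x \<otimes> a)" using a by (intro is_linearI) (simp_all add: l_distr smult_mult_left)
  fix p assume p: "p \<in> csn A"
  obtain s where s: "submult A s" "sn_le A p s" using submult_above[OF p] by (elim exE conjE)
  note sc = submultD(1)[OF s(1)]
  show "\<exists>r\<in>csn A. \<forall>x\<in>car A. p (x \<otimes> a) \<le> r x"
  proof (rule bexI[OF _ csn_scale[OF sc sn_nonneg[OF csnD[OF sc] a]]], intro ballI)
    fix x assume x: "x \<in> car A"
    show "p (x \<otimes> a) \<le> s a * s x"
     using order_trans[OF sn_leD[OF s(2) m_closed[OF x a]] submultD(2)[OF s(1) x a]] by (simp add: mult.commute)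
  qed
qed

text \<open>Multiplicativity extends by density, in one argument at a time.\<close>

lemma multiplicative_on_total:
  assumes A: "am_algebra A" and B: "am_algebra B" and cB: "is_complete_lcs B" and f: "cont_linear A B f"
    and tot: "total_in A K Y"
    and m: "\<And>j k. j \<in> K ==> k \<in> K ==> f (Y j \<otimes>\<^sub>A Y k) = f (Y j) \<otimes>\<^sub>B f (Y k)"
    and x: "x \<in> car A" and y: "y \<in> car A"
  shows "f (x \<otimes>\<^sub>A y) = f x \<otimes>\<^sub>B f y"
proof -
  interpret A: am_algebra A by fact
  interpret B: am_algebra B by fact
  have fc: "f a \<in> car B" if "a \<in> car A" for a by (rule lin_closed[OF cont_linearD[OF f] that])
  have Yc: "Y k \<in> car A" if "k \<in> K" for k using total_in_family[OF tot] that by auto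
  have 1: "f (a \<otimes>\<^sub>A Y k) = f a \<otimes>\<^sub>B f (Y k)" if k: "k \<in> K" and a: "a \<in> car A" for k a
    by (rule cont_linear_eq_on_total[OF A.lc_space_axioms cB
       clin_compose[OF A.cont_linear_mult_right[OF Yc[OF k]] f]
       clin_compose[OF f B.cont_linear_mult_right[OF fc[OF Yc[OF k]]]] tot m[OF _ k] a])
  show ?thesis by (rule cont_linear_eq_on_total[OF A.lc_space_axioms cB
       clin_compose[OF A.cont_linear_mult_left[OF x] f]
       clin_compose[OF f B.cont_linear_mult_left[OF fc[OF x]]] tot 1[OF _ x] y])
qed

lemma homI:
  assumes "cont_linear A B f" "\<And>x y. x \<in> car A ==> y \<in> car A ==> f (x \<otimes>\<^sub>A y) = f x \<otimes>\<^sub>B f y"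
    "f \<one>\<^sub>A = \<one>\<^sub>B"
  shows "cont_alg_hom A B f" unfolding cont_alg_hom_def by (intro conjI assms(1) ring_hom_memI)
    (simp_all add: assms(2,3) lin_closed[OF cont_linearD[OF assms(1)]] lin_add[OF cont_linearD[OF assms(1)]])

lemma homD:
  assumes "cont_alg_hom A B f"
  shows "cont_linear A B f" "is_linear A B f"
    "x \<in> car A ==> f x \<in> car B"
    "x \<in> car A ==> y \<in> car A ==> f (x \<otimes>\<^sub>A y) = f x \<otimes>\<^sub>B f y"
    "f \<one>\<^sub>A = \<one>\<^sub>B"
  using assms cont_linearD[of A B f] lin_closed[of A B f x] unfolding cont_alg_hom_def
  by (auto simp: ring_hom_mult ring_hom_one)

lemma cont_alg_hom_compose:
  assumes f: "cont_alg_hom A B f" and g: "cont_alg_hom B C g"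
  shows "cont_alg_hom A C (\<lambda>x. g (f x))" by (rule homI[OF clin_compose[OF homD(1)[OF f] homD(1)[OF g]]])
    (simp_all add: homD(3-5)[OF f] homD(3-5)[OF g])

lemma cont_alg_hom_id: "cont_alg_hom A A (\<lambda>x. x)" by (rule homI[OF cont_linear_id]) simp_all

section \<open>Maps between tensor products\<close>

lemma bounded_pure_maps:
  assumes EF: "lc_pair E F" and EF': "lc_pair E' F'" and f: "cont_linear E E' f" and g: "cont_linear F F' g"
  shows "lc_pair.bounded_bilinear_map E F (PT E' F') (\<lambda>x y. pure E' F' (f x) (g y))"
proof -
  interpret S: lc_pair E F by fact
  interpret R: lc_pair E' F' by fact
  note lf = cont_linearD[OF f] and lg = cont_linearD[OF g]
  show ?thesis unfolding S.bounded_bilinear_map_def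
  proof (intro conjI ballI)
    show "is_bilinear E F (PT E' F') (\<lambda>x y. pure E' F' (f x) (g y))"
    proof (rule is_bilinearI)
     fix x assume "x \<in> car E"
     then show "is_linear F (PT E' F') (\<lambda>y. pure E' F' (f x) (g y))"
      by (intro lin_compose[OF lg is_bilinearD(1)[OF R.is_bilinear_pure lin_closed[OF lf]]])
    next
     fix y assume "y \<in> car F"
     then show "is_linear E (PT E' F') (\<lambda>x. pure E' F' (f x) (g y))"
      by (intro lin_compose[OF lf is_bilinearD(2)[OF R.is_bilinear_pure lin_closed[OF lg]]])
    qed
    fix q assume "q \<in> csn (PT E' F')"
    from R.T_cont_seminorm_bound[OF this] obtain p r where pr: "p \<in> csn E'" "r \<in> csn F'"
     and le: "sn_le (PT E' F') q (R.tproj p r)" by (elim bexE)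
    show "\<exists>p\<in>csn E. \<exists>r\<in>csn F. \<forall>x\<in>car E. \<forall>y\<in>car F.
      q (pure E' F' (f x) (g y)) \<le> p x * r y"
    proof (rule bexI, rule bexI, intro ballI)
     show "(\<lambda>x. p (f x)) \<in> csn E" "(\<lambda>y. r (g y)) \<in> csn F"
      by (rule cont_linear_seminorm[OF S.E.lc_space_axioms R.E.lc_space_axioms f pr(1)],
        rule cont_linear_seminorm[OF S.F.lc_space_axioms R.F.lc_space_axioms g pr(2)])
     fix x y assume "x \<in> car E" "y \<in> car F"
     then have c: "f x \<in> car E'" "g y \<in> car F'" using lin_closed[OF lf] lin_closed[OF lg] by auto
     show "q (pure E' F' (f x) (g y)) \<le> p (f x) * r (g y)"
      by (rule order_trans[OF sn_leD[OF le R.pure_closed[OF c]] R.tproj_pure_le[OF pr c]])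
    qed
  qed
qed

lemma tensor_map_cont:
  assumes "lc_pair E F" "lc_pair E' F'" "cont_linear E E' f" "cont_linear F F' g"
  shows "cont_linear (PT E F) (PT E' F') (tensor_map E F E' F' f g)"
    and "x \<in> car E ==> y \<in> car F ==>
     tensor_map E F E' F' f g (pure E F x y) = pure E' F' (f x) (g y)" unfolding tensor_map_def
  using lc_pair.linearization_cont[OF assms(1) lc_pair.tensor_complete[OF assms(2)] bounded_pure_maps[OF assms]]
    lc_pair.linearization_pure[OF assms(1) lc_pair.tensor_complete[OF assms(2)] bounded_pure_maps[OF assms], of x y]
  by blast+

text \<open>
  Multiplicativity needs to be verified on elementary tensors only, because these are total.
\<close>

lemma hom_from_tensor:
  assumes EF: "am_pair E F" and B: "am_algebra B" and cB: "is_complete_lcs B"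
    and h: "cont_linear (PT E F) B h"
    and m: "\<And>x y x' y'. x \<in> car E ==> y \<in> car F ==> x' \<in> car E ==> y' \<in> car F ==>
     h (pure E F (x \<otimes>\<^sub>E x') (y \<otimes>\<^sub>F y')) = h (pure E F x y) \<otimes>\<^sub>B h (pure E F x' y')"
    and one: "h (pure E F \<one>\<^sub>E \<one>\<^sub>F) = \<one>\<^sub>B"
  shows "cont_alg_hom (PT E F) B h"
proof -
  interpret S: am_pair E F by fact
  show ?thesis
  proof (rule homI[OF h])
    show "h \<one>\<^bsub>PT E F\<^esub> = \<one>\<^sub>B" using one by (simp add: S.pure_one)
    fix t u assume t: "t \<in> car (PT E F)" and u: "u \<in> car (PT E F)"
    show "h (t \<otimes>\<^bsub>PT E F\<^esub> u) = h t \<otimes>\<^sub>B h u"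
    proof (rule multiplicative_on_total[OF S.am_algebra_T B cB h S.total_pure _ t u])
     fix j k assume "j \<in> car E \<times> car F" "k \<in> car E \<times> car F"
     then show "h (pure E F (fst j) (snd j) \<otimes>\<^bsub>PT E F\<^esub> pure E F (fst k) (snd k)) =
       h (pure E F (fst j) (snd j)) \<otimes>\<^sub>B h (pure E F (fst k) (snd k))"
      by (subst S.pure_mult) (auto intro: m)
    qed
  qed
qed

lemma tensor_map_hom:
  assumes EF: "am_pair E F" and EF': "am_pair E' F'" and f: "cont_alg_hom E E' f" and g: "cont_alg_hom F F' g"
  shows "cont_alg_hom (PT E F) (PT E' F') (tensor_map E F E' F' f g)"
proof -
  interpret S: am_pair E F by fact
  interpret R: am_pair E' F' by fact
  note c = tensor_map_cont[OF S.lc_pair_axioms R.lc_pair_axioms homD(1)[OF f] homD(1)[OF g]]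
  show ?thesis by (rule hom_from_tensor[OF EF R.am_algebra_T R.tensor_complete c(1)])
     (simp_all add: c(2) homD(3-5)[OF f] homD(3-5)[OF g] R.pure_mult R.pure_one)
qed

locale lc_triple = E: lc_space E + F: lc_space F + G: lc_space G
  for E :: "'a lcs" and F :: "'b lcs" and G :: "'c lcs"
begin

sublocale EF: lc_pair E F by unfold_locales
sublocale FG: lc_pair F G by unfold_locales
sublocale L: lc_pair "PT E F" G by (rule lc_pair.intro[OF EF.lc_space_T G.lc_space_axioms])
sublocale R: lc_pair E "PT F G" by (rule lc_pair.intro[OF E.lc_space_axioms FG.lc_space_T])

text \<open>The candidate for the associativity constraint, for a fixed last factor \<open>z\<close>.\<close>

abbreviation slice :: "'c => ('a, 'b) tensor => ('a, ('b, 'c) tensor) tensor" where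
  "slice z \<equiv> linearization E F R.T (\<lambda>x y. pure E (PT F G) x (pure F G y z))"

lemma R_bound:
  assumes "q \<in> csn R.T"
  shows "\<exists>p\<in>csn E. \<exists>r\<in>csn F. \<exists>s\<in>csn G. \<forall>x\<in>car E. \<forall>y\<in>car F. \<forall>z\<in>car G.
    q (pure E (PT F G) x (pure F G y z)) \<le> p x * (r y * s z)"
proof -
  obtain p u where pu: "p \<in> csn E" "u \<in> csn FG.T" and le: "sn_le R.T q (R.tproj p u)"
    using R.T_cont_seminorm_bound[OF assms] by (elim bexE)
  obtain r s where rs: "r \<in> csn F" "s \<in> csn G" and le': "sn_le FG.T u (FG.tproj r s)"
    using FG.T_cont_seminorm_bound[OF pu(2)] by (elim bexE)
  have "q (pure E (PT F G) x (pure F G y z)) \<le> p x * (r y * s z)"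
    if x: "x \<in> car E" and y: "y \<in> car F" and z: "z \<in> car G" for x y z
  proof -
    have "q (pure E (PT F G) x (pure F G y z)) \<le> p x * u (pure F G y z)"
     by (rule order_trans[OF sn_leD[OF le R.pure_closed[OF x FG.pure_closed[OF y z]]]
        R.tproj_pure_le[OF pu x FG.pure_closed[OF y z]]])
    also have "\<dots> \<le> p x * (r y * s z)"
     by (rule mult_left_mono[OF order_trans[OF sn_leD[OF le' FG.pure_closed[OF y z]] FG.tproj_pure_le[OF rs y z]]
        E.sn_nonneg[OF E.csnD[OF pu(1)] x]])
    finally show ?thesis .
  qed
  then show ?thesis using pu(1) rs by (intro bexI[of _ p] bexI[of _ r] bexI[of _ s] ballI)
qed

lemma bounded_slice:
  assumes z: "z \<in> car G"
  shows "EF.bounded_bilinear_map R.T (\<lambda>x y. pure E (PT F G) x (pure F G y z))"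
  unfolding EF.bounded_bilinear_map_def
proof (intro conjI ballI)
  show "is_bilinear E F R.T (\<lambda>x y. pure E (PT F G) x (pure F G y z))"
  proof (rule is_bilinearI)
    fix x assume x: "x \<in> car E"
    show "is_linear F R.T (\<lambda>y. pure E (PT F G) x (pure F G y z))"
     by (rule lin_compose[OF is_bilinearD(2)[OF FG.is_bilinear_pure z] is_bilinearD(1)[OF R.is_bilinear_pure x]])
  next
    fix y assume y: "y \<in> car F"
    show "is_linear E R.T (\<lambda>x. pure E (PT F G) x (pure F G y z))"
     by (rule is_bilinearD(2)[OF R.is_bilinear_pure FG.pure_closed[OF y z]])
  qed
  fix q assume "q \<in> csn R.T"
  from R_bound[OF this] obtain p r s where prs: "p \<in> csn E" "r \<in> csn F" "s \<in> csn G"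
    and le: "\<forall>x\<in>car E. \<forall>y\<in>car F. \<forall>z\<in>car G.
     q (pure E (PT F G) x (pure F G y z)) \<le> p x * (r y * s z)" by (elim bexE)
  show "\<exists>p\<in>csn E. \<exists>r\<in>csn F. \<forall>x\<in>car E. \<forall>y\<in>car F.
     q (pure E (PT F G) x (pure F G y z)) \<le> p x * r y"
  proof (rule bexI[OF _ E.csn_scale[OF prs(1) G.sn_nonneg[OF G.csnD[OF prs(3)] z]]],
     rule bexI[OF _ prs(2)], intro ballI)
    fix x y assume "x \<in> car E" "y \<in> car F"
    from le[rule_format, OF this z]
    show "q (pure E (PT F G) x (pure F G y z)) \<le> s z * p x * r y" by (simp add: mult_ac)
  qed
qed

lemma slice_cont: "z \<in> car G ==> cont_linear EF.T R.T (slice z)"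
  by (rule EF.linearization_cont[OF R.tensor_complete bounded_slice])

lemma slice_pure:
  "x \<in> car E ==> y \<in> car F ==> z \<in> car G ==>
    slice z (pure E F x y) = pure E (PT F G) x (pure F G y z)"
  by (rule EF.linearization_pure[OF R.tensor_complete bounded_slice])

text \<open>
  For fixed \<open>z\<close> the candidate is determined by its values on elementary tensors, which makes it linear in \<open>z\<close>; the bound
  in both variables comes from the estimate on elementary tensors.
\<close>

lemma bounded_assoc: "L.bounded_bilinear_map R.T (\<lambda>t z. slice z t)" unfolding L.bounded_bilinear_map_def
proof (intro conjI ballI)
  interpret RT: lc_space R.T by (rule R.lc_space_T)
  have slc: "slice z t \<in> car R.T" if "z \<in> car G" "t \<in> car EF.T" for z t
    by (rule lin_closed[OF cont_linearD[OF slice_cont[OF that(1)]] that(2)])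
  show "is_bilinear EF.T G R.T (\<lambda>t z. slice z t)"
  proof (rule is_bilinearI)
    fix z assume z: "z \<in> car G"
    show "is_linear EF.T R.T (slice z)" by (rule cont_linearD[OF slice_cont[OF z]])
  next
    fix t assume t: "t \<in> car EF.T"
    have lin: "is_linear R.T R.T (\<lambda>u. c \<odot>\<^sub>R.T u)" for c
     by (rule is_linearI) (simp_all add: RT.smult_r_distr RT.smult_assoc mult.commute)
    have csc: "cont_linear R.T R.T (\<lambda>u. c \<odot>\<^sub>R.T u)" for c
    proof (rule cont_linearI[OF R.lc_space_T R.lc_space_T lin])
     fix q assume q: "q \<in> csn R.T"
     show "\<exists>r\<in>csn R.T. \<forall>u\<in>car R.T. q (c \<odot>\<^sub>R.T u) \<le> r u"
      by (rule bexI[OF _ RT.csn_scale[OF q norm_ge_zero[of c]]])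
       (simp add: RT.seminorm_smult[OF RT.csnD[OF q]])
    qed
    have cadd: "cont_linear EF.T R.T (\<lambda>t. f t \<oplus>\<^sub>R.T g t)"
     if f: "cont_linear EF.T R.T f" and g: "cont_linear EF.T R.T g" for f g
    proof (rule cont_linearI[OF EF.lc_space_T R.lc_space_T])
     note lf = cont_linearD[OF f] and lg = cont_linearD[OF g]
     show "is_linear EF.T R.T (\<lambda>t. f t \<oplus>\<^sub>R.T g t)"
      by (rule is_linearI) (simp_all add: lin_closed[OF lf] lin_closed[OF lg] lin_add[OF lf]
        lin_add[OF lg] lin_smult[OF lf] lin_smult[OF lg] RT.smult_r_distr RT.a_ac)
     fix q assume q: "q \<in> csn R.T"
     show "\<exists>r\<in>csn EF.T. \<forall>u\<in>car EF.T. q (f u \<oplus>\<^sub>R.T g u) \<le> r u"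
      by (rule bexI[OF _ lc_space.csn_add[OF EF.lc_space_T cont_linear_seminorm[OF EF.lc_space_T R.lc_space_T f q]
         cont_linear_seminorm[OF EF.lc_space_T R.lc_space_T g q]]])
       (simp add: RT.seminorm_add[OF RT.csnD[OF q]] lin_closed[OF lf] lin_closed[OF lg])
    qed
    show "is_linear G R.T (\<lambda>z. slice z t)"
    proof (rule is_linearI)
     fix z z' c assume z: "z \<in> car G"
     show "slice z t \<in> car R.T" by (rule slc[OF z t])
     show "slice (c \<odot>\<^sub>G z) t = c \<odot>\<^sub>R.T slice z t"
     proof (rule EF.tensor_map_unique[OF R.tensor_complete slice_cont[OF G.smult_closed[OF z]] clin_compose[OF slice_cont[OF z] csc] _ t])
      fix x y assume "x \<in> car E" "y \<in> car F"
      then show "slice (c \<odot>\<^sub>G z) (pure E F x y) = c \<odot>\<^sub>R.T slice z (pure E F x y)"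
       using z by (simp add: slice_pure lin_smult[OF is_bilinearD(1)[OF FG.is_bilinear_pure]]
         lin_smult[OF is_bilinearD(1)[OF R.is_bilinear_pure]] FG.pure_closed)
     qed
     assume z': "z' \<in> car G"
     show "slice (z \<oplus>\<^sub>G z') t = slice z t \<oplus>\<^sub>R.T slice z' t"
     proof (rule EF.tensor_map_unique[OF R.tensor_complete slice_cont[OF G.a_closed[OF z z']] cadd[OF slice_cont[OF z] slice_cont[OF z']] _ t])
      fix x y assume "x \<in> car E" "y \<in> car F"
      then show "slice (z \<oplus>\<^sub>G z') (pure E F x y) = slice z (pure E F x y) \<oplus>\<^sub>R.T slice z' (pure E F x y)"
       using z z' by (simp add: slice_pure lin_add[OF is_bilinearD(1)[OF FG.is_bilinear_pure]]
         lin_add[OF is_bilinearD(1)[OF R.is_bilinear_pure]] FG.pure_closed)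
     qed
    qed
  qed
  fix q assume q: "q \<in> csn R.T"
  from R_bound[OF this] obtain p r s where prs: "p \<in> csn E" "r \<in> csn F" "s \<in> csn G"
    and le: "\<forall>x\<in>car E. \<forall>y\<in>car F. \<forall>z\<in>car G.
     q (pure E (PT F G) x (pure F G y z)) \<le> p x * (r y * s z)" by (elim bexE)
  have "q (slice z t) \<le> EF.tproj p r t * s z" if t: "t \<in> car EF.T" and z: "z \<in> car G" for t z
  proof -
    note sz = G.sn_nonneg[OF G.csnD[OF prs(3)] z]
    have szp: "(\<lambda>x. s z * p x) \<in> csn E" by (rule E.csn_scale[OF prs(1) sz])
    have tp: "(\<lambda>t. s z * EF.tproj p r t) \<in> csn EF.T"
     by (rule L.E.csn_scale[OF EF.tproj_cont[OF prs(1,2)] sz])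
    \<comment> \<open>The factor \<open>s z\<close> is moved into the first seminorm.\<close>
    have eq: "EF.tproj (\<lambda>x. s z * p x) r t \<le> s z * EF.tproj p r t"
    proof -
     have w: "weight (\<lambda>x. s z * p x) r v = s z * weight p r v" for v
      unfolding weight_def sum_distrib_left by (intro sum.cong) (auto simp: mult_ac)
     have pm: "proj_seminorm (\<lambda>x. s z * p x) r U \<le> s z * proj_seminorm p r U" if U: "U \<in> car EF.AT" for U
     proof -
      obtain u where u: "U = EF.Q.proj u" "u \<in> car EF.FS" using U unfolding EF.alg_tensor_carrier by (elim imageE)
      note sw = EF.is_seminorm_weight[OF E.csnD[OF prs(1)] F.csnD[OF prs(2)]]
      note sw' = EF.is_seminorm_weight[OF E.csnD[OF szp] F.csnD[OF prs(2)]]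
      have "qsn (weight (\<lambda>x. s z * p x) r) U \<le> qsn (weight p r) U * s z" unfolding u(1)
      proof (rule EF.Q.qsn_greatest_mult[OF sw u(2) sz])
       fix v assume v: "v \<in> car EF.FS" "EF.Q.proj v = EF.Q.proj u"
       show "qsn (weight (\<lambda>x. s z * p x) r) (EF.Q.proj u) \<le> weight p r v * s z"
        unfolding mult.commute[of "weight p r v"] w[symmetric] v(2)[symmetric] by (rule EF.Q.qsn_le[OF sw' v(1)])
      qed
      then show ?thesis unfolding proj_seminorm_quot mult.commute[of "s z" "qsn (weight p r) U"] .
     qed
     note c1 = EF.proj_seminorm_cont[OF szp prs(2)] and c2 = EF.proj_seminorm_cont[OF prs(1,2)]
     have "EF.AT.hat (proj_seminorm (\<lambda>x. s z * p x) r) t \<le> EF.AT.hat (\<lambda>U. s z * proj_seminorm p r U) t"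
      using t pm by (intro EF.AT.hat_mono c1 EF.AT.csn_scale[OF c2 sz] sn_leI) (simp_all add: proj_tensor_def)
     then show ?thesis using t EF.AT.hat_scale[OF _ c2 sz, of t] by (simp add: EF.tproj_def proj_tensor_def)
    qed
    have "q (slice z t) \<le> EF.tproj (\<lambda>x. s z * p x) r t"
    proof (rule EF.linearization_bound[OF R.tensor_complete bounded_slice[OF z] q szp prs(2) _ t], intro ballI)
     fix x y assume "x \<in> car E" "y \<in> car F"
     from le[rule_format, OF this z]
     show "q (pure E (PT F G) x (pure F G y z)) \<le> s z * p x * r y" by (simp add: mult_ac)
    qed
    then show ?thesis using order_trans[OF _ eq] unfolding mult.commute[of "EF.tproj p r t" "s z"] by blast
  qed
  then show "\<exists>p\<in>csn EF.T. \<exists>r\<in>csn G. \<forall>t\<in>car EF.T. \<forall>z\<in>car G. q (slice z t) \<le> p t * r z"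
    using EF.tproj_cont[OF prs(1,2)] prs(3) by (intro bexI[of _ "EF.tproj p r"] bexI[of _ s] ballI)
qed

lemma tensor_assoc_spec:
  "cont_linear L.T R.T (tensor_assoc E F G)"
  "x \<in> car E ==> y \<in> car F ==> z \<in> car G ==>
    tensor_assoc E F G (pure (PT E F) G (pure E F x y) z) =
    pure E (PT F G) x (pure F G y z)"
proof -
  let ?h = "linearization EF.T G R.T (\<lambda>t z. slice z t)"
  let ?P = "\<lambda>h. h \<in> extensional (car L.T) \<and> cont_linear L.T R.T h \<and>
    (\<forall>x\<in>car E. \<forall>y\<in>car F. \<forall>z\<in>car G.
     h (pure (PT E F) G (pure E F x y) z) = pure E (PT F G) x (pure F G y z))"
  note spec = L.linearization_ext[OF R.tensor_complete bounded_assoc] L.linearization_cont[OF R.tensor_complete bounded_assoc]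
  have h: "?P ?h"
    using spec L.linearization_pure[OF R.tensor_complete bounded_assoc] by (simp add: slice_pure EF.pure_closed)
  have "\<exists>!h. ?P h"
  proof (rule ex1I[of ?P ?h, OF h])
    fix g assume g: "?P g"
    have gc: "cont_linear L.T R.T g" using g by simp
    show "g = ?h"
    proof (rule extensionalityI[of _ "car L.T"])
     show "g \<in> extensional (car L.T)" using g by simp
     show "?h \<in> extensional (car L.T)" by (rule spec(1))
     fix u assume u: "u \<in> car L.T"
     show "g u = ?h u"
     proof (rule L.tensor_map_unique[OF R.tensor_complete gc spec(2) _ u])
      fix t z assume t: "t \<in> car EF.T" and z: "z \<in> car G"
      have cp: "cont_linear EF.T L.T (\<lambda>t. pure (PT E F) G t z)"
      proof (rule cont_linearI[OF EF.lc_space_T L.lc_space_T is_bilinearD(2)[OF L.is_bilinear_pure z]])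
       fix q assume "q \<in> csn L.T"
       from L.T_cont_seminorm_bound[OF this] obtain a b where ab: "a \<in> csn EF.T" "b \<in> csn G"
        and le: "sn_le L.T q (L.tproj a b)" by (elim bexE)
       show "\<exists>r\<in>csn EF.T. \<forall>t\<in>car EF.T. q (pure (PT E F) G t z) \<le> r t"
       proof (rule bexI[OF _ L.E.csn_scale[OF ab(1) G.sn_nonneg[OF G.csnD[OF ab(2)] z]]], intro ballI)
        fix t assume t: "t \<in> car EF.T"
        show "q (pure (PT E F) G t z) \<le> b z * a t"
         using order_trans[OF sn_leD[OF le L.pure_closed[OF t z]] L.tproj_pure_le[OF ab t z]] by (simp add: mult.commute)
       qed
      qed
      show "g (pure (PT E F) G t z) = ?h (pure (PT E F) G t z)"
       by (rule EF.tensor_map_unique[OF R.tensor_complete clin_compose[OF cp gc] clin_compose[OF cp spec(2)] _ t])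
        (use g h z in simp)
     qed
    qed
  qed
  from theI'[OF this] have P: "?P (tensor_assoc E F G)" unfolding tensor_assoc_def .
  show "cont_linear L.T R.T (tensor_assoc E F G)" using P by simp
  show "tensor_assoc E F G (pure (PT E F) G (pure E F x y) z) =
     pure E (PT F G) x (pure F G y z)"
    if "x \<in> car E" "y \<in> car F" "z \<in> car G" using P that by simp
qed

end

section \<open>The exponential in complete algebras\<close>

lemma (in lc_space) complete_sequence:
  assumes complete: "is_complete_lcs E" and x: "\<And>n. x n \<in> car E"
    and cauchy: "\<And>p e. p \<in> csn E ==> 0 < e ==> \<exists>N. \<forall>m\<ge>N. \<forall>n\<ge>m. p (x n \<ominus> x m) < e"
  shows "\<exists>l. limitin (lctop E) x l sequentially"
proof -
  have "cauchy_filter E (filtermap x sequentially)" unfolding cauchy_filter_iff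
  proof (intro conjI ballI allI impI)
    show "filtermap x sequentially \<noteq> bot" by (simp add: filtermap_bot_iff)
    show "eventually (\<lambda>y. y \<in> car E) (filtermap x sequentially)" by (simp add: eventually_filtermap x)
    fix p and e :: real assume p: "p \<in> csn E" and e: "0 < e"
    obtain N where N: "\<forall>m\<ge>N. \<forall>n\<ge>m. p (x n \<ominus> x m) < e" using cauchy[OF p e] by (elim exE)
    show "\<exists>Q. eventually Q (filtermap x sequentially) \<and>
      (\<forall>y\<in>car E. \<forall>z\<in>car E. Q y --> Q z --> p (y \<ominus> z) < e)"
    proof (intro exI[of _ "\<lambda>y. y \<in> x ` {N..}"] conjI ballI impI)
     show "eventually (\<lambda>y. y \<in> x ` {N..}) (filtermap x sequentially)"
      unfolding eventually_filtermap by (rule eventually_mono[OF eventually_ge_at_top[of N]]) simp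
     fix y z assume "y \<in> x ` {N..}" "z \<in> x ` {N..}"
     then obtain m n where mn: "y = x m" "z = x n" "N \<le> m" "N \<le> n" by auto
     have "p (x m \<ominus> x n) = p (x n \<ominus> x m)" by (rule seminorm_minus_commute[OF csnD[OF p] x x])
     then show "p (y \<ominus> z) < e"
      using N[rule_format, OF mn(3), of n] N[rule_format, OF mn(4), of m] unfolding mn(1,2) by (cases "m \<le> n") simp_all
    qed
  qed
  then have "\<exists>l. limitin (lctop E) (\<lambda>y. y) l (filtermap x sequentially)"
    using complete unfolding is_complete_lcs_def by simp
  then show ?thesis by (simp add: limitin_def eventually_filtermap)
qed

locale cam_algebra = am_algebra A for A :: "'a lcs" (structure) +
  assumes complete: "is_complete_lcs A"

definition exp_sum :: "'a lcs => 'a => nat => 'a" where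
  "exp_sum A x N = (\<Oplus>\<^bsub>A\<^esub>k\<in>{..<N}. (1 / fact k) \<odot>\<^sub>A (x [^]\<^bsub>A\<^esub> (k::nat)))"

context am_algebra
begin

lemma continuous_mult: "continuous_map (prod_topology (lctop A) (lctop A)) (lctop A) (\<lambda>(x, y). x \<otimes> y)"
  unfolding continuous_map_def
proof (intro conjI allI impI)
  show "(\<lambda>(x, y). x \<otimes> y) \<in> topspace (prod_topology (lctop A) (lctop A)) \<rightarrow> topspace (lctop A)" by auto
  fix W assume W: "openin (lctop A) W"
  show "openin (prod_topology (lctop A) (lctop A)) {z \<in> topspace (prod_topology (lctop A) (lctop A)). (case z of (x, y) => x \<otimes> y) \<in> W}"
    unfolding openin_prod_topology_alt
  proof (intro allI impI)
    fix x y assume "(x, y) \<in> {z \<in> topspace (prod_topology (lctop A) (lctop A)). (case z of (x, y) => x \<otimes> y) \<in> W}"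
    then have x: "x \<in> car A" and y: "y \<in> car A" and xy: "x \<otimes> y \<in> W" by auto
    obtain p where p: "p \<in> csn A" "{z \<in> car A. p (z \<ominus> x \<otimes> y) < 1} \<subseteq> W"
     using bspec[OF conjunct2[OF W[unfolded openin_iff]] xy] by (elim bexE)
    obtain s where s: "submult A s" "sn_le A p s" using submult_above[OF p(1)] by (elim exE conjE)
    note sc = submultD(1)[OF s(1)] and sm = submultD(2)[OF s(1)]
    note ss = csnD[OF sc]
    have n: "0 \<le> s x" "0 \<le> s y" using sn_nonneg[OF ss] x y by auto
    define d where "d = 1 / (s x + s y + 2)"
    have d: "0 < d" "d \<le> 1" "d * (s x + s y + 1) < 1" using n by (simp_all add: d_def field_simps)
    let ?U = "\<lambda>x. {z \<in> car A. s (z \<ominus> x) < d}"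
    have "x' \<otimes> y' \<in> W" if x': "x' \<in> ?U x" and y': "y' \<in> ?U y" for x' y'
    proof -
     have c: "x' \<in> car A" "y' \<in> car A" and le: "s (x' \<ominus> x) < d" "s (y' \<ominus> y) < d" using x' y' by auto
     have "s y' \<le> s (y' \<ominus> y) + s y" using seminorm_diff_le[OF ss c(2) y] by simp
     then have sy': "s y' \<le> s y + 1" using le d by simp
     have eq: "x' \<otimes> y' \<ominus> x \<otimes> y = (x' \<ominus> x) \<otimes> y' \<oplus> x \<otimes> (y' \<ominus> y)"
     proof -
      have "(x' \<ominus> x) \<otimes> y' \<oplus> x \<otimes> (y' \<ominus> y) = (x' \<otimes> y' \<ominus> x \<otimes> y') \<oplus> (x \<otimes> y' \<ominus> x \<otimes> y)"
       using x y c by (simp add: a_minus_def l_distr r_distr l_minus r_minus)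
      then show ?thesis using x y c by (simp add: minus_chain)
     qed
     have "p (x' \<otimes> y' \<ominus> x \<otimes> y) \<le> s (x' \<otimes> y' \<ominus> x \<otimes> y)" using x y c by (intro sn_leD[OF s(2)]) simp
     also have "\<dots> \<le> s ((x' \<ominus> x) \<otimes> y') + s (x \<otimes> (y' \<ominus> y))" unfolding eq using x y c by (intro seminorm_add[OF ss]) auto
     also have "\<dots> \<le> s (x' \<ominus> x) * s y' + s x * s (y' \<ominus> y)" using x y c by (intro add_mono sm) auto
     also have "\<dots> \<le> d * (s y + 1) + s x * d"
      using le sy' n sn_nonneg[OF ss] c x y d by (intro add_mono mult_mono) auto
     also have "\<dots> < 1" using d(3) by (simp add: algebra_simps)
     finally show ?thesis using p(2) c by auto
    qed
    moreover have "x \<in> ?U x" "y \<in> ?U y" using x y d seminorm_zero[OF ss] by auto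
    ultimately show "\<exists>U V. openin (lctop A) U \<and> openin (lctop A) V \<and> x \<in> U \<and> y \<in> V \<and>
      U \<times> V \<subseteq> {z \<in> topspace (prod_topology (lctop A) (lctop A)). (case z of (x, y) => x \<otimes> y) \<in> W}"
     using ball_nhd[OF sc x d(1)] ball_nhd[OF sc y d(1)] by (intro exI[of _ "?U x"] exI[of _ "?U y"] conjI) auto
  qed
qed

lemma seminorm_pow:
  assumes s: "submult A s" and x: "x \<in> car A"
  shows "s (x [^] (k::nat)) \<le> s \<one> * s x ^ k"
proof (induction k)
  case (Suc k)
  note ss = csnD[OF submultD(1)[OF s]]
  have "s (x [^] Suc k) \<le> s (x [^] k) * s x" using submultD(2)[OF s, of "x [^] k" x] x by simp
  also have "\<dots> \<le> (s \<one> * s x ^ k) * s x" using Suc sn_nonneg[OF ss x] by (rule mult_right_mono)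
  finally show ?case by (simp add: mult_ac)
qed simp

lemma exp_sum_closed: "x \<in> car A ==> exp_sum A x N \<in> car A" unfolding exp_sum_def by (intro finsum_closed) simp

lemma exp_sum_diff:
  assumes s: "submult A s" and x: "x \<in> car A" and MN: "M \<le> N"
  shows "s (exp_sum A x N \<ominus> exp_sum A x M) \<le> s \<one> * (\<Sum>k\<in>{M..<N}. s x ^ k / fact k)"
proof -
  note ss = csnD[OF submultD(1)[OF s]]
  let ?t = "\<lambda>k::nat. (1 / fact k) \<odot> (x [^] k)"
  have "exp_sum A x N = (\<Oplus>k\<in>{..<M} \<union> {M..<N}. ?t k)"
    unfolding exp_sum_def using MN by (simp add: ivl_disj_un)
  also have "\<dots> = exp_sum A x M \<oplus> (\<Oplus>k\<in>{M..<N}. ?t k)"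
    unfolding exp_sum_def using x by (intro finsum_Un_disjoint) auto
  finally have eq: "exp_sum A x N \<ominus> exp_sum A x M = (\<Oplus>k\<in>{M..<N}. ?t k)"
    using exp_sum_closed[OF x] finsum_closed[of ?t "{M..<N}"] x
    by (simp add: a_minus_def a_comm[of "exp_sum A x M"] a_assoc r_neg)
  have "s (exp_sum A x N \<ominus> exp_sum A x M) \<le> (\<Sum>k\<in>{M..<N}. s (?t k))"
    unfolding eq using x by (intro seminorm_finsum[OF ss]) auto
  also have "\<dots> \<le> (\<Sum>k\<in>{M..<N}. s \<one> * (s x ^ k / fact k))"
  proof (rule sum_mono)
    fix k
    have "s (?t k) = s (x [^] k) / fact k" using x by (simp add: seminorm_smult[OF ss] norm_divide)
    also have "\<dots> \<le> s \<one> * s x ^ k / fact k" by (rule divide_right_mono[OF seminorm_pow[OF s x]]) simp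
    finally show "s (?t k) \<le> s \<one> * (s x ^ k / fact k)" by simp
  qed
  finally show ?thesis by (simp add: sum_distrib_left)
qed

end

context cam_algebra
begin

lemma complete_algebra: "is_complete_algebra A" unfolding is_complete_algebra_def
  using complete ring_axioms continuous_mult smult_mult_left smult_mult_right by simp

lemma limit_unique:
  assumes "limitin (lctop A) f l F" "limitin (lctop A) f l' F" "F \<noteq> bot"
  shows "l = l'" using limitin_Hausdorff_unique[OF assms] complete by (simp add: is_complete_lcs_def)

text \<open>
  In a submultiplicative seminorm the partial sums are compared with the exponential series of real numbers.
\<close>

lemma exp_sum_limit:
  assumes x: "x \<in> car A"
  shows "limitin (lctop A) (exp_sum A x) (alg_exp A x) sequentially"
proof -
  have "\<exists>y. limitin (lctop A) (exp_sum A x) y sequentially"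
  proof (rule complete_sequence[OF complete exp_sum_closed[OF x]])
    fix p and e :: real assume p: "p \<in> csn A" and e: "0 < e"
    obtain s where s: "submult A s" "sn_le A p s" using submult_above[OF p] by (elim exE conjE)
    note ss = csnD[OF submultD(1)[OF s(1)]]
    have s1: "0 \<le> s \<one>" by (rule sn_nonneg[OF ss]) simp
    have "0 < e / (s \<one> + 1)" using e s1 by simp
    moreover have "summable (\<lambda>k. s x ^ k / fact k)"
     using summable_exp[of "s x"] by (simp add: divide_inverse mult.commute)
    ultimately obtain N where N: "\<And>m n. N \<le> m ==> norm (\<Sum>k\<in>{m..<n}. s x ^ k / fact k) < e / (s \<one> + 1)"
     unfolding summable_Cauchy by metis
    have main: "p (exp_sum A x n \<ominus> exp_sum A x m) < e" if "N \<le> m" "m \<le> n" for m n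
    proof -
     have "p (exp_sum A x n \<ominus> exp_sum A x m) \<le> s (exp_sum A x n \<ominus> exp_sum A x m)"
      using exp_sum_closed[OF x] by (intro sn_leD[OF s(2)]) simp
     also have "\<dots> \<le> s \<one> * (\<Sum>k\<in>{m..<n}. s x ^ k / fact k)" by (rule exp_sum_diff[OF s(1) x that(2)])
     also have "\<dots> \<le> s \<one> * (e / (s \<one> + 1))" using N[OF that(1), of n] s1 by (intro mult_left_mono) auto
     also have "\<dots> < e" using s1 e by (simp add: field_simps)
     finally show ?thesis .
    qed
    show "\<exists>N. \<forall>m\<ge>N. \<forall>n\<ge>m. p (exp_sum A x n \<ominus> exp_sum A x m) < e"
     by (intro exI[of _ N] allI impI main)
  qed
  then obtain y where y: "limitin (lctop A) (exp_sum A x) y sequentially" by (elim exE)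
  have "alg_exp A x = y" unfolding alg_exp_def
  proof (rule the_equality)
    show "limitin (lctop A) (\<lambda>N. \<Oplus>k\<in>{..<N}. (1 / fact k) \<odot> (x [^] (k::nat))) y sequentially"
     using y by (simp add: exp_sum_def[abs_def])
    fix y' assume "limitin (lctop A) (\<lambda>N. \<Oplus>k\<in>{..<N}. (1 / fact k) \<odot> (x [^] (k::nat))) y' sequentially"
    then have "limitin (lctop A) (exp_sum A x) y' sequentially" by (simp add: exp_sum_def[abs_def])
    then show "y' = y" using y limit_unique sequentially_bot by blast
  qed
  then show ?thesis using y by simp
qed

lemma alg_exp_closed: "x \<in> car A ==> alg_exp A x \<in> car A"
  using exp_sum_limit[of x] unfolding limitin_iff by simp

lemma alg_exp_eqI: "x \<in> car A ==> limitin (lctop A) (exp_sum A x) y sequentially ==> alg_exp A x = y"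
  using limit_unique[OF exp_sum_limit] sequentially_bot by blast

lemma alg_exp_zero: "alg_exp A \<zero> = \<one>"
proof (rule alg_exp_eqI[OF zero_closed])
  have "exp_sum A \<zero> N = \<one>" if "0 < N" for N
  proof -
    have "exp_sum A \<zero> N = (\<Oplus>k\<in>{..<N}. if k = 0 then \<one> else \<zero>)"
     unfolding exp_sum_def by (rule finsum_cong') (auto simp: nat_pow_zero)
    also have "\<dots> = \<one>"
     using add.finprod_singleton[of 0 "{..<N}" "\<lambda>_. \<one>"] that by (simp add: eq_commute)
    finally show ?thesis .
  qed
  then have "eventually (\<lambda>N. exp_sum A \<zero> N = \<one>) sequentially"
    by (intro eventually_mono[OF eventually_gt_at_top[of 0]]) simp
  then show "limitin (lctop A) (exp_sum A \<zero>) \<one> sequentially" unfolding limitin_iff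
    by (auto elim!: eventually_mono simp: seminorm_zero[OF csnD])
qed

end

text \<open>
  A continuous homomorphism maps the partial sums of one exponential to those of the other.
\<close>

lemma hom_exp:
  assumes A: "cam_algebra A" and B: "cam_algebra B" and f: "cont_alg_hom A B f"
    and x: "x \<in> car A"
  shows "f (alg_exp A x) = alg_exp B (f x)"
proof -
  interpret A: cam_algebra A by fact
  interpret B: cam_algebra B by fact
  note fc = homD(3)[OF f] and lf = homD(2)[OF f]
  have pow: "f (x [^]\<^bsub>A\<^esub> k) = f x [^]\<^bsub>B\<^esub> k" for k :: nat
    using x by (induction k) (simp_all add: homD(4,5)[OF f])
  have sum: "f (exp_sum A x N) = exp_sum B (f x) N" for N
  proof (induction N)
    case 0
    then show ?case by (simp add: exp_sum_def lin_zero[OF A.cvs_axioms B.cvs_axioms lf])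
  next
    case (Suc N)
    have "exp_sum A x (Suc N) = (1 / fact N) \<odot>\<^sub>A (x [^]\<^bsub>A\<^esub> N) \<oplus>\<^sub>A exp_sum A x N"
     unfolding exp_sum_def lessThan_Suc using x by (intro A.finsum_insert) auto
    moreover have "exp_sum B (f x) (Suc N) = (1 / fact N) \<odot>\<^sub>B (f x [^]\<^bsub>B\<^esub> N) \<oplus>\<^sub>B exp_sum B (f x) N"
     unfolding exp_sum_def lessThan_Suc using fc[OF x] by (intro B.finsum_insert) auto
    ultimately show ?case using x Suc A.exp_sum_closed[OF x] by (simp add: lin_add[OF lf] lin_smult[OF lf] pow)
  qed
  have "continuous_map (lctop A) (lctop B) f" using homD(1)[OF f] by (simp add: cont_linear_def)
  from continuous_map_limit[OF this A.exp_sum_limit[OF x]]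
  have "limitin (lctop B) (exp_sum B (f x)) (f (alg_exp A x)) sequentially" by (simp add: o_def sum)
  from B.alg_exp_eqI[OF fc[OF x] this] show ?thesis by simp
qed

text \<open>
  The functional equation of the exponential for commuting elements. The map \<open>eval2\<close> sends polynomials
  in two commuting variables to the algebra; both sides of the functional equation are limits of
  images of polynomials, and the difference of these polynomials is the part of
  \<open>\<Sum>\<^sub>i\<^sub>j u\<^sup>i v\<^sup>j / (i! j!)\<close> in which \<open>i, j < N \<le> i + j\<close>.
\<close>

locale commuting_pair = cam_algebra +
  fixes x y
  assumes x: "x \<in> car A" and y: "y \<in> car A" and comm: "x \<otimes> y = y \<otimes> x"
begin

definition mono :: "nat \<times> nat => 'a" where
  "mono k = x [^] fst k \<otimes> y [^] snd k"

abbreviation eval2 :: "(nat \<times> nat \<Rightarrow>\<^sub>0 complex) => 'a" where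
  "eval2 \<equiv> lincomb A mono"

lemma mono_closed [simp]: "mono k \<in> car A" using x y by (simp add: mono_def)

lemma mono_fun: "mono \<in> UNIV \<rightarrow> car A" by simp

lemma eval2_closed [simp]: "eval2 a \<in> car A" by (rule lincomb_closed[OF mono_fun]) simp

lemma eval2_add: "eval2 (a + b) = eval2 a \<oplus> eval2 b" by (rule lincomb_add[OF mono_fun]) simp_all

lemma eval2_minus: "eval2 (a - b) = eval2 a \<ominus> eval2 b" by (rule lincomb_minus[OF mono_fun]) simp_all

lemma mono_add: "mono (k + l) = mono k \<otimes> mono l"
proof -
  have c: "x [^] i \<otimes> y [^] j = y [^] j \<otimes> x [^] i" for i j :: nat
    using group_commutes_pow[of y "x [^] i" j] group_commutes_pow[of x y i] comm x y by simp
  have "mono (k + l) = (x [^] fst k \<otimes> x [^] fst l) \<otimes> (y [^] snd k \<otimes> y [^] snd l)"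
    using x y by (simp add: mono_def nat_pow_mult)
  also have "\<dots> = x [^] fst k \<otimes> (x [^] fst l \<otimes> y [^] snd k) \<otimes> y [^] snd l" using x y by (simp add: m_assoc)
  also have "\<dots> = x [^] fst k \<otimes> (y [^] snd k \<otimes> x [^] fst l) \<otimes> y [^] snd l" by (simp only: c)
  also have "\<dots> = mono k \<otimes> mono l" using x y by (simp add: mono_def m_assoc)
  finally show ?thesis .
qed

lemma eval2_mult: "eval2 (a * b) = eval2 a \<otimes> eval2 b"
proof -
  have "keys a \<subseteq> UNIV" by simp
  then show ?thesis
  proof (induction a rule: free_vector_induct)
    case (step k c a)
    have "keys b \<subseteq> UNIV" by simp
    then have "eval2 (single k c * b) = eval2 (single k c) \<otimes> eval2 b"
    proof (induction b rule: free_vector_induct)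
     case (step l d b)
     then show ?case
      by (simp add: distrib_left eval2_add mult_single lincomb_single mono_add smult_mult_left smult_mult_right
        smult_assoc r_distr mult.commute[of d])
    qed simp
    then show ?case using step by (simp add: distrib_right eval2_add l_distr)
  qed simp
qed

lemma eval2_const: "eval2 (single 0 c) = c \<odot> \<one>"
  using x y by (simp add: lincomb_single mono_def zero_prod_def)

lemma eval2_one: "eval2 1 = \<one>" using eval2_const[of 1] by simp

lemma eval2_power: "eval2 (a ^ n) = eval2 a [^] n"
  by (induction n) (simp_all add: eval2_one eval2_mult power_Suc2 del: power_Suc)

definition psum :: "(nat \<times> nat \<Rightarrow>\<^sub>0 complex) => nat => (nat \<times> nat \<Rightarrow>\<^sub>0 complex)" where
  "psum a N = (\<Sum>k<N. single 0 (1 / fact k) * a ^ k)"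

lemma eval2_psum: "eval2 (psum a N) = exp_sum A (eval2 a) N"
proof (induction N)
  case 0
  then show ?case by (simp add: psum_def exp_sum_def)
next
  case (Suc N)
  have "exp_sum A (eval2 a) (Suc N) = (1 / fact N) \<odot> (eval2 a [^] N) \<oplus> exp_sum A (eval2 a) N"
    unfolding exp_sum_def lessThan_Suc by (intro finsum_insert) auto
  moreover have "eval2 (psum a (Suc N)) = eval2 (psum a N) \<oplus> (1 / fact N) \<odot> (eval2 a [^] N)"
    by (simp add: psum_def eval2_add eval2_mult eval2_const eval2_power smult_mult_left)
  ultimately show ?case using Suc exp_sum_closed[of "eval2 a" N] by (simp add: a_comm)
qed

definition U :: "nat \<times> nat \<Rightarrow>\<^sub>0 complex" where "U = single (1, 0) 1"
definition V :: "nat \<times> nat \<Rightarrow>\<^sub>0 complex" where "V = single (0, 1) 1"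

lemma U_pow: "U ^ i = single (i, 0) 1" by (induction i) (simp_all add: U_def mult_single zero_prod_def flip: single_one)

lemma V_pow: "V ^ j = single (0, j) 1" by (induction j) (simp_all add: V_def mult_single zero_prod_def flip: single_one)

definition dterm :: "nat \<times> nat => (nat \<times> nat \<Rightarrow>\<^sub>0 complex)" where
  "dterm k = single k (1 / (fact (fst k) * fact (snd k)))"

lemma psum_product: "psum U N * psum V N = (\<Sum>k\<in>{..<N} \<times> {..<N}. dterm k)"
  unfolding psum_def sum_product sum.cartesian_product by (rule sum.cong) (auto simp: U_pow V_pow mult_single dterm_def)

lemma psum_sum: "psum (U + V) N = (\<Sum>k\<in>{(i, j). i + j < N}. dterm k)"
proof -
  have "single 0 (1 / fact n) * (U + V) ^ n = (\<Sum>i\<le>n. dterm (i, n - i))" for n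
  proof -
    have "single 0 (1 / fact n) * (of_nat (n choose i) * U ^ i * V ^ (n - i)) = dterm (i, n - i)"
     if "i \<le> n" for i
    proof -
     have "of_nat (n choose i) / fact n = (1 / (fact i * fact (n - i)) :: complex)"
      using binomial_fact[OF that, where 'a = complex] by simp
     then show ?thesis by (simp add: U_pow V_pow mult_single dterm_def flip: single_of_nat)
    qed
    then show ?thesis unfolding binomial_ring sum_distrib_left by (intro sum.cong) auto
  qed
  then show ?thesis
    unfolding psum_def using sum.triangle_reindex[of "\<lambda>i j. dterm (i, j)" N] by (simp add: case_prod_beta')
qed

lemma exp_product_difference:
  assumes s: "submult A s"
  shows "s (exp_sum A x N \<otimes> exp_sum A y N \<ominus> exp_sum A (x \<oplus> y) N) \<le> s \<one> * s \<one> *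
    ((\<Sum>i<N. s x ^ i / fact i) * (\<Sum>j<N. s y ^ j / fact j) - (\<Sum>n<N. \<Sum>i\<le>n. (s x ^ i / fact i) * (s y ^ (n - i) / fact (n - i))))"
proof -
  note ss = csnD[OF submultD(1)[OF s]]
  have n: "0 \<le> s x" "0 \<le> s y" "0 \<le> s \<one>" using sn_nonneg[OF ss] x y by auto
  define S1 where "S1 = {..<N} \<times> {..<N}"
  define S2 where "S2 = {(i, j). i + j < N}"
  have sub: "S2 \<subseteq> S1" "finite S1" by (auto simp: S1_def S2_def)
  have ev: "eval2 U = x" "eval2 V = y" using x y by (simp_all add: U_def V_def lincomb_single mono_def)
  have "exp_sum A x N \<otimes> exp_sum A y N \<ominus> exp_sum A (x \<oplus> y) N = eval2 (psum U N * psum V N - psum (U + V) N)"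
    by (simp add: eval2_minus eval2_mult eval2_psum eval2_add ev)
  also have "psum U N * psum V N - psum (U + V) N = (\<Sum>k\<in>S1 - S2. dterm k)"
    unfolding psum_product psum_sum S1_def[symmetric] S2_def[symmetric] using sub by (simp add: sum_diff)
  finally have eq: "exp_sum A x N \<otimes> exp_sum A y N \<ominus> exp_sum A (x \<oplus> y) N = eval2 (\<Sum>k\<in>S1 - S2. dterm k)" .
  define c where "c k = (s x ^ fst k / fact (fst k)) * (s y ^ snd k / fact (snd k))" for k
  have term_le: "s (eval2 (dterm k)) \<le> s \<one> * s \<one> * c k" for k
  proof -
    have "s (mono k) \<le> s (x [^] fst k) * s (y [^] snd k)"
     unfolding mono_def using x y by (intro submultD(2)[OF s]) auto
    also have "\<dots> \<le> (s \<one> * s x ^ fst k) * (s \<one> * s y ^ snd k)"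
     using n x y sn_nonneg[OF ss] by (intro mult_mono seminorm_pow[OF s]) auto
    finally have "s (mono k) / (fact (fst k) * fact (snd k)) \<le> (s \<one> * s x ^ fst k) * (s \<one> * s y ^ snd k) / (fact (fst k) * fact (snd k))"
     by (intro divide_right_mono) auto
    then show ?thesis by (simp add: dterm_def lincomb_single seminorm_smult[OF ss] norm_divide norm_mult c_def mult_ac)
  qed
  have "s (eval2 (\<Sum>k\<in>I. dterm k)) \<le> (\<Sum>k\<in>I. s \<one> * s \<one> * c k)" if "finite I" for I
    using that
  proof (induction I)
    case (insert k I)
    have "s (eval2 (\<Sum>k\<in>insert k I. dterm k)) \<le> s (eval2 (dterm k)) + s (eval2 (\<Sum>k\<in>I. dterm k))"
     using insert(1,2) seminorm_add[OF ss, of "eval2 (dterm k)" "eval2 (\<Sum>k\<in>I. dterm k)"] by (simp add: eval2_add)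
    then show ?case using insert term_le[of k] by simp
  qed (simp add: seminorm_zero[OF ss])
  from this[of "S1 - S2"] sub
  have "s (exp_sum A x N \<otimes> exp_sum A y N \<ominus> exp_sum A (x \<oplus> y) N) \<le> s \<one> * s \<one> * (\<Sum>k\<in>S1 - S2. c k)"
    by (simp add: eq sum_distrib_left)
  also have "(\<Sum>k\<in>S1 - S2. c k) = (\<Sum>k\<in>S1. c k) - (\<Sum>k\<in>S2. c k)" using sub by (simp add: sum_diff)
  also have "(\<Sum>k\<in>S1. c k) = (\<Sum>i<N. s x ^ i / fact i) * (\<Sum>j<N. s y ^ j / fact j)"
    unfolding S1_def sum_product sum.cartesian_product by (rule sum.cong) (auto simp: c_def)
  also have "(\<Sum>k\<in>S2. c k) = (\<Sum>n<N. \<Sum>i\<le>n. (s x ^ i / fact i) * (s y ^ (n - i) / fact (n - i)))"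
    unfolding S2_def
    using sum.triangle_reindex[of "\<lambda>i j. (s x ^ i / fact i) * (s y ^ j / fact j)" N] by (simp add: c_def case_prod_beta')
  finally show ?thesis .
qed

lemma exp_add: "alg_exp A (x \<oplus> y) = alg_exp A x \<otimes> alg_exp A y"
proof (rule alg_exp_eqI[OF a_closed[OF x y]])
  note cl = exp_sum_closed[OF x] exp_sum_closed[OF y] exp_sum_closed[OF a_closed[OF x y]]
    alg_exp_closed[OF x] alg_exp_closed[OF y]
  have "limitin (prod_topology (lctop A) (lctop A)) (\<lambda>N. (exp_sum A x N, exp_sum A y N)) (alg_exp A x, alg_exp A y) sequentially"
    using exp_sum_limit[OF x] exp_sum_limit[OF y] by (simp add: limitin_pairwise o_def)
  from continuous_map_limit[OF continuous_mult this]
  have "limitin (lctop A) (\<lambda>N. exp_sum A x N \<otimes> exp_sum A y N) (alg_exp A x \<otimes> alg_exp A y) sequentially"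
    by (simp add: o_def)
  then have lim: "\<forall>p\<in>csn A. \<forall>e>0. eventually (\<lambda>N. p (exp_sum A x N \<otimes> exp_sum A y N \<ominus> alg_exp A x \<otimes> alg_exp A y) < e) sequentially"
    unfolding limitin_iff by (elim conjE)
  show "limitin (lctop A) (exp_sum A (x \<oplus> y)) (alg_exp A x \<otimes> alg_exp A y) sequentially"
    unfolding limitin_iff
  proof (intro conjI ballI allI impI)
    fix p and e :: real assume p: "p \<in> csn A" and "0 < e"
    then have e: "0 < e / 2" by simp
    obtain s where s: "submult A s" "sn_le A p s" using submult_above[OF p] by (elim exE conjE)
    note sp = csnD[OF p]
    define a where "a r k = r ^ k / fact k" for r :: real and k
    have a: "summable (\<lambda>k. norm (a r k))" for r
    proof -
     have "norm (a r k) = inverse (fact k) * \<bar>r\<bar> ^ k" for k by (simp add: a_def abs_mult power_abs divide_inverse mult.commute)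
     then show ?thesis using summable_exp[of "\<bar>r\<bar>"] by simp
    qed
    have t1: "(\<lambda>N. (\<Sum>i<N. a r i)) \<longlonglongrightarrow> suminf (a r)" for r
     by (rule summable_LIMSEQ[OF summable_norm_cancel[OF a]])
    have t2: "(\<lambda>N. \<Sum>n<N. \<Sum>i\<le>n. a r i * a t (n - i)) \<longlonglongrightarrow> suminf (a r) * suminf (a t)" for r t
     using Cauchy_product_sums[OF a a] by (simp add: sums_def)
    have "(\<lambda>N. s \<one> * s \<one> * ((\<Sum>i<N. a (s x) i) * (\<Sum>j<N. a (s y) j) - (\<Sum>n<N. \<Sum>i\<le>n. a (s x) i * a (s y) (n - i)))) \<longlonglongrightarrow>
      s \<one> * s \<one> * (suminf (a (s x)) * suminf (a (s y)) - suminf (a (s x)) * suminf (a (s y)))"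
     by (intro tendsto_intros t1 t2)
    then have lim0: "(\<lambda>N. s \<one> * s \<one> * ((\<Sum>i<N. a (s x) i) * (\<Sum>j<N. a (s y) j) - (\<Sum>n<N. \<Sum>i\<le>n. a (s x) i * a (s y) (n - i)))) \<longlonglongrightarrow> 0"
     by simp
    have "eventually (\<lambda>N. s \<one> * s \<one> * ((\<Sum>i<N. a (s x) i) * (\<Sum>j<N. a (s y) j) - (\<Sum>n<N. \<Sum>i\<le>n. a (s x) i * a (s y) (n - i))) < e / 2) sequentially"
     by (rule order_tendstoD(2)[OF lim0 e])
    then show "eventually (\<lambda>N. p (exp_sum A (x \<oplus> y) N \<ominus> alg_exp A x \<otimes> alg_exp A y) < e) sequentially"
     using lim[rule_format, OF p e]
    proof eventually_elim
     fix N assume 1: "s \<one> * s \<one> * ((\<Sum>i<N. a (s x) i) * (\<Sum>j<N. a (s y) j) - (\<Sum>n<N. \<Sum>i\<le>n. a (s x) i * a (s y) (n - i))) < e / 2"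
      and 2: "p (exp_sum A x N \<otimes> exp_sum A y N \<ominus> alg_exp A x \<otimes> alg_exp A y) < e / 2"
     have "p (exp_sum A (x \<oplus> y) N \<ominus> exp_sum A x N \<otimes> exp_sum A y N) = p (exp_sum A x N \<otimes> exp_sum A y N \<ominus> exp_sum A (x \<oplus> y) N)"
      using cl by (intro seminorm_minus_commute[OF sp]) auto
     also have "\<dots> \<le> s (exp_sum A x N \<otimes> exp_sum A y N \<ominus> exp_sum A (x \<oplus> y) N)"
      using cl by (intro sn_leD[OF s(2)]) auto
     also have "\<dots> < e / 2" by (rule le_less_trans[OF exp_product_difference[OF s(1), folded a_def] 1])
     finally have 3: "p (exp_sum A (x \<oplus> y) N \<ominus> exp_sum A x N \<otimes> exp_sum A y N) < e / 2" .
     have "p (exp_sum A (x \<oplus> y) N \<ominus> alg_exp A x \<otimes> alg_exp A y) \<le>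
       p (exp_sum A (x \<oplus> y) N \<ominus> exp_sum A x N \<otimes> exp_sum A y N) + p (exp_sum A x N \<otimes> exp_sum A y N \<ominus> alg_exp A x \<otimes> alg_exp A y)"
      using cl by (intro seminorm_triangle[OF sp]) auto
     then show "p (exp_sum A (x \<oplus> y) N \<ominus> alg_exp A x \<otimes> alg_exp A y) < e" using 2 3 by simp
    qed
  qed (use cl in auto)
qed

end

lemma (in cam_algebra) exp_neg:
  assumes x: "x \<in> car A"
  shows "alg_exp A x \<otimes> alg_exp A (\<ominus> x) = \<one>" "alg_exp A (\<ominus> x) \<otimes> alg_exp A x = \<one>"
proof -
  interpret P: commuting_pair A x "\<ominus> x" using x by unfold_locales (simp_all add: l_minus r_minus)
  interpret Q: commuting_pair A "\<ominus> x" x using x by unfold_locales (simp_all add: l_minus r_minus)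
  show "alg_exp A x \<otimes> alg_exp A (\<ominus> x) = \<one>" "alg_exp A (\<ominus> x) \<otimes> alg_exp A x = \<one>"
    using P.exp_add Q.exp_add x by (simp_all add: r_neg l_neg alg_exp_zero)
qed

section \<open>Opposite algebras\<close>

text \<open>
  Antihomomorphisms are homomorphisms into the opposite algebra, so that existence and uniqueness of homomorphisms apply to
  them.
\<close>

definition opp :: "'a lcs => 'a lcs" where
  "opp A = A\<lparr>mult := (\<lambda>x y. y \<otimes>\<^sub>A x)\<rparr>"

lemma opp_simps [simp]:
  "car (opp A) = car A" "add (opp A) = add A" "zero (opp A) = zero A" "one (opp A) = one A"
  "smult (opp A) = smult A" "lctop (opp A) = lctop A" "x \<otimes>\<^sub>(opp A) y = y \<otimes>\<^sub>A x"
  by (simp_all add: opp_def)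

lemma opp_seminorm [simp]: "is_seminorm (opp A) = is_seminorm A" "csn (opp A) = csn A"
  by (simp_all add: fun_eq_iff is_seminorm_def cont_seminorms_def)

lemma opp_minus [simp]: "a_minus (opp A) = a_minus A" by (rule a_minus_cong) simp_all

lemma opp_topology [simp]: "seminorm_topology (opp A) P = seminorm_topology A P"
proof -
  have "seminorm_open (opp A) P = seminorm_open A P" by (simp add: fun_eq_iff seminorm_open_def)
  then show ?thesis by (simp add: seminorm_topology_def)
qed

lemma opp_complete_am:
  assumes "cam_algebra A"
  shows "cam_algebra (opp A)"
proof -
  interpret A: cam_algebra A by fact
  have c: "cvs (opp A)" by (rule cvs_image[OF A.cvs_axioms, of _ "\<lambda>x. x"]) simp_all
  have lc: "lc_space (opp A)" using c A.topology_seminorms by (simp add: lc_space_def lc_space_axioms_def)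
  have ab: "abelian_group (opp A)" using c by (simp add: cvs_def module_def)
  have R: "Ring.ring (opp A)" by (rule ringI[OF ab]) (auto intro!: monoidI simp: A.m_assoc A.l_distr A.r_distr)
  have sub: "submult (opp A) s" if "submult A s" for s unfolding submult_def opp_simps opp_seminorm
  proof (intro conjI ballI)
    show "s \<in> csn A" by (rule submultD(1)[OF that])
    fix x y assume "x \<in> car A" "y \<in> car A"
    then show "s (y \<otimes>\<^sub>A x) \<le> s x * s y" using submultD(2)[OF that, of y x] by (simp add: mult.commute)
  qed
  have cf: "cauchy_filter (opp A) F = cauchy_filter A F" for F by (simp add: cauchy_filter_def)
  have "is_complete_lcs (opp A)" using A.complete lc by (simp add: is_complete_lcs_def is_lcs_iff cf)
  moreover have "am_algebra (opp A)"
  proof (intro am_algebra.intro lc R am_algebra_axioms.intro)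
    fix p assume "p \<in> csn (opp A)"
    then have "p \<in> csn A" by simp
    from A.submult_above[OF this] obtain s where "submult A s" "sn_le A p s" by (elim exE conjE)
    then show "\<exists>s. submult (opp A) s \<and> sn_le (opp A) p s"
     using sub[of s] by (intro exI[of _ s]) (simp add: sn_le_def)
  qed (simp_all add: A.smult_mult_left A.smult_mult_right)
  ultimately show ?thesis by (simp add: cam_algebra_def cam_algebra_axioms_def)
qed

lemma opp_cont_linear [simp]: "cont_linear A (opp B) f = cont_linear A B f" by (simp add: cont_linear_def)

lemma antihom_iff_hom_opp: "cont_alg_antihom A B f \<longleftrightarrow> cont_alg_hom A (opp B) f"
proof
  assume f: "cont_alg_antihom A B f"
  show "cont_alg_hom A (opp B) f" by (rule homI) (use f in \<open>simp_all add: cont_alg_antihom_def\<close>)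
next
  assume f: "cont_alg_hom A (opp B) f"
  show "cont_alg_antihom A B f" using homD(1,4,5)[OF f] by (simp add: cont_alg_antihom_def)
qed

lemma opp_exp:
  assumes "cam_algebra A" "x \<in> car A"
  shows "alg_exp (opp A) x = alg_exp A x"
proof -
  interpret A: cam_algebra A by fact
  have pow: "x [^]\<^bsub>opp A\<^esub> k = x [^]\<^bsub>A\<^esub> k" for k :: nat
  proof (induction k)
    case (Suc k)
    have "x [^]\<^bsub>opp A\<^esub> Suc k = x \<otimes>\<^sub>A x [^]\<^bsub>opp A\<^esub> k" by (simp add: nat_pow_def)
    then show ?case using Suc A.nat_pow_Suc2[OF assms(2)] by simp
  qed (simp add: nat_pow_def)
  have sum: "finsum (opp A) f I = finsum A f I" for f and I :: "nat set" by (simp add: finsum_def finprod_def)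
  show ?thesis by (simp add: alg_exp_def pow sum)
qed

section \<open>Free entire functions\<close>

definition words :: "nat => nat list set" where
  "words n = {w. set w \<subseteq> {1..n}}"

definition delta :: "nat list => nat list => complex" where
  "delta w = (\<lambda>v. if v = w then 1 else 0)"

context
  fixes n :: nat
begin

abbreviation FE where "FE \<equiv> free_entire n"

lemma free_entire_simps:
  "car FE = {a. (\<forall>w. w \<notin> words n --> a w = 0) \<and> (\<forall>\<rho>>0. (\<lambda>w. cmod (a w) * \<rho> ^ length w) summable_on UNIV)}"
  "mult FE = (\<lambda>a b w. \<Sum>k\<le>length w. a (take k w) * b (drop k w))"
  "one FE = delta []" "zero FE = (\<lambda>w. 0)" "add FE = (\<lambda>a b w. a w + b w)" "smult FE = (\<lambda>c a w. c * a w)"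
  by (simp_all add: free_entire_def free_entire_module_def words_def delta_def)

abbreviation part :: "real => nat list set => (nat list => complex) => real" where
  "part \<rho> W a \<equiv> (\<Sum>w\<in>W. cmod (a w) * \<rho> ^ length w)"

lemma fe_memI:
  assumes "\<And>w. w \<notin> words n ==> a w = 0" and "\<And>\<rho>. 0 < \<rho> ==> \<exists>B. \<forall>W. finite W --> part \<rho> W a \<le> B"
  shows "a \<in> car FE" unfolding free_entire_simps
proof (intro CollectI conjI allI impI)
  fix \<rho> :: real assume r: "0 < \<rho>"
  obtain B where "\<forall>W. finite W --> part \<rho> W a \<le> B" using assms(2)[OF r] by (elim exE)
  then show "(\<lambda>w. cmod (a w) * \<rho> ^ length w) summable_on UNIV"
    using r by (intro nonneg_bdd_above_summable_on bdd_aboveI[of _ B]) auto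
qed (rule assms(1))

lemma fe_summable: "a \<in> car FE ==> 0 < \<rho> ==> (\<lambda>w. cmod (a w) * \<rho> ^ length w) summable_on UNIV"
  by (simp add: free_entire_simps)

lemma fe_support: "a \<in> car FE ==> w \<notin> words n ==> a w = 0" by (simp add: free_entire_simps)

lemma fe_norm_leI: "a \<in> car FE ==> 0 < \<rho> ==> (\<And>W. finite W ==> part \<rho> W a \<le> B) ==> fe_norm \<rho> a \<le> B"
  unfolding fe_norm_def by (intro infsum_le_finite_sums fe_summable)

lemma part_le_norm: "a \<in> car FE ==> 0 < \<rho> ==> finite W ==> part \<rho> W a \<le> fe_norm \<rho> a"
  unfolding fe_norm_def by (intro finite_sum_le_infsum fe_summable) auto

lemma fe_norm_nonneg: "0 < \<rho> ==> 0 \<le> fe_norm \<rho> a" unfolding fe_norm_def by (intro infsum_nonneg) auto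

lemma part_add: "0 < \<rho> ==> part \<rho> W (\<lambda>w. a w + b w) \<le> part \<rho> W a + part \<rho> W b"
  unfolding sum.distrib[symmetric]
  by (intro sum_mono) (simp add: distrib_right[symmetric] mult_right_mono norm_triangle_ineq)

lemma part_smult: "part \<rho> W (\<lambda>w. c * a w) = cmod c * part \<rho> W a"
  by (simp add: sum_distrib_left norm_mult mult.assoc)

lemma fe_add_closed:
  assumes "a \<in> car FE" "b \<in> car FE"
  shows "(\<lambda>w. a w + b w) \<in> car FE" "0 < \<rho> ==> fe_norm \<rho> (\<lambda>w. a w + b w) \<le> fe_norm \<rho> a + fe_norm \<rho> b"
proof -
  have le: "part \<rho> W (\<lambda>w. a w + b w) \<le> fe_norm \<rho> a + fe_norm \<rho> b" if "0 < \<rho>" "finite W" for \<rho> W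
    using part_add[OF that(1), where W = W and a = a and b = b] part_le_norm[OF assms(1) that] part_le_norm[OF assms(2) that] by linarith
  show c: "(\<lambda>w. a w + b w) \<in> car FE"
  proof (rule fe_memI)
    fix \<rho> :: real assume "0 < \<rho>"
    then show "\<exists>B. \<forall>W. finite W --> part \<rho> W (\<lambda>w. a w + b w) \<le> B" using le by blast
  qed (simp add: fe_support[OF assms(1)] fe_support[OF assms(2)])
  show "0 < \<rho> ==> fe_norm \<rho> (\<lambda>w. a w + b w) \<le> fe_norm \<rho> a + fe_norm \<rho> b"
    by (intro fe_norm_leI c le)
qed

lemma fe_smult_closed:
  assumes a: "a \<in> car FE"
  shows "(\<lambda>w. c * a w) \<in> car FE" "0 < \<rho> ==> fe_norm \<rho> (\<lambda>w. c * a w) = cmod c * fe_norm \<rho> a"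
proof -
  show "(\<lambda>w. c * a w) \<in> car FE"
  proof (rule fe_memI)
    fix \<rho> :: real assume r: "0 < \<rho>"
    have "part \<rho> W (\<lambda>w. c * a w) \<le> cmod c * fe_norm \<rho> a" if "finite W" for W
     unfolding part_smult by (rule mult_left_mono[OF part_le_norm[OF a r that]]) simp
    then show "\<exists>B. \<forall>W. finite W --> part \<rho> W (\<lambda>w. c * a w) \<le> B" by blast
  qed (simp add: fe_support[OF a])
  show "0 < \<rho> ==> fe_norm \<rho> (\<lambda>w. c * a w) = cmod c * fe_norm \<rho> a"
    unfolding fe_norm_def by (simp add: norm_mult mult.assoc infsum_cmult_right')
qed

lemma fe_zero_closed: "(\<lambda>w. 0) \<in> car FE" by (rule fe_memI) auto

lemma cvs_FE: "cvs FE"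
proof -
  have "abelian_group FE"
  proof (rule abelian_groupI)
    fix x assume "x \<in> car FE"
    then show "\<exists>y\<in>car FE. y \<oplus>\<^sub>FE x = \<zero>\<^sub>FE"
     using fe_smult_closed(1)[of x "-1"] by (intro bexI[of _ "\<lambda>w. - 1 * x w"]) (auto simp: free_entire_simps(4,5))
  qed (simp_all add: free_entire_simps(4,5) fe_add_closed fe_zero_closed fun_eq_iff)
  then have "Module.module CC FE"
    by (intro moduleI cring_complex) (simp_all add: free_entire_simps(5,6) fe_smult_closed algebra_simps)
  then show ?thesis by (rule cvs.intro)
qed

lemma fe_minus: "a \<in> car FE ==> b \<in> car FE ==> a \<ominus>\<^sub>FE b = (\<lambda>w. a w - b w)"
  using cvs.uminus_smult[OF cvs_FE, of b] by (simp add: a_minus_def free_entire_simps(5,6))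

text \<open>
  Different words or cutting points give different pairs of factors, so the sum over all factorizations
  is part of the product of the two sums.
\<close>

lemma part_mult_le:
  assumes a: "a \<in> car FE" and b: "b \<in> car FE" and r: "0 < \<rho>" and W: "finite W"
  shows "part \<rho> W (\<lambda>w. \<Sum>k\<le>length w. a (take k w) * b (drop k w)) \<le> fe_norm \<rho> a * fe_norm \<rho> b"
proof -
  let ?g = "\<lambda>a u. cmod (a u) * \<rho> ^ length u"
  define D where "D = Sigma W (\<lambda>w. {..length w})"
  have D: "finite D" using W by (simp add: D_def)
  define h where "h = (\<lambda>z::nat list \<times> nat. (take (snd z) (fst z), drop (snd z) (fst z)))"
  have inj: "inj_on h D"
  proof (rule inj_onI)
    fix z z' assume z: "z \<in> D" "z' \<in> D" "h z = h z'"
    then have t: "take (snd z) (fst z) = take (snd z') (fst z')" and d: "drop (snd z) (fst z) = drop (snd z') (fst z')"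
     by (auto simp: h_def)
    have "fst z = fst z'" using t d by (metis append_take_drop_id)
    moreover have "snd z = snd z'" using z arg_cong[OF t, of length] by (auto simp: D_def)
    ultimately show "z = z'" by (simp add: prod_eq_iff)
  qed
  have "part \<rho> W (\<lambda>w. \<Sum>k\<le>length w. a (take k w) * b (drop k w)) \<le>
     (\<Sum>w\<in>W. \<Sum>k\<le>length w. ?g a (take k w) * ?g b (drop k w))"
  proof (rule sum_mono)
    fix w
    have "cmod (\<Sum>k\<le>length w. a (take k w) * b (drop k w)) * \<rho> ^ length w \<le>
      (\<Sum>k\<le>length w. cmod (a (take k w) * b (drop k w))) * \<rho> ^ length w"
     using r by (intro mult_right_mono norm_sum) simp
    also have "\<dots> = (\<Sum>k\<le>length w. ?g a (take k w) * ?g b (drop k w))" unfolding sum_distrib_right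
    proof (rule sum.cong[OF refl])
     fix k assume "k \<in> {..length w}"
     then have "\<rho> ^ length w = \<rho> ^ length (take k w) * \<rho> ^ length (drop k w)" by (simp flip: power_add)
     then show "cmod (a (take k w) * b (drop k w)) * \<rho> ^ length w = ?g a (take k w) * ?g b (drop k w)"
      by (simp add: norm_mult)
    qed
    finally show "cmod (\<Sum>k\<le>length w. a (take k w) * b (drop k w)) * \<rho> ^ length w \<le>
      (\<Sum>k\<le>length w. ?g a (take k w) * ?g b (drop k w))" .
  qed
  also have "\<dots> = (\<Sum>z\<in>D. ?g a (fst (h z)) * ?g b (snd (h z)))"
    unfolding D_def h_def fst_conv snd_conv using W
    by (subst sum.Sigma) (simp_all only: finite_atMost case_prod_beta' ball_simps simp_thms ball_UNIV ball_triv implies_True_equals)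
  also have "\<dots> = (\<Sum>z\<in>h ` D. ?g a (fst z) * ?g b (snd z))" by (simp add: sum.reindex[OF inj])
  also have "\<dots> \<le> (\<Sum>z\<in>(fst ` h ` D) \<times> (snd ` h ` D). ?g a (fst z) * ?g b (snd z))"
  proof (rule sum_mono2)
    show "h ` D \<subseteq> (fst ` h ` D) \<times> (snd ` h ` D)"
    proof
     fix y assume "y \<in> h ` D"
     then show "y \<in> (fst ` h ` D) \<times> (snd ` h ` D)" unfolding mem_Times_iff by (intro conjI imageI)
    qed
  qed (use D r in auto)
  also have "\<dots> = part \<rho> (fst ` h ` D) a * part \<rho> (snd ` h ` D) b"
    by (simp add: sum_product sum.cartesian_product case_prod_beta')
  also have "\<dots> \<le> fe_norm \<rho> a * fe_norm \<rho> b"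
    using D r by (intro mult_mono part_le_norm a b sum_nonneg fe_norm_nonneg) auto
  finally show ?thesis .
qed

lemma take_drop_words: "k \<le> length w ==> w \<notin> words n ==> take k w \<notin> words n \<or> drop k w \<notin> words n"
  unfolding words_def by (metis (no_types, lifting) Un_least append_take_drop_id mem_Collect_eq set_append)

lemma fe_mult_closed:
  assumes a: "a \<in> car FE" and b: "b \<in> car FE"
  shows "a \<otimes>\<^sub>FE b \<in> car FE" "0 < \<rho> ==> fe_norm \<rho> (a \<otimes>\<^sub>FE b) \<le> fe_norm \<rho> a * fe_norm \<rho> b"
proof -
  have z: "a (take k w) * b (drop k w) = 0" if "k \<le> length w" "w \<notin> words n" for k w
    using take_drop_words[OF that] fe_support[OF a] fe_support[OF b] by auto
  show c: "a \<otimes>\<^sub>FE b \<in> car FE" unfolding free_entire_simps(2)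
  proof (rule fe_memI)
    fix w assume "w \<notin> words n"
    then show "(\<Sum>k\<le>length w. a (take k w) * b (drop k w)) = 0" by (intro sum.neutral ballI z) auto
  next
    fix \<rho> :: real assume r: "0 < \<rho>"
    show "\<exists>B. \<forall>W. finite W --> part \<rho> W (\<lambda>w. \<Sum>k\<le>length w. a (take k w) * b (drop k w)) \<le> B"
     using part_mult_le[OF a b r] by blast
  qed
  show "fe_norm \<rho> (a \<otimes>\<^sub>FE b) \<le> fe_norm \<rho> a * fe_norm \<rho> b" if r: "0 < \<rho>"
  proof -
    have "part \<rho> W (a \<otimes>\<^sub>FE b) \<le> fe_norm \<rho> a * fe_norm \<rho> b" if "finite W" for W
     unfolding free_entire_simps(2) by (rule part_mult_le[OF a b r that])
    then show ?thesis by (rule fe_norm_leI[OF c r])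
  qed
qed

lemma delta_closed:
  assumes w: "w \<in> words n"
  shows "delta w \<in> car FE"
proof (rule fe_memI)
  fix v assume "v \<notin> words n"
  then show "delta w v = 0" using w by (auto simp: delta_def)
next
  fix \<rho> :: real assume r: "0 < \<rho>"
  have "part \<rho> W (delta w) \<le> \<rho> ^ length w" if "finite W" for W
  proof -
    have "part \<rho> W (delta w) = (\<Sum>v\<in>W. if v = w then \<rho> ^ length w else 0)"
     by (intro sum.cong) (auto simp: delta_def)
    then show ?thesis using that r by simp
  qed
  then show "\<exists>B. \<forall>W. finite W --> part \<rho> W (delta w) \<le> B" by blast
qed

lemma fe_mult_assoc: "(a \<otimes>\<^sub>FE b) \<otimes>\<^sub>FE c = a \<otimes>\<^sub>FE (b \<otimes>\<^sub>FE c)"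
proof (rule ext)
  fix w :: "nat list"
  define L where "L = length w"
  define g where "g i j = a (take i w) * (b (take j (drop i w)) * c (drop (i + j) w))" for i j
  have "((a \<otimes>\<^sub>FE b) \<otimes>\<^sub>FE c) w = (\<Sum>k\<le>L. \<Sum>i\<le>k. g i (k - i))"
    unfolding free_entire_simps(2) L_def sum_distrib_right
  proof (rule sum.cong[OF refl])
    fix k assume k: "k \<in> {..length w}"
    then have l: "length (take k w) = k" by simp
    show "(\<Sum>i\<le>length (take k w). a (take i (take k w)) * b (drop i (take k w)) * c (drop k w)) = (\<Sum>i\<le>k. g i (k - i))"
     unfolding l by (rule sum.cong) (auto simp: g_def drop_take min_def mult.assoc)
  qed
  also have "\<dots> = (\<Sum>(i, j)\<in>{(i, j). i + j \<le> L}. g i j)" by (rule sum.triangle_reindex_eq[symmetric])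
  also have "{(i, j). i + j \<le> L} = Sigma {..L} (\<lambda>i. {..L - i})" by auto
  also have "(\<Sum>(i, j)\<in>Sigma {..L} (\<lambda>i. {..L - i}). g i j) = (\<Sum>i\<le>L. \<Sum>j\<le>L - i. g i j)" by (rule sum.Sigma[symmetric]) auto
  also have "\<dots> = (a \<otimes>\<^sub>FE (b \<otimes>\<^sub>FE c)) w"
    unfolding free_entire_simps(2) L_def sum_distrib_left by (intro sum.cong) (auto simp: g_def add.commute)
  finally show "((a \<otimes>\<^sub>FE b) \<otimes>\<^sub>FE c) w = (a \<otimes>\<^sub>FE (b \<otimes>\<^sub>FE c)) w" .
qed

lemma delta_mult: "delta u \<otimes>\<^sub>FE delta v = delta (u @ v)"
proof (rule ext)
  fix w
  show "(delta u \<otimes>\<^sub>FE delta v) w = delta (u @ v) w"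
  proof (cases "w = u @ v")
    case True
    have "delta u (take k w) * delta v (drop k w) = (if k = length u then 1 else 0)" if "k \<in> {..length w}" for k
    proof (cases "k = length u")
     case False
     have "length (take k w) \<noteq> length u" using that False by simp
     then have "take k w \<noteq> u" by blast
     then show ?thesis using False by (simp add: delta_def)
    qed (simp add: True delta_def)
    then have "(\<Sum>k\<le>length w. delta u (take k w) * delta v (drop k w)) = (\<Sum>k\<le>length w. if k = length u then 1 else 0)"
     by (rule sum.cong[OF refl])
    then show ?thesis using True by (simp add: free_entire_simps(2) delta_def)
  next
    case False
    have "delta u (take k w) * delta v (drop k w) = 0" for k
     using False append_take_drop_id[of k w] by (auto simp: delta_def)
    then have "(\<Sum>k\<le>length w. delta u (take k w) * delta v (drop k w)) = 0" by (intro sum.neutral ballI)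
    then show ?thesis using False by (simp add: free_entire_simps(2) delta_def[of "u @ v"])
  qed
qed

lemma fe_mult_one: "delta [] \<otimes>\<^sub>FE a = a" "a \<otimes>\<^sub>FE delta [] = a"
proof -
  have "(\<Sum>k\<le>length w. delta [] (take k w) * a (drop k w)) = (\<Sum>k\<le>length w. if k = 0 then a w else 0)" for w
    by (rule sum.cong) (auto simp: delta_def)
  then show "delta [] \<otimes>\<^sub>FE a = a" by (simp add: free_entire_simps(2))
  have "(\<Sum>k\<le>length w. a (take k w) * delta [] (drop k w)) = (\<Sum>k\<le>length w. if k = length w then a w else 0)" for w
    by (rule sum.cong) (auto simp: delta_def)
  then show "a \<otimes>\<^sub>FE delta [] = a" by (simp add: free_entire_simps(2))
qed

lemma ring_FE: "Ring.ring FE"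
proof (rule ringI)
  interpret cvs FE by (rule cvs_FE)
  show "abelian_group FE" by (rule abelian_group_axioms)
  show "Group.monoid FE"
    by (rule monoidI) (simp_all add: fe_mult_closed free_entire_simps(3) fe_mult_assoc fe_mult_one delta_closed words_def)
qed (simp_all add: free_entire_simps(2,5) fun_eq_iff algebra_simps sum.distrib)

lemma FE_topology: "lctop FE = seminorm_topology FE (fe_norm ` {\<rho>. 0 < \<rho>})" by (simp add: free_entire_def)

lemma is_seminorm_fe: "0 < \<rho> ==> is_seminorm FE (fe_norm \<rho>)" by (rule cvs.is_seminormI[OF cvs_FE])
    (simp_all add: fe_norm_nonneg free_entire_simps(5,6) fe_add_closed fe_smult_closed)

lemma FE_seminorms: "\<forall>p\<in>fe_norm ` {\<rho>. 0 < \<rho>}. is_seminorm FE p" using is_seminorm_fe by auto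

lemma lc_space_FE: "lc_space FE" by (rule lc_space_seminorm_topology[OF cvs_FE FE_seminorms FE_topology])

lemma fe_norm_cont: "0 < \<rho> ==> fe_norm \<rho> \<in> csn FE"
  using generating_cont_seminorms[OF cvs_FE FE_seminorms FE_topology] by auto

lemma fe_norm_mono:
  assumes "a \<in> car FE" "0 < \<rho>" "\<rho> \<le> \<sigma>"
  shows "fe_norm \<rho> a \<le> fe_norm \<sigma> a"
proof -
  have s: "0 < \<sigma>" using assms by simp
  show ?thesis
  proof (rule fe_norm_leI[OF assms(1,2)])
    fix W :: "nat list set" assume "finite W"
    have "part \<rho> W a \<le> part \<sigma> W a" using assms by (intro sum_mono mult_left_mono power_mono) auto
    also have "\<dots> \<le> fe_norm \<sigma> a" by (rule part_le_norm) fact+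
    finally show "part \<rho> W a \<le> fe_norm \<sigma> a" .
  qed
qed

text \<open>
  The norms increase with \<open>\<rho>\<close>, so finitely many of them are dominated by one.
\<close>

lemma fe_dominated:
  assumes "p \<in> csn FE"
  shows "\<exists>\<rho>>0. \<exists>C>0. \<forall>a\<in>car FE. p a \<le> C * fe_norm \<rho> a"
proof -
  have "\<exists>q\<in>fe_norm ` {\<rho>. 0 < \<rho>}. \<exists>C>0. \<forall>x\<in>car FE. p x \<le> C * q x"
  proof (rule cont_seminorm_dominated[OF cvs_FE FE_seminorms FE_topology _ _ assms])
    show "fe_norm ` {\<rho>. 0 < \<rho>} \<noteq> {}" by (auto intro: exI[of _ 1])
    fix q q' assume "q \<in> fe_norm ` {\<rho>. 0 < \<rho>}" "q' \<in> fe_norm ` {\<rho>. 0 < \<rho>}"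
    then obtain \<rho> \<sigma> where "q = fe_norm \<rho>" "0 < \<rho>" "q' = fe_norm \<sigma>" "0 < \<sigma>" by auto
    then show "\<exists>q''\<in>fe_norm ` {\<rho>. 0 < \<rho>}. \<forall>x\<in>car FE. q x \<le> q'' x \<and> q' x \<le> q'' x"
     by (intro bexI[of _ "fe_norm (max \<rho> \<sigma>)"]) (auto intro: fe_norm_mono)
  qed
  then show ?thesis by auto
qed

lemma am_algebra_FE: "am_algebra FE"
proof (intro am_algebra.intro lc_space_FE ring_FE am_algebra_axioms.intro)
  interpret lc_space FE by (rule lc_space_FE)
  fix p assume "p \<in> csn FE"
  from fe_dominated[OF this] obtain \<rho> C where r: "0 < \<rho>" "0 < C" and le: "\<forall>a\<in>car FE. p a \<le> C * fe_norm \<rho> a"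
    by (elim exE conjE)
  have s: "submult FE (fe_norm \<rho>)"
    unfolding submult_def using fe_norm_cont[OF r(1)] fe_mult_closed(2)[OF _ _ r(1)] by simp
  have "submult FE (\<lambda>x. max 1 C * fe_norm \<rho> x)" by (rule submult_scale[OF s _ fe_mult_closed(1)]) simp
  moreover have "p a \<le> max 1 C * fe_norm \<rho> a" if a: "a \<in> car FE" for a
    by (rule order_trans[OF le[rule_format, OF a] mult_right_mono[OF _ fe_norm_nonneg[OF r(1)]]]) simp
  ultimately show "\<exists>s. submult FE s \<and> sn_le FE p s"
    by (intro exI[of _ "\<lambda>x. max 1 C * fe_norm \<rho> x"] conjI sn_leI)
qed (simp_all add: free_entire_simps(2,6) fun_eq_iff sum_distrib_left mult_ac)

text \<open>
  The limit is taken coefficientwise; finite partial sums of the norm pass to the limit, which gives both its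
  membership and the convergence in norm.
\<close>

lemma FE_complete: "is_complete_lcs FE"
proof -
  interpret lc_space FE by (rule lc_space_FE)
  have coef: "cmod (a w) \<le> fe_norm 1 a" if "a \<in> car FE" for a w using part_le_norm[OF that, of 1 "{w}"] by simp
  have "\<exists>l. limitin (lctop FE) (\<lambda>y. y) l F" if F: "cauchy_filter FE F" for F
  proof -
    note F' = F[unfolded cauchy_filter_iff]
    note nt = conjunct1[OF F'] and car = conjunct1[OF conjunct2[OF F']] and cau = conjunct2[OF conjunct2[OF F']]
    have "\<exists>l. ((\<lambda>a. a w) \<longlongrightarrow> l) F" for w
    proof -
     have "uniform_space_class.cauchy_filter (filtermap (\<lambda>a. a w) F)" unfolding cauchy_filter_metric_filtermap
     proof (intro allI impI)
      fix e :: real assume e: "0 < e"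
      obtain Q where Q: "eventually Q F" "\<forall>x\<in>car FE. \<forall>y\<in>car FE. Q x --> Q y --> fe_norm 1 (x \<ominus>\<^sub>FE y) < e"
       using cau[rule_format, OF fe_norm_cont[of 1] e] by auto
      show "\<exists>P. eventually P F \<and> (\<forall>x y. P x \<and> P y --> dist (x w) (y w) < e)"
      proof (intro exI[of _ "\<lambda>x. Q x \<and> x \<in> car FE"] conjI allI impI eventually_conj Q(1) car)
       fix x y assume xy: "(Q x \<and> x \<in> car FE) \<and> (Q y \<and> y \<in> car FE)"
       have "cmod ((x \<ominus>\<^sub>FE y) w) \<le> fe_norm 1 (x \<ominus>\<^sub>FE y)" using xy by (intro coef) simp
       also have "\<dots> < e" using xy Q(2) by simp
       finally show "dist (x w) (y w) < e" using xy by (simp add: fe_minus dist_norm)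
      qed
     qed
     then have "\<exists>c. filtermap (\<lambda>a. a w) F \<le> nhds c"
      using cauchy_filter_complete_converges[of "filtermap (\<lambda>a. a w) F" UNIV] complete_UNIV nt
      by (simp add: filtermap_bot_iff)
     then show ?thesis by (simp add: filterlim_def)
    qed
    then have "\<forall>w. \<exists>l. ((\<lambda>a. a w) \<longlongrightarrow> l) F" by blast
    from choice[OF this] obtain l where l: "\<And>w. ((\<lambda>a. a w) \<longlongrightarrow> l w) F" by auto
    have bound: "\<exists>Q. eventually Q F \<and> (\<forall>x\<in>car FE. Q x --> (\<forall>W. finite W --> part \<rho> W (\<lambda>w. x w - l w) \<le> e))"
     if r: "0 < \<rho>" and e: "0 < e" for \<rho> e
    proof -
     obtain Q where Q: "eventually Q F" "\<forall>x\<in>car FE. \<forall>y\<in>car FE. Q x --> Q y --> fe_norm \<rho> (x \<ominus>\<^sub>FE y) < e"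
      using cau[rule_format, OF fe_norm_cont[OF r] e] by auto
     have "part \<rho> W (\<lambda>w. x w - l w) \<le> e" if x: "x \<in> car FE" "Q x" and W: "finite W" for x W
     proof (rule tendsto_upperbound[OF _ _ nt])
      show "((\<lambda>y. part \<rho> W (\<lambda>w. x w - y w)) \<longlongrightarrow> part \<rho> W (\<lambda>w. x w - l w)) F"
       by (intro tendsto_intros l)
      show "eventually (\<lambda>y. part \<rho> W (\<lambda>w. x w - y w) \<le> e) F" using Q(1) car
      proof eventually_elim
       fix y assume y: "Q y" "y \<in> car FE"
       have "part \<rho> W (x \<ominus>\<^sub>FE y) \<le> fe_norm \<rho> (x \<ominus>\<^sub>FE y)" using x y by (intro part_le_norm r W) simp
       also have "\<dots> < e" using x y Q(2) by simp
       finally show "part \<rho> W (\<lambda>w. x w - y w) \<le> e" using x y by (simp add: fe_minus)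
      qed
     qed
     then show ?thesis using Q(1) by blast
    qed
    obtain x0 where x0: "x0 \<in> car FE" using eventually_happens[OF car] nt by auto
    have lc: "l \<in> car FE"
    proof (rule fe_memI)
     fix w assume w: "w \<notin> words n"
     have "eventually (\<lambda>a. a w = 0) F" using car by eventually_elim (rule fe_support[OF _ w])
     then have "((\<lambda>a. a w) \<longlongrightarrow> 0) F" by (rule tendsto_eventually)
     then show "l w = 0" using l[of w] tendsto_unique[OF nt] by blast
    next
     fix \<rho> :: real assume r: "0 < \<rho>"
     obtain Q where Q: "eventually Q F" "\<forall>x\<in>car FE. Q x --> (\<forall>W. finite W --> part \<rho> W (\<lambda>w. x w - l w) \<le> 1)"
      using bound[OF r, of 1] by auto
     obtain x where x: "Q x" "x \<in> car FE" using eventually_happens[OF eventually_conj[OF Q(1) car]] nt by auto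
     have "part \<rho> W l \<le> 1 + fe_norm \<rho> x" if W: "finite W" for W
     proof -
      have "part \<rho> W l \<le> part \<rho> W (\<lambda>w. -1 * (x w - l w)) + part \<rho> W x"
       using part_add[OF r, where W = W and a = "\<lambda>w. -1 * (x w - l w)" and b = x] by simp
      moreover have "part \<rho> W (\<lambda>w. -1 * (x w - l w)) \<le> 1"
       unfolding part_smult using bspec[OF Q(2) x(2)] x(1) W by simp
      ultimately show ?thesis using part_le_norm[OF x(2) r W] by linarith
     qed
     then show "\<exists>B. \<forall>W. finite W --> part \<rho> W l \<le> B" by blast
    qed
    have "limitin (lctop FE) (\<lambda>y. y) l F" unfolding limitin_iff
    proof (intro conjI lc car ballI allI impI)
     fix p and e :: real assume p: "p \<in> csn FE" and e: "0 < e"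
     obtain \<rho> C where r: "0 < \<rho>" "0 < C" and le: "\<forall>a\<in>car FE. p a \<le> C * fe_norm \<rho> a"
      using fe_dominated[OF p] by (elim exE conjE)
     have e2: "0 < e / (2 * C)" using e r by simp
     obtain Q where Q: "eventually Q F" "\<forall>x\<in>car FE. Q x --> (\<forall>W. finite W --> part \<rho> W (\<lambda>w. x w - l w) \<le> e / (2 * C))"
      using bound[OF r(1) e2] by auto
     show "eventually (\<lambda>y. p (y \<ominus>\<^sub>FE l) < e) F" using Q(1) car
     proof eventually_elim
      fix y assume y: "Q y" "y \<in> car FE"
      have "fe_norm \<rho> (y \<ominus>\<^sub>FE l) \<le> e / (2 * C)"
      proof (rule fe_norm_leI[OF minus_closed[OF y(2) lc] r(1)])
       fix W :: "nat list set" assume W: "finite W"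
       show "part \<rho> W (y \<ominus>\<^sub>FE l) \<le> e / (2 * C)"
        unfolding fe_minus[OF y(2) lc] using bspec[OF Q(2) y(2)] y(1) W by simp
      qed
      then have "C * fe_norm \<rho> (y \<ominus>\<^sub>FE l) \<le> C * (e / (2 * C))" using r by (intro mult_left_mono) auto
      also have "\<dots> < e" using r e by simp
      finally show "p (y \<ominus>\<^sub>FE l) < e" using bspec[OF le, of "y \<ominus>\<^sub>FE l"] y lc by simp
     qed
    qed
    then show ?thesis by blast
  qed
  moreover have "Hausdorff_space (lctop FE)" unfolding Hausdorff_iff
  proof (intro ballI impI)
    fix a assume a: "a \<in> car FE" and 0: "\<forall>p\<in>csn FE. p a = 0"
    have "fe_norm 1 a = 0" using bspec[OF 0 fe_norm_cont[of 1]] by simp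
    then have "a w = 0" for w using coef[OF a, of w] by simp
    then show "a = \<zero>\<^sub>FE" by (simp add: free_entire_simps(4) fun_eq_iff)
  qed
  ultimately show ?thesis unfolding is_complete_lcs_def is_lcs_iff using lc_space_FE by blast
qed

lemma complete_am_FE: "cam_algebra FE" by (intro cam_algebra.intro am_algebra_FE cam_algebra_axioms.intro FE_complete)

lemma delta_fun: "delta \<in> words n \<rightarrow> car FE" by (simp add: delta_closed)

lemma lincomb_delta:
  assumes "keys p \<subseteq> words n"
  shows "lincomb FE delta p = lookup p" using assms
proof (induction p rule: free_vector_induct)
  interpret cvs FE by (rule cvs_FE)
  {
    case zero
    then show ?case by (simp add: free_entire_simps(4) fun_eq_iff)
  next
    case (step w c p)
    show ?case unfolding lincomb_add[OF delta_fun keys_single_subset[OF step(1)] step(2)] step(3)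
     by (simp add: lincomb_single delta_closed[OF step(1)] free_entire_simps(5,6))
      (simp add: fun_eq_iff delta_def lookup_add lookup_single when_def)
  }
qed

lemma fe_norm_finite:
  assumes p: "keys p \<subseteq> words n"
  shows "fe_norm \<rho> (lincomb FE delta p) = part \<rho> (keys p) (lookup p)"
proof -
  have "fe_norm \<rho> (lincomb FE delta p) = infsum (\<lambda>w. cmod (lookup p w) * \<rho> ^ length w) (keys p)"
    unfolding lincomb_delta[OF p] fe_norm_def by (rule infsum_cong_neutral) (auto simp: in_keys_iff)
  then show ?thesis by simp
qed

text \<open>
  The tail of an absolutely convergent series is small in the norm under consideration.
\<close>

lemma total_delta: "total_in FE (words n) delta" unfolding total_in_def
proof (intro conjI ballI allI impI delta_fun)
  interpret lc_space FE by (rule lc_space_FE)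
  fix a p and e :: real assume a: "a \<in> car FE" and p: "p \<in> csn FE" and e: "0 < e"
  obtain \<rho> C where r: "0 < \<rho>" "0 < C" and le: "\<forall>a\<in>car FE. p a \<le> C * fe_norm \<rho> a"
    using fe_dominated[OF p] by (elim exE conjE)
  let ?f = "\<lambda>w. cmod (a w) * \<rho> ^ length w"
  have e2: "0 < e / (2 * C)" using e r by simp
  have "eventually (\<lambda>W. dist (sum ?f W) (infsum ?f UNIV) < e / (2 * C)) (finite_subsets_at_top UNIV)"
    by (rule tendstoD[OF infsum_tendsto[OF fe_summable[OF a r(1)]] e2])
  then obtain W where W: "finite W" "dist (sum ?f W) (infsum ?f UNIV) < e / (2 * C)"
    unfolding eventually_finite_subsets_at_top by auto
  define q where "q = Abs_poly_mapping (\<lambda>w. if w \<in> W then a w else 0)"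
  have lq: "lookup q = (\<lambda>w. if w \<in> W then a w else 0)"
    unfolding q_def by (rule lookup_Abs_poly_mapping) (rule finite_subset[OF _ W(1)], auto split: if_splits)
  have kq: "keys q \<subseteq> words n"
  proof (rule subsetI, rule ccontr)
    fix w assume "w \<in> keys q" "w \<notin> words n"
    then show False using fe_support[OF a] by (simp add: in_keys_iff lq split: if_splits)
  qed
  have qc: "lookup q \<in> car FE" using lincomb_closed[OF delta_fun kq] by (simp add: lincomb_delta[OF kq])
  have "fe_norm \<rho> (lincomb FE delta q \<ominus>\<^sub>FE a) \<le> e / (2 * C)"
    unfolding lincomb_delta[OF kq] fe_minus[OF qc a]
  proof (rule fe_norm_leI[OF _ r(1)])
    show "(\<lambda>w. lookup q w - a w) \<in> car FE" using minus_closed[OF qc a] by (simp add: fe_minus[OF qc a])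
    fix V :: "nat list set" assume V: "finite V"
    have "part \<rho> V (\<lambda>w. lookup q w - a w) = sum ?f (V - W)"
     using V by (intro sum.mono_neutral_cong_right) (auto simp: lq)
    also have "\<dots> = sum ?f (V \<union> W) - sum ?f W" using V W(1) by (subst sum_diff[symmetric]) (auto intro!: sum.cong)
    also have "sum ?f (V \<union> W) \<le> infsum ?f UNIV"
     using part_le_norm[OF a r(1), of "V \<union> W"] V W(1) by (simp add: fe_norm_def)
    finally show "part \<rho> V (\<lambda>w. lookup q w - a w) \<le> e / (2 * C)"
     using W(2) by (simp add: dist_real_def)
  qed
  then have "C * fe_norm \<rho> (lincomb FE delta q \<ominus>\<^sub>FE a) \<le> C * (e / (2 * C))" using r by (intro mult_left_mono) auto
  also have "\<dots> < e" using r e by simp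
  finally have "p (lincomb FE delta q \<ominus>\<^sub>FE a) < e"
    using bspec[OF le minus_closed[OF lincomb_closed[OF delta_fun kq] a]] by simp
  then show "\<exists>w. keys w \<subseteq> words n \<and> p (lincomb FE delta w \<ominus>\<^sub>FE a) < e" using kq by blast
qed

lemma fe_gen_delta: "fe_gen i = delta [i]" by (simp add: fe_gen_def delta_def)

text \<open>
  The universal property. The monomials in given elements \<open>g i\<close> grow at most geometrically in each
  submultiplicative seminorm, so substituting \<open>g\<close> is dominated by one of the norms of \<open>FE\<close>.
\<close>

lemma evaluation_exists:
  assumes B: "cam_algebra B" and g: "\<And>i. i \<in> {1..n} ==> g i \<in> car B"
  shows "\<exists>f. cont_alg_hom FE B f \<and> (\<forall>i\<in>{1..n}. f (fe_gen i) = g i)"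
proof -
  interpret B: cam_algebra B by fact
  define X where "X w = foldr (\<lambda>i b. g i \<otimes>\<^sub>B b) w \<one>\<^sub>B" for w
  have Xs: "X [] = \<one>\<^sub>B" "X (i # w) = g i \<otimes>\<^sub>B X w" for i w by (simp_all add: X_def)
  have Xc: "X w \<in> car B" if "w \<in> words n" for w using that by (induction w) (auto simp: Xs words_def intro!: g)
  then have Xf: "X \<in> words n \<rightarrow> car B" by simp
  have X_app: "X (u @ v) = X u \<otimes>\<^sub>B X v" if "u \<in> words n" "v \<in> words n" for u v using that
  proof (induction u)
    case (Cons i u)
    then have "g i \<in> car B" "X u \<in> car B" "X v \<in> car B" by (auto simp: words_def intro!: g Xc)
    then show ?case using Cons by (simp add: Xs B.m_assoc words_def)
  qed (simp add: Xs Xc)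
  have dom: "\<exists>r\<in>csn FE. \<forall>w. keys w \<subseteq> words n --> p (lincomb B X w) \<le> r (lincomb FE delta w)"
    if p: "p \<in> csn B" for p
  proof -
    obtain s where s: "submult B s" "sn_le B p s" using B.submult_above[OF p] by (elim exE conjE)
    note sc = submultD(1)[OF s(1)]
    note ss = B.csnD[OF sc]
    define R where "R = 1 + (\<Sum>i\<in>{1..n}. s (g i))"
    have sg: "0 \<le> s (g i)" if "i \<in> {1..n}" for i by (rule B.sn_nonneg[OF ss g[OF that]])
    have R: "0 < R" unfolding R_def using sg by (intro add_pos_nonneg sum_nonneg) auto
    have gR: "s (g i) \<le> R" if "i \<in> {1..n}" for i
     using member_le_sum[of i "{1..n}" "\<lambda>i. s (g i)"] that sg by (simp add: R_def)
    have sX: "s (X w) \<le> s \<one>\<^sub>B * R ^ length w" if "w \<in> words n" for w using that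
    proof (induction w)
     case (Cons i w)
     then have i: "i \<in> {1..n}" and w: "w \<in> words n" by (auto simp: words_def)
     have "s (X (i # w)) \<le> s (g i) * s (X w)" unfolding Xs by (rule submultD(2)[OF s(1) g[OF i] Xc[OF w]])
     also have "\<dots> \<le> R * (s \<one>\<^sub>B * R ^ length w)"
      using gR[OF i] Cons.IH[OF w] R B.sn_nonneg[OF ss Xc[OF w]] by (intro mult_mono) auto
     finally show ?case by (simp add: mult_ac)
    qed (simp add: Xs)
    have one: "0 \<le> s \<one>\<^sub>B" by (rule B.sn_nonneg[OF ss]) simp
    show ?thesis
    proof (rule bexI[OF _ lc_space.csn_scale[OF lc_space_FE fe_norm_cont[OF R] one]], intro allI impI)
     fix w :: "nat list \<Rightarrow>\<^sub>0 complex" assume w: "keys w \<subseteq> words n"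
     have "p (lincomb B X w) \<le> s (lincomb B X w)" by (rule sn_leD[OF s(2) B.lincomb_closed[OF Xf w]])
     also have "\<dots> \<le> (\<Sum>k\<in>keys w. cmod (lookup w k) * s (X k))" by (rule B.seminorm_lincomb[OF ss Xf w])
     also have "\<dots> \<le> (\<Sum>k\<in>keys w. cmod (lookup w k) * (s \<one>\<^sub>B * R ^ length k))"
      using w sX by (intro sum_mono mult_left_mono) auto
     also have "\<dots> = s \<one>\<^sub>B * fe_norm R (lincomb FE delta w)"
      by (simp add: fe_norm_finite[OF w] sum_distrib_left mult_ac)
     finally show "p (lincomb B X w) \<le> s \<one>\<^sub>B * fe_norm R (lincomb FE delta w)" .
    qed
  qed
  have "\<exists>f. cont_linear FE B f \<and> (\<forall>w\<in>words n. f (delta w) = X w)"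
    by (rule extension_exists[OF lc_space_FE B.complete total_delta Xf dom])
  then obtain f where f: "cont_linear FE B f" "\<forall>w\<in>words n. f (delta w) = X w" by (elim exE conjE)
  have nil: "[] \<in> words n" by (simp add: words_def)
  have "cont_alg_hom FE B f"
  proof (rule homI[OF f(1)])
    show "f \<one>\<^sub>FE = \<one>\<^sub>B" using f(2) nil by (simp add: free_entire_simps(3) Xs)
    fix x y assume x: "x \<in> car FE" and y: "y \<in> car FE"
    show "f (x \<otimes>\<^sub>FE y) = f x \<otimes>\<^sub>B f y"
    proof (rule multiplicative_on_total[OF am_algebra_FE B.am_algebra_axioms B.complete f(1) total_delta _ x y])
     fix u v assume uv: "u \<in> words n" "v \<in> words n"
     then have "u @ v \<in> words n" by (simp add: words_def)
     then show "f (delta u \<otimes>\<^sub>FE delta v) = f (delta u) \<otimes>\<^sub>B f (delta v)" using uv f(2) by (simp add: delta_mult X_app)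
    qed
  qed
  moreover have "f (fe_gen i) = g i" if i: "i \<in> {1..n}" for i
  proof -
    have "[i] \<in> words n" using i by (auto simp: words_def)
    then have "f (delta [i]) = X [i]" using f(2) by blast
    then show ?thesis using g[OF i] by (simp add: fe_gen_delta Xs)
  qed
  ultimately show ?thesis by blast
qed

lemma hom_unique:
  assumes B: "cam_algebra B" and f: "cont_alg_hom FE B f" and g: "cont_alg_hom FE B g"
    and eq: "\<And>i. i \<in> {1..n} ==> f (fe_gen i) = g (fe_gen i)" and x: "x \<in> car FE"
  shows "f x = g x"
proof -
  interpret B: cam_algebra B by fact
  show ?thesis
  proof (rule cont_linear_eq_on_total[OF lc_space_FE B.complete homD(1)[OF f] homD(1)[OF g] total_delta _ x])
    fix w assume "w \<in> words n"
    then show "f (delta w) = g (delta w)"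
    proof (induction w)
     case Nil
     then show ?case using homD(5)[OF f] homD(5)[OF g] by (simp add: free_entire_simps(3))
    next
     case (Cons i w)
     then have i: "i \<in> {1..n}" and w: "w \<in> words n" and i': "[i] \<in> words n" by (auto simp: words_def)
     have d: "delta (i # w) = delta [i] \<otimes>\<^sub>FE delta w" by (simp add: delta_mult)
     show ?case unfolding d homD(4)[OF f delta_closed[OF i'] delta_closed[OF w]]
       homD(4)[OF g delta_closed[OF i'] delta_closed[OF w]] using eq[OF i] Cons.IH[OF w] by (simp add: fe_gen_delta)
    qed
  qed
qed

lemma fe_gen_closed: "i \<in> {1..n} ==> fe_gen i \<in> car FE"
  unfolding fe_gen_delta by (rule delta_closed) (simp add: words_def)

end

section \<open>Frechet spaces and their quotients\<close>

text \<open>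
  An increasing sequence of seminorms that is cofinal among the continuous ones.
\<close>

locale frechet_seminorms = lc_space E for E :: "'a lcs" (structure) +
  fixes P :: "nat => 'a => real"
  assumes P_cont: "P k \<in> csn E"
    and P_Suc: "x \<in> car E ==> P k x \<le> P (Suc k) x"
    and P_dominates: "p \<in> csn E ==> \<exists>k. \<exists>C>0. sn_le E p (\<lambda>x. C * P k x)"
begin

lemma P_seminorm: "is_seminorm E (P k)" by (rule csnD[OF P_cont])

lemma P_mono: "x \<in> car E ==> j \<le> k ==> P j x \<le> P k x"
  by (rule lift_Suc_mono_le[of "\<lambda>k. P k x"]) (rule P_Suc)

text \<open>
  Cutting the \<open>k\<close>-th seminorm off at \<open>1 / (k + 1)\<close> makes a small distance control only finitely many seminorms.
\<close>

definition dst :: "'a => 'a => real" where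
  "dst x y = (if x \<in> car E \<and> y \<in> car E then SUP k. min (P k (x \<ominus> y)) (1 / real (Suc k)) else 0)"

lemma min_bdd: "bdd_above (range (\<lambda>k. min (P k z) (1 / real (Suc k))))"
proof (rule bdd_aboveI2)
  fix k show "min (P k z) (1 / real (Suc k)) \<le> 1" by (rule min.coboundedI2) simp
qed

lemma dst_upper: "x \<in> car E ==> y \<in> car E ==> min (P k (x \<ominus> y)) (1 / real (Suc k)) \<le> dst x y"
  unfolding dst_def by (simp only: simp_thms if_True) (rule cSUP_upper[OF UNIV_I min_bdd])

lemma dst_least:
  "x \<in> car E ==> y \<in> car E ==> (\<And>k. min (P k (x \<ominus> y)) (1 / real (Suc k)) \<le> B) ==> dst x y \<le> B"
  unfolding dst_def by (simp only: simp_thms if_True) (rule cSUP_least[OF UNIV_not_empty])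

lemma min_nonneg: "z \<in> car E ==> 0 \<le> min (P k z) (1 / real (Suc k))" using sn_nonneg[OF P_seminorm] by simp

lemma metric_dst:
  assumes H: "Hausdorff_space (lctop E)"
  shows "Metric_space (car E) dst"
proof
  show "0 \<le> dst x y" for x y
  proof (cases "x \<in> car E \<and> y \<in> car E")
    case True
    then show ?thesis using order_trans[OF min_nonneg dst_upper[of x y 0]] by blast
  next
    case False
    then show ?thesis unfolding dst_def by (simp only: if_False order_refl)
  qed
  show "dst x y = dst y x" for x y
  proof (cases "x \<in> car E \<and> y \<in> car E")
    case True
    then have "P k (x \<ominus> y) = P k (y \<ominus> x)" for k using seminorm_minus_commute[OF P_seminorm] by blast
    then show ?thesis using True by (simp add: dst_def)
  next
    case False
    then have "\<not> (y \<in> car E \<and> x \<in> car E)" by blast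
    then show ?thesis using False unfolding dst_def by (simp only: if_False)
  qed
  show "dst x y = 0 \<longleftrightarrow> x = y" if x: "x \<in> car E" and y: "y \<in> car E" for x y
  proof
    assume 0: "dst x y = 0"
    have z: "P k (x \<ominus> y) = 0" for k
     using dst_upper[OF x y, of k] 0 sn_nonneg[OF P_seminorm minus_closed[OF x y], of k] of_nat_0_less_iff[of "Suc k"]
     by (simp add: min_le_iff_disj)
    have "p (x \<ominus> y) = 0" if p: "p \<in> csn E" for p
    proof -
     obtain k C where C: "0 < C" "sn_le E p (\<lambda>x. C * P k x)" using P_dominates[OF p] by (elim exE conjE)
     from sn_leD[OF C(2) minus_closed[OF x y]] have "p (x \<ominus> y) \<le> 0" by (simp add: z)
     then show ?thesis using sn_nonneg[OF csnD[OF p] minus_closed[OF x y]] by simp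
    qed
    then have "x \<ominus> y = \<zero>" using H[unfolded Hausdorff_iff] minus_closed[OF x y] by blast
    then show "x = y" using minus_eq_zero[OF x y] by simp
  next
    assume "x = y"
    then show "dst x y = 0" using x by (simp add: dst_def seminorm_zero[OF P_seminorm])
  qed
  show "dst x z \<le> dst x y + dst y z" if x: "x \<in> car E" and y: "y \<in> car E" and z: "z \<in> car E" for x y z
  proof (rule dst_least[OF x z])
    fix k
    have "P k (x \<ominus> z) \<le> P k (x \<ominus> y) + P k (y \<ominus> z)" by (rule seminorm_triangle[OF P_seminorm x y z])
    then have "min (P k (x \<ominus> z)) (1 / real (Suc k)) \<le>
      min (P k (x \<ominus> y)) (1 / real (Suc k)) + min (P k (y \<ominus> z)) (1 / real (Suc k))"
     using min_nonneg[OF minus_closed[OF x y], of k] min_nonneg[OF minus_closed[OF y z], of k] by linarith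
    then show "min (P k (x \<ominus> z)) (1 / real (Suc k)) \<le> dst x y + dst y z"
     using dst_upper[OF x y, of k] dst_upper[OF y z, of k] by linarith
  qed
qed

lemma metrizable:
  assumes H: "Hausdorff_space (lctop E)"
  shows "metrizable_space (lctop E)"
proof -
  interpret Metric_space "car E" dst by (rule metric_dst[OF H])
  have small: "\<exists>r>0. \<forall>y\<in>car E. dst x y < r --> p (y \<ominus> x) < 1"
    if x: "x \<in> car E" and p: "p \<in> csn E" for x p
  proof -
    obtain k C where C: "0 < C" "sn_le E p (\<lambda>x. C * P k x)" using P_dominates[OF p] by (elim exE conjE)
    have "0 < 1 / C" using C by simp
    then obtain m0 where m0: "1 / real (Suc m0) < 1 / C" using nat_approx_posE by blast
    define m where "m = max k m0"
    have m: "k \<le> m" "1 / real (Suc m) < 1 / C"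
    proof -
     have "1 / real (Suc m) \<le> 1 / real (Suc m0)" by (simp add: m_def field_simps)
     then show "1 / real (Suc m) < 1 / C" using m0 by linarith
    qed (simp add: m_def)
    have "p (y \<ominus> x) < 1" if y: "y \<in> car E" and d: "dst x y < 1 / real (Suc m)" for y
    proof -
     have "P m (x \<ominus> y) < 1 / real (Suc m)" using dst_upper[OF x y, of m] d by linarith
     then have "P k (y \<ominus> x) < 1 / C"
      using P_mono[OF minus_closed[OF y x] m(1)] seminorm_minus_commute[OF P_seminorm x y, of m] m(2) by linarith
     then have "C * P k (y \<ominus> x) < 1" using C(1) by (simp add: field_simps)
     then show ?thesis using sn_leD[OF C(2) minus_closed[OF y x]] by linarith
    qed
    moreover have "0 < 1 / real (Suc m)" by simp
    ultimately show ?thesis by blast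
  qed
  have ball: "\<exists>p\<in>csn E. \<forall>y\<in>car E. p (y \<ominus> x) < 1 --> dst x y < r"
    if x: "x \<in> car E" and r: "0 < r" for x r
  proof -
    have "0 < r / 2" using r by simp
    then obtain m where m: "1 / real (Suc m) < r / 2" using nat_approx_posE by blast
    have "dst x y < r" if y: "y \<in> car E" and p: "2 / r * P m (y \<ominus> x) < 1" for y
    proof -
     have p': "P m (x \<ominus> y) < r / 2" using p r seminorm_minus_commute[OF P_seminorm x y, of m] by (simp add: field_simps)
     have "dst x y \<le> r / 2"
     proof (rule dst_least[OF x y])
      fix k
      show "min (P k (x \<ominus> y)) (1 / real (Suc k)) \<le> r / 2"
      proof (cases "k \<le> m")
       case True
       then show ?thesis using P_mono[OF minus_closed[OF x y] True] p' by linarith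
      next
       case False
       then have "1 / real (Suc k) \<le> 1 / real (Suc m)" by (simp add: field_simps)
       then show ?thesis using m by linarith
      qed
     qed
     then show ?thesis using r by simp
    qed
    moreover have "(\<lambda>z. 2 / r * P m z) \<in> csn E" using r by (intro csn_scale P_cont) simp
    ultimately show ?thesis by (intro bexI[of _ "\<lambda>z. 2 / r * P m z"] ballI impI)
  qed
  have "openin (lctop E) U \<longleftrightarrow> openin mtopology U" for U unfolding openin_iff openin_mtopology
  proof (intro conj_cong refl iffI allI ballI impI)
    fix x assume U: "U \<subseteq> car E" and o: "\<forall>x\<in>U. \<exists>p\<in>csn E. {y \<in> car E. p (y \<ominus> x) < 1} \<subseteq> U" and x: "x \<in> U"
    obtain p where p: "p \<in> csn E" "{y \<in> car E. p (y \<ominus> x) < 1} \<subseteq> U" using bspec[OF o x] by (elim bexE)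
    obtain r where r: "0 < r" "\<forall>y\<in>car E. dst x y < r --> p (y \<ominus> x) < 1" using small[OF subsetD[OF U x] p(1)] by (elim exE conjE)
    have "mball x r \<subseteq> U"
    proof
     fix y assume "y \<in> mball x r"
     then have y: "y \<in> car E" "dst x y < r" by (simp_all add: in_mball)
     then show "y \<in> U" using r(2)[rule_format, OF y] by (intro subsetD[OF p(2)]) simp
    qed
    then show "\<exists>r>0. mball x r \<subseteq> U" using r(1) by blast
  next
    fix x assume U: "U \<subseteq> car E" and o: "\<forall>x. x \<in> U --> (\<exists>r>0. mball x r \<subseteq> U)" and x: "x \<in> U"
    obtain r where r: "0 < r" "mball x r \<subseteq> U" using o[rule_format, OF x] by (elim exE conjE)
    have xc: "x \<in> car E" using U x by blast
    obtain p where p: "p \<in> csn E" "\<forall>y\<in>car E. p (y \<ominus> x) < 1 --> dst x y < r" using ball[OF xc r(1)] by (elim bexE)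
    have "{y \<in> car E. p (y \<ominus> x) < 1} \<subseteq> U"
    proof
     fix y assume "y \<in> {y \<in> car E. p (y \<ominus> x) < 1}"
     then have y: "y \<in> car E" "p (y \<ominus> x) < 1" by simp_all
     then have "y \<in> mball x r" using p(2)[rule_format, OF y] xc by (simp add: in_mball)
     then show "y \<in> U" using r(2) by blast
    qed
    then show "\<exists>p\<in>csn E. {y \<in> car E. p (y \<ominus> x) < 1} \<subseteq> U" by (rule bexI[OF _ p(1)])
  qed
  then have "lctop E = mtopology" by (simp add: topology_eq)
  then show ?thesis using metrizable_space_mtopology by simp
qed

end

text \<open>
  By domination, every neighbourhood of \<open>0\<close> contains a ball of a submultiplicative seminorm.
\<close>

lemma (in am_algebra) submult_topology:
  "lctop A = seminorm_topology A {s. submult A s}" unfolding topology_eq openin_seminorm_topology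
proof (intro allI iffI)
  fix U assume o: "openin (lctop A) U"
  show "seminorm_open A {s. submult A s} U" unfolding seminorm_open_def
  proof (intro conjI ballI)
    show "U \<subseteq> car A" using o unfolding openin_iff by simp
    fix x assume x: "x \<in> U"
    then have xc: "x \<in> car A" using o unfolding openin_iff by blast
    obtain p where p: "p \<in> csn A" "{y \<in> car A. p (y \<ominus> x) < 1} \<subseteq> U"
     using bspec[OF conjunct2[OF o[unfolded openin_iff]] x] by (elim bexE)
    obtain s where s: "submult A s" "sn_le A p s" using submult_above[OF p(1)] by (elim exE conjE)
    have "{y \<in> car A. \<forall>p\<in>{s}. p (y \<ominus> x) < 1} \<subseteq> U"
    proof
     fix y assume "y \<in> {y \<in> car A. \<forall>p\<in>{s}. p (y \<ominus> x) < 1}"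
     then have y: "y \<in> car A" "s (y \<ominus> x) < 1" by simp_all
     then show "y \<in> U" using sn_leD[OF s(2) minus_closed[OF y(1) xc]] by (intro subsetD[OF p(2)]) simp
    qed
    then show "\<exists>Q e. finite Q \<and> Q \<subseteq> {s. submult A s} \<and> 0 < e \<and> {y \<in> car A. \<forall>p\<in>Q. p (y \<ominus> x) < e} \<subseteq> U"
     using s(1) by (intro exI[of _ "{s}"] exI[of _ "1::real"]) simp
  qed
next
  fix U assume o: "seminorm_open A {s. submult A s} U"
  show "openin (lctop A) U" unfolding openin_iff
  proof (intro conjI ballI)
    show U: "U \<subseteq> car A" using o unfolding seminorm_open_def by simp
    fix x assume x: "x \<in> U"
    have xc: "x \<in> car A" using x U by blast
    obtain Q e where Q: "finite Q" "Q \<subseteq> {s. submult A s}" "0 < e" "{y \<in> car A. \<forall>p\<in>Q. p (y \<ominus> x) < e} \<subseteq> U"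
     using bspec[OF conjunct2[OF o[unfolded seminorm_open_def]] x] by (elim exE conjE)
    have c: "s \<in> csn A" if "s \<in> Q" for s using submultD(1)[of A s] that Q(2) by blast
    define p where "p = (\<lambda>y. \<Sum>s\<in>Q. 1 / e * s y)"
    have pc: "p \<in> csn A" unfolding p_def using Q(3) by (intro csn_sum Q(1) csn_scale c) simp_all
    have "{y \<in> car A. p (y \<ominus> x) < 1} \<subseteq> U"
    proof
     fix y assume "y \<in> {y \<in> car A. p (y \<ominus> x) < 1}"
     then have y: "y \<in> car A" "p (y \<ominus> x) < 1" by simp_all
     have "s (y \<ominus> x) < e" if s: "s \<in> Q" for s
     proof -
      have "1 / e * s (y \<ominus> x) \<le> p (y \<ominus> x)"
       unfolding p_def using Q(3) xc y(1) sn_nonneg[OF csnD[OF c]]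
       by (intro member_le_sum[OF s]) (simp_all add: Q(1))
      then have "1 / e * s (y \<ominus> x) < 1" using y(2) by linarith
      then show ?thesis using Q(3) by (simp add: field_simps)
     qed
     then show "y \<in> U" using y(1) by (intro subsetD[OF Q(4)]) simp
    qed
    then show "\<exists>p\<in>csn A. {y \<in> car A. p (y \<ominus> x) < 1} \<subseteq> U" by (rule bexI[OF _ pc])
  qed
qed

lemma frechet_arens_michaelI:
  assumes "cam_algebra A" "frechet_seminorms A P"
  shows "is_frechet_arens_michael A"
proof -
  interpret cam_algebra A by fact
  interpret frechet_seminorms A P by fact
  have "Hausdorff_space (lctop A)" using complete by (simp add: is_complete_lcs_def)
  then have m: "metrizable_space (lctop A)" by (rule metrizable)
  have s: "is_seminorm A s \<and> (\<forall>x\<in>car A. \<forall>y\<in>car A. s (x \<otimes>\<^sub>A y) \<le> s x * s y)"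
    if "s \<in> {s. submult A s}" for s
  proof -
    have s: "submult A s" using that by simp
    show ?thesis by (intro conjI ballI csnD submultD[OF s])
  qed
  show ?thesis unfolding is_frechet_arens_michael_def
    by (intro conjI complete_algebra m exI[of _ "{s. submult A s}"] ballI[OF s] submult_topology)
qed

locale am_quotient = cam_algebra A for A :: "'a lcs" (structure) +
  fixes I :: "'a set"
  assumes ideal: "ideal I A" and closed: "closedin (lctop A) I"
begin

abbreviation Q where "Q \<equiv> quot_lcs A I"

lemma submodule_ideal: "submodule I CC A"
proof -
  interpret M: Module.module CC A by (rule is_module)
  interpret I: ideal I A by (rule ideal)
  show ?thesis
  proof (rule M.submoduleI)
    show "I \<subseteq> car A" by (rule I.a_subset)
    fix c x assume x: "x \<in> I"
    have xc: "x \<in> car A" using x I.a_subset by blast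
    have "c \<odot> x = (c \<odot> \<one>) \<otimes> x" using xc by (simp add: smult_mult_left)
    then show "c \<odot> x \<in> I" using I.I_l_closed[OF x, of "c \<odot> \<one>"] by simp
  qed (simp_all add: I.a_closed)
qed

sublocale q: quot_space A I by (rule quot_space.intro[OF cvs_axioms quot_space_axioms.intro[OF submodule_ideal]])

lemma quot_simps [simp]:
  "car Q = q.proj ` car A" "add Q = add (quot_module A I)" "zero Q = zero (quot_module A I)"
  "mult Q = mult (quot_module A I)" "one Q = one (quot_module A I)" "smult Q = smult (quot_module A I)"
  by (simp_all add: quot_lcs_def q.carrier_quot)

lemma Q_cases: "X \<in> car Q ==> \<exists>x. X = q.proj x \<and> x \<in> car A" by auto

lemma qsns: "\<forall>p\<in>qsn ` csn A. is_seminorm (quot_module A I) p" using q.is_seminorm_quot[OF csnD] by auto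

text \<open>The unit ball of a quotient seminorm is the image of a unit ball, so the two topologies have the same open sets.\<close>

lemma quot_topology: "lctop Q = seminorm_topology Q (qsn ` csn A)"
proof -
  define Q' where "Q' = module.extend (quot_module A I)
    (lcs.fields (seminorm_topology (quot_module A I) (qsn ` csn A)))"
  have top: "lctop Q' = seminorm_topology Q' (qsn ` csn A)" by (simp add: Q'_def)
  have cv: "cvs Q'" unfolding Q'_def by (rule cvs_extend[OF q.cvs_quot])
  have sn: "\<forall>p\<in>qsn ` csn A. is_seminorm Q' p" using qsns by (simp add: Q'_def)
  have lc: "lc_space Q'" by (rule lc_space_seminorm_topology[OF cv sn top])
  interpret Q': lc_space Q' by (rule lc)
  have car: "car Q' = q.proj ` car A" by (simp add: Q'_def q.carrier_quot)
  have lin: "is_linear A Q' q.proj" using q.lin_proj by (simp add: is_linear_def Q'_def)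
  have qc: "qsn s \<in> csn Q'" if "s \<in> csn A" for s
    by (rule subsetD[OF generating_cont_seminorms[OF cv sn top] imageI[OF that]])
  have dom: "\<exists>s\<in>csn A. \<exists>C>0. \<forall>X\<in>car Q'. p X \<le> C * qsn s X" if p: "p \<in> csn Q'" for p
  proof -
    have "\<exists>r\<in>qsn ` csn A. \<exists>C>0. \<forall>X\<in>car Q'. p X \<le> C * r X"
    proof (rule cont_seminorm_dominated[OF cv sn top _ _ p])
     show "qsn ` csn A \<noteq> {}" using csn_zero by blast
     fix r r' assume "r \<in> qsn ` csn A" "r' \<in> qsn ` csn A"
     then obtain s s' where s: "r = qsn s" "s \<in> csn A" "r' = qsn s'" "s' \<in> csn A" by (elim imageE)
     note ss = csnD[OF s(2)] csnD[OF s(4)]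
     have "\<forall>X\<in>car Q'. r X \<le> qsn (\<lambda>x. s x + s' x) X \<and> r' X \<le> qsn (\<lambda>x. s x + s' x) X"
      unfolding car
     proof (intro ballI, elim imageE)
      fix X x assume x: "X = q.proj x" "x \<in> car A"
      show "r X \<le> qsn (\<lambda>x. s x + s' x) X \<and> r' X \<le> qsn (\<lambda>x. s x + s' x) X"
       unfolding x(1) s(1,3)
      proof (intro conjI q.qsn_greatest[OF x(2)])
       fix y assume y: "y \<in> car A" "q.proj y = q.proj x"
       show "qsn s (q.proj x) \<le> s y + s' y"
        using q.qsn_le[OF ss(1) y(1)] sn_nonneg[OF ss(2) y(1)] unfolding y(2) by linarith
       show "qsn s' (q.proj x) \<le> s y + s' y"
        using q.qsn_le[OF ss(2) y(1)] sn_nonneg[OF ss(1) y(1)] unfolding y(2) by linarith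
      qed
     qed
     then show "\<exists>r''\<in>qsn ` csn A. \<forall>X\<in>car Q'. r X \<le> r'' X \<and> r' X \<le> r'' X"
      using csn_add[OF s(2,4)] by (intro bexI[of _ "qsn (\<lambda>x. s x + s' x)"] imageI)
    qed
    then show ?thesis by (elim bexE imageE) (rule bexI, simp_all)
  qed
  have cont: "cont_linear A Q' q.proj"
  proof (rule cont_linearI[OF lc_space_axioms lc lin])
    fix p assume p: "p \<in> csn Q'"
    obtain s C where s: "s \<in> csn A" "0 < C" "\<forall>X\<in>car Q'. p X \<le> C * qsn s X"
     using dom[OF p] by (elim bexE exE conjE)
    have "\<forall>x\<in>car A. p (q.proj x) \<le> C * s x"
    proof
     fix x assume x: "x \<in> car A"
     have "p (q.proj x) \<le> C * qsn s (q.proj x)" using bspec[OF s(3), of "q.proj x"] x by (simp add: car)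
     also have "\<dots> \<le> C * s x" using s(2) q.qsn_le[OF csnD[OF s(1)] x] by (intro mult_left_mono) auto
     finally show "p (q.proj x) \<le> C * s x" .
    qed
    then show "\<exists>r\<in>csn A. \<forall>x\<in>car A. p (q.proj x) \<le> r x"
     by (rule bexI[OF _ csn_scale[OF s(1) less_imp_le[OF s(2)]]])
  qed
  have "quot_open A I U \<longleftrightarrow> openin (lctop Q') U" for U
  proof
    assume U: "openin (lctop Q') U"
    have "openin (lctop A) {x \<in> topspace (lctop A). q.proj x \<in> U}"
     using cont U unfolding cont_linear_def by (intro openin_continuous_map_preimage) auto
    moreover have "U \<subseteq> q.proj ` topspace (lctop A)" using U unfolding Q'.openin_iff by (simp add: car)
    ultimately show "quot_open A I U" unfolding quot_open_def by simp
  next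
    assume U: "quot_open A I U"
    then have UA: "U \<subseteq> q.proj ` car A" and o: "openin (lctop A) {x \<in> car A. q.proj x \<in> U}"
     by (simp_all add: quot_open_def)
    show "openin (lctop Q') U" unfolding Q'.openin_iff
    proof (intro conjI ballI)
     show "U \<subseteq> car Q'" using UA by (simp add: car)
     fix X assume X: "X \<in> U"
     then obtain x where x: "X = q.proj x" "x \<in> car A" using UA by blast
     then have xm: "x \<in> {x \<in> car A. q.proj x \<in> U}" using X by simp
     obtain p where p: "p \<in> csn A" "{y \<in> car A. p (y \<ominus> x) < 1} \<subseteq> {x \<in> car A. q.proj x \<in> U}"
      using bspec[OF conjunct2[OF o[unfolded openin_iff]] xm] by (elim bexE)
     have "{Y \<in> car Q'. qsn p (Y \<ominus>\<^sub>Q' X) < 1} \<subseteq> U"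
     proof
      fix Y assume "Y \<in> {Y \<in> car Q'. qsn p (Y \<ominus>\<^sub>Q' X) < 1}"
      then have Y: "Y \<in> car Q'" "qsn p (Y \<ominus>\<^sub>Q' X) < 1" by simp_all
      obtain y where y: "Y = q.proj y" "y \<in> car A" using Y(1) unfolding car by (elim imageE)
      have e: "Y \<ominus>\<^sub>Q' X = q.proj (y \<ominus> x)"
       unfolding x(1) y(1) by (rule lin_minus[OF cvs_axioms cv lin y(2) x(2), symmetric])
      have "0 < 1 - qsn p (q.proj (y \<ominus> x))" using Y(2) unfolding e by simp
      from q.qsn_approx[OF minus_closed[OF y(2) x(2)] this, of p]
      have "\<exists>d\<in>car A. q.proj d = q.proj (y \<ominus> x) \<and> p d < 1" by simp
      then obtain d where d: "d \<in> car A" "q.proj d = q.proj (y \<ominus> x)" "p d < 1" by (elim bexE conjE)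
      have "d \<oplus> x \<in> {y \<in> car A. p (y \<ominus> x) < 1}"
       using d x(2) by (simp add: a_minus_def a_assoc r_neg)
      then have "q.proj (d \<oplus> x) \<in> U" using p(2) by blast
      moreover have "q.proj (d \<oplus> x) = Y"
      proof -
       have "q.proj (d \<oplus> x) = q.proj d \<oplus>\<^bsub>quot_module A I\<^esub> q.proj x" using d(1) x(2) by (simp add: q.add_quot)
       also have "\<dots> = q.proj ((y \<ominus> x) \<oplus> x)" unfolding d(2) using y(2) x(2) by (simp add: q.add_quot)
       finally show ?thesis using y x(2) by (simp add: minus_add_cancel)
      qed
      ultimately show "Y \<in> U" by simp
     qed
     then show "\<exists>p\<in>csn Q'. {Y \<in> car Q'. p (Y \<ominus>\<^sub>Q' X) < 1} \<subseteq> U" by (rule bexI[OF _ qc[OF p(1)]])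
    qed
  qed
  then have "lctop Q = lctop Q'" unfolding topology_eq openin_quot_lcs by simp
  then show ?thesis by (simp add: Q'_def quot_lcs_def)
qed

lemma cvs_Q: "cvs Q" unfolding quot_lcs_def by (rule cvs_extend[OF q.cvs_quot])

lemma Q_seminorms: "\<forall>p\<in>qsn ` csn A. is_seminorm Q p" using qsns by (simp add: quot_lcs_def)

lemma lc_space_Q: "lc_space Q" by (rule lc_space_seminorm_topology[OF cvs_Q Q_seminorms quot_topology])

lemma qsn_cont: "s \<in> csn A ==> qsn s \<in> csn Q"
  by (rule subsetD[OF generating_cont_seminorms[OF cvs_Q Q_seminorms quot_topology] imageI])

lemma lin_proj: "is_linear A Q q.proj" using q.lin_proj by (simp add: is_linear_def quot_lcs_def)

lemma cont_linear_proj: "cont_linear A Q q.proj"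
proof -
  have "openin (lctop A) {x \<in> topspace (lctop A). q.proj x \<in> U}" if "openin (lctop Q) U" for U
    using that unfolding openin_quot_lcs quot_open_def by simp
  then have "continuous_map (lctop A) (lctop Q) q.proj"
    unfolding continuous_map_def lc_space.topspace[OF lc_space_Q] by auto
  then show ?thesis using lin_proj by (simp add: cont_linear_def is_linear_def)
qed

lemma pullback: "p \<in> csn Q ==> (\<lambda>x. p (q.proj x)) \<in> csn A"
  by (rule cont_linear_seminorm[OF lc_space_axioms lc_space_Q cont_linear_proj])

text \<open>
  A seminorm on the quotient is constant on cosets when pulled back, so any bound upstairs passes to the infimum.
\<close>

lemma qsn_pullback:
  assumes x: "x \<in> car A" and s: "\<And>y. y \<in> car A ==> p (q.proj y) \<le> s y"
  shows "p (q.proj x) \<le> qsn s (q.proj x)"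
proof (rule q.qsn_greatest[OF x])
  fix y assume y: "y \<in> car A" "q.proj y = q.proj x"
  show "p (q.proj x) \<le> s y" using s[OF y(1)] unfolding y(2) .
qed

lemma am_algebra_Q: "am_algebra Q"
proof (intro am_algebra.intro lc_space_Q am_algebra_axioms.intro)
  show "Ring.ring Q" unfolding quot_lcs_def by (rule ring_extend[OF q.ring_quot[OF ideal]])
  note ops = q.mult_quot[OF ideal] q.smult_quot
  show "(c \<odot>\<^sub>Q X) \<otimes>\<^sub>Q Y = c \<odot>\<^sub>Q (X \<otimes>\<^sub>Q Y)" "X \<otimes>\<^sub>Q (c \<odot>\<^sub>Q Y) = c \<odot>\<^sub>Q (X \<otimes>\<^sub>Q Y)"
    if "X \<in> car Q" "Y \<in> car Q" for c X Y using that by (auto simp: ops smult_mult_left smult_mult_right)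
  fix p assume p: "p \<in> csn Q"
  obtain s where s: "submult A s" "sn_le A (\<lambda>x. p (q.proj x)) s"
    using submult_above[OF pullback[OF p]] by (elim exE conjE)
  note sc = submultD(1)[OF s(1)]
  have "submult Q (qsn s)" unfolding submult_def
  proof (intro conjI qsn_cont[OF sc] ballI)
    fix X Y assume "X \<in> car Q" "Y \<in> car Q"
    then show "qsn s (X \<otimes>\<^sub>Q Y) \<le> qsn s X * qsn s Y"
     using q.qsn_submult[OF ideal csnD[OF sc] submultD(2)[OF s(1)], of X Y] by (simp add: q.carrier_quot)
  qed
  moreover have "sn_le Q p (qsn s)"
  proof (rule sn_leI)
    fix X assume "X \<in> car Q"
    from Q_cases[OF this] obtain x where x: "X = q.proj x" "x \<in> car A" by (elim exE conjE)
    show "p X \<le> qsn s X" unfolding x(1) by (rule qsn_pullback[where p = p, OF x(2) sn_leD[OF s(2)]])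
  qed
  ultimately show "\<exists>s. submult Q s \<and> sn_le Q p s" by (intro exI conjI)
qed

lemma cont_alg_hom_proj: "cont_alg_hom A Q q.proj"
  by (rule homI[OF cont_linear_proj]) (simp_all add: q.mult_quot[OF ideal] q.one_quot)

text \<open>
  A class of seminorm zero has representatives in each ball around \<open>0\<close>, so it meets each neighbourhood of \<open>0\<close>; the ideal is
  closed.
\<close>

lemma Q_Hausdorff: "Hausdorff_space (lctop Q)" unfolding lc_space.Hausdorff_iff[OF lc_space_Q]
proof (intro ballI impI)
  fix X assume XQ: "X \<in> car Q" and 0: "\<forall>p\<in>csn Q. p X = 0"
  obtain x where x: "X = q.proj x" "x \<in> car A" using Q_cases[OF XQ] by (elim exE conjE)
  have "x \<in> I"
  proof (rule ccontr)
    assume "x \<notin> I"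
    then have xm: "x \<in> car A - I" using x by simp
    have "openin (lctop A) (car A - I)" using closed by (simp add: closedin_def)
    from bspec[OF conjunct2[OF this[unfolded openin_iff]] xm]
    obtain p where p: "p \<in> csn A" "{y \<in> car A. p (y \<ominus> x) < 1} \<subseteq> car A - I" by (elim bexE)
    have "qsn p (q.proj x) = 0" using bspec[OF 0 qsn_cont[OF p(1)]] unfolding x(1) .
    with q.qsn_approx[OF x(2), of 1 p]
    have "\<exists>y\<in>car A. q.proj y = q.proj x \<and> p y < 1" by simp
    then obtain y where y: "y \<in> car A" "q.proj y = q.proj x" "p y < 1" by (elim bexE conjE)
    have "x \<ominus> y \<in> I" using q.proj_eq_iff[OF x(2) y(1)] y(2) by simp
    moreover have "(x \<ominus> y) \<ominus> x = \<ominus> y"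
    proof -
     have "x \<ominus> y = \<ominus> y \<oplus> x" using x(2) y(1) by (simp add: a_minus_def a_comm)
     then show ?thesis using x(2) y(1) by (simp add: a_minus_def a_assoc r_neg)
    qed
    then have "x \<ominus> y \<in> {y \<in> car A. p (y \<ominus> x) < 1}"
     using x(2) y seminorm_uminus[OF csnD[OF p(1)] y(1)] by simp
    ultimately show False using p(2) by blast
  qed
  then show "X = \<zero>\<^sub>Q" using q.proj_eq_iff[OF x(2) zero_closed] x by (simp add: q.zero_quot)
qed

text \<open>A seminorm of \<open>f x\<close> depends only on the coset of \<open>x\<close>, so it is bounded by a quotient seminorm.\<close>

lemma factor_hom:
  assumes B: "cam_algebra B" and f: "cont_alg_hom A B f" and 0: "\<And>x. x \<in> I ==> f x = \<zero>\<^sub>B"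
  shows "\<exists>g. cont_alg_hom Q B g \<and> (\<forall>x\<in>car A. g (q.proj x) = f x)"
proof -
  interpret B: cam_algebra B by fact
  note lf = homD(2)[OF f]
  define g where "g X = f (SOME x. x \<in> car A \<and> q.proj x = X)" for X
  have g: "g (q.proj x) = f x" if x: "x \<in> car A" for x
  proof -
    define y where "y = (SOME y. y \<in> car A \<and> q.proj y = q.proj x)"
    have y: "y \<in> car A \<and> q.proj y = q.proj x" unfolding y_def
     by (rule someI[of "\<lambda>y. y \<in> car A \<and> q.proj y = q.proj x" x]) (simp add: x)
    then have "y \<ominus> x \<in> I" using q.proj_eq_iff[of y x] x by simp
    then have "f y \<ominus>\<^sub>B f x = \<zero>\<^sub>B" using 0 lin_minus[OF cvs_axioms B.cvs_axioms lf, of y x] x y by simp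
    then have "f y = f x" using B.minus_eq_zero lin_closed[OF lf] x y by simp
    then show ?thesis by (simp add: g_def y_def)
  qed
  have lin: "is_linear Q B g"
    by (rule is_linearI) (auto simp: g q.add_quot q.smult_quot lin_closed[OF lf] lin_add[OF lf] lin_smult[OF lf])
  have "cont_linear Q B g"
  proof (rule cont_linearI[OF lc_space_Q B.lc_space_axioms lin])
    fix p assume p: "p \<in> csn B"
    have pf: "(\<lambda>x. p (f x)) \<in> csn A"
     by (rule cont_linear_seminorm[OF lc_space_axioms B.lc_space_axioms homD(1)[OF f] p])
    have "\<forall>X\<in>car Q. p (g X) \<le> qsn (\<lambda>x. p (f x)) X"
    proof
     fix X assume "X \<in> car Q"
     from Q_cases[OF this] obtain x where x: "X = q.proj x" "x \<in> car A" by (elim exE conjE)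
     show "p (g X) \<le> qsn (\<lambda>x. p (f x)) X"
      unfolding x(1) by (rule qsn_pullback[OF x(2), where p = "\<lambda>X. p (g X)"]) (simp add: g)
    qed
    then show "\<exists>r\<in>csn Q. \<forall>x\<in>car Q. p (g x) \<le> r x" by (rule bexI[OF _ qsn_cont[OF pf]])
  qed
  then have "cont_alg_hom Q B g" by (rule homI) (auto simp: g q.mult_quot[OF ideal] q.one_quot homD(4,5)[OF f])
  then show ?thesis using g by blast
qed

end

locale frechet_quotient = am_quotient A I + frechet_seminorms A P
  for A :: "'a lcs" (structure) and I P
begin

lemma frechet_Q: "frechet_seminorms Q (\<lambda>k. qsn (P k))"
proof (intro frechet_seminorms.intro lc_space_Q frechet_seminorms_axioms.intro)
  show "qsn (P k) \<in> csn Q" for k by (rule qsn_cont[OF P_cont])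
  show "qsn (P k) X \<le> qsn (P (Suc k)) X" if XQ: "X \<in> car Q" for k X
  proof -
    obtain x where x: "X = q.proj x" "x \<in> car A" using Q_cases[OF XQ] by (elim exE conjE)
    show ?thesis unfolding x(1)
    proof (rule q.qsn_greatest[OF x(2)])
     fix y assume y: "y \<in> car A" "q.proj y = q.proj x"
     show "qsn (P k) (q.proj x) \<le> P (Suc k) y"
      using q.qsn_le[OF P_seminorm y(1), of k] P_Suc[OF y(1), of k] unfolding y(2) by linarith
    qed
  qed
  fix p assume p: "p \<in> csn Q"
  obtain k C where C: "0 < C" "sn_le A (\<lambda>x. p (q.proj x)) (\<lambda>x. C * P k x)"
    using P_dominates[OF pullback[OF p]] by (elim exE conjE)
  have "sn_le Q p (\<lambda>X. C * qsn (P k) X)"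
  proof (rule sn_leI)
    fix X assume "X \<in> car Q"
    from Q_cases[OF this] obtain x where x: "X = q.proj x" "x \<in> car A" by (elim exE conjE)
    have "p X \<le> qsn (P k) (q.proj x) * C"
    proof (rule q.qsn_greatest_mult[OF P_seminorm x(2) less_imp_le[OF C(1)]])
     fix y assume y: "y \<in> car A" "q.proj y = q.proj x"
     show "p X \<le> P k y * C" using sn_leD[OF C(2) y(1)] unfolding x(1) y(2) by (simp add: mult.commute)
    qed
    then show "p X \<le> C * qsn (P k) X" by (simp add: x(1) mult.commute)
  qed
  then show "\<exists>k. \<exists>C>0. sn_le Q p (\<lambda>X. C * qsn (P k) X)" using C(1) by (intro exI conjI)
qed

text \<open>
  A Cauchy filter in the quotient contains a sequence whose successive differences lift to elements
  \<open>z\<^sub>k\<close> with \<open>P\<^sub>k(z\<^sub>k) < 2\<^sup>-\<^sup>k\<close>; their sum converges upstairs.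
\<close>

lemma Q_complete: "is_complete_lcs Q"
proof -
  interpret FQ: frechet_seminorms Q "\<lambda>k. qsn (P k)" by (rule frechet_Q)
  let ?h = "\<lambda>k. (1/2::real) ^ k"
  have "\<exists>L. limitin (lctop Q) (\<lambda>y. y) L F" if F: "cauchy_filter Q F" for F
  proof -
    note F' = F[unfolded FQ.cauchy_filter_iff]
    note nt = conjunct1[OF F'] and car = conjunct1[OF conjunct2[OF F']] and cau = conjunct2[OF conjunct2[OF F']]
    have "\<exists>Ev. eventually Ev F \<and> (\<forall>X\<in>car Q. \<forall>Y\<in>car Q. Ev X --> Ev Y --> qsn (P k) (X \<ominus>\<^sub>Q Y) < ?h k)" for k
     by (rule cau[rule_format, OF FQ.P_cont]) simp
    then have "\<forall>k. \<exists>Ev. eventually Ev F \<and> (\<forall>X\<in>car Q. \<forall>Y\<in>car Q. Ev X --> Ev Y --> qsn (P k) (X \<ominus>\<^sub>Q Y) < ?h k)" ..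
    from choice[OF this] obtain Ev where "\<forall>k. eventually (Ev k) F \<and>
     (\<forall>X\<in>car Q. \<forall>Y\<in>car Q. Ev k X --> Ev k Y --> qsn (P k) (X \<ominus>\<^sub>Q Y) < ?h k)" by (elim exE)
    then have Ev: "eventually (Ev k) F"
     "X \<in> car Q ==> Y \<in> car Q ==> Ev k X ==> Ev k Y ==> qsn (P k) (X \<ominus>\<^sub>Q Y) < ?h k" for k X Y
     by blast+
    have "\<exists>X. X \<in> car Q \<and> (\<forall>j\<in>{..k}. Ev j X)" for k
    proof -
     have "eventually (\<lambda>X. X \<in> car Q \<and> (\<forall>j\<in>{..k}. Ev j X)) F"
      by (intro eventually_conj car eventually_ball_finite ballI Ev(1)) simp
     then show ?thesis by (rule eventually_happens'[OF nt])
    qed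
    then have "\<forall>k. \<exists>X. X \<in> car Q \<and> (\<forall>j\<in>{..k}. Ev j X)" ..
    from choice[OF this] obtain X where "\<forall>k. X k \<in> car Q \<and> (\<forall>j\<in>{..k}. Ev j (X k))" by (elim exE)
    then have X: "X k \<in> car Q" and XE: "j \<le> k ==> Ev j (X k)" for j k by simp_all
    have "\<exists>z. z \<in> car A \<and> q.proj z = X (Suc k) \<ominus>\<^sub>Q X k \<and> P k z < ?h k" for k
    proof -
     have "X (Suc k) \<ominus>\<^sub>Q X k \<in> car Q" by (rule FQ.minus_closed[OF X X])
     from Q_cases[OF this] obtain w where w: "X (Suc k) \<ominus>\<^sub>Q X k = q.proj w" "w \<in> car A" by (elim exE conjE)
     have "qsn (P k) (q.proj w) < ?h k" unfolding w(1)[symmetric] by (rule Ev(2)[OF X X XE XE]) simp_all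
     then have "0 < ?h k - qsn (P k) (q.proj w)" by simp
     from q.qsn_approx[OF w(2) this, of "P k"] have "\<exists>z\<in>car A. q.proj z = q.proj w \<and> P k z < ?h k" by simp
     then show ?thesis unfolding w(1) by (elim bexE conjE) (intro exI conjI)
    qed
    then have "\<forall>k. \<exists>z. z \<in> car A \<and> q.proj z = X (Suc k) \<ominus>\<^sub>Q X k \<and> P k z < ?h k" ..
    from choice[OF this] obtain z where "\<forall>k. z k \<in> car A \<and> q.proj (z k) = X (Suc k) \<ominus>\<^sub>Q X k \<and> P k (z k) < ?h k" by (elim exE)
    then have z: "z k \<in> car A" "q.proj (z k) = X (Suc k) \<ominus>\<^sub>Q X k" "P k (z k) < ?h k" for k by simp_all
    obtain x0 where x0: "X 0 = q.proj x0" "x0 \<in> car A" using Q_cases[OF X[of 0]] by (elim exE conjE)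
    define x where "x = rec_nat x0 (\<lambda>k y. y \<oplus> z k)"
    have xs: "x 0 = x0" "x (Suc k) = x k \<oplus> z k" for k by (simp_all add: x_def)
    have xc: "x k \<in> car A" for k by (induction k) (simp_all add: xs x0 z)
    have xX: "q.proj (x k) = X k" for k
    proof (induction k)
     case (Suc k)
     have "q.proj (x (Suc k)) = X k \<oplus>\<^sub>Q (X (Suc k) \<ominus>\<^sub>Q X k)"
      unfolding xs Suc[symmetric] z(2)[of k, unfolded Suc[symmetric], symmetric] lin_add[OF lin_proj xc z(1)] ..
     also have "\<dots> = X (Suc k)" using FQ.a_comm[OF X FQ.minus_closed[OF X X]] FQ.minus_add_cancel[OF X X] by simp
     finally show ?case .
    qed (simp add: xs x0)
    have diff: "P k (x n \<ominus> x m) \<le> 2 * ?h m - 2 * ?h n" if km: "k \<le> m" and mn: "m \<le> n" for k m n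
     using mn
    proof (induction n rule: dec_induct)
     case base
     show ?case using xc[of m] by (simp add: seminorm_zero[OF P_seminorm])
    next
     case (step n)
     have "x (Suc n) \<ominus> x n = z n"
     proof -
      have "x (Suc n) = z n \<oplus> x n" unfolding xs by (rule a_comm[OF xc z(1)])
      then show ?thesis using z(1)[of n] xc[of n] by (simp add: a_minus_def a_assoc r_neg)
     qed
     then have "P k (x (Suc n) \<ominus> x m) \<le> P k (z n) + P k (x n \<ominus> x m)"
      using seminorm_triangle[OF P_seminorm xc[of "Suc n"] xc[of n] xc[of m], of k] by simp
     also have "P k (z n) \<le> ?h n" using P_mono[OF z(1), of k n n] z(3)[of n] km step by linarith
     finally show ?case using step by simp
    qed
    have small: "\<exists>N. \<forall>m\<ge>N. C * (2 * ?h m) < e" if C: "0 < C" and e: "0 < e" for C e :: real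
    proof -
     obtain N where N: "?h N < e / (2 * C)" using real_arch_pow_inv[of "e / (2 * C)" "1/2"] C e by auto
     have "C * (2 * ?h m) < e" if "N \<le> m" for m
     proof -
      have "?h m \<le> ?h N" by (rule power_decreasing) (use that in auto)
      then have "?h m < e / (2 * C)" using N by linarith
      then show ?thesis using C by (simp add: field_simps)
     qed
     then show ?thesis by blast
    qed
    have "\<exists>l. limitin (lctop A) x l sequentially"
    proof (rule complete_sequence[OF complete xc])
     fix p and e :: real assume p: "p \<in> csn A" and e: "0 < e"
     obtain k C where C: "0 < C" "sn_le A p (\<lambda>x. C * P k x)" using P_dominates[OF p] by (elim exE conjE)
     obtain N where N: "\<forall>m\<ge>N. C * (2 * ?h m) < e" using small[OF C(1) e] by (elim exE)
     have "p (x n \<ominus> x m) < e" if m: "max N k \<le> m" and n: "m \<le> n" for m n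
     proof -
      have "P k (x n \<ominus> x m) \<le> 2 * ?h m" using diff[of k m n] m n zero_le_power[of "1/2::real" n] by linarith
      then have "C * P k (x n \<ominus> x m) \<le> C * (2 * ?h m)" using C(1) by simp
      also have "\<dots> < e" using N m by simp
      finally show ?thesis using sn_leD[OF C(2) minus_closed[OF xc[of n] xc[of m]]] by linarith
     qed
     then show "\<exists>N. \<forall>m\<ge>N. \<forall>n\<ge>m. p (x n \<ominus> x m) < e" by (intro exI[of _ "max N k"] allI impI)
    qed
    then obtain l where l: "limitin (lctop A) x l sequentially" by (elim exE)
    have lc: "l \<in> car A" using l unfolding limitin_iff by simp
    have lQ: "q.proj l \<in> car Q" using lc by simp
    have "limitin (lctop Q) (\<lambda>y. y) (q.proj l) F" unfolding FQ.limitin_iff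
    proof (intro conjI lQ car ballI allI impI)
     fix p and e :: real assume p: "p \<in> csn Q" and e: "0 < e"
     obtain k C where C: "0 < C" "sn_le Q p (\<lambda>X. C * qsn (P k) X)"
      using FQ.P_dominates[OF p] by (elim exE conjE)
     have e2: "0 < e / 2" using e by simp
     have "0 < e" by (rule e)
     obtain N where N: "\<forall>m\<ge>N. C * (2 * ?h m) < e" using small[OF C(1) e] by (elim exE)
     have "eventually (\<lambda>n. p (q.proj (x n \<ominus> l)) < e / 2) sequentially"
      by (rule l[unfolded limitin_iff, THEN conjunct2, THEN conjunct2, rule_format, OF pullback[OF p] e2])
     then have "eventually (\<lambda>n. p (q.proj (x n \<ominus> l)) < e / 2 \<and> max N k \<le> n) sequentially"
      by (intro eventually_conj eventually_ge_at_top)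
     from eventually_happens'[OF sequentially_bot this]
     obtain n where "p (q.proj (x n \<ominus> l)) < e / 2 \<and> max N k \<le> n" by (elim exE)
     then have n: "p (q.proj (x n \<ominus> l)) < e / 2" "N \<le> n" "k \<le> n" by simp_all
     have Xl: "p (X n \<ominus>\<^sub>Q q.proj l) < e / 2"
      using n(1) unfolding lin_minus[OF cvs_axioms cvs_Q lin_proj xc lc] xX .
     show "eventually (\<lambda>Y. p (Y \<ominus>\<^sub>Q q.proj l) < e) F" using Ev(1)[of n] car
     proof eventually_elim
      fix Y assume Y: "Ev n Y" "Y \<in> car Q"
      have "qsn (P k) (Y \<ominus>\<^sub>Q X n) < ?h n"
       using FQ.P_mono[OF FQ.minus_closed[OF Y(2) X[of n]] n(3)] Ev(2)[OF Y(2) X Y(1) XE[OF order_refl]] by linarith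
      then have "C * qsn (P k) (Y \<ominus>\<^sub>Q X n) < C * ?h n" using C(1) by simp
      moreover have "C * (2 * ?h n) < e" using N n(2) by simp
      ultimately have "p (Y \<ominus>\<^sub>Q X n) < e / 2" using sn_leD[OF C(2) FQ.minus_closed[OF Y(2) X[of n]]] by linarith
      then show "p (Y \<ominus>\<^sub>Q q.proj l) < e"
       using FQ.seminorm_triangle[OF FQ.csnD[OF p] Y(2) X lQ, of n] Xl by linarith
     qed
    qed
    then show ?thesis by (rule exI)
  qed
  moreover have "is_lcs Q" using lc_space_Q by (simp only: is_lcs_iff)
  ultimately show ?thesis unfolding is_complete_lcs_def by (intro conjI Q_Hausdorff allI impI)
qed

lemma complete_am_Q: "cam_algebra Q" by (intro cam_algebra.intro am_algebra_Q cam_algebra_axioms.intro Q_complete)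

lemma frechet_arens_michael_Q: "is_frechet_arens_michael Q" by (rule frechet_arens_michaelI[OF complete_am_Q frechet_Q])

end

section \<open>Universal HFG algebras\<close>

lemma frechet_FE: "frechet_seminorms (free_entire n) (\<lambda>k. fe_norm (real (Suc k)))"
proof (intro frechet_seminorms.intro lc_space_FE frechet_seminorms_axioms.intro)
  show "fe_norm (real (Suc k)) \<in> csn (free_entire n)" for k by (rule fe_norm_cont) simp
  show "fe_norm (real (Suc k)) x \<le> fe_norm (real (Suc (Suc k))) x" if "x \<in> car (free_entire n)" for k x
    by (rule fe_norm_mono[OF that]) simp_all
  fix p assume "p \<in> csn (free_entire n)"
  from fe_dominated[OF this] obtain \<rho> C where r: "0 < \<rho>" "0 < C" and
    le: "\<forall>a\<in>car (free_entire n). p a \<le> C * fe_norm \<rho> a" by (elim exE conjE)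
  obtain k where k: "\<rho> \<le> real (Suc k)" using real_arch_simple[of \<rho>] by (metis le_SucI of_nat_le_iff order_refl order_trans)
  have "p a \<le> C * fe_norm (real (Suc k)) a" if a: "a \<in> car (free_entire n)" for a
    using bspec[OF le a] mult_left_mono[OF fe_norm_mono[OF a r(1) k] less_imp_le[OF r(2)]] by linarith
  then show "\<exists>k. \<exists>C>0. sn_le (free_entire n) p (\<lambda>a. C * fe_norm (real (Suc k)) a)"
    using r(2) by (intro exI[of _ k] exI[of _ C] conjI sn_leI)
qed

text \<open>
  The target is Hausdorff, so the kernel is closed as the preimage of a point.
\<close>

lemma hom_kernel:
  assumes A: "cam_algebra A" and B: "cam_algebra B" and f: "cont_alg_hom A B f"
  shows "ideal {x \<in> car A. f x = \<zero>\<^sub>B} A" "closedin (lctop A) {x \<in> car A. f x = \<zero>\<^sub>B}"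
proof -
  interpret A: cam_algebra A by fact
  interpret B: cam_algebra B by fact
  have "ring_hom_ring A B f"
    by (rule ring_hom_ringI2[OF A.ring_axioms B.ring_axioms conjunct2[OF f[unfolded cont_alg_hom_def]]])
  from ring_hom_ring.kernel_is_ideal[OF this]
  show "ideal {x \<in> car A. f x = \<zero>\<^sub>B} A" unfolding a_kernel_def' .
  have "Hausdorff_space (lctop B)" using B.complete by (simp add: is_complete_lcs_def)
  then have "closedin (lctop B) {\<zero>\<^sub>B}" by (simp add: closedin_Hausdorff_sing_eq)
  moreover have "continuous_map (lctop A) (lctop B) f" using homD(1)[OF f] unfolding cont_linear_def by (elim conjE)
  ultimately have "closedin (lctop A) {x \<in> topspace (lctop A). f x \<in> {\<zero>\<^sub>B}}"
    by (rule closedin_continuous_map_preimage[rotated])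
  then show "closedin (lctop A) {x \<in> car A. f x = \<zero>\<^sub>B}" by simp
qed

lemma closed_ideal_generated_least:
  "ideal I A ==> closedin (lctop A) I ==> R \<subseteq> I ==> closed_ideal_generated A R \<subseteq> I"
  unfolding closed_ideal_generated_def by (rule Inter_lower) simp

context
  fixes n :: nat and R :: "(nat list => complex) set"
  assumes R: "R \<subseteq> car (free_entire n)"
begin

abbreviation (input) IR where "IR \<equiv> closed_ideal_generated (free_entire n) R"
abbreviation (input) UA where "UA \<equiv> universal_HFG n R"

lemma relations_in_ideal: "R \<subseteq> IR" by (auto simp: closed_ideal_generated_def)

lemma frechet_quotient_FE: "frechet_quotient (free_entire n) IR (\<lambda>k. fe_norm (real (Suc k)))"
proof -
  interpret A: cam_algebra "free_entire n" by (rule complete_am_FE)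
  have all: "car (free_entire n) \<in> {I. ideal I (free_entire n) \<and> closedin (lctop (free_entire n)) I \<and> R \<subseteq> I}"
    using R A.oneideal closedin_topspace[of "lctop (free_entire n)"] by simp
  have "ideal IR (free_entire n)" unfolding closed_ideal_generated_def using all by (intro A.i_Intersect) auto
  moreover have "closedin (lctop (free_entire n)) IR"
    unfolding closed_ideal_generated_def using all by (intro closedin_Inter) auto
  ultimately show ?thesis
    by (intro frechet_quotient.intro am_quotient.intro am_quotient_axioms.intro complete_am_FE frechet_FE)
qed

interpretation frechet_quotient "free_entire n" IR "\<lambda>k. fe_norm (real (Suc k))" by (rule frechet_quotient_FE)

lemma complete_am_universal: "cam_algebra UA" unfolding universal_HFG_def by (rule complete_am_Q)

lemma is_HFG_universal: "is_HFG UA"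
proof -
  have "topologically_isomorphic UA (quot_lcs (free_entire n) IR)"
    unfolding topologically_isomorphic_def universal_HFG_def
    using homeomorphic_map_id[of "lctop (quot_lcs (free_entire n) IR)"] cont_alg_hom_id
    by (intro exI[of _ "\<lambda>x. x"]) (simp add: id_def)
  then show ?thesis unfolding is_HFG_def using frechet_arens_michael_Q ideal closed by (auto simp: universal_HFG_def)
qed

lemma universal_gen_closed: "i \<in> {1..n} ==> universal_HFG_gen n R i \<in> car UA"
  unfolding universal_HFG_def universal_HFG_gen_def by (simp add: fe_gen_closed)

lemma universal_proj:
  "\<exists>f. cont_alg_hom (free_entire n) UA f \<and> (\<forall>i. f (fe_gen i) = universal_HFG_gen n R i) \<and>
    (\<forall>x\<in>R. f x = \<zero>\<^sub>UA) \<and> car UA = f ` car (free_entire n)"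
proof (intro exI conjI allI ballI)
  show "cont_alg_hom (free_entire n) UA q.proj" unfolding universal_HFG_def by (rule cont_alg_hom_proj)
  fix x assume "x \<in> R"
  then have "x \<in> IR" "x \<in> car (free_entire n)" using relations_in_ideal R by auto
  then show "q.proj x = \<zero>\<^sub>UA"
    unfolding universal_HFG_def using q.proj_eq_iff[of x "\<zero>\<^bsub>free_entire n\<^esub>"] by (simp add: q.zero_quot)
qed (simp_all add: universal_HFG_def universal_HFG_gen_def)

lemma universal_hom_exists:
  assumes B: "cam_algebra B" and f: "cont_alg_hom (free_entire n) B f" and 0: "\<And>x. x \<in> R ==> f x = \<zero>\<^sub>B"
  shows "\<exists>g. cont_alg_hom UA B g \<and> (\<forall>i\<in>{1..n}. g (universal_HFG_gen n R i) = f (fe_gen i))"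
proof -
  have RK: "R \<subseteq> {x \<in> car (free_entire n). f x = \<zero>\<^sub>B}"
  proof
    fix x assume "x \<in> R"
    then show "x \<in> {x \<in> car (free_entire n). f x = \<zero>\<^sub>B}" using subsetD[OF R] 0[of x] by simp
  qed
  have IK: "IR \<subseteq> {x \<in> car (free_entire n). f x = \<zero>\<^sub>B}"
    by (rule closed_ideal_generated_least[OF hom_kernel[OF complete_am_FE B f] RK])
  have k0: "f x = \<zero>\<^sub>B" if "x \<in> IR" for x using subsetD[OF IK that] by simp
  have "\<exists>g. cont_alg_hom (quot_lcs (free_entire n) IR) B g \<and> (\<forall>x\<in>car (free_entire n). g (q.proj x) = f x)"
    by (rule factor_hom[OF B f k0])
  then obtain g where
    g: "cont_alg_hom (quot_lcs (free_entire n) IR) B g" "\<forall>x\<in>car (free_entire n). g (q.proj x) = f x" by (elim exE conjE)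
  have "\<forall>i\<in>{1..n}. g (q.proj (fe_gen i)) = f (fe_gen i)" by (intro ballI g(2)[rule_format] fe_gen_closed)
  then show ?thesis unfolding universal_HFG_def universal_HFG_gen_def using g(1) by (intro exI conjI)
qed

lemma universal_hom_unique:
  assumes B: "cam_algebra B" and f: "cont_alg_hom UA B f" and g: "cont_alg_hom UA B g"
    and eq: "\<And>i. i \<in> {1..n} ==> f (universal_HFG_gen n R i) = g (universal_HFG_gen n R i)" and X: "X \<in> car UA"
  shows "f X = g X"
proof -
  obtain x where x: "X = q.proj x" "x \<in> car (free_entire n)"
    using Q_cases[OF X[unfolded universal_HFG_def]] by (elim exE conjE)
  note p = cont_alg_hom_proj[folded universal_HFG_def]
  show ?thesis unfolding x(1)
    by (rule hom_unique[OF B cont_alg_hom_compose[OF p f] cont_alg_hom_compose[OF p g] _ x(2)])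
     (use eq in \<open>simp add: universal_HFG_gen_def\<close>)
qed

text \<open>
  The products of generators have dense span. The auxiliary predicate \<open>P\<close> serves for identities whose
  two sides are not homomorphisms, so that agreement on generators alone would not suffice.
\<close>

lemma universal_induct:
  assumes G: "is_complete_lcs G" and u: "cont_linear UA G u" and v: "cont_linear UA G v"
    and one: "P \<one>\<^sub>UA"
    and step: "\<And>i X. i \<in> {1..n} ==> X \<in> car UA ==> P X ==> P (universal_HFG_gen n R i \<otimes>\<^sub>UA X)"
    and eq: "\<And>X. X \<in> car UA ==> P X ==> u X = v X" and X: "X \<in> car UA"
  shows "u X = v X"
proof -
  obtain x where x: "X = q.proj x" "x \<in> car (free_entire n)"
    using Q_cases[OF X[unfolded universal_HFG_def]] by (elim exE conjE)
  note p = cont_alg_hom_proj[folded universal_HFG_def]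
  have P: "P (q.proj (delta w))" if "w \<in> words n" for w using that
  proof (induction w)
    case Nil
    then show ?case using one homD(5)[OF p] by (simp add: free_entire_simps(3))
  next
    case (Cons i w)
    then have i: "i \<in> {1..n}" and w: "w \<in> words n" and i': "[i] \<in> words n" by (auto simp: words_def)
    have "q.proj (delta (i # w)) = q.proj (fe_gen i) \<otimes>\<^sub>UA q.proj (delta w)"
     using homD(4)[OF p delta_closed[OF i'] delta_closed[OF w]] by (simp add: delta_mult fe_gen_delta)
    then show ?case using step[OF i homD(3)[OF p delta_closed[OF w]] Cons.IH[OF w]] by (simp add: universal_HFG_gen_def)
  qed
  show ?thesis unfolding x(1) by (rule cont_linear_eq_on_total[OF lc_space_FE G clin_compose[OF homD(1)[OF p] u]
       clin_compose[OF homD(1)[OF p] v] total_delta _ x(2)])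
     (rule eq[OF homD(3)[OF p delta_closed] P])
qed

end

section \<open>The complex numbers\<close>

lemma complex_topology: "lctop CC = seminorm_topology CC {cmod}" unfolding topology_eq openin_seminorm_topology
proof
  fix U :: "complex set"
  have "openin (lctop CC) U \<longleftrightarrow> (\<forall>x\<in>U. \<exists>e>0. {y. cmod (y - x) < e} \<subseteq> U)"
    by (simp add: complex_lcs_def open_dist dist_norm subset_eq)
  also have "\<dots> \<longleftrightarrow> seminorm_open CC {cmod} U" unfolding seminorm_open_def
  proof (intro iffI conjI ballI)
    fix x assume "\<forall>x\<in>U. \<exists>e>0. {y. cmod (y - x) < e} \<subseteq> U" "x \<in> U"
    then obtain e where "0 < e" "{y. cmod (y - x) < e} \<subseteq> U" by blast
    then show "\<exists>Q e. finite Q \<and> Q \<subseteq> {cmod} \<and> 0 < e \<and> {y \<in> car CC. \<forall>p\<in>Q. p (y \<ominus>\<^bsub>CC\<^esub> x) < e} \<subseteq> U"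
     by (intro exI[of _ "{cmod}"] exI[of _ e]) simp
  next
    fix x assume "U \<subseteq> car CC \<and> (\<forall>x\<in>U. \<exists>Q e. finite Q \<and> Q \<subseteq> {cmod} \<and> 0 < e \<and>
     {y \<in> car CC. \<forall>p\<in>Q. p (y \<ominus>\<^bsub>CC\<^esub> x) < e} \<subseteq> U)" and x: "x \<in> U"
    from bspec[OF conjunct2[OF this(1)] x] obtain Q e where Q: "Q \<subseteq> {cmod}" "0 < e"
     "{y \<in> car CC. \<forall>p\<in>Q. p (y \<ominus>\<^bsub>CC\<^esub> x) < e} \<subseteq> U" by (elim exE conjE)
    have "{y. cmod (y - x) < e} \<subseteq> {y \<in> car CC. \<forall>p\<in>Q. p (y \<ominus>\<^bsub>CC\<^esub> x) < e}"
     using Q(1) by auto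
    then show "\<exists>e>0. {y. cmod (y - x) < e} \<subseteq> U" using Q(2,3) by blast
  qed simp
  finally show "openin (lctop CC) U \<longleftrightarrow> seminorm_open CC {cmod} U" .
qed

lemma complete_am_complex: "cam_algebra CC"
proof -
  interpret R: cring CC by (rule cring_complex)
  have m: "Module.module CC CC" by (rule moduleI[OF cring_complex R.abelian_group_axioms]) (simp_all add: algebra_simps)
  have cv: "cvs CC" by (rule cvs.intro[OF m])
  have sn: "\<forall>p\<in>{cmod}. is_seminorm CC p" by (simp add: is_seminorm_def norm_triangle_ineq norm_mult)
  have lc: "lc_space CC" by (rule lc_space_seminorm_topology[OF cv sn complex_topology])
  interpret lc_space CC by (rule lc)
  have cm: "cmod \<in> csn CC" using generating_cont_seminorms[OF cv sn complex_topology] by simp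
  have sub: "submult CC cmod" unfolding submult_def using cm by (simp add: norm_mult)
  have "am_algebra CC"
  proof (intro am_algebra.intro lc R.ring_axioms am_algebra_axioms.intro)
    fix p assume p: "p \<in> csn CC"
    have sc: "submult CC (\<lambda>x. max 1 (p 1) * cmod x)" by (rule submult_scale[OF sub]) simp_all
    have "p x \<le> max 1 (p 1) * cmod x" for x
    proof -
     have "p x = cmod x * p 1" using seminorm_smult[OF csnD[OF p], of 1 x] by simp
     also have "\<dots> \<le> cmod x * max 1 (p 1)" by (intro mult_left_mono) simp_all
     finally show ?thesis by (simp add: mult.commute)
    qed
    then show "\<exists>s. submult CC s \<and> sn_le CC p s" using sc by (intro exI conjI sn_leI)
  qed (simp_all add: algebra_simps)
  moreover have "\<exists>c. limitin (lctop CC) (\<lambda>y. y) c F" if F: "Defs.cauchy_filter CC F" for F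
  proof -
    note F' = F[unfolded cauchy_filter_iff]
    note nt = conjunct1[OF F'] and cau = conjunct2[OF conjunct2[OF F']]
    have "uniform_space_class.cauchy_filter F" unfolding cauchy_filter_metric
    proof (intro allI impI)
     fix e :: real assume e: "0 < e"
     obtain Q where Q: "eventually Q F" "\<forall>x\<in>car CC. \<forall>y\<in>car CC. Q x --> Q y --> cmod (x \<ominus>\<^bsub>CC\<^esub> y) < e"
      using cau[rule_format, OF cm e] by (elim exE conjE)
     then show "\<exists>P. eventually P F \<and> (\<forall>x y. P x \<and> P y --> dist x y < e)"
      by (intro exI[of _ Q]) (simp add: dist_norm)
    qed
    then have "\<exists>c. F \<le> nhds c" using cauchy_filter_complete_converges[of F UNIV] complete_UNIV nt by simp
    then show ?thesis by (simp add: complex_lcs_def filterlim_def)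
  qed
  moreover have "Hausdorff_space (lctop CC)" by (simp add: complex_lcs_def)
  ultimately show ?thesis using lc by (simp add: cam_algebra_def cam_algebra_axioms_def is_complete_lcs_def is_lcs_iff)
qed

lemma cmod_cont: "cmod \<in> csn CC"
proof -
  have "\<forall>p\<in>{cmod}. is_seminorm CC p" by (simp add: is_seminorm_def norm_triangle_ineq norm_mult)
  from generating_cont_seminorms[OF _ this complex_topology] complete_am_complex
  show ?thesis by (simp add: cam_algebra_def am_algebra_def lc_space_def)
qed

section \<open>Homomorphisms between tensor products\<close>

context am_pair
begin

lemma mult_pure_cont_left: "y \<in> car F ==> cont_linear E T (\<lambda>x. pure E F x y)"
proof (rule cont_linearI[OF E.lc_space_axioms lc_space_T is_bilinearD(2)[OF is_bilinear_pure]])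
  fix q assume y: "y \<in> car F" and q: "q \<in> csn T"
  obtain p r where pr: "p \<in> csn E" "r \<in> csn F" and le: "sn_le T q (tproj p r)"
    using T_cont_seminorm_bound[OF q] by (elim bexE)
  have ry: "0 \<le> r y" by (rule F.sn_nonneg[OF F.csnD[OF pr(2)] y])
  have "\<forall>x\<in>car E. q (pure E F x y) \<le> r y * p x"
  proof
    fix x assume x: "x \<in> car E"
    show "q (pure E F x y) \<le> r y * p x"
     using order_trans[OF sn_leD[OF le pure_closed[OF x y]] tproj_pure_le[OF pr x y]] by (simp add: mult.commute)
  qed
  then show "\<exists>r\<in>csn E. \<forall>x\<in>car E. q (pure E F x y) \<le> r x"
    by (rule bexI[OF _ E.csn_scale[OF pr(1) ry]])
qed

lemma mult_pure_cont_right: "x \<in> car E ==> cont_linear F T (pure E F x)"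
proof (rule cont_linearI[OF F.lc_space_axioms lc_space_T is_bilinearD(1)[OF is_bilinear_pure]])
  fix q assume x: "x \<in> car E" and q: "q \<in> csn T"
  obtain p r where pr: "p \<in> csn E" "r \<in> csn F" and le: "sn_le T q (tproj p r)"
    using T_cont_seminorm_bound[OF q] by (elim bexE)
  have px: "0 \<le> p x" by (rule E.sn_nonneg[OF E.csnD[OF pr(1)] x])
  have "\<forall>y\<in>car F. q (pure E F x y) \<le> p x * r y"
    by (intro ballI order_trans[OF sn_leD[OF le pure_closed[OF x]] tproj_pure_le[OF pr x]])
  then show "\<exists>r\<in>csn F. \<forall>y\<in>car F. q (pure E F x y) \<le> r y"
    by (rule bexI[OF _ F.csn_scale[OF pr(2) px]])
qed

text \<open>
  The two embeddings into the tensor square let exponentials of \<open>1 \<otimes> x\<close> and \<open>x \<otimes> 1\<close> be computed inside the factors.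
\<close>

lemma hom_pure_left: "cont_alg_hom E T (\<lambda>x. pure E F x \<one>\<^sub>F)"
  by (rule homI[OF mult_pure_cont_left]) (simp_all add: pure_mult pure_one)

lemma hom_pure_right: "cont_alg_hom F T (pure E F \<one>\<^sub>E)"
  by (rule homI[OF mult_pure_cont_right]) (simp_all add: pure_mult pure_one)

lemma complete_am_T: "cam_algebra T" by (intro cam_algebra.intro am_algebra_T cam_algebra_axioms.intro tensor_complete)

end

lemma (in am_algebra) bounded_mult: "lc_pair.bounded_bilinear_map A A A (mult A)"
proof -
  interpret lc_pair A A by (rule lc_pair.intro[OF lc_space_axioms lc_space_axioms])
  show ?thesis unfolding bounded_bilinear_map_def
  proof (intro conjI ballI)
    show "is_bilinear A A A (mult A)"
     by (intro is_bilinearI cont_linearD[OF cont_linear_mult_left] cont_linearD[OF cont_linear_mult_right])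
    fix p assume p: "p \<in> csn A"
    obtain s where s: "submult A s" "sn_le A p s" using submult_above[OF p] by (elim exE conjE)
    note sc = submultD(1)[OF s(1)]
    have "\<forall>x\<in>car A. \<forall>y\<in>car A. p (x \<otimes> y) \<le> s x * s y"
     by (intro ballI order_trans[OF sn_leD[OF s(2)] submultD(2)[OF s(1)]] m_closed)
    then show "\<exists>r\<in>csn A. \<exists>t\<in>csn A. \<forall>x\<in>car A. \<forall>y\<in>car A. p (x \<otimes> y) \<le> r x * t y"
     by (intro bexI[OF _ sc])
  qed
qed

text \<open>
  Apply the uniqueness of linearizations first in the outer and then in the inner tensor product.
\<close>

lemma triple_unique:
  assumes E: "am_algebra E" and F: "am_algebra F" and G: "am_algebra G" and C: "is_complete_lcs C"
    and f: "cont_linear (PT (PT E F) G) C f" and g: "cont_linear (PT (PT E F) G) C g"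
    and eq: "\<And>x y z. x \<in> car E ==> y \<in> car F ==> z \<in> car G ==>
     f (pure (PT E F) G (pure E F x y) z) = g (pure (PT E F) G (pure E F x y) z)"
    and t: "t \<in> car (PT (PT E F) G)"
  shows "f t = g t"
proof -
  have EF: "am_pair E F" by (rule am_pair.intro[OF E F])
  have L: "am_pair (PT E F) G" by (rule am_pair.intro[OF am_pair.am_algebra_T[OF EF] G])
  have EF': "lc_pair E F" using E F by (simp add: am_algebra_def lc_pair_def)
  have L': "lc_pair (PT E F) G" using am_pair.am_algebra_T[OF EF] G by (simp add: am_algebra_def lc_pair_def)
  show ?thesis
  proof (rule lc_pair.tensor_map_unique[OF L' C f g _ t])
    fix u z assume u: "u \<in> car (PT E F)" and z: "z \<in> car G"
    show "f (pure (PT E F) G u z) = g (pure (PT E F) G u z)"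
     by (rule lc_pair.tensor_map_unique[OF EF' C clin_compose[OF am_pair.mult_pure_cont_left[OF L z] f]
        clin_compose[OF am_pair.mult_pure_cont_left[OF L z] g] eq[OF _ _ z] u])
  qed
qed

text \<open>
  Multiplicativity is checked on elementary triple tensors, one argument at a time.
\<close>

lemma tensor_assoc_hom:
  assumes E: "am_algebra E" and F: "am_algebra F" and G: "am_algebra G"
  shows "cont_alg_hom (PT (PT E F) G) (PT E (PT F G)) (tensor_assoc E F G)"
proof -
  have EF: "am_pair E F" by (rule am_pair.intro[OF E F])
  have FG: "am_pair F G" by (rule am_pair.intro[OF F G])
  have L: "am_pair (PT E F) G" by (rule am_pair.intro[OF am_pair.am_algebra_T[OF EF] G])
  have R: "am_pair E (PT F G)" by (rule am_pair.intro[OF E am_pair.am_algebra_T[OF FG]])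
  have lEF: "lc_pair E F" and lFG: "lc_pair F G" using E F G by (simp_all add: am_algebra_def lc_pair_def)
  have lL: "lc_pair (PT E F) G" and lR: "lc_pair E (PT F G)"
    using am_pair.am_algebra_T[OF EF] am_pair.am_algebra_T[OF FG] E G by (simp_all add: am_algebra_def lc_pair_def)
  have tri: "lc_triple E F G" using E F G by (simp add: am_algebra_def lc_triple_def)
  note ac = lc_triple.tensor_assoc_spec(1)[OF tri] and av = lc_triple.tensor_assoc_spec(2)[OF tri]
  let ?L = "PT (PT E F) G" and ?R = "PT E (PT F G)"
  interpret LT: am_algebra ?L by (rule am_pair.am_algebra_T[OF L])
  interpret RT: am_algebra ?R by (rule am_pair.am_algebra_T[OF R])
  interpret E: am_algebra E by fact
  interpret F: am_algebra F by fact
  interpret G: am_algebra G by fact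
  have Rc: "is_complete_lcs ?R" by (rule lc_pair.tensor_complete[OF lR])
  let ?a = "tensor_assoc E F G"
  let ?p = "\<lambda>x y z. pure (PT E F) G (pure E F x y) z"
  note cl = lc_pair.pure_closed[OF lL] lc_pair.pure_closed[OF lR] lc_pair.pure_closed[OF lEF] lc_pair.pure_closed[OF lFG]
  have pc: "?p x y z \<in> car ?L" if "x \<in> car E" "y \<in> car F" "z \<in> car G" for x y z by (intro cl that)
  have acl: "?a t \<in> car ?R" if "t \<in> car ?L" for t by (rule lin_closed[OF cont_linearD[OF ac] that])
  have m1: "?a (?p x y z \<otimes>\<^sub>?L u) = ?a (?p x y z) \<otimes>\<^sub>?R ?a u"
    if v: "x \<in> car E" "y \<in> car F" "z \<in> car G" and u: "u \<in> car ?L" for x y z u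
  proof (rule triple_unique[OF E F G Rc clin_compose[OF LT.cont_linear_mult_left[OF pc[OF v]] ac]
      clin_compose[OF ac RT.cont_linear_mult_left[OF acl[OF pc[OF v]]]] _ u])
    fix x' y' z' assume v': "x' \<in> car E" "y' \<in> car F" "z' \<in> car G"
    show "?a (?p x y z \<otimes>\<^sub>?L ?p x' y' z') = ?a (?p x y z) \<otimes>\<^sub>?R ?a (?p x' y' z')"
     using v v' by (simp add: av cl am_pair.pure_mult[OF L] am_pair.pure_mult[OF R] am_pair.pure_mult[OF EF] am_pair.pure_mult[OF FG])
  qed
  show ?thesis
  proof (rule homI[OF ac])
    fix t u assume t: "t \<in> car ?L" and u: "u \<in> car ?L"
    show "?a (t \<otimes>\<^sub>?L u) = ?a t \<otimes>\<^sub>?R ?a u"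
     by (rule triple_unique[OF E F G Rc clin_compose[OF LT.cont_linear_mult_right[OF u] ac]
        clin_compose[OF ac RT.cont_linear_mult_right[OF acl[OF u]]] m1[OF _ _ _ u] t])
  next
    show "?a \<one>\<^sub>?L = \<one>\<^sub>?R" using av[of "\<one>\<^sub>E" "\<one>\<^sub>F" "\<one>\<^sub>G"]
     by (simp add: am_pair.pure_one[OF L] am_pair.pure_one[OF R] am_pair.pure_one[OF EF] am_pair.pure_one[OF FG])
  qed
qed

section \<open>The quantum affine group\<close>

lemma am_pair_lc: "am_pair E F ==> lc_pair E F" by (simp add: am_pair_def am_algebra_def lc_pair_def)

lemma relation_closed: "{Af_relation q} \<subseteq> car (free_entire 2)"
proof -
  interpret A: cam_algebra "free_entire 2" by (rule complete_am_FE)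
  have g: "fe_gen 1 \<in> car (free_entire 2)" "fe_gen 2 \<in> car (free_entire 2)" by (simp_all add: fe_gen_closed)
  show ?thesis unfolding Af_relation_def using g A.alg_exp_closed[OF g(1)] by simp
qed

lemma complete_am_Af: "cam_algebra (Af q)" unfolding Af_def by (rule complete_am_universal[OF relation_closed])

lemma Af_gen_closed: "Af_z q \<in> car (Af q)" "Af_b q \<in> car (Af q)"
  unfolding Af_def Af_z_def Af_b_def by (rule universal_gen_closed[OF relation_closed], simp)+

text \<open>
  Homomorphisms commute with the exponential, so the image of the relator is the relator of the images.
\<close>

lemma hom_relation:
  assumes B: "cam_algebra B" and f: "cont_alg_hom (free_entire 2) B f"
  shows "f (Af_relation q) = \<zero>\<^sub>B \<longleftrightarrow> alg_exp B (f (fe_gen 1)) \<otimes>\<^sub>B f (fe_gen 2) =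
    q \<odot>\<^sub>B (f (fe_gen 2) \<otimes>\<^sub>B alg_exp B (f (fe_gen 1)))"
proof -
  interpret A: cam_algebra "free_entire 2" by (rule complete_am_FE)
  interpret B: cam_algebra B by fact
  note lf = homD(2)[OF f]
  have g: "fe_gen 1 \<in> car (free_entire 2)" "fe_gen 2 \<in> car (free_entire 2)" by (simp_all add: fe_gen_closed)
  note ec = A.alg_exp_closed[OF g(1)]
  have fe: "f (alg_exp (free_entire 2) (fe_gen 1)) = alg_exp B (f (fe_gen 1))"
    by (rule hom_exp[OF A.cam_algebra_axioms B f g(1)])
  have "f (Af_relation q) = (alg_exp B (f (fe_gen 1)) \<otimes>\<^sub>B f (fe_gen 2)) \<ominus>\<^sub>B
     (q \<odot>\<^sub>B (f (fe_gen 2) \<otimes>\<^sub>B alg_exp B (f (fe_gen 1))))" unfolding Af_relation_def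
    using g ec by (simp add: lin_minus[OF A.cvs_axioms B.cvs_axioms lf] lin_smult[OF lf] homD(4)[OF f] fe del: One_nat_def)
  moreover have "f (fe_gen 1) \<in> car B" "f (fe_gen 2) \<in> car B" using g homD(3)[OF f] by auto
  ultimately show ?thesis using B.alg_exp_closed by (simp add: B.minus_eq_zero)
qed

text \<open>
  The universal property of the algebra: every pair of elements that satisfies the relation is the image of \<open>z\<close>, \<open>b\<close>.
\<close>

lemma Af_hom_exists:
  assumes B: "cam_algebra B" and x: "x \<in> car B" and y: "y \<in> car B"
    and rel: "alg_exp B x \<otimes>\<^sub>B y = q \<odot>\<^sub>B (y \<otimes>\<^sub>B alg_exp B x)"
  shows "\<exists>f. cont_alg_hom (Af q) B f \<and> f (Af_z q) = x \<and> f (Af_b q) = y"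
proof -
  have "\<exists>f. cont_alg_hom (free_entire 2) B f \<and> (\<forall>i\<in>{1..2}. f (fe_gen i) = (if i = 1 then x else y))"
    by (rule evaluation_exists[OF B]) (use x y in simp)
  then obtain f where f: "cont_alg_hom (free_entire 2) B f" "\<forall>i\<in>{1..2}. f (fe_gen i) = (if i = 1 then x else y)" by (elim exE conjE)
  have v: "f (fe_gen 1) = x" "f (fe_gen 2) = y" using bspec[OF f(2), of 1] bspec[OF f(2), of 2] by simp_all
  have "f (Af_relation q) = \<zero>\<^sub>B" unfolding hom_relation[OF B f(1)] v by (rule rel)
  then have k: "f w = \<zero>\<^sub>B" if "w \<in> {Af_relation q}" for w using that by simp
  have "\<exists>g. cont_alg_hom (universal_HFG 2 {Af_relation q}) B g \<and>
     (\<forall>i\<in>{1..2}. g (universal_HFG_gen 2 {Af_relation q} i) = f (fe_gen i))"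
    by (rule universal_hom_exists[OF relation_closed B f(1) k])
  then obtain g where g: "cont_alg_hom (Af q) B g" "\<forall>i\<in>{1..2}. g (universal_HFG_gen 2 {Af_relation q} i) = f (fe_gen i)"
    unfolding Af_def by (elim exE conjE)
  have "g (Af_z q) = x" "g (Af_b q) = y"
    using bspec[OF g(2), of 1] bspec[OF g(2), of 2] v by (simp_all add: Af_z_def Af_b_def)
  then show ?thesis using g(1) by (intro exI conjI)
qed

lemma Af_gen_cases: "i \<in> {1..2::nat} ==> i = 1 \<or> i = 2" by auto

lemma Af_hom_unique:
  assumes "cam_algebra B" "cont_alg_hom (Af q) B f" "cont_alg_hom (Af q) B g"
    and "f (Af_z q) = g (Af_z q)" "f (Af_b q) = g (Af_b q)" and "X \<in> car (Af q)"
  shows "f X = g X"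
proof (rule universal_hom_unique[OF relation_closed assms(1,2,3)[unfolded Af_def] _ assms(6)[unfolded Af_def]])
  fix i assume i: "i \<in> {1..2::nat}"
  show "f (universal_HFG_gen 2 {Af_relation q} i) = g (universal_HFG_gen 2 {Af_relation q} i)"
    using Af_gen_cases[OF i] assms(4,5) unfolding Af_z_def Af_b_def by (elim disjE) simp_all
qed

lemma Af_induct:
  assumes "is_complete_lcs G" "cont_linear (Af q) G u" "cont_linear (Af q) G v"
    and "P \<one>\<^sub>(Af q)"
    and "\<And>X. X \<in> car (Af q) ==> P X ==> P (Af_z q \<otimes>\<^sub>(Af q) X)"
    and "\<And>X. X \<in> car (Af q) ==> P X ==> P (Af_b q \<otimes>\<^sub>(Af q) X)"
    and "\<And>X. X \<in> car (Af q) ==> P X ==> u X = v X" and "X \<in> car (Af q)"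
  shows "u X = v X"
proof (rule universal_induct[OF relation_closed assms(1) assms(2,3)[unfolded Af_def], where P = P])
  fix i X assume i: "i \<in> {1..2::nat}" and X: "X \<in> car (universal_HFG 2 {Af_relation q})" "P X"
  then show "P (universal_HFG_gen 2 {Af_relation q} i \<otimes>\<^bsub>universal_HFG 2 {Af_relation q}\<^esub> X)"
    using assms(5,6)[of X] Af_gen_cases[OF i] by (auto simp: Af_def Af_z_def Af_b_def)
qed (use assms(4,7,8) in \<open>simp_all add: Af_def\<close>)

lemma is_HFG_Af: "is_HFG (Af q)" unfolding Af_def by (rule is_HFG_universal[OF relation_closed])

lemma Af_relation_holds:
  "alg_exp (Af q) (Af_z q) \<otimes>\<^sub>(Af q) Af_b q = q \<odot>\<^sub>(Af q) (Af_b q \<otimes>\<^sub>(Af q) alg_exp (Af q) (Af_z q))"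
proof -
  from universal_proj[OF relation_closed, of q] obtain f where
    f: "cont_alg_hom (free_entire 2) (Af q) f" "\<forall>i. f (fe_gen i) = universal_HFG_gen 2 {Af_relation q} i"
     "\<forall>x\<in>{Af_relation q}. f x = \<zero>\<^sub>(Af q)" unfolding Af_def by (elim exE conjE)
  from f(3) have "f (Af_relation q) = \<zero>\<^sub>(Af q)" by simp
  then show ?thesis unfolding hom_relation[OF complete_am_Af f(1)] f(2)[rule_format] by (simp add: Af_z_def Af_b_def)
qed

text \<open>
  The relation is multiplied by \<open>e\<^sup>-\<^sup>z\<close> on both sides.
\<close>

lemma Af_relation_neg:
  fixes q
  defines "H \<equiv> Af q" and "z \<equiv> Af_z q" and "b \<equiv> Af_b q"
  shows "b \<otimes>\<^sub>H alg_exp H (\<ominus>\<^sub>H z) = q \<odot>\<^sub>H (alg_exp H (\<ominus>\<^sub>H z) \<otimes>\<^sub>H b)"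
proof -
  interpret cam_algebra H unfolding H_def by (rule complete_am_Af)
  have z: "z \<in> car H" and b: "b \<in> car H" unfolding H_def z_def b_def by (rule Af_gen_closed)+
  define e where "e = alg_exp H z"
  define e' where "e' = alg_exp H (\<ominus>\<^sub>H z)"
  have e: "e \<in> car H" "e' \<in> car H" unfolding e_def e'_def using z by (simp_all add: alg_exp_closed)
  have ee: "e \<otimes>\<^sub>H e' = \<one>\<^sub>H" "e' \<otimes>\<^sub>H e = \<one>\<^sub>H" unfolding e_def e'_def using exp_neg[OF z] by simp_all
  have rel: "e \<otimes>\<^sub>H b = q \<odot>\<^sub>H (b \<otimes>\<^sub>H e)" unfolding e_def H_def b_def z_def by (rule Af_relation_holds)
  have "b \<otimes>\<^sub>H e' = (e' \<otimes>\<^sub>H e) \<otimes>\<^sub>H (b \<otimes>\<^sub>H e')" using b e by (simp add: ee)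
  also have "\<dots> = e' \<otimes>\<^sub>H ((e \<otimes>\<^sub>H b) \<otimes>\<^sub>H e')" using b e by (simp add: m_assoc)
  also have "\<dots> = q \<odot>\<^sub>H (e' \<otimes>\<^sub>H (b \<otimes>\<^sub>H (e \<otimes>\<^sub>H e')))"
    unfolding rel using b e by (simp add: m_assoc smult_mult_left smult_mult_right)
  finally show ?thesis unfolding ee(1) e'_def[symmetric] using b e by simp
qed

section \<open>Infinite dimension\<close>

text \<open>Gaussian elimination: one equation is used up to eliminate one unknown.\<close>

lemma homogeneous_system:
  fixes c :: "'k => 'v => complex"
  assumes "finite B" "finite I" "card B < card I"
  shows "\<exists>d. (\<exists>k\<in>I. d k \<noteq> 0) \<and> (\<forall>v\<in>B. (\<Sum>k\<in>I. d k * c k v) = 0)"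
  using assms
proof (induction B arbitrary: I c rule: finite_induct)
  case empty
  then have "I \<noteq> {}" by auto
  then show ?case by (intro exI[of _ "\<lambda>k. 1"]) auto
next
  case (insert v B)
  show ?case
  proof (cases "\<forall>k\<in>I. c k v = 0")
    case True
    have "card B < card I" using insert.prems insert.hyps by simp
    from insert.IH[OF insert.prems(1) this, of c] True show ?thesis by auto
  next
    case False
    then obtain k0 where k0: "k0 \<in> I" "c k0 v \<noteq> 0" by blast
    define I' where "I' = I - {k0}"
    have I': "finite I'" "I = insert k0 I'" "k0 \<notin> I'" using insert.prems k0 by (auto simp: I'_def)
    have "card B < card I'" using insert.prems insert.hyps I' by simp
    from insert.IH[OF I'(1) this, of "\<lambda>k u. c k u - c k v / c k0 v * c k0 u"] obtain d where
     d: "\<exists>k\<in>I'. d k \<noteq> 0" "\<forall>u\<in>B. (\<Sum>k\<in>I'. d k * (c k u - c k v / c k0 v * c k0 u)) = 0" by (elim exE conjE)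
    define s where "s = (\<Sum>k\<in>I'. d k * c k v) / c k0 v"
    define d' where "d' = d(k0 := - s)"
    have sum: "(\<Sum>k\<in>I. d' k * c k u) = (\<Sum>k\<in>I'. d k * c k u) - s * c k0 u" for u
    proof -
     have "(\<Sum>k\<in>I'. d' k * c k u) = (\<Sum>k\<in>I'. d k * c k u)" using I'(3) by (intro sum.cong) (auto simp: d'_def)
     then show ?thesis using I' by (simp add: d'_def)
    qed
    have "(\<Sum>k\<in>I. d' k * c k u) = 0" if "u \<in> insert v B" for u
    proof (cases "u = v")
     case True
     then show ?thesis unfolding sum using k0(2) by (simp add: s_def)
    next
     case False
     then have "(\<Sum>k\<in>I'. d k * (c k u - c k v / c k0 v * c k0 u)) = 0" using that d(2) by blast
     moreover have "(\<Sum>k\<in>I'. d k * (c k u - c k v / c k0 v * c k0 u)) = (\<Sum>k\<in>I'. d k * c k u) - s * c k0 u"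
     proof -
      have "d k * (c k u - c k v / c k0 v * c k0 u) = d k * c k u - d k * c k v * (c k0 u / c k0 v)" for k
       by (simp add: algebra_simps)
      then show ?thesis by (simp add: s_def sum_subtractf sum_distrib_right sum_divide_distrib)
     qed
     ultimately show ?thesis unfolding sum by simp
    qed
    moreover have "\<exists>k\<in>I. d' k \<noteq> 0" using d(1) I'(2,3) by (auto simp: d'_def)
    ultimately show ?thesis by blast
  qed
qed

text \<open>
  The characters \<open>z \<mapsto> t\<close>, \<open>b \<mapsto> 0\<close> send \<open>z\<^sup>k\<close> to \<open>t\<^sup>k\<close>, so a finite spanning set would make
  finitely many powers of \<open>t\<close> linearly dependent functions.
\<close>

lemma infinite_dimensional_Af: "infinite_dimensional (Af q)" unfolding infinite_dimensional_def
proof (rule notI, elim exE conjE)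
  interpret H: cam_algebra "Af q" by (rule complete_am_Af)
  interpret C: cam_algebra CC by (rule complete_am_complex)
  fix B assume B: "finite B" "B \<subseteq> car (Af q)" and
    span: "\<forall>x\<in>car (Af q). \<exists>c. x = (\<Oplus>\<^bsub>Af q\<^esub>v\<in>B. c v \<odot>\<^sub>(Af q) v)"
  note z = Af_gen_closed(1)[of q]
  have "\<forall>k. \<exists>c. Af_z q [^]\<^bsub>Af q\<^esub> (k::nat) = (\<Oplus>\<^bsub>Af q\<^esub>v\<in>B. c v \<odot>\<^sub>(Af q) v)"
    by (intro allI bspec[OF span] H.nat_pow_closed z)
  from choice[OF this] obtain c where c: "\<forall>k. Af_z q [^]\<^bsub>Af q\<^esub> (k::nat) = (\<Oplus>\<^bsub>Af q\<^esub>v\<in>B. c k v \<odot>\<^sub>(Af q) v)" by (elim exE)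
  have "\<exists>d. (\<exists>k\<in>{..card B}. d k \<noteq> 0) \<and> (\<forall>v\<in>B. (\<Sum>k\<in>{..card B}. d k * c k v) = 0)"
    by (rule homogeneous_system[OF B(1)]) simp_all
  then obtain d where d: "\<exists>k\<in>{..card B}. d k \<noteq> 0" "\<forall>v\<in>B. (\<Sum>k\<in>{..card B}. d k * c k v) = 0" by (elim exE conjE)
  have "(\<Sum>k\<le>card B. d k * t ^ k) = 0" for t
  proof -
    have "\<exists>f. cont_alg_hom (Af q) CC f \<and> f (Af_z q) = t \<and> f (Af_b q) = 0"
     by (rule Af_hom_exists[OF complete_am_complex]) simp_all
    then obtain f where f: "cont_alg_hom (Af q) CC f" "f (Af_z q) = t" by (elim exE conjE)
    note lf = homD(2)[OF f(1)]
    have sum: "f (\<Oplus>\<^bsub>Af q\<^esub>v\<in>A. a v \<odot>\<^sub>(Af q) v) = (\<Sum>v\<in>A. a v * f v)" if "finite A" "A \<subseteq> car (Af q)" for a A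
     using that
    proof (induction A rule: finite_induct)
     case empty
     then show ?case using lin_zero[OF H.cvs_axioms C.cvs_axioms lf] by simp
    next
     case (insert v A)
     have "(\<Oplus>\<^bsub>Af q\<^esub>w\<in>insert v A. a w \<odot>\<^sub>(Af q) w) = a v \<odot>\<^sub>(Af q) v \<oplus>\<^sub>(Af q) (\<Oplus>\<^bsub>Af q\<^esub>w\<in>A. a w \<odot>\<^sub>(Af q) w)"
      using insert by (intro H.finsum_insert) auto
     moreover have "(\<Oplus>\<^bsub>Af q\<^esub>w\<in>A. a w \<odot>\<^sub>(Af q) w) \<in> car (Af q)" using insert by (intro H.finsum_closed) auto
     ultimately show ?case using insert by (simp add: lin_add[OF lf] lin_smult[OF lf])
    qed
    have pow: "f (Af_z q [^]\<^bsub>Af q\<^esub> (k::nat)) = t ^ k" for k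
     by (induction k) (simp_all add: homD(4,5)[OF f(1)] z f(2) mult.commute)
    have "t ^ k = (\<Sum>v\<in>B. c k v * f v)" for k using pow[of k] sum[OF B, of "c k"] c by simp
    then have "(\<Sum>k\<le>card B. d k * t ^ k) = (\<Sum>k\<le>card B. \<Sum>v\<in>B. d k * c k v * f v)"
     by (simp add: sum_distrib_left mult.assoc)
    also have "\<dots> = (\<Sum>v\<in>B. (\<Sum>k\<le>card B. d k * c k v) * f v)"
     by (subst sum.swap) (simp add: sum_distrib_right)
    also have "\<dots> = 0" using d(2) by (intro sum.neutral) simp
    finally show ?thesis .
  qed
  then have "\<forall>k\<le>card B. d k = 0" using polyfun_eq_0[of d "card B"] by blast
  then show False using d(1) by auto
qed

section \<open>The Hopf structure\<close>

definition Af_comult where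
  "Af_comult q = (\<lambda>D. cont_alg_hom (Af q) (PT (Af q) (Af q)) D \<and>
    D (Af_z q) = pure (Af q) (Af q) \<one>\<^sub>(Af q) (Af_z q) \<oplus>\<^bsub>PT (Af q) (Af q)\<^esub>
     pure (Af q) (Af q) (Af_z q) \<one>\<^sub>(Af q) \<and>
    D (Af_b q) = pure (Af q) (Af q) (alg_exp (Af q) (Af_z q)) (Af_b q) \<oplus>\<^bsub>PT (Af q) (Af q)\<^esub>
     pure (Af q) (Af q) (Af_b q) \<one>\<^sub>(Af q))"

definition Af_counit where
  "Af_counit q = (\<lambda>e. cont_alg_hom (Af q) CC e \<and> e (Af_z q) = 0 \<and> e (Af_b q) = 0)"

definition Af_antipode where
  "Af_antipode q = (\<lambda>s. cont_alg_antihom (Af q) (Af q) s \<and> s (Af_z q) = \<ominus>\<^sub>(Af q) (Af_z q) \<and>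
    s (Af_b q) = \<ominus>\<^sub>(Af q) (alg_exp (Af q) (\<ominus>\<^sub>(Af q) (Af_z q)) \<otimes>\<^sub>(Af q) (Af_b q)))"

context
  fixes q :: complex
begin

abbreviation (input) H where "H \<equiv> Af q"
abbreviation (input) z where "z \<equiv> Af_z q"
abbreviation (input) b where "b \<equiv> Af_b q"
abbreviation (input) T where "T \<equiv> PT H H"
abbreviation (input) E where "E \<equiv> alg_exp H z"
abbreviation (input) E' where "E' \<equiv> alg_exp H (\<ominus>\<^sub>H z)"
abbreviation (input) pt where "pt \<equiv> pure H H"

interpretation H: cam_algebra H by (rule complete_am_Af)
interpretation HH: am_pair H H by (rule am_pair.intro[OF H.am_algebra_axioms H.am_algebra_axioms])
interpretation T: cam_algebra T by (rule HH.complete_am_T)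
interpretation C: cam_algebra CC by (rule complete_am_complex)

lemma gens [simp]: "z \<in> car H" "b \<in> car H" by (rule Af_gen_closed)+

lemma exps [simp]: "E \<in> car H" "E' \<in> car H" by (simp_all add: H.alg_exp_closed)

lemma exp_inverse: "E \<otimes>\<^sub>H E' = \<one>\<^sub>H" "E' \<otimes>\<^sub>H E = \<one>\<^sub>H"
  using H.exp_neg[OF gens(1)] by simp_all

lemmas pt_smult_left = lin_smult[OF is_bilinearD(2)[OF HH.is_bilinear_pure]]
lemmas pt_smult_right = lin_smult[OF is_bilinearD(1)[OF HH.is_bilinear_pure]]

text \<open>
  \<open>1 \<otimes> z\<close> and \<open>z \<otimes> 1\<close> commute, so \<open>e\<^sup>z\<close> is group-like.
\<close>

lemma exp_comult:
  "pt \<one>\<^sub>H z \<oplus>\<^sub>T pt z \<one>\<^sub>H \<in> car T"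
  "alg_exp T (pt \<one>\<^sub>H z \<oplus>\<^sub>T pt z \<one>\<^sub>H) = pt E E"
proof -
  interpret P: commuting_pair T "pt \<one>\<^sub>H z" "pt z \<one>\<^sub>H"
    by unfold_locales (simp_all add: HH.pure_mult HH.pure_closed)
  show "pt \<one>\<^sub>H z \<oplus>\<^sub>T pt z \<one>\<^sub>H \<in> car T" by (simp add: HH.pure_closed)
  have "alg_exp T (pt \<one>\<^sub>H z) = pt \<one>\<^sub>H E"
    by (rule hom_exp[OF H.cam_algebra_axioms T.cam_algebra_axioms HH.hom_pure_right gens(1), symmetric])
  moreover have "alg_exp T (pt z \<one>\<^sub>H) = pt E \<one>\<^sub>H"
    by (rule hom_exp[OF H.cam_algebra_axioms T.cam_algebra_axioms HH.hom_pure_left gens(1), symmetric])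
  ultimately show "alg_exp T (pt \<one>\<^sub>H z \<oplus>\<^sub>T pt z \<one>\<^sub>H) = pt E E"
    by (simp add: P.exp_add HH.pure_mult)
qed

text \<open>
  Both sides of the relation for the images are \<open>e\<^sup>z e\<^sup>z \<otimes> e\<^sup>z b + e\<^sup>z b \<otimes> e\<^sup>z\<close>, since \<open>e\<^sup>z\<close> commutes with itself and passes \<open>b\<close> in one
  factor of each summand.
\<close>

lemma comult_exists: "\<exists>D. Af_comult q D" unfolding Af_comult_def
proof (rule Af_hom_exists[OF T.cam_algebra_axioms])
  have "pt E E \<otimes>\<^sub>T (pt E b \<oplus>\<^sub>T pt b \<one>\<^sub>H) = pt (E \<otimes>\<^sub>H E) (E \<otimes>\<^sub>H b) \<oplus>\<^sub>T pt (E \<otimes>\<^sub>H b) E"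
    by (simp add: T.r_distr HH.pure_mult HH.pure_closed)
  also have "\<dots> = q \<odot>\<^sub>T pt (E \<otimes>\<^sub>H E) (b \<otimes>\<^sub>H E) \<oplus>\<^sub>T q \<odot>\<^sub>T pt (b \<otimes>\<^sub>H E) E"
    unfolding Af_relation_holds by (simp add: pt_smult_left pt_smult_right)
  also have "\<dots> = q \<odot>\<^sub>T ((pt E b \<oplus>\<^sub>T pt b \<one>\<^sub>H) \<otimes>\<^sub>T pt E E)"
    by (simp add: T.l_distr HH.pure_mult HH.pure_closed T.smult_r_distr)
  finally show "alg_exp T (pt \<one>\<^sub>H z \<oplus>\<^sub>T pt z \<one>\<^sub>H) \<otimes>\<^sub>T (pt E b \<oplus>\<^sub>T pt b \<one>\<^sub>H) =
     q \<odot>\<^sub>T ((pt E b \<oplus>\<^sub>T pt b \<one>\<^sub>H) \<otimes>\<^sub>T alg_exp T (pt \<one>\<^sub>H z \<oplus>\<^sub>T pt z \<one>\<^sub>H))"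
    unfolding exp_comult(2) .
qed (simp_all add: HH.pure_closed)

lemma counit_exists: "\<exists>e. Af_counit q e" unfolding Af_counit_def
  by (rule Af_hom_exists[OF complete_am_complex]) simp_all

text \<open>
  The required relation is the original one for \<open>-z\<close> and \<open>y\<close>, read in the opposite algebra.
\<close>

lemma antihom_exists:
  assumes y: "y \<in> car H" and rel: "y \<otimes>\<^sub>H E' = q \<odot>\<^sub>H (E' \<otimes>\<^sub>H y)"
  shows "\<exists>s. cont_alg_antihom H H s \<and> s z = \<ominus>\<^sub>H z \<and> s b = y"
  unfolding antihom_iff_hom_opp by (rule Af_hom_exists[OF opp_complete_am[OF complete_am_Af]])
    (use y rel in \<open>simp_all add: opp_exp[OF complete_am_Af]\<close>)

lemma antipode_exists: "\<exists>s. Af_antipode q s" unfolding Af_antipode_def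
proof (rule antihom_exists)
  have "(E' \<otimes>\<^sub>H b) \<otimes>\<^sub>H E' = q \<odot>\<^sub>H (E' \<otimes>\<^sub>H (E' \<otimes>\<^sub>H b))"
    by (simp add: H.m_assoc Af_relation_neg H.smult_mult_right)
  then show "\<ominus>\<^sub>H (E' \<otimes>\<^sub>H b) \<otimes>\<^sub>H E' = q \<odot>\<^sub>H (E' \<otimes>\<^sub>H \<ominus>\<^sub>H (E' \<otimes>\<^sub>H b))"
    by (simp add: H.l_minus H.r_minus H.smult_neg)
qed simp

text \<open>
  The inverse of the antipode has \<open>e\<^sup>-\<^sup>z\<close> on the other side of \<open>b\<close>.
\<close>

lemma antipode_inverse_exists: "\<exists>s. cont_alg_antihom H H s \<and> s z = \<ominus>\<^sub>H z \<and> s b = \<ominus>\<^sub>H (b \<otimes>\<^sub>H E')"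
proof (rule antihom_exists)
  have "(b \<otimes>\<^sub>H E') \<otimes>\<^sub>H E' = q \<odot>\<^sub>H (E' \<otimes>\<^sub>H (b \<otimes>\<^sub>H E'))"
    by (subst (1) Af_relation_neg) (simp add: H.m_assoc H.smult_mult_left)
  then show "\<ominus>\<^sub>H (b \<otimes>\<^sub>H E') \<otimes>\<^sub>H E' = q \<odot>\<^sub>H (E' \<otimes>\<^sub>H \<ominus>\<^sub>H (b \<otimes>\<^sub>H E'))"
    by (simp add: H.l_minus H.r_minus H.smult_neg)
qed simp

lemma antihomD:
  assumes "cont_alg_antihom H H s"
  shows "cont_linear H H s" "is_linear H H s" "x \<in> car H ==> s x \<in> car H"
    "x \<in> car H ==> y \<in> car H ==> s (x \<otimes>\<^sub>H y) = s y \<otimes>\<^sub>H s x" "s \<one>\<^sub>H = \<one>\<^sub>H"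
    "x \<in> car H ==> s (\<ominus>\<^sub>H x) = \<ominus>\<^sub>H s x"
    "x \<in> car H ==> s (alg_exp H x) = alg_exp H (s x)"
proof -
  have h: "cont_alg_hom H (opp H) s" using assms by (simp add: antihom_iff_hom_opp)
  show c: "cont_linear H H s" using assms by (simp add: cont_alg_antihom_def)
  show l: "is_linear H H s" by (rule cont_linearD[OF c])
  show cl: "x \<in> car H ==> s x \<in> car H" for x by (rule lin_closed[OF l])
  show "x \<in> car H ==> y \<in> car H ==> s (x \<otimes>\<^sub>H y) = s y \<otimes>\<^sub>H s x" "s \<one>\<^sub>H = \<one>\<^sub>H"
    using assms by (simp_all add: cont_alg_antihom_def)
  show "x \<in> car H ==> s (\<ominus>\<^sub>H x) = \<ominus>\<^sub>H s x"
    by (rule lin_uminus[OF H.cvs_axioms H.cvs_axioms l])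
  show "x \<in> car H ==> s (alg_exp H x) = alg_exp H (s x)"
    using hom_exp[OF complete_am_Af opp_complete_am[OF complete_am_Af] h, of x] cl[of x] by (simp add: opp_exp[OF complete_am_Af])
qed

lemma antihom_compose_identity:
  assumes s: "cont_alg_antihom H H s" and t: "cont_alg_antihom H H t"
    and st: "s (t z) = z" "s (t b) = b" and x: "x \<in> car H"
  shows "s (t x) = x"
proof (rule Af_hom_unique[OF complete_am_Af _ cont_alg_hom_id _ _ x])
  show "cont_alg_hom H H (\<lambda>x. s (t x))" by (rule homI[OF clin_compose[OF antihomD(1)[OF t] antihomD(1)[OF s]]])
     (simp_all add: antihomD(3-5)[OF s] antihomD(3-5)[OF t])
qed (rule st)+

lemma antipode_homeomorphic:
  assumes "Af_antipode q s"
  shows "homeomorphic_map (lctop H) (lctop H) s"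
proof -
  have s: "cont_alg_antihom H H s" "s z = \<ominus>\<^sub>H z" "s b = \<ominus>\<^sub>H (E' \<otimes>\<^sub>H b)"
    using assms unfolding Af_antipode_def by simp_all
  obtain t where t: "cont_alg_antihom H H t" "t z = \<ominus>\<^sub>H z" "t b = \<ominus>\<^sub>H (b \<otimes>\<^sub>H E')"
    using antipode_inverse_exists by (elim exE conjE)
  note S = antihomD[OF s(1)] and T = antihomD[OF t(1)]
  have sE: "s E' = E" and tE: "t E' = E" using s(2) t(2) by (simp_all add: S T)
  have "s (t z) = z" "t (s z) = z" using s(2) t(2) by (simp_all add: S T)
  moreover have "t (s b) = b" using s(3) t(3) tE exp_inverse by (simp add: T H.l_minus H.m_assoc)
  moreover have "s (t b) = b" using s(3) t(3) sE exp_inverse by (simp add: S H.r_minus H.m_assoc[symmetric])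
  ultimately have "s (t x) = x" "t (s x) = x" if "x \<in> car H" for x
    using antihom_compose_identity[OF s(1) t(1)] antihom_compose_identity[OF t(1) s(1)] that by blast+
  moreover have "continuous_map (lctop H) (lctop H) s" "continuous_map (lctop H) (lctop H) t"
    using S(1) T(1) unfolding cont_linear_def by blast+
  ultimately have "homeomorphic_maps (lctop H) (lctop H) s t" by (simp add: homeomorphic_maps_def)
  then show ?thesis unfolding homeomorphic_map_maps by blast
qed

end

lemmas bilinear_pure = lc_pair.is_bilinear_pure[OF am_pair_lc]
lemmas pure_rules = lc_pair.pure_closed[OF am_pair_lc]
  lin_add[OF is_bilinearD(2)[OF bilinear_pure]] lin_add[OF is_bilinearD(1)[OF bilinear_pure]]
  am_pair.pure_mult am_pair.pure_one

locale Af_hopf =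
  fixes q D e S
  assumes comult: "Af_comult q D" and counit: "Af_counit q e" and antipode: "Af_antipode q S"
begin

lemmas D = comult[unfolded Af_comult_def, THEN conjunct1]
  and Dz = comult[unfolded Af_comult_def, THEN conjunct2, THEN conjunct1]
  and Db = comult[unfolded Af_comult_def, THEN conjunct2, THEN conjunct2]
lemmas e = counit[unfolded Af_counit_def, THEN conjunct1]
  and ez = counit[unfolded Af_counit_def, THEN conjunct2, THEN conjunct1]
  and eb = counit[unfolded Af_counit_def, THEN conjunct2, THEN conjunct2]
lemmas S = antipode[unfolded Af_antipode_def, THEN conjunct1]
  and Sz = antipode[unfolded Af_antipode_def, THEN conjunct2, THEN conjunct1]
  and Sb = antipode[unfolded Af_antipode_def, THEN conjunct2, THEN conjunct2]

abbreviation H where "H \<equiv> Af q"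
abbreviation z where "z \<equiv> Af_z q"
abbreviation b where "b \<equiv> Af_b q"
abbreviation T where "T \<equiv> PT H H"
abbreviation E where "E \<equiv> alg_exp H z"
abbreviation E' where "E' \<equiv> alg_exp H (\<ominus>\<^sub>H z)"
abbreviation pt where "pt \<equiv> pure H H"

lemmas H_am = complete_am_Af[of q]
lemmas H_am' = cam_algebra.axioms(1)[OF H_am]
lemmas HH_pair = am_pair.intro[OF H_am' H_am']
lemmas T_am = am_pair.complete_am_T[OF HH_pair]
lemmas T_am' = cam_algebra.axioms(1)[OF T_am]

sublocale H: cam_algebra H by (rule H_am)
sublocale T: cam_algebra T by (rule T_am)
sublocale C: cam_algebra CC by (rule complete_am_complex)

lemmas TH_pair = am_pair.intro[OF T_am' H_am'] and HT_pair = am_pair.intro[OF H_am' T_am']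
lemmas CH_pair = am_pair.intro[OF cam_algebra.axioms(1)[OF complete_am_complex] H_am']
  and HC_pair = am_pair.intro[OF H_am' cam_algebra.axioms(1)[OF complete_am_complex]]

lemmas gens [simp] = gens[of q]
lemmas exps [simp] = exps[of q]
lemmas pHH = pure_rules[OF HH_pair] and pTH = pure_rules[OF TH_pair] and pHT = pure_rules[OF HT_pair]
lemmas pCH = pure_rules[OF CH_pair] and pHC = pure_rules[OF HC_pair]

lemma DE: "D E = pt E E" using hom_exp[OF H_am T_am D gens(1)] exp_comult(2)[of q] by (simp add: Dz)

lemma eE: "e E = 1" using hom_exp[OF H_am complete_am_complex e gens(1)] C.alg_exp_zero by (simp add: ez)

lemmas D' = homD[OF D] and e' = homD[OF e] and S' = antihomD[OF S]

lemma tensor_maps: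
  assumes "am_pair U V" "am_pair U' V'" "cont_alg_hom U U' f" "cont_alg_hom V V' g"
  shows "cont_alg_hom (PT U V) (PT U' V') (tensor_map U V U' V' f g)"
    "x \<in> car U ==> y \<in> car V ==> tensor_map U V U' V' f g (pure U V x y) = pure U' V' (f x) (g y)"
  by (rule tensor_map_hom[OF assms])
    (rule tensor_map_cont(2)[OF am_pair_lc[OF assms(1)] am_pair_lc[OF assms(2)] homD(1)[OF assms(3)] homD(1)[OF assms(4)]])

text \<open>
  Both sides are continuous homomorphisms, so it suffices to compare them on \<open>z\<close> and \<open>b\<close>. The same argument gives the
  counit axioms.
\<close>

lemma coassociative:
  assumes a: "a \<in> car H"
  shows "tensor_assoc H H H (tensor_map H H T H D (\<lambda>x. x) (D a)) = tensor_map H H H T (\<lambda>x. x) D (D a)"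
proof -
  interpret TH: am_algebra "PT T H" by (rule am_pair.am_algebra_T[OF TH_pair])
  interpret HT: am_algebra "PT H T" by (rule am_pair.am_algebra_T[OF HT_pair])
  note l = tensor_maps[OF HH_pair TH_pair D cont_alg_hom_id]
  note r = tensor_maps[OF HH_pair HT_pair cont_alg_hom_id D]
  note as = tensor_assoc_hom[OF H_am' H_am' H_am']
  have tri: "lc_triple H H H" using H_am' by (simp add: am_algebra_def lc_triple_def)
  note av = lc_triple.tensor_assoc_spec(2)[OF tri]
  note add = lin_add[OF homD(2)[OF l(1)]] lin_add[OF homD(2)[OF r(1)]] lin_add[OF homD(2)[OF as]]
  note simps = Dz Db DE D'(5) add l(2) r(2) av pHH(1) pTH(1) pHT(1) pHH(5)[symmetric] pTH(2) pHT(3) HT.a_assoc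
  show ?thesis
  proof (rule Af_hom_unique[OF am_pair.complete_am_T[OF HT_pair] cont_alg_hom_compose[OF cont_alg_hom_compose[OF D l(1)] as]
      cont_alg_hom_compose[OF D r(1)] _ _ a])
    show "tensor_assoc H H H (tensor_map H H T H D (\<lambda>x. x) (D z)) = tensor_map H H H T (\<lambda>x. x) D (D z)"
     by (simp add: simps)
    show "tensor_assoc H H H (tensor_map H H T H D (\<lambda>x. x) (D b)) = tensor_map H H H T (\<lambda>x. x) D (D b)"
     by (simp add: simps)
  qed
qed

lemma counital:
  assumes a: "a \<in> car H"
  shows "tensor_map H H CC H e (\<lambda>x. x) (D a) = pure CC H 1 a"
    "tensor_map H H H CC (\<lambda>x. x) e (D a) = pure H CC a 1"
proof -
  interpret CH: am_algebra "PT CC H" by (rule am_pair.am_algebra_T[OF CH_pair])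
  interpret HC: am_algebra "PT H CC" by (rule am_pair.am_algebra_T[OF HC_pair])
  note l = tensor_maps[OF HH_pair CH_pair e cont_alg_hom_id]
  note r = tensor_maps[OF HH_pair HC_pair cont_alg_hom_id e]
  have cl: "pure CC H x y \<in> car (PT CC H)"
    "pure H CC y x \<in> car (PT H CC)" if "y \<in> car H" for x y using pCH(1)[of x y] pHC(1)[of y x] that by simp_all
  have zero: "pure CC H 0 y = \<zero>\<^bsub>PT CC H\<^esub>"
    "pure H CC y 0 = \<zero>\<^bsub>PT H CC\<^esub>" if "y \<in> car H" for y
    using lin_zero[OF C.cvs_axioms CH.cvs_axioms is_bilinearD(2)[OF bilinear_pure[OF CH_pair] that]]
     lin_zero[OF C.cvs_axioms HC.cvs_axioms is_bilinearD(1)[OF bilinear_pure[OF HC_pair] that]] by simp_all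
  have e1: "e \<one>\<^sub>H = 1" using e'(5) by simp
  note simps = Dz Db eE ez eb e1 lin_add[OF homD(2)[OF l(1)]] lin_add[OF homD(2)[OF r(1)]]
    l(2) r(2) pHH(1) cl zero
  have h: "cont_alg_hom H (PT CC H) (pure CC H 1)"
    "cont_alg_hom H (PT H CC) (\<lambda>x. pure H CC x 1)"
    using am_pair.hom_pure_right[OF CH_pair] am_pair.hom_pure_left[OF HC_pair] by simp_all
  show "tensor_map H H CC H e (\<lambda>x. x) (D a) = pure CC H 1 a"
    by (rule Af_hom_unique[OF am_pair.complete_am_T[OF CH_pair] cont_alg_hom_compose[OF D l(1)] h(1) _ _ a]) (simp_all add: simps)
  show "tensor_map H H H CC (\<lambda>x. x) e (D a) = pure H CC a 1"
    by (rule Af_hom_unique[OF am_pair.complete_am_T[OF HC_pair] cont_alg_hom_compose[OF D r(1)] h(2) _ _ a]) (simp_all add: simps)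
qed

lemma counit_smult_cont:
  assumes c: "c \<in> car H"
  shows "cont_linear H H (\<lambda>a. e a \<odot>\<^sub>H c)"
proof (rule cont_linearI[OF H.lc_space_axioms H.lc_space_axioms])
  show "is_linear H H (\<lambda>a. e a \<odot>\<^sub>H c)"
    using c by (intro is_linearI) (simp_all add: lin_add[OF e'(2)] lin_smult[OF e'(2)] H.smult_l_distr H.smult_assoc)
  fix p assume p: "p \<in> csn H"
  have "(\<lambda>a. cmod (e a)) \<in> csn H"
    by (rule cont_linear_seminorm[OF H.lc_space_axioms C.lc_space_axioms e'(1) cmod_cont])
  from H.csn_scale[OF this H.sn_nonneg[OF H.csnD[OF p] c]]
  show "\<exists>r\<in>csn H. \<forall>a\<in>car H. p (e a \<odot>\<^sub>H c) \<le> r a"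
    by (rule bexI[rotated]) (simp add: H.seminorm_smult[OF H.csnD[OF p] c] mult.commute)
qed

lemma convolution_map:
  assumes f: "cont_linear H H f" and g: "cont_linear H H g"
  shows "cont_linear T H (\<lambda>t. linearization H H H (mult H) (tensor_map H H H H f g t))"
    "x \<in> car H ==> y \<in> car H ==>
     linearization H H H (mult H) (tensor_map H H H H f g (pt x y)) = f x \<otimes>\<^sub>H g y"
proof -
  note lc = am_pair_lc[OF HH_pair]
  note t = tensor_map_cont[OF lc lc f g]
  note m = lc_pair.linearization_cont[OF lc H.complete H.bounded_mult] lc_pair.linearization_pure[OF lc H.complete H.bounded_mult]
  show "cont_linear T H (\<lambda>t. linearization H H H (mult H) (tensor_map H H H H f g t))"
    by (rule clin_compose[OF t(1) m(1)])
  show "x \<in> car H ==> y \<in> car H ==>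
     linearization H H H (mult H) (tensor_map H H H H f g (pt x y)) = f x \<otimes>\<^sub>H g y"
    using m(2)[of "f x" "g y"] t(2)[of x y] lin_closed[OF cont_linearD[OF f]] lin_closed[OF cont_linearD[OF g]] by simp
qed

text \<open>
  The set of \<open>a\<close> with \<open>L(\<Delta>(a) w) = \<epsilon>(a) L(w)\<close> for all \<open>w\<close>, where \<open>L(x \<otimes> y) = S(x) y\<close>, is closed
  under products. Quantifying over \<open>w\<close> is what makes this work: \<open>L\<close> itself is not multiplicative.
\<close>

lemma antipode_left:
  assumes a: "a \<in> car H"
  shows "linearization H H H (mult H) (tensor_map H H H H S (\<lambda>x. x) (D a)) = e a \<odot>\<^sub>H \<one>\<^sub>H"
proof -
  define L where "L t = linearization H H H (mult H) (tensor_map H H H H S (\<lambda>x. x) t)" for t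
  have Lc: "cont_linear T H L" and Lp: "x \<in> car H ==> y \<in> car H ==> L (pt x y) = S x \<otimes>\<^sub>H y" for x y
    using convolution_map[OF S'(1) cont_linear_id] by (simp_all add: L_def[abs_def])
  note Ll = cont_linearD[OF Lc]
  have Lw: "L w \<in> car H" if "w \<in> car T" for w by (rule lin_closed[OF Ll that])
  have zero: "cont_linear T H (\<lambda>w. \<zero>\<^sub>H)"
    by (intro cont_linearI[OF T.lc_space_axioms H.lc_space_axioms] is_linearI bexI[OF _ T.csn_zero])
     (simp_all add: H.seminorm_zero[OF H.csnD])
  have gen: "L (D g \<otimes>\<^sub>T w) = \<zero>\<^sub>H" if g: "g = z \<or> g = b" and w: "w \<in> car T" for g w
  proof -
    have gc: "D g \<in> car T" using g D'(3) gens by blast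
    show ?thesis
    proof (rule lc_pair.tensor_map_unique[OF am_pair_lc[OF HH_pair] H.complete
       clin_compose[OF T.cont_linear_mult_left[OF gc] Lc] zero _ w])
     fix x y assume x: "x \<in> car H" and y: "y \<in> car H"
     note s = x y T.l_distr pHH(1) pHH(4) lin_add[OF Ll] Lp S'(3,4)
     have "L (D z \<otimes>\<^sub>T pt x y) = S x \<otimes>\<^sub>H (z \<otimes>\<^sub>H y) \<oplus>\<^sub>H S x \<otimes>\<^sub>H \<ominus>\<^sub>H z \<otimes>\<^sub>H y"
      by (simp add: Dz s Sz)
     also have "\<dots> = \<zero>\<^sub>H" using x y S'(3)[OF x] by (simp add: H.m_assoc H.l_minus H.r_minus H.r_neg)
     finally have 1: "L (D z \<otimes>\<^sub>T pt x y) = \<zero>\<^sub>H" .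
     have "L (D b \<otimes>\<^sub>T pt x y) = S x \<otimes>\<^sub>H E' \<otimes>\<^sub>H (b \<otimes>\<^sub>H y) \<oplus>\<^sub>H S x \<otimes>\<^sub>H \<ominus>\<^sub>H (E' \<otimes>\<^sub>H b) \<otimes>\<^sub>H y"
      by (simp add: Db s Sb S'(7) Sz)
     also have "\<dots> = \<zero>\<^sub>H" using x y S'(3)[OF x] by (simp add: H.m_assoc H.l_minus H.r_minus H.r_neg)
     finally show "L (D g \<otimes>\<^sub>T pt x y) = \<zero>\<^sub>H" using 1 g by blast
    qed
  qed
  let ?P = "\<lambda>X. \<forall>w\<in>car T. L (D X \<otimes>\<^sub>T w) = e X \<odot>\<^sub>H L w"
  have step: "?P (g \<otimes>\<^sub>H X)" if g: "g = z \<or> g = b" and X: "X \<in> car H" for g X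
  proof
    fix w assume w: "w \<in> car T"
    have gc: "g \<in> car H" and eg: "e g = 0" using g ez eb gens by auto
    show "L (D (g \<otimes>\<^sub>H X) \<otimes>\<^sub>T w) = e (g \<otimes>\<^sub>H X) \<odot>\<^sub>H L w"
     using gen[OF g, of "D X \<otimes>\<^sub>T w"] w X gc eg Lw[OF w] by (simp add: D'(3,4) e'(4) T.m_assoc)
  qed
  have "L (D a \<otimes>\<^sub>T \<one>\<^sub>T) = e a \<odot>\<^sub>H L \<one>\<^sub>T"
  proof (rule Af_induct[OF H.complete clin_compose[OF clin_compose[OF D'(1) T.cont_linear_mult_right] Lc]
      counit_smult_cont[OF Lw], where P = ?P])
    show "?P \<one>\<^sub>H" using D'(5) e'(5) Lw by simp
  qed (use step a in simp_all)
  then show ?thesis using a D'(3)[OF a] Lp[of "\<one>\<^sub>H" "\<one>\<^sub>H"] S'(5) by (simp add: L_def pHH(5))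
qed

text \<open>
  The mirror image of the preceding argument, with \<open>L(w \<Delta>(a)) = \<epsilon>(a) L(w)\<close> and \<open>L(x \<otimes> y) = x S(y)\<close>.
\<close>

lemma antipode_right:
  assumes a: "a \<in> car H"
  shows "linearization H H H (mult H) (tensor_map H H H H (\<lambda>x. x) S (D a)) = e a \<odot>\<^sub>H \<one>\<^sub>H"
proof -
  define L where "L t = linearization H H H (mult H) (tensor_map H H H H (\<lambda>x. x) S t)" for t
  have Lc: "cont_linear T H L" and Lp: "x \<in> car H ==> y \<in> car H ==> L (pt x y) = x \<otimes>\<^sub>H S y" for x y
    using convolution_map[OF cont_linear_id S'(1)] by (simp_all add: L_def[abs_def])
  note Ll = cont_linearD[OF Lc]
  have Lw: "L w \<in> car H" if "w \<in> car T" for w by (rule lin_closed[OF Ll that])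
  have ecl: "cont_linear T H (\<lambda>w. \<zero>\<^sub>H)"
    by (intro cont_linearI[OF T.lc_space_axioms H.lc_space_axioms] is_linearI bexI[OF _ T.csn_zero])
     (simp_all add: H.seminorm_zero[OF H.csnD])
  have gen: "L (w \<otimes>\<^sub>T D g) = \<zero>\<^sub>H" if g: "g = z \<or> g = b" and w: "w \<in> car T" for g w
  proof -
    have gc: "D g \<in> car T" using g D'(3) gens by blast
    show ?thesis
    proof (rule lc_pair.tensor_map_unique[OF am_pair_lc[OF HH_pair] H.complete
       clin_compose[OF T.cont_linear_mult_right[OF gc] Lc] ecl _ w])
     fix x y assume x: "x \<in> car H" and y: "y \<in> car H"
     note s = x y T.r_distr pHH(1) pHH(4) lin_add[OF Ll] Lp S'(3,4)
     have "L (pt x y \<otimes>\<^sub>T D z) = x \<otimes>\<^sub>H (\<ominus>\<^sub>H z \<otimes>\<^sub>H S y) \<oplus>\<^sub>H x \<otimes>\<^sub>H z \<otimes>\<^sub>H S y"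
      by (simp add: Dz s Sz)
     also have "\<dots> = \<zero>\<^sub>H" using x y S'(3)[OF y] by (simp add: H.m_assoc H.l_minus H.r_minus H.l_neg)
     finally have 1: "L (pt x y \<otimes>\<^sub>T D z) = \<zero>\<^sub>H" .
     have "L (pt x y \<otimes>\<^sub>T D b) = x \<otimes>\<^sub>H E \<otimes>\<^sub>H (\<ominus>\<^sub>H (E' \<otimes>\<^sub>H b) \<otimes>\<^sub>H S y) \<oplus>\<^sub>H x \<otimes>\<^sub>H b \<otimes>\<^sub>H S y"
      by (simp add: Db s Sb)
     also have "x \<otimes>\<^sub>H E \<otimes>\<^sub>H (\<ominus>\<^sub>H (E' \<otimes>\<^sub>H b) \<otimes>\<^sub>H S y) = \<ominus>\<^sub>H (x \<otimes>\<^sub>H (E \<otimes>\<^sub>H E') \<otimes>\<^sub>H b \<otimes>\<^sub>H S y)"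
      using x y S'(3)[OF y] by (simp add: H.m_assoc H.l_minus H.r_minus)
     also have "\<dots> \<oplus>\<^sub>H x \<otimes>\<^sub>H b \<otimes>\<^sub>H S y = \<zero>\<^sub>H" using x y S'(3)[OF y] by (simp add: exp_inverse H.l_neg)
     finally show "L (pt x y \<otimes>\<^sub>T D g) = \<zero>\<^sub>H" using 1 g by blast
    qed
  qed
  let ?P = "\<lambda>X. \<forall>w\<in>car T. L (w \<otimes>\<^sub>T D X) = e X \<odot>\<^sub>H L w"
  have step: "?P (g \<otimes>\<^sub>H X)" if g: "g = z \<or> g = b" and X: "X \<in> car H" and P: "?P X" for g X
  proof
    fix w assume w: "w \<in> car T"
    have gc: "g \<in> car H" and eg: "e g = 0" using g ez eb gens by auto
    have "L (w \<otimes>\<^sub>T D (g \<otimes>\<^sub>H X)) = L ((w \<otimes>\<^sub>T D g) \<otimes>\<^sub>T D X)" using w gc X by (simp add: D'(3,4) T.m_assoc)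
    also have "\<dots> = e X \<odot>\<^sub>H L (w \<otimes>\<^sub>T D g)" by (rule bspec[OF P]) (simp add: w gc D'(3))
    finally show "L (w \<otimes>\<^sub>T D (g \<otimes>\<^sub>H X)) = e (g \<otimes>\<^sub>H X) \<odot>\<^sub>H L w"
     using gen[OF g w] Lw[OF w] gc X eg by (simp add: e'(4))
  qed
  have "L (\<one>\<^sub>T \<otimes>\<^sub>T D a) = e a \<odot>\<^sub>H L \<one>\<^sub>T"
  proof (rule Af_induct[OF H.complete clin_compose[OF clin_compose[OF D'(1) T.cont_linear_mult_left] Lc]
      counit_smult_cont[OF Lw], where P = ?P])
    show "?P \<one>\<^sub>H" using D'(5) e'(5) Lw by simp
  qed (use step a in simp_all)
  then show ?thesis using a D'(3)[OF a] Lp[of "\<one>\<^sub>H" "\<one>\<^sub>H"] S'(5) by (simp add: L_def pHH(5))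
qed

lemma is_HFG_hopf: "is_HFG_hopf_algebra H D e S" unfolding is_HFG_hopf_algebra_def is_hopf_algebra_def
  by (intro conjI ballI is_HFG_Af H.complete_algebra D e S'(1) coassociative counital antipode_left antipode_right)

end

text \<open>
  A condition that prescribes the values on \<open>z\<close> and \<open>b\<close> of a continuous homomorphism determines it.
\<close>

lemma determined_hom:
  assumes B: "cam_algebra B" and f: "P f"
    and P: "\<And>g. P g ==> cont_alg_hom (Af q) B g \<and> g (Af_z q) = x \<and> g (Af_b q) = y"
  shows "determined_on (car (Af q)) P f" unfolding determined_on_def
proof (intro conjI f allI impI ballI)
  fix g X assume g: "P g" and X: "X \<in> car (Af q)"
  show "g X = f X" by (rule Af_hom_unique[OF B _ _ _ _ X]) (simp_all add: P[OF g] P[OF f])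
qed

lemma complete_am_square: "cam_algebra (PT (Af q) (Af q))"
  by (intro am_pair.complete_am_T am_pair.intro cam_algebra.axioms(1)[OF complete_am_Af])

lemma determined_comult: "Af_comult q D ==> determined_on (car (Af q)) (Af_comult q) D"
  by (rule determined_hom[OF complete_am_square _ Af_comult_def[THEN fun_cong, THEN iffD1]])

lemma determined_counit: "Af_counit q e ==> determined_on (car (Af q)) (Af_counit q) e"
  by (rule determined_hom[OF complete_am_complex _ Af_counit_def[THEN fun_cong, THEN iffD1]])

lemma determined_antipode: "Af_antipode q S ==> determined_on (car (Af q)) (Af_antipode q) S"
  by (rule determined_hom[OF opp_complete_am[OF complete_am_Af] _
      Af_antipode_def[unfolded antihom_iff_hom_opp, THEN fun_cong, THEN iffD1]])

theorem proposition5p7: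
  fixes q :: complex
  assumes "q \<noteq> 0"
  shows "let H = Af q; z = Af_z q; b = Af_b q; T = proj_tensor H H; tensor = pure_tensor H H in
    infinite_dimensional H \<and>
    (\<exists>\<Delta> \<epsilon> S.
      determined_on (carrier H)
        (\<lambda>D. cont_alg_hom H T D \<and>
             D z = tensor \<one>\<^bsub>H\<^esub> z \<oplus>\<^bsub>T\<^esub> tensor z \<one>\<^bsub>H\<^esub> \<and>
             D b = tensor (alg_exp H z) b \<oplus>\<^bsub>T\<^esub> tensor b \<one>\<^bsub>H\<^esub>) \<Delta> \<and>
      determined_on (carrier H)
        (\<lambda>e. cont_alg_hom H complex_lcs e \<and> e z = 0 \<and> e b = 0) \<epsilon> \<and>
      determined_on (carrier H)
        (\<lambda>s. cont_alg_antihom H H s \<and>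
             s z = \<ominus>\<^bsub>H\<^esub> z \<and>
             s b = \<ominus>\<^bsub>H\<^esub> (alg_exp H (\<ominus>\<^bsub>H\<^esub> z) \<otimes>\<^bsub>H\<^esub> b)) S \<and>
      is_HFG_hopf_algebra H \<Delta> \<epsilon> S \<and>
      homeomorphic_map (lctop H) (lctop H) S)"
proof -
  obtain D e S where DeS: "Af_comult q D" "Af_counit q e" "Af_antipode q S"
    using comult_exists[of q] counit_exists[of q] antipode_exists[of q] by (elim exE)
  show ?thesis unfolding Let_def by (intro conjI exI)
     (rule infinite_dimensional_Af determined_comult[OF DeS(1), unfolded Af_comult_def]
      determined_counit[OF DeS(2), unfolded Af_counit_def] determined_antipode[OF DeS(3), unfolded Af_antipode_def]
      Af_hopf.is_HFG_hopf[OF Af_hopf.intro[OF DeS]] antipode_homeomorphic[OF DeS(3)])+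
qed

end
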